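(* Consider the linear regression model $Y_i=\beta^TX_i+\epsilon_i$, $i=1,\ldots,n$, with non-random covariates $X_i\in\mathbb R^p$ and i.i.d. errors $\epsilon_i$ with density $p_\eta$, parametrized by $(\beta,\eta)\in\mathcal B\times\mathcal H$ (see context). Suppose the observations are generated from this model with true parameter $(\beta_0,\eta_0)\in\mathcal B\times\mathcal H$, that $\liminf_{n\to\infty}\rho_{\min}(\mathbb X_n)>0$, where $\mathbb X_n=n^{-1}\sum_{i=1}^nX_iX_i^T$, and that $\sup_i|X_i|\le L$ for some $L>0$. Endow the model with a product prior $\Pi=\Pi_{\mathcal B}\times\Pi_{\mathcal H}$, where $\Pi_{\mathcal B}$ is thick at $\beta_0$ and $\Pi_{\mathcal H}(U)>0$ for every weak neighborhood $U$ of $\eta_0$. Then $$\sup_B\left|\Pi\big(\sqrt n(\beta-\beta_0)\in B\mid (X_1,Y_1),\ldots,(X_n,Y_n)\big)-N_{\Delta_n,V_{n,\eta_0}^{-1}}(B)\right|\to0$$ in $P_0$-probability as $n\to\infty$ (where $P_0$ is the law of the observations under $(\beta_0,\eta_0)$), the supremum being over all Borel sets $B\subset\mathbb R^p$, and $$\Delta_n=\frac1{\sqrt n}\sum_{i=1}^nV_{n,\eta_0}^{-1}\dot\ell_{\beta_0,\eta_0,i}.$$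
   Context: $\mathcal B$ is an open subset of $\mathbb R^p$. Fix constants $M>0$ and $0<\sigma_1<\sigma_2<\infty$. $\mathcal H$ is the set of all Borel probability measures $\eta$ supported on $[-M,M]\times[\sigma_1,\sigma_2]$ with $d\eta(z,\sigma)=d\eta(-z,\sigma)$ (invariance under $(z,\sigma)\mapsto(-z,\sigma)$). $\phi_\sigma$ is the density of the univariate normal distribution with mean $0$ and variance $\sigma^2$, $p_\eta(y)=\int\phi_\sigma(y-z)\,d\eta(z,\sigma)$ and $\ell_\eta=\log p_\eta$. The density of $Y_i$ under $(\beta,\eta)$ is $y\mapsto p_\eta(y-\beta^TX_i)$. Put $\dot\ell_{\beta,\eta,i}=-\ell_\eta'(Y_i-\beta^TX_i)\,X_i$ (the gradient of $\beta\mapsto\ell_\eta(Y_i-\beta^TX_i)$), $V_\eta=\int\ell_\eta'(y)\,\ell_{\eta_0}'(y)\,p_{\eta_0}(y)\,dy$ and $V_{n,\eta}=V_\eta\cdot\mathbb X_n$. $\rho_{\min}(A)$ is the minimum eigenvalue of $A$. A weak neighborhood of $\eta_0$ is a neighborhood in the topology of weak convergence on $\mathcal H$, i.e. a set containing one of the form $\{\eta\in\mathcal H: |\int f_i\,d\eta-\int f_i\,d\eta_0|<\epsilon,\ i=1,\ldots,m\}$ with $\epsilon>0$ and $f_i$ bounded continuous on $[-M,M]\times[\sigma_1,\sigma_2]$. A prior $\Pi_{\mathcal B}$ is thick at $\beta_0$ if it has a positive continuous Lebesgue density in a neighborhood of $\beta_0$. The posterior is given by Bayes' rule with likelihood $\prod_{i=1}^np_\eta(Y_i-\beta^TX_i)$.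 $N_{\mu,\Sigma}$ denotes the multivariate normal distribution with mean $\mu$ and variance $\Sigma$. *)

theory Defs
  imports "HOL-Probability.Probability"
begin

definition rect :: "real \<Rightarrow> real \<Rightarrow> real \<Rightarrow> (real \<times> real) set" where
  "rect M s1 s2 = {-M..M} \<times> {s1..s2}"

text \<open>A measure on the rectangle is encoded as a Borel probability measure on the whole plane that
  gives the (closed) rectangle mass one.\<close>

definition mixing_set :: "real \<Rightarrow> real \<Rightarrow> real \<Rightarrow> (real \<times> real) measure set" where
  "mixing_set M s1 s2 =
     {\<eta>. sets \<eta> = sets borel \<and> prob_space \<eta> \<and> emeasure \<eta> (rect M s1 s2) = 1 \<and>
         distr \<eta> borel (\<lambda>(z, s). (- z, s)) = \<eta>}"

text \<open>The measurable space of mixing distributions. Its sigma-algebra is generated by the maps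
  \<open>\<eta> \<mapsto> \<eta>(A)\<close> for Borel sets \<open>A\<close>; as the rectangle is compact metrizable, this is the Borel
  sigma-algebra of the weak topology.\<close>

definition mixing_space :: "real \<Rightarrow> real \<Rightarrow> real \<Rightarrow> (real \<times> real) measure measure" where
  "mixing_space M s1 s2 = restrict_space (prob_algebra borel) (mixing_set M s1 s2)"

definition weak_nbhd ::
    "real \<Rightarrow> real \<Rightarrow> real \<Rightarrow> (real \<times> real) measure \<Rightarrow> (real \<times> real) measure set \<Rightarrow> bool" where
  "weak_nbhd M s1 s2 \<eta>0 U \<longleftrightarrow> U \<subseteq> mixing_set M s1 s2 \<and>
     (\<exists>\<epsilon>>0. \<exists>F. finite F \<and>
        (\<forall>f\<in>F. continuous_on (rect M s1 s2) f \<and> bounded (f ` rect M s1 s2)) \<and>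
        {\<eta> \<in> mixing_set M s1 s2.
           \<forall>f\<in>F. \<bar>(LINT x:rect M s1 s2|\<eta>. f x) - (LINT x:rect M s1 s2|\<eta>0. f x)\<bar> < (\<epsilon>::real)}
          \<subseteq> U)"

definition mix_density :: "(real \<times> real) measure \<Rightarrow> real \<Rightarrow> real" where
  "mix_density \<eta> y = (\<integral>x. normal_density 0 (snd x) (y - fst x) \<partial>\<eta>)"

definition log_density :: "(real \<times> real) measure \<Rightarrow> real \<Rightarrow> real" where
  "log_density \<eta> y = ln (mix_density \<eta> y)"

definition score :: "(real \<times> real) measure \<Rightarrow> real^'p \<Rightarrow> real^'p \<Rightarrow> real \<Rightarrow> real^'p" where
  "score \<eta> \<beta> x y = (- deriv (log_density \<eta>) (y - \<beta> \<bullet> x)) *\<^sub>R x"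

definition info :: "(real \<times> real) measure \<Rightarrow> (real \<times> real) measure \<Rightarrow> real" where
  "info \<eta>0 \<eta> =
     (\<integral>y. deriv (log_density \<eta>) y * deriv (log_density \<eta>0) y * mix_density \<eta>0 y \<partial>lborel)"

text \<open>Observations are numbered from 1; the index 0 is never used.\<close>

definition design_matrix :: "(nat \<Rightarrow> real^'p) \<Rightarrow> nat \<Rightarrow> real^'p^'p" where
  "design_matrix X n = (1 / real n) *\<^sub>R (\<Sum>i=1..n. (\<chi> j k. X i $ j * X i $ k))"

definition info_matrix ::
    "(nat \<Rightarrow> real^'p) \<Rightarrow> (real \<times> real) measure \<Rightarrow> nat \<Rightarrow> (real \<times> real) measure \<Rightarrow> real^'p^'p" where
  "info_matrix X \<eta>0 n \<eta> = info \<eta>0 \<eta> *\<^sub>R design_matrix X n"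

text \<open>Used for symmetric matrices only, whose eigenvalues form a finite nonempty set of reals.\<close>

definition min_eigenvalue :: "real^'p^'p \<Rightarrow> real" where
  "min_eigenvalue A = Min {r. \<exists>v. v \<noteq> 0 \<and> A *v v = r *\<^sub>R v}"

definition thick_at :: "(real^'p) measure \<Rightarrow> real^'p \<Rightarrow> bool" where
  "thick_at prior \<beta>0 \<longleftrightarrow>
     (\<exists>U f. open U \<and> \<beta>0 \<in> U \<and> U \<subseteq> space prior \<and> continuous_on U f \<and> (\<forall>\<beta>\<in>U. f \<beta> > (0::real)) \<and>
        (\<forall>A\<in>sets borel. A \<subseteq> U \<longrightarrow>
           emeasure prior A = (\<integral>\<^sup>+\<beta>. ennreal (f \<beta>) * indicator A \<beta> \<partial>lborel)))"

definition likelihood ::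
    "(nat \<Rightarrow> real^'p) \<Rightarrow> nat \<Rightarrow> (nat \<Rightarrow> real) \<Rightarrow> (real^'p) \<times> (real \<times> real) measure \<Rightarrow> real" where
  "likelihood X n y = (\<lambda>(\<beta>, \<eta>). \<Prod>i=1..n. mix_density \<eta> (y i - \<beta> \<bullet> X i))"

definition posterior ::
    "((real^'p) \<times> (real \<times> real) measure) measure \<Rightarrow> (nat \<Rightarrow> real^'p) \<Rightarrow> nat \<Rightarrow> (nat \<Rightarrow> real) \<Rightarrow>
     ((real^'p) \<times> (real \<times> real) measure) measure" where
  "posterior prior X n y = density prior (\<lambda>\<theta>.
     ennreal (likelihood X n y \<theta>) / (\<integral>\<^sup>+\<theta>'. ennreal (likelihood X n y \<theta>') \<partial>prior))"

text \<open>Nondegenerate multivariate normal distribution; meaningful for positive definite \<open>\<Sigma>\<close>.\<close>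

definition mv_normal :: "real^'p \<Rightarrow> real^'p^'p \<Rightarrow> (real^'p) measure" where
  "mv_normal \<mu> \<Sigma> = density lborel (\<lambda>x. ennreal
     (1 / sqrt ((2 * pi) ^ CARD('p) * det \<Sigma>) *
      exp (- ((x - \<mu>) \<bullet> (matrix_inv \<Sigma> *v (x - \<mu>))) / 2)))"

definition centering ::
    "(nat \<Rightarrow> real^'p) \<Rightarrow> real^'p \<Rightarrow> (real \<times> real) measure \<Rightarrow> nat \<Rightarrow> (nat \<Rightarrow> real) \<Rightarrow> real^'p" where
  "centering X \<beta>0 \<eta>0 n y = (1 / sqrt (real n)) *\<^sub>R
     (\<Sum>i=1..n. matrix_inv (info_matrix X \<eta>0 n \<eta>0) *v score \<eta>0 \<beta>0 (X i) (y i))"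

text \<open>Outer measure, so that the notion cannot hold merely because an event fails to be measurable
  (\<open>emeasure\<close> is 0 on nonmeasurable sets). On measurable events it is the probability.\<close>

definition tendsto_in_prob :: "'w measure \<Rightarrow> (nat \<Rightarrow> 'w \<Rightarrow> real) \<Rightarrow> real \<Rightarrow> bool" where
  "tendsto_in_prob P Z c \<longleftrightarrow>
     (\<forall>\<epsilon>>0. (\<lambda>n. outer_measure_of P {\<omega> \<in> space P. \<epsilon> < \<bar>Z n \<omega> - c\<bar>}) \<longlonglongrightarrow> 0)"

end

theory Submission
  imports Defs
begin

text \<open>For a fixed symmetric \<open>\<eta>\<close> the score \<open>\<ell>'_\<eta>\<close> is odd, hence centred under \<open>\<eta>0\<close>, so the
  quadratic expansion of the log-likelihood ratio in \<open>h = \<surd>n (\<beta> - \<beta>0)\<close> with base point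
  \<open>(\<beta>0, \<eta>)\<close> has the same linear and quadratic terms, up to small errors, for all \<open>\<eta>\<close> with \<open>p_\<eta>\<close>
  uniformly close to \<open>p_\<eta>0\<close>. Uniformity over \<open>\<eta>\<close> comes from
  \<open>g(z) - g(0) = \<integral>_[0,z] g'\<close>: a centred sum of \<open>g\<close> is an integral of \<open>g'\<close> against one fixed random
  function, so no entropy bound is needed. The same device gives a uniform law of large numbers,
  which together with Kullback--Leibler separation shows that the likelihood is exponentially small
  outside a neighbourhood of \<open>(\<beta>0, \<eta>0)\<close>. Integrating the expansion over \<open>\<eta>\<close> factors the mass
  \<open>\<integral> \<Prod> p_\<eta>(\<epsilon>_i) d\<Pi>(\<eta>)\<close> out of Bayes' rule and leaves a Gaussian integral in \<open>h\<close>.\<close>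

section \<open>Normal kernels and their derivatives\<close>

text \<open>The expansion error is not o(1): on a neighbourhood of fixed size it is \<gamma> (|h| +
  |h|^2) with an arbitrarily small constant \<gamma>. The curvature of the Gaussian exponent absorbs
  such an error, so one Laplace estimate covers everything from the scale n^(-1/2) up to the
  boundary of the neighbourhood, and the exponential bound deals only with the complement of a fixed
  set. Both regimes rest on the same bound for centred sums. It asks for derivatives growing at most
  like (1 + |y|)^3, a condition met by log p_\<eta> and its first two derivatives with one constant
  for the whole class, because p_\<eta> and its derivatives carry the same Gaussian tails and these
  cancel in the quotients. The error of the numerator of Bayes' rule does not depend on the Borel
  set, which is what yields total variation. Statements that quantify over all \<eta> and u are
  asserted on a measurable event of large probability, as the sample points satisfying them are
  described by uncountably many conditions.\<close>

lemma mvt_abs: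
  fixes f :: "real \<Rightarrow> real"
  assumes "\<And>x. (f has_real_derivative f' x) (at x)"
  obtains \<xi> where "\<bar>\<xi> - y\<bar> \<le> \<bar>h\<bar>" "f (y + h) - f y = h * f' \<xi>"
proof (cases "h = 0")
  case True
  then show ?thesis using that[of y] by simp
next
  case False
  show ?thesis
  proof (cases "h > 0")
    case True
    obtain z where "y < z" "z < y + h" "f (y + h) - f y = (y + h - y) * f' z"
      using MVT2[of y "y + h" f f'] assms True by auto
    then show ?thesis using that[of z] by auto
  next
    case False
    then have "h < 0" using \<open>h \<noteq> 0\<close> by simp
    obtain z where "y + h < z" "z < y" "f y - f (y + h) = (y - (y + h)) * f' z"
      using MVT2[of "y + h" y f f'] assms \<open>h < 0\<close> by auto
    then show ?thesis using that[of z] \<open>h < 0\<close> by (auto simp: algebra_simps)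
  qed
qed

lemma lipschitz_of_derivative:
  fixes f :: "real \<Rightarrow> real"
  assumes "\<And>x. (f has_real_derivative f' x) (at x)" "\<And>x. \<bar>f' x\<bar> \<le> B"
  shows "\<bar>f x - f y\<bar> \<le> B * \<bar>x - y\<bar>"
proof -
  obtain \<xi> where "f (y + (x - y)) - f y = (x - y) * f' \<xi>"
    using mvt_abs[OF assms(1)] by blast
  then have "\<bar>f x - f y\<bar> = \<bar>x - y\<bar> * \<bar>f' \<xi>\<bar>" by (simp add: abs_mult)
  also have "\<dots> \<le> \<bar>x - y\<bar> * B" by (intro mult_left_mono assms) simp
  finally show ?thesis by (simp add: mult.commute)
qed

text \<open>A uniform bound on the second derivative puts each difference quotient within B |h| of
  \<open>f'\<close>, uniformly in the parameter, so the error survives integration over a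
  probability measure and vanishes with h.\<close>

lemma integral_has_real_derivative:
  fixes f f' f'' :: "'a \<Rightarrow> real \<Rightarrow> real"
  assumes "prob_space N" and ae: "AE a in N. a \<in> R"
    and f: "\<And>a y. a \<in> R \<Longrightarrow> (f a has_real_derivative f' a y) (at y)"
    and f': "\<And>a y. a \<in> R \<Longrightarrow> (f' a has_real_derivative f'' a y) (at y)"
    and int: "\<And>y. integrable N (\<lambda>a. f a y)" "\<And>y. integrable N (\<lambda>a. f' a y)"
    and B: "\<And>a y. a \<in> R \<Longrightarrow> \<bar>f'' a y\<bar> \<le> B"
  shows "((\<lambda>y. \<integral>a. f a y \<partial>N) has_real_derivative (\<integral>a. f' a y \<partial>N)) (at y)"
proof -
  interpret prob_space N by fact
  \<comment> \<open>Mass one forces R to be nonempty, and at any of its points B bounds an absolute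
    value.\<close>
  have "B \<ge> 0"
  proof -
    have "\<exists>a. a \<in> R"
    proof (rule ccontr)
      assume "\<nexists>a. a \<in> R"
      then have "AE a in N. False" using ae by simp
      then show False by simp
    qed
    then show ?thesis using B abs_ge_zero order_trans by blast
  qed
  have key: "\<bar>((\<integral>a. f a (y + h) \<partial>N) - (\<integral>a. f a y \<partial>N)) / h - (\<integral>a. f' a y \<partial>N)\<bar> \<le> B * \<bar>h\<bar>"
    if "h \<noteq> 0" for h
  proof -
    have "((\<integral>a. f a (y + h) \<partial>N) - (\<integral>a. f a y \<partial>N)) / h - (\<integral>a. f' a y \<partial>N)
        = (\<integral>a. (f a (y + h) - f a y) / h - f' a y \<partial>N)"
      using int by simp
    also have "\<bar>\<dots>\<bar> \<le> (\<integral>a. \<bar>(f a (y + h) - f a y) / h - f' a y\<bar> \<partial>N)"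
      by (rule integral_abs_bound)
    also have "\<dots> \<le> (\<integral>a. B * \<bar>h\<bar> \<partial>N)"
    proof (rule integral_mono_AE)
      show "AE a in N. \<bar>(f a (y + h) - f a y) / h - f' a y\<bar> \<le> B * \<bar>h\<bar>"
        using ae
      proof eventually_elim
        case (elim a)
        obtain \<xi> where \<xi>: "\<bar>\<xi> - y\<bar> \<le> \<bar>h\<bar>" "f a (y + h) - f a y = h * f' a \<xi>"
          using mvt_abs[OF f[OF elim]] by blast
        have "\<bar>f' a \<xi> - f' a y\<bar> \<le> B * \<bar>\<xi> - y\<bar>"
          by (rule lipschitz_of_derivative[OF f'[OF elim] B[OF elim]])
        also have "\<dots> \<le> B * \<bar>h\<bar>" using \<xi> \<open>B \<ge> 0\<close> by (intro mult_left_mono)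
        finally show ?case using \<xi> that by simp
      qed
    qed (use int in auto)
    finally show ?thesis by (simp add: prob_space)
  qed
  have "((\<lambda>h. ((\<integral>a. f a (y + h) \<partial>N) - (\<integral>a. f a y \<partial>N)) / h - (\<integral>a. f' a y \<partial>N)) \<longlongrightarrow> 0) (at 0)"
  proof (rule Lim_null_comparison)
    show "\<forall>\<^sub>F h in at 0. norm (((\<integral>a. f a (y + h) \<partial>N) - (\<integral>a. f a y \<partial>N)) / h - (\<integral>a. f' a y \<partial>N)) \<le> B * \<bar>h\<bar>"
      using key by (auto simp: eventually_at intro!: exI[of _ 1])
    show "((\<lambda>h. B * \<bar>h\<bar>) \<longlongrightarrow> 0) (at 0)"
      by (auto intro!: tendsto_eq_intros)
  qed
  then show ?thesis unfolding DERIV_def by (simp add: LIM_zero_iff)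
qed

text \<open>The k-th derivative of the centred normal density with standard deviation s, that is
  (-1)^k s^(-k) He_k(x/s) times the density. The third equation is s^2 \<phi>' = - x \<phi>
  differentiated k + 1 times.\<close>

fun nd :: "nat \<Rightarrow> real \<Rightarrow> real \<Rightarrow> real" where
  "nd 0 s x = normal_density 0 s x"
| "nd (Suc 0) s x = - (x / s\<^sup>2) * normal_density 0 s x"
| "nd (Suc (Suc k)) s x = - (x * nd (Suc k) s x + real (Suc k) * nd k s x) / s\<^sup>2"

lemma nd_0_has_derivative: "(nd 0 s has_real_derivative nd (Suc 0) s x) (at x)"
proof -
  have *: "nd 0 s = (\<lambda>x. 1 / sqrt (2 * pi * s\<^sup>2) * exp (- (1 / (2 * s\<^sup>2)) * x\<^sup>2))"
    by (simp add: fun_eq_iff normal_density_def)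
  have "((\<lambda>x. c * exp (- d * x\<^sup>2)) has_real_derivative - (x * (2 * d)) * (c * exp (- d * x\<^sup>2))) (at x)"
    for c d :: real
    by (auto intro!: derivative_eq_intros)
  from this[of "1 / sqrt (2 * pi * s\<^sup>2)" "1 / (2 * s\<^sup>2)"] show ?thesis
    unfolding * by (simp add: normal_density_def)
qed

lemma nd_has_derivative: "(nd k s has_real_derivative nd (Suc k) s x) (at x)"
proof (induction k s x rule: nd.induct)
  case (1 s x)
  show ?case by (rule nd_0_has_derivative)
next
  case (2 s x)
  have *: "nd (Suc 0) s = (\<lambda>x. (- 1 / s\<^sup>2) * (x * nd 0 s x))"
    by (simp add: fun_eq_iff)
  have **: "nd (Suc (Suc 0)) s x = (- 1 / s\<^sup>2) * (1 * nd 0 s x + nd (Suc 0) s x * x)"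
    by (simp add: algebra_simps diff_divide_distrib add_divide_distrib)
  show ?case
    by (subst *, subst **) (intro DERIV_cmult DERIV_mult DERIV_ident nd_0_has_derivative)
next
  case (3 k s x)
  have *: "nd (Suc (Suc k)) s = (\<lambda>x. (- 1 / s\<^sup>2) * (x * nd (Suc k) s x + real (Suc k) * nd k s x))"
    by (simp add: fun_eq_iff add_divide_distrib diff_divide_distrib)
  have **: "nd (Suc (Suc (Suc k))) s x
      = (- 1 / s\<^sup>2) * ((1 * nd (Suc k) s x + nd (Suc (Suc k)) s x * x) + real (Suc k) * nd (Suc k) s x)"
    by (simp add: algebra_simps diff_divide_distrib add_divide_distrib)
  show ?case
    by (subst *, subst **) (intro DERIV_cmult DERIV_mult DERIV_ident DERIV_add 3)
qed

lemma nd_measurable[measurable]: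
  assumes [measurable]: "f \<in> borel_measurable N" "g \<in> borel_measurable N"
  shows "(\<lambda>a. nd k (f a) (g a)) \<in> borel_measurable N"
proof (induction k rule: induct_nat_012)
  case 0
  have "(\<lambda>a. 1 / sqrt (2 * pi * (f a)\<^sup>2) * exp (-(g a - 0)\<^sup>2/ (2 * (f a)\<^sup>2))) \<in> borel_measurable N"
    by measurable
  then show ?case by (simp add: normal_density_def)
next
  case 1
  have "(\<lambda>a. - (g a / (f a)\<^sup>2) * (1 / sqrt (2 * pi * (f a)\<^sup>2) * exp (-(g a - 0)\<^sup>2/ (2 * (f a)\<^sup>2)))) \<in> borel_measurable N"
    by measurable
  then show ?case by (simp add: normal_density_def)
next
  case (ge2 k)
  note [measurable] = ge2
  show ?case by simp
qed

text \<open>The density stays as a factor on the right. Integrated over a mixing distribution it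
  turns into the mixture density itself, which is what bounds the ratio of a derivative of the
  mixture to the mixture.\<close>

lemma nd_poly_bound:
  assumes "s1 > 0"
  shows "\<exists>C\<ge>0. \<forall>s\<ge>s1. \<forall>x. \<bar>nd k s x\<bar> \<le> C * (1 + \<bar>x\<bar>) ^ k * normal_density 0 s x"
proof (induction k rule: induct_nat_012)
  case 0
  then show ?case by (intro exI[of _ 1]) auto
next
  case 1
  have "\<bar>nd (Suc 0) s x\<bar> \<le> (1 / s1\<^sup>2) * (1 + \<bar>x\<bar>) ^ Suc 0 * normal_density 0 s x" if "s \<ge> s1" for s x
  proof -
    have "\<bar>x\<bar> * (1 / s\<^sup>2) \<le> (1 + \<bar>x\<bar>) * (1 / s1\<^sup>2)"
      using that assms by (intro mult_mono) (auto simp: frac_le power_mono)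
    then have "\<bar>x\<bar> * (1 / s\<^sup>2) * normal_density 0 s x \<le> (1 + \<bar>x\<bar>) * (1 / s1\<^sup>2) * normal_density 0 s x"
      by (intro mult_right_mono) auto
    then show ?thesis by (simp add: abs_mult mult_ac)
  qed
  then show ?case by (intro exI[of _ "1 / s1\<^sup>2"]) auto
next
  case (ge2 k)
  obtain C0 where C0: "C0 \<ge> 0" "\<And>s x. s \<ge> s1 \<Longrightarrow> \<bar>nd k s x\<bar> \<le> C0 * (1 + \<bar>x\<bar>) ^ k * normal_density 0 s x"
    using ge2 by blast
  obtain C1 where C1: "C1 \<ge> 0" "\<And>s x. s \<ge> s1 \<Longrightarrow> \<bar>nd (Suc k) s x\<bar> \<le> C1 * (1 + \<bar>x\<bar>) ^ Suc k * normal_density 0 s x"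
    using ge2 by blast
  have "\<bar>nd (Suc (Suc k)) s x\<bar> \<le> ((C1 + Suc k * C0) / s1\<^sup>2) * (1 + \<bar>x\<bar>) ^ Suc (Suc k) * normal_density 0 s x"
    if s: "s \<ge> s1" for s x
  proof -
    let ?v = "1 + \<bar>x\<bar>" and ?\<phi> = "normal_density 0 s x"
    have "\<bar>x * nd (Suc k) s x + real (Suc k) * nd k s x\<bar> \<le> \<bar>x\<bar> * \<bar>nd (Suc k) s x\<bar> + real (Suc k) * \<bar>nd k s x\<bar>"
      by (rule order_trans[OF abs_triangle_ineq]) (simp add: abs_mult)
    also have "\<dots> \<le> ?v * (C1 * ?v ^ Suc k * ?\<phi>) + real (Suc k) * (C0 * ?v ^ Suc (Suc k) * ?\<phi>)"
    proof (intro add_mono mult_mono C1 s)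
      have "\<bar>nd k s x\<bar> \<le> C0 * ?v ^ k * ?\<phi>" using C0 s by blast
      also have "\<dots> \<le> C0 * ?v ^ Suc (Suc k) * ?\<phi>"
        using C0 by (intro mult_right_mono mult_left_mono power_increasing) auto
      finally show "\<bar>nd k s x\<bar> \<le> C0 * ?v ^ Suc (Suc k) * ?\<phi>" .
    qed auto
    also have "\<dots> = (C1 + real (Suc k) * C0) * ?v ^ Suc (Suc k) * ?\<phi>" by (simp add: algebra_simps)
    finally have *: "\<bar>x * nd (Suc k) s x + real (Suc k) * nd k s x\<bar> \<le> (C1 + real (Suc k) * C0) * ?v ^ Suc (Suc k) * ?\<phi>" .
    have "\<bar>nd (Suc (Suc k)) s x\<bar> = \<bar>x * nd (Suc k) s x + real (Suc k) * nd k s x\<bar> / s\<^sup>2"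
      by (simp add: abs_minus_commute add.commute del: of_nat_Suc)
    also have "\<dots> \<le> ((C1 + real (Suc k) * C0) * ?v ^ Suc (Suc k) * ?\<phi>) / s1\<^sup>2"
      using assms s C0 C1 by (intro frac_le * power_mono) (auto intro!: mult_nonneg_nonneg)
    finally show ?thesis by simp
  qed
  then show ?case using C0 C1 by (intro exI[of _ "(C1 + Suc k * C0) / s1\<^sup>2"]) auto
qed

text \<open>Completing a square gives |v| <= v^2/(2w) + w/2, and (1 + |v|)^k / k! is one term of the
  series of exp (1 + |v|).\<close>

lemma power_exp_bound:
  fixes v w :: real
  assumes "w > 0"
  shows "(1 + \<bar>v\<bar>) ^ k * exp (- (v\<^sup>2 / (2 * w))) \<le> fact k * exp (1 + w / 2)"
proof -
  have "\<bar>v\<bar> \<le> v\<^sup>2 / (2 * w) + w / 2"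
  proof -
    have "0 \<le> (\<bar>v\<bar> - w)\<^sup>2" by simp
    then have "2 * w * \<bar>v\<bar> \<le> v\<^sup>2 + w\<^sup>2" by (simp add: power2_diff mult_ac)
    then show ?thesis using assms by (simp add: field_simps power2_eq_square)
  qed
  moreover have "(1 + \<bar>v\<bar>) ^ k / fact k \<le> exp (1 + \<bar>v\<bar>)"
  proof -
    have "(\<Sum>i\<in>{k}. (1 + \<bar>v\<bar>) ^ i /\<^sub>R fact i) \<le> exp (1 + \<bar>v\<bar>)"
      unfolding exp_def
      by (intro sum_le_suminf summable_exp_generic) auto
    then show ?thesis by (simp add: divide_inverse mult.commute)
  qed
  ultimately have "(1 + \<bar>v\<bar>) ^ k \<le> fact k * exp (1 + (v\<^sup>2 / (2 * w) + w / 2))"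
    by (smt (verit, best) divide_le_eq exp_le_cancel_iff fact_gt_zero mult.commute)
  then have "(1 + \<bar>v\<bar>) ^ k * exp (- (v\<^sup>2 / (2 * w)))
      \<le> fact k * exp (1 + (v\<^sup>2 / (2 * w) + w / 2)) * exp (- (v\<^sup>2 / (2 * w)))"
    by (intro mult_right_mono) auto
  also have "\<dots> = fact k * exp (1 + w / 2)"
    by (simp add: mult.assoc exp_add[symmetric])
  finally show ?thesis .
qed

text \<open>Normalising constant and exponent are extremised separately, so the bound mixes s1 and
  s2; in return it no longer depends on s.\<close>

lemma normal_density_le:
  assumes "0 < s1" "s1 \<le> s" "s \<le> s2"
  shows "normal_density 0 s x \<le> 1 / sqrt (2 * pi * s1\<^sup>2) * exp (- (x\<^sup>2 / (2 * s2\<^sup>2)))"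
proof -
  have "1 / sqrt (2 * pi * s\<^sup>2) \<le> 1 / sqrt (2 * pi * s1\<^sup>2)"
    using assms by (intro frac_le) (auto simp: power_mono)
  moreover have "exp (- ((x - 0)\<^sup>2 / (2 * s\<^sup>2))) \<le> exp (- (x\<^sup>2 / (2 * s2\<^sup>2)))"
    using assms by (auto intro!: divide_left_mono simp: power_mono)
  ultimately show ?thesis unfolding normal_density_def
    by (intro mult_mono) auto
qed

lemma normal_density_ge:
  assumes "0 < s1" "s1 \<le> s" "s \<le> s2"
  shows "normal_density 0 s x \<ge> 1 / sqrt (2 * pi * s2\<^sup>2) * exp (- (x\<^sup>2 / (2 * s1\<^sup>2)))"
proof -
  have "1 / sqrt (2 * pi * s\<^sup>2) \<ge> 1 / sqrt (2 * pi * s2\<^sup>2)"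
    using assms by (intro frac_le) (auto simp: power_mono)
  moreover have "exp (- ((x - 0)\<^sup>2 / (2 * s\<^sup>2))) \<ge> exp (- (x\<^sup>2 / (2 * s1\<^sup>2)))"
    using assms by (auto intro!: divide_left_mono simp: power_mono)
  ultimately show ?thesis unfolding normal_density_def
    by (intro mult_mono) auto
qed

lemma nd_bounded:
  assumes "0 < s1" "s1 \<le> s2"
  shows "\<exists>B\<ge>0. \<forall>s\<in>{s1..s2}. \<forall>x. \<bar>nd k s x\<bar> \<le> B"
proof -
  obtain C where C: "C \<ge> 0" "\<And>s x. s \<ge> s1 \<Longrightarrow> \<bar>nd k s x\<bar> \<le> C * (1 + \<bar>x\<bar>) ^ k * normal_density 0 s x"
    using nd_poly_bound[OF assms(1)] by blast
  let ?c = "1 / sqrt (2 * pi * s1\<^sup>2)"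
  have "\<bar>nd k s x\<bar> \<le> C * ?c * (fact k * exp (1 + s2\<^sup>2 / 2))" if "s \<in> {s1..s2}" for s x
  proof -
    have "\<bar>nd k s x\<bar> \<le> C * (1 + \<bar>x\<bar>) ^ k * normal_density 0 s x" using C that by auto
    also have "\<dots> \<le> C * (1 + \<bar>x\<bar>) ^ k * (?c * exp (- (x\<^sup>2 / (2 * s2\<^sup>2))))"
      using C that assms by (intro mult_left_mono normal_density_le) auto
    also have "\<dots> = C * ?c * ((1 + \<bar>x\<bar>) ^ k * exp (- (x\<^sup>2 / (2 * s2\<^sup>2))))" by simp
    also have "\<dots> \<le> C * ?c * (fact k * exp (1 + s2\<^sup>2 / 2))"
      using C assms by (intro mult_left_mono power_exp_bound) auto
    finally show ?thesis .
  qed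
  then show ?thesis using C by (intro exI[of _ "C * ?c * (fact k * exp (1 + s2\<^sup>2 / 2))"]) auto
qed

declare nd.simps[simp del]

section \<open>Densities of normal mixtures\<close>

text \<open>The k-th derivative of the mixture density p_\<eta>, written as the mixture of the k-th
  derivatives of the kernels (\<open>md_has_derivative\<close>).\<close>

definition md :: "nat \<Rightarrow> (real \<times> real) measure \<Rightarrow> real \<Rightarrow> real" where
  "md k \<eta> y = (\<integral>x. nd k (snd x) (y - fst x) \<partial>\<eta>)"

lemma md_0: "md 0 \<eta> = mix_density \<eta>"
  by (simp add: md_def mix_density_def fun_eq_iff nd.simps)

lemma nd_pair_measurable[measurable]:
  "(\<lambda>x::real \<times> real. nd k (snd x) (y - fst x)) \<in> borel_measurable borel"
  unfolding borel_prod[symmetric] by measurable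

locale normal_mixture =
  fixes M s1 s2 :: real
  assumes M_pos: "0 < M" and s1_pos: "0 < s1" and s12: "s1 < s2"
begin

abbreviation "HH \<equiv> mixing_set M s1 s2"

lemma HH_prob: "\<eta> \<in> HH \<Longrightarrow> prob_space \<eta>"
  and HH_sets: "\<eta> \<in> HH \<Longrightarrow> sets \<eta> = sets borel"
  by (auto simp: mixing_set_def)

lemma AE_rect:
  assumes "\<eta> \<in> HH"
  shows "AE x in \<eta>. x \<in> rect M s1 s2"
proof -
  interpret prob_space \<eta> using assms by (rule HH_prob)
  have "prob (rect M s1 s2) = 1"
    using assms by (simp add: mixing_set_def measure_def)
  then show ?thesis by (rule AE_prob_1)
qed

lemma nd_integrable:
  assumes "\<eta> \<in> HH"
  shows "integrable \<eta> (\<lambda>x. nd k (snd x) (y - fst x))"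
proof -
  interpret prob_space \<eta> using assms by (rule HH_prob)
  obtain B where B: "\<And>s x. s \<in> {s1..s2} \<Longrightarrow> \<bar>nd k s x\<bar> \<le> B"
    using nd_bounded[OF s1_pos less_imp_le[OF s12], of k] by blast
  show ?thesis
  proof (rule integrable_const_bound[where B=B])
    show "random_variable borel (\<lambda>x. nd k (snd x) (y - fst x))"
      unfolding measurable_cong_sets[OF HH_sets[OF assms] refl] by measurable
    show "AE x in \<eta>. norm (nd k (snd x) (y - fst x)) \<le> B"
      using AE_rect[OF assms] by eventually_elim (use B in \<open>auto simp: rect_def\<close>)
  qed
qed

lemma md_bounded: "\<exists>B\<ge>0. \<forall>\<eta>\<in>HH. \<forall>y. \<bar>md k \<eta> y\<bar> \<le> B"
proof -
  obtain B where B: "B \<ge> 0" "\<And>s x. s \<in> {s1..s2} \<Longrightarrow> \<bar>nd k s x\<bar> \<le> B"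
    using nd_bounded[OF s1_pos less_imp_le[OF s12], of k] by blast
  have "\<bar>md k \<eta> y\<bar> \<le> B" if "\<eta> \<in> HH" for \<eta> y
  proof -
    interpret prob_space \<eta> using that by (rule HH_prob)
    have "\<bar>md k \<eta> y\<bar> \<le> (\<integral>x. \<bar>nd k (snd x) (y - fst x)\<bar> \<partial>\<eta>)"
      unfolding md_def by (rule integral_abs_bound)
    also have "\<dots> \<le> (\<integral>x. B \<partial>\<eta>)"
    proof (rule integral_mono_AE)
      show "AE x in \<eta>. \<bar>nd k (snd x) (y - fst x)\<bar> \<le> B"
        using AE_rect[OF that] by eventually_elim (use B in \<open>auto simp: rect_def\<close>)
    qed (use nd_integrable[OF that] in auto)
    finally show ?thesis by (simp add: prob_space)
  qed
  then show ?thesis using B by blast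
qed

lemma md_has_derivative:
  assumes "\<eta> \<in> HH"
  shows "(md k \<eta> has_real_derivative md (Suc k) \<eta> y) (at y)"
proof -
  obtain B where B: "\<And>s x. s \<in> {s1..s2} \<Longrightarrow> \<bar>nd (Suc (Suc k)) s x\<bar> \<le> B"
    using nd_bounded[OF s1_pos less_imp_le[OF s12], of "Suc (Suc k)"] by blast
  have shift: "((\<lambda>y. nd j s (y - z)) has_real_derivative nd (Suc j) s (y - z)) (at y)" for j s y z
    using DERIV_shift[of "nd j s" "nd (Suc j) s (y - z)" y "- z"] nd_has_derivative[of j s "y - z"]
    by simp
  have "((\<lambda>y. \<integral>x. nd k (snd x) (y - fst x) \<partial>\<eta>) has_real_derivative
      (\<integral>x. nd (Suc k) (snd x) (y - fst x) \<partial>\<eta>)) (at y)"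
    by (rule integral_has_real_derivative[OF HH_prob[OF assms] AE_rect[OF assms], where B=B
          and f''="\<lambda>x y. nd (Suc (Suc k)) (snd x) (y - fst x)"])
      (use assms B in \<open>auto intro: nd_integrable shift simp: rect_def\<close>)
  then show ?thesis by (simp add: md_def[abs_def])
qed

lemma md_continuous: "\<eta> \<in> HH \<Longrightarrow> continuous_on A (md k \<eta>)"
  by (meson DERIV_continuous_on has_field_derivative_at_within md_has_derivative)

lemma md_measurable[measurable]: "\<eta> \<in> HH \<Longrightarrow> md k \<eta> \<in> borel_measurable borel"
  by (intro borel_measurable_continuous_onI md_continuous)

text \<open>The worst case has its centre at distance |y| + M and the smallest admissible kernel
  value there. Depending on \<eta> only through the rectangle, the bound holds for the whole class
  and keeps log p_\<eta> above a quadratic.\<close>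

lemma md0_lower:
  assumes "\<eta> \<in> HH"
  shows "1 / sqrt (2 * pi * s2\<^sup>2) * exp (- ((\<bar>y\<bar> + M)\<^sup>2 / (2 * s1\<^sup>2))) \<le> md 0 \<eta> y"
proof -
  interpret prob_space \<eta> using assms by (rule HH_prob)
  let ?c = "1 / sqrt (2 * pi * s2\<^sup>2) * exp (- ((\<bar>y\<bar> + M)\<^sup>2 / (2 * s1\<^sup>2)))"
  have "?c = (\<integral>x. ?c \<partial>\<eta>)" by (simp add: prob_space)
  also have "\<dots> \<le> (\<integral>x. nd 0 (snd x) (y - fst x) \<partial>\<eta>)"
  proof (rule integral_mono_AE)
    show "AE x in \<eta>. ?c \<le> nd 0 (snd x) (y - fst x)"
      using AE_rect[OF assms]
    proof eventually_elim
      case (elim x)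
      then have x: "\<bar>fst x\<bar> \<le> M" "s1 \<le> snd x" "snd x \<le> s2" by (auto simp: rect_def)
      have "(y - fst x)\<^sup>2 \<le> (\<bar>y\<bar> + M)\<^sup>2"
        using x M_pos by (intro abs_le_square_iff[THEN iffD1]) auto
      then have "?c \<le> 1 / sqrt (2 * pi * s2\<^sup>2) * exp (- ((y - fst x)\<^sup>2 / (2 * s1\<^sup>2)))"
        by (intro mult_left_mono) (auto intro!: divide_right_mono)
      also have "\<dots> \<le> normal_density 0 (snd x) (y - fst x)"
        using x s1_pos by (intro normal_density_ge) auto
      finally show ?case by (simp add: nd.simps)
    qed
  qed (use nd_integrable[OF assms] in auto)
  finally show ?thesis by (simp add: md_def)
qed

lemma md0_pos: "\<eta> \<in> HH \<Longrightarrow> 0 < md 0 \<eta> y"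
  using s1_pos s12 by (intro less_le_trans[OF _ md0_lower]) auto

text \<open>For |z| <= M, (y - z)^2 >= y^2/2 - M^2: half of the exponent is given up to remove the
  centre z, and the part with M^2 goes into this prefactor.\<close>

definition Cup :: real where
  "Cup = 1 / sqrt (2 * pi * s1\<^sup>2) * exp (M\<^sup>2 / (2 * s2\<^sup>2))"

lemma md0_upper:
  assumes "\<eta> \<in> HH"
  shows "md 0 \<eta> y \<le> Cup * exp (- (y\<^sup>2 / (4 * s2\<^sup>2)))"
proof -
  interpret prob_space \<eta> using assms by (rule HH_prob)
  let ?c = "Cup * exp (- (y\<^sup>2 / (4 * s2\<^sup>2)))"
  have "(\<integral>x. nd 0 (snd x) (y - fst x) \<partial>\<eta>) \<le> (\<integral>x. ?c \<partial>\<eta>)"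
  proof (rule integral_mono_AE)
    show "AE x in \<eta>. nd 0 (snd x) (y - fst x) \<le> ?c"
      using AE_rect[OF assms]
    proof eventually_elim
      case (elim x)
      then have x: "\<bar>fst x\<bar> \<le> M" "s1 \<le> snd x" "snd x \<le> s2" by (auto simp: rect_def)
      have "(fst x)\<^sup>2 \<le> M\<^sup>2" using x M_pos by (intro abs_le_square_iff[THEN iffD1]) auto
      moreover have "0 \<le> (y - 2 * fst x)\<^sup>2" by simp
      ultimately have sq: "y\<^sup>2 / 2 - M\<^sup>2 \<le> (y - fst x)\<^sup>2" by (simp add: power2_eq_square algebra_simps)
      have "normal_density 0 (snd x) (y - fst x)
          \<le> 1 / sqrt (2 * pi * s1\<^sup>2) * exp (- ((y - fst x)\<^sup>2 / (2 * s2\<^sup>2)))"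
        using x s1_pos by (intro normal_density_le) auto
      also have "\<dots> \<le> 1 / sqrt (2 * pi * s1\<^sup>2) * exp (- ((y\<^sup>2 / 2 - M\<^sup>2) / (2 * s2\<^sup>2)))"
        using sq by (intro mult_left_mono) (auto intro!: divide_right_mono)
      also have "- ((y\<^sup>2 / 2 - M\<^sup>2) / (2 * s2\<^sup>2)) = M\<^sup>2 / (2 * s2\<^sup>2) + - (y\<^sup>2 / (4 * s2\<^sup>2))"
        by (simp add: diff_divide_distrib)
      finally show ?case by (simp only: exp_add Cup_def nd.simps mult.assoc)
    qed
  qed (use nd_integrable[OF assms] in auto)
  then show ?thesis by (simp add: md_def prob_space)
qed

lemma Cup_pos: "Cup > 0" using s1_pos by (simp add: Cup_def)

text \<open>The pointwise bound \<open>nd_poly_bound\<close> has the kernel as a factor, so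
  integration over \<eta> reproduces \<open>md 0 \<eta>\<close>; 1 + |y - z| <= (1 + M)(1 + |y|)
  takes the centre out of the polynomial.\<close>

lemma md_ratio: "\<exists>C\<ge>0. \<forall>\<eta>\<in>HH. \<forall>y. \<bar>md k \<eta> y\<bar> \<le> C * (1 + \<bar>y\<bar>) ^ k * md 0 \<eta> y"
proof -
  obtain C where C: "C \<ge> 0" "\<And>s x. s \<ge> s1 \<Longrightarrow> \<bar>nd k s x\<bar> \<le> C * (1 + \<bar>x\<bar>) ^ k * normal_density 0 s x"
    using nd_poly_bound[OF s1_pos] by blast
  have "\<bar>md k \<eta> y\<bar> \<le> (C * (1 + M) ^ k) * (1 + \<bar>y\<bar>) ^ k * md 0 \<eta> y" if "\<eta> \<in> HH" for \<eta> y
  proof -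
    have "\<bar>md k \<eta> y\<bar> \<le> (\<integral>x. \<bar>nd k (snd x) (y - fst x)\<bar> \<partial>\<eta>)"
      unfolding md_def by (rule integral_abs_bound)
    also have "\<dots> \<le> (\<integral>x. (C * (1 + M) ^ k) * (1 + \<bar>y\<bar>) ^ k * nd 0 (snd x) (y - fst x) \<partial>\<eta>)"
    proof (rule integral_mono_AE)
      show "AE x in \<eta>. \<bar>nd k (snd x) (y - fst x)\<bar>
          \<le> (C * (1 + M) ^ k) * (1 + \<bar>y\<bar>) ^ k * nd 0 (snd x) (y - fst x)"
        using AE_rect[OF that]
      proof eventually_elim
        case (elim x)
        then have x: "\<bar>fst x\<bar> \<le> M" "s1 \<le> snd x" "snd x \<le> s2" by (auto simp: rect_def)
        have "1 + \<bar>y - fst x\<bar> \<le> 1 + M + \<bar>y\<bar>" using x by simp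
        also have "\<dots> \<le> (1 + M) * (1 + \<bar>y\<bar>)"
          using M_pos by (simp add: algebra_simps)
        finally have "(1 + \<bar>y - fst x\<bar>) ^ k \<le> (1 + M) ^ k * (1 + \<bar>y\<bar>) ^ k"
          unfolding power_mult_distrib[symmetric] by (intro power_mono) auto
        then have "C * (1 + \<bar>y - fst x\<bar>) ^ k * normal_density 0 (snd x) (y - fst x)
            \<le> C * ((1 + M) ^ k * (1 + \<bar>y\<bar>) ^ k) * normal_density 0 (snd x) (y - fst x)"
          using C by (intro mult_right_mono mult_left_mono) auto
        then show ?case using C(2)[of "snd x" "y - fst x"] x by (simp add: mult.assoc nd.simps)
      qed
    qed (use nd_integrable[OF that] in auto)
    also have "\<dots> = (C * (1 + M) ^ k) * (1 + \<bar>y\<bar>) ^ k * md 0 \<eta> y"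
      by (simp add: md_def)
    finally show ?thesis .
  qed
  then show ?thesis using C M_pos by (intro exI[of _ "C * (1 + M) ^ k"]) auto
qed

text \<open>The invariance of \<eta> replaces z by - z, and the kernel is even in y - z. Every later
  use of the symmetry constraint passes through this evenness.\<close>

lemma md0_even:
  assumes "\<eta> \<in> HH"
  shows "md 0 \<eta> (- y) = md 0 \<eta> y"
proof -
  have inv: "distr \<eta> borel (\<lambda>(z, s). (- z, s)) = \<eta>" using assms by (simp add: mixing_set_def)
  have "md 0 \<eta> (- y) = (\<integral>x. normal_density 0 (snd x) (- y - fst x) \<partial>distr \<eta> borel (\<lambda>(z, s). (- z, s)))"
    by (simp add: md_def inv nd.simps)
  also have "\<dots> = (\<integral>x. normal_density 0 (snd x) (- y - fst ((\<lambda>(z, s). (- z, s)) x)) \<partial>\<eta>)"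
  proof (subst integral_distr)
    show "(\<lambda>(z, s). (- z, s)) \<in> \<eta> \<rightarrow>\<^sub>M borel"
      unfolding measurable_cong_sets[OF HH_sets[OF assms] refl]
      by (intro borel_measurable_continuous_onI) (auto intro!: continuous_intros simp: case_prod_beta)
    have "(\<lambda>x. nd 0 (snd x) (- y - fst x)) \<in> borel_measurable (borel :: (real \<times> real) measure)"
      by measurable
    then show "(\<lambda>x. normal_density 0 (snd x) (- y - fst x)) \<in> borel_measurable borel"
      by (simp add: nd.simps)
  qed (simp add: case_prod_beta)
  also have "\<dots> = md 0 \<eta> y"
    unfolding md_def
    by (intro Bochner_Integration.integral_cong)
      (auto simp: case_prod_beta nd.simps normal_density_def power2_eq_square algebra_simps)
  finally show ?thesis .
qed

lemma md0_nn_integral: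
  assumes "\<eta> \<in> HH"
  shows "(\<integral>\<^sup>+y. ennreal (md 0 \<eta> y) \<partial>lborel) = 1"
proof -
  interpret prob_space \<eta> using assms by (rule HH_prob)
  interpret pair_sigma_finite lborel \<eta> ..
  have *: "(\<lambda>p. nd 0 (snd (snd p)) (fst p - fst (snd p)))
      \<in> borel_measurable (lborel \<Otimes>\<^sub>M \<eta>)"
  proof -
    have *: "sets (lborel \<Otimes>\<^sub>M \<eta>) = sets (borel \<Otimes>\<^sub>M (borel \<Otimes>\<^sub>M borel :: (real \<times> real) measure))"
      by (intro sets_pair_measure_cong sets_lborel) (simp only: HH_sets[OF assms] borel_prod)
    show ?thesis unfolding measurable_cong_sets[OF * refl] by measurable
  qed
  have "(\<integral>\<^sup>+y. ennreal (md 0 \<eta> y) \<partial>lborel)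
      = (\<integral>\<^sup>+y. (\<integral>\<^sup>+x. ennreal (nd 0 (snd x) (y - fst x)) \<partial>\<eta>) \<partial>lborel)"
    unfolding md_def
    by (intro nn_integral_cong nn_integral_eq_integral[symmetric] nd_integrable[OF assms]) (auto simp: nd.simps)
  also have "\<dots> = (\<integral>\<^sup>+x. (\<integral>\<^sup>+y. ennreal (nd 0 (snd x) (y - fst x)) \<partial>lborel) \<partial>\<eta>)"
    using * by (intro Fubini'[symmetric]) (simp add: case_prod_beta')
  also have "\<dots> = (\<integral>\<^sup>+x. 1 \<partial>\<eta>)"
  proof (rule nn_integral_cong_AE)
    show "AE x in \<eta>. (\<integral>\<^sup>+y. ennreal (nd 0 (snd x) (y - fst x)) \<partial>lborel) = 1"
      using AE_rect[OF assms]
    proof eventually_elim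
      case (elim x)
      then have "snd x > 0" using s1_pos by (auto simp: rect_def)
      have "nd 0 (snd x) (y - fst x) = normal_density (fst x) (snd x) y" for y
        by (simp add: nd.simps normal_density_def)
      moreover have "(\<integral>\<^sup>+y. ennreal (normal_density (fst x) (snd x) y) \<partial>lborel) = 1"
        using \<open>snd x > 0\<close> by (subst nn_integral_eq_integral) auto
      ultimately show ?case by simp
    qed
  qed
  also have "\<dots> = 1" by (simp add: emeasure_space_1)
  finally show ?thesis .
qed

lemma md0_integral:
  assumes "\<eta> \<in> HH"
  shows "integrable lborel (md 0 \<eta>)" "(\<integral>y. md 0 \<eta> y \<partial>lborel) = 1"
proof -
  have nn: "(\<integral>\<^sup>+y. ennreal (md 0 \<eta> y) \<partial>lborel) = ennreal 1" using md0_nn_integral[OF assms] by simp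
  have "has_bochner_integral lborel (md 0 \<eta>) 1"
    by (rule has_bochner_integral_nn_integral[OF _ _ _ nn])
      (use md0_pos[OF assms] assms in \<open>auto intro: less_imp_le\<close>)
  then show "integrable lborel (md 0 \<eta>)" "(\<integral>y. md 0 \<eta> y \<partial>lborel) = 1"
    by (auto simp: has_bochner_integral_iff)
qed

lemma gauss_moment_integrable:
  "integrable lborel (\<lambda>y. (1 + \<bar>y\<bar>) ^ k * exp (- (y\<^sup>2 / (4 * s2\<^sup>2))))"
proof -
  let ?w = "4 * s2\<^sup>2" and ?s = "2 * s2"
  have s: "?s > 0" using s1_pos s12 by simp
  have "integrable lborel (\<lambda>y. (fact k * exp (1 + ?w / 2)) * sqrt (2 * pi * ?s\<^sup>2) * normal_density 0 ?s y)"
    using s by (intro integrable_mult_right integrable_normal_density)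
  then show ?thesis
  proof (rule Bochner_Integration.integrable_bound)
    show "AE y in lborel. norm ((1 + \<bar>y\<bar>) ^ k * exp (- (y\<^sup>2 / (4 * s2\<^sup>2))))
        \<le> norm ((fact k * exp (1 + ?w / 2)) * sqrt (2 * pi * ?s\<^sup>2) * normal_density 0 ?s y)"
    proof (rule AE_I2)
      fix y :: real
      \<comment> \<open>Half of the exponent absorbs the polynomial through
        \<open>power_exp_bound\<close> with w = 4 s2^2; the other half is a Gaussian of standard
        deviation 2 s2.\<close>
      have "exp (- (y\<^sup>2 / (4 * s2\<^sup>2))) = exp (- (y\<^sup>2 / (2 * ?w))) * exp (- (y\<^sup>2 / (2 * ?w)))"
        by (simp add: exp_add[symmetric] del: exp_minus)
      then have "(1 + \<bar>y\<bar>) ^ k * exp (- (y\<^sup>2 / (4 * s2\<^sup>2)))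
          = ((1 + \<bar>y\<bar>) ^ k * exp (- (y\<^sup>2 / (2 * ?w)))) * exp (- (y\<^sup>2 / (2 * ?w)))" by simp
      also have "\<dots> \<le> (fact k * exp (1 + ?w / 2)) * exp (- (y\<^sup>2 / (2 * ?w)))"
        using s by (intro mult_right_mono power_exp_bound) auto
      also have "exp (- (y\<^sup>2 / (2 * ?w))) = sqrt (2 * pi * ?s\<^sup>2) * normal_density 0 ?s y"
        using s by (simp add: normal_density_def power_mult_distrib)
      finally show "norm ((1 + \<bar>y\<bar>) ^ k * exp (- (y\<^sup>2 / (4 * s2\<^sup>2))))
        \<le> norm ((fact k * exp (1 + ?w / 2)) * sqrt (2 * pi * ?s\<^sup>2) * normal_density 0 ?s y)"
        by (simp add: mult.assoc abs_mult)
    qed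
  qed measurable
qed

lemma md0_moment_integrable:
  assumes "\<eta> \<in> HH"
  shows "integrable lborel (\<lambda>y. (1 + \<bar>y\<bar>) ^ k * md 0 \<eta> y)"
proof (rule Bochner_Integration.integrable_bound[OF integrable_mult_right[OF gauss_moment_integrable[of k], of Cup]])
  have [measurable]: "md 0 \<eta> \<in> borel_measurable borel" using assms by measurable
  show "(\<lambda>y. (1 + \<bar>y\<bar>) ^ k * md 0 \<eta> y) \<in> borel_measurable lborel" by measurable
  show "AE y in lborel. norm ((1 + \<bar>y\<bar>) ^ k * md 0 \<eta> y)
      \<le> norm (Cup * ((1 + \<bar>y\<bar>) ^ k * exp (- (y\<^sup>2 / (4 * s2\<^sup>2)))))"
  proof (rule AE_I2)
    fix y :: real
    have "(1 + \<bar>y\<bar>) ^ k * md 0 \<eta> y \<le> (1 + \<bar>y\<bar>) ^ k * (Cup * exp (- (y\<^sup>2 / (4 * s2\<^sup>2))))"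
      by (intro mult_left_mono md0_upper assms) auto
    then show "norm ((1 + \<bar>y\<bar>) ^ k * md 0 \<eta> y)
      \<le> norm (Cup * ((1 + \<bar>y\<bar>) ^ k * exp (- (y\<^sup>2 / (4 * s2\<^sup>2)))))"
      using md0_pos[OF assms, of y] Cup_pos by (simp add: abs_mult mult_ac)
  qed
qed

lemma md0_weighted_integrable:
  assumes "\<eta> \<in> HH" and [measurable]: "f \<in> borel_measurable borel"
    and f: "\<And>y. \<bar>f y\<bar> \<le> C * (1 + \<bar>y\<bar>) ^ k"
  shows "integrable lborel (\<lambda>y. f y * md 0 \<eta> y)"
proof (rule Bochner_Integration.integrable_bound[OF integrable_mult_right[OF md0_moment_integrable[of \<eta> k], of C]])
  have [measurable]: "md 0 \<eta> \<in> borel_measurable borel" using assms by measurable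
  show "(\<lambda>y. f y * md 0 \<eta> y) \<in> borel_measurable lborel" by measurable
  show "AE y in lborel. norm (f y * md 0 \<eta> y) \<le> norm (C * ((1 + \<bar>y\<bar>) ^ k * md 0 \<eta> y))"
  proof (rule AE_I2)
    fix y :: real
    have "\<bar>f y\<bar> * md 0 \<eta> y \<le> \<bar>C * (1 + \<bar>y\<bar>) ^ k\<bar> * md 0 \<eta> y"
      using f[of y] md0_pos[OF assms(1), of y] by (intro mult_right_mono) auto
    then show "norm (f y * md 0 \<eta> y) \<le> norm (C * ((1 + \<bar>y\<bar>) ^ k * md 0 \<eta> y))"
      using md0_pos[OF assms(1), of y] by (simp add: abs_mult mult_ac)
  qed
qed (rule assms(1))

end

section \<open>Log-densities of normal mixtures\<close>

text \<open>Together with the two following definitions: the first three derivatives of log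
  p_\<eta>, spelled out in terms of \<open>md\<close> so that growth, continuity and measurability
  can be read off.\<close>

definition l1 :: "(real \<times> real) measure \<Rightarrow> real \<Rightarrow> real" where
  "l1 \<eta> y = md 1 \<eta> y / md 0 \<eta> y"

definition l2 :: "(real \<times> real) measure \<Rightarrow> real \<Rightarrow> real" where
  "l2 \<eta> y = md 2 \<eta> y / md 0 \<eta> y - (l1 \<eta> y)\<^sup>2"

definition l3 :: "(real \<times> real) measure \<Rightarrow> real \<Rightarrow> real" where
  "l3 \<eta> y = md 3 \<eta> y / md 0 \<eta> y - md 1 \<eta> y * md 2 \<eta> y / (md 0 \<eta> y)\<^sup>2 - 2 * l1 \<eta> y * l2 \<eta> y"

text \<open>A Landau-Kolmogorov inequality. Over a step \<tau> the mean value theorem finds a point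
  with |f'| <= 2 \<kappa> / \<tau> = \<delta> / 2, and returning to y costs at most K \<tau> <=
  \<delta> / 2. As \<kappa> depends on \<delta> and K alone, it serves all mixtures at once.\<close>

lemma derivative_interpolation:
  fixes K \<delta> :: real
  assumes "\<delta> > 0" "K \<ge> 0"
  shows "\<exists>\<kappa>>0. \<forall>f f' f''. (\<forall>x::real. (f has_real_derivative f' x) (at x)) \<longrightarrow>
      (\<forall>x. (f' has_real_derivative f'' x) (at x)) \<longrightarrow> (\<forall>x. \<bar>f x\<bar> \<le> \<kappa>) \<longrightarrow> (\<forall>x. \<bar>f'' x\<bar> \<le> K) \<longrightarrow>
      (\<forall>x. \<bar>f' x\<bar> \<le> \<delta>)"
proof -
  define \<tau> where "\<tau> = \<delta> / (2 * (K + 1))"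
  have \<tau>: "\<tau> > 0" "K * \<tau> \<le> \<delta> / 2"
    using assms by (auto simp: \<tau>_def field_simps)
  show ?thesis
  proof (intro exI[of _ "\<delta> * \<tau> / 4"] conjI allI impI)
    show "\<delta> * \<tau> / 4 > 0" using assms \<tau> by simp
    fix f f' f'' :: "real \<Rightarrow> real" and y
    assume f: "\<forall>x. (f has_real_derivative f' x) (at x)" "\<forall>x. (f' has_real_derivative f'' x) (at x)"
      and b: "\<forall>x. \<bar>f x\<bar> \<le> \<delta> * \<tau> / 4" "\<forall>x. \<bar>f'' x\<bar> \<le> K"
    obtain \<xi> where \<xi>: "\<bar>\<xi> - y\<bar> \<le> \<bar>\<tau>\<bar>" "f (y + \<tau>) - f y = \<tau> * f' \<xi>"
      using mvt_abs[of f f'] f by blast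
    have "\<tau> * \<bar>f' \<xi>\<bar> = \<bar>f (y + \<tau>) - f y\<bar>" using \<xi> \<tau> by (simp add: abs_mult)
    also have "\<dots> \<le> \<delta> * \<tau> / 4 + \<delta> * \<tau> / 4" using b by (smt (verit))
    also have "\<dots> = \<tau> * (\<delta> / 2)" by simp
    finally have "\<bar>f' \<xi>\<bar> \<le> \<delta> / 2" using \<tau> by simp
    moreover have "\<bar>f' y - f' \<xi>\<bar> \<le> K * \<bar>y - \<xi>\<bar>"
      using f b by (intro lipschitz_of_derivative) auto
    moreover have "K * \<bar>y - \<xi>\<bar> \<le> K * \<tau>" using \<xi> \<tau> assms by (intro mult_left_mono) auto
    ultimately show "\<bar>f' y\<bar> \<le> \<delta>" using \<tau> by linarith
  qed
qed

context normal_mixture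
begin

lemma l0_has_derivative:
  assumes "\<eta> \<in> HH"
  shows "(log_density \<eta> has_real_derivative l1 \<eta> y) (at y)"
proof -
  have "((\<lambda>y. ln (md 0 \<eta> y)) has_real_derivative l1 \<eta> y) (at y)"
    using md_has_derivative[OF assms, of 0 y] md0_pos[OF assms, of y]
    by (auto intro!: derivative_eq_intros simp: l1_def)
  then show ?thesis by (simp add: log_density_def[abs_def] md_0)
qed

lemma l1_has_derivative:
  assumes "\<eta> \<in> HH"
  shows "(l1 \<eta> has_real_derivative l2 \<eta> y) (at y)"
proof -
  have "((\<lambda>y. md 1 \<eta> y / md 0 \<eta> y) has_real_derivative l2 \<eta> y) (at y)"
    using md_has_derivative[OF assms, of 0 y] md_has_derivative[OF assms, of 1 y] md0_pos[OF assms, of y]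
    by (auto intro!: derivative_eq_intros simp: l2_def l1_def numeral_2_eq_2 field_simps)
  then show ?thesis by (simp add: l1_def[abs_def])
qed

lemma l2_has_derivative:
  assumes "\<eta> \<in> HH"
  shows "(l2 \<eta> has_real_derivative l3 \<eta> y) (at y)"
proof -
  have "((\<lambda>y. md 2 \<eta> y / md 0 \<eta> y - (l1 \<eta> y)\<^sup>2) has_real_derivative l3 \<eta> y) (at y)"
    using md_has_derivative[OF assms, of 0 y] md_has_derivative[OF assms, of 2 y] l1_has_derivative[OF assms, of y]
      md0_pos[OF assms, of y]
    by (auto intro!: derivative_eq_intros simp: l3_def numeral_3_eq_3 numeral_2_eq_2 field_simps)
  then show ?thesis by (simp add: l2_def[abs_def])
qed

lemma score_eq: "\<eta> \<in> HH \<Longrightarrow> deriv (log_density \<eta>) = l1 \<eta>"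
  using l0_has_derivative by (auto simp: fun_eq_iff intro: DERIV_imp_deriv)

text \<open>Derivatives of log p_\<eta> are polynomials in the ratios
  \<open>md k \<eta> y / md 0 \<eta> y\<close>, each of growth (1 + |y|)^k, so the order of the
  derivative is the order of growth. The Gaussian envelopes give the quadratic growth of log
  p_\<eta> itself.\<close>

lemma log_density_bounds:
  "\<exists>C\<ge>1. \<forall>\<eta>\<in>HH. \<forall>y. \<bar>log_density \<eta> y\<bar> \<le> C * (1 + \<bar>y\<bar>)\<^sup>2 \<and> \<bar>l1 \<eta> y\<bar> \<le> C * (1 + \<bar>y\<bar>) \<and>
     \<bar>l2 \<eta> y\<bar> \<le> C * (1 + \<bar>y\<bar>)\<^sup>2 \<and> \<bar>l3 \<eta> y\<bar> \<le> C * (1 + \<bar>y\<bar>) ^ 3"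
proof -
  have ratio: "\<exists>C\<ge>0. \<forall>\<eta>\<in>HH. \<forall>y. \<bar>md k \<eta> y / md 0 \<eta> y\<bar> \<le> C * (1 + \<bar>y\<bar>) ^ k" for k
  proof -
    obtain C where C: "C \<ge> 0" "\<forall>\<eta>\<in>HH. \<forall>y. \<bar>md k \<eta> y\<bar> \<le> C * (1 + \<bar>y\<bar>) ^ k * md 0 \<eta> y"
      using md_ratio by blast
    have "\<bar>md k \<eta> y / md 0 \<eta> y\<bar> \<le> C * (1 + \<bar>y\<bar>) ^ k" if "\<eta> \<in> HH" for \<eta> y
      using C that md0_pos[OF that, of y] by (simp add: divide_le_eq)
    then show ?thesis using C by blast
  qed
  obtain C1 where C1: "C1 \<ge> 0" "\<forall>\<eta>\<in>HH. \<forall>y. \<bar>md 1 \<eta> y / md 0 \<eta> y\<bar> \<le> C1 * (1 + \<bar>y\<bar>) ^ 1" using ratio by blast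
  obtain C2 where C2: "C2 \<ge> 0" "\<forall>\<eta>\<in>HH. \<forall>y. \<bar>md 2 \<eta> y / md 0 \<eta> y\<bar> \<le> C2 * (1 + \<bar>y\<bar>) ^ 2" using ratio by blast
  obtain C3 where C3: "C3 \<ge> 0" "\<forall>\<eta>\<in>HH. \<forall>y. \<bar>md 3 \<eta> y / md 0 \<eta> y\<bar> \<le> C3 * (1 + \<bar>y\<bar>) ^ 3" using ratio by blast
  let ?c = "1 / sqrt (2 * pi * s2\<^sup>2)"
  let ?C0 = "\<bar>ln Cup\<bar> + \<bar>ln ?c\<bar> + (1 + M)\<^sup>2 / (2 * s1\<^sup>2)"
  define CA where "CA = C2 + C1\<^sup>2"
  define CB where "CB = C3 + C1 * C2 + 2 * C1 * CA"
  have c: "?c > 0" using s1_pos s12 by simp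
  have b0: "\<bar>log_density \<eta> y\<bar> \<le> ?C0 * (1 + \<bar>y\<bar>)\<^sup>2" if "\<eta> \<in> HH" for \<eta> y
  proof -
    have v1: "(1 + \<bar>y\<bar>)\<^sup>2 \<ge> 1" by (simp add: one_le_power)
    have "ln (md 0 \<eta> y) \<le> ln (Cup * exp (- (y\<^sup>2 / (4 * s2\<^sup>2))))"
      using md0_pos[OF that] md0_upper[OF that] Cup_pos by (subst ln_le_cancel_iff) auto
    also have "\<dots> \<le> \<bar>ln Cup\<bar>"
    proof -
      have "0 \<le> y\<^sup>2 / (4 * s2\<^sup>2)" by simp
      moreover have "ln (Cup * exp (- (y\<^sup>2 / (4 * s2\<^sup>2)))) = ln Cup - y\<^sup>2 / (4 * s2\<^sup>2)"
        using Cup_pos by (simp add: ln_mult)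
      ultimately show ?thesis by linarith
    qed
    also have "\<dots> \<le> ?C0 * 1" by simp
    also have "\<dots> \<le> ?C0 * (1 + \<bar>y\<bar>)\<^sup>2" by (intro mult_left_mono v1) auto
    finally have up: "ln (md 0 \<eta> y) \<le> ?C0 * (1 + \<bar>y\<bar>)\<^sup>2" .
    have "ln (?c * exp (- ((\<bar>y\<bar> + M)\<^sup>2 / (2 * s1\<^sup>2)))) \<le> ln (md 0 \<eta> y)"
      using md0_pos[OF that, of y] md0_lower[OF that, of y] c by (subst ln_le_cancel_iff) auto
    then have "- ln (md 0 \<eta> y) \<le> - ln ?c + (\<bar>y\<bar> + M)\<^sup>2 / (2 * s1\<^sup>2)"
      unfolding ln_mult_pos[OF c exp_gt_zero] ln_exp by linarith
    also have "\<dots> \<le> \<bar>ln ?c\<bar> * (1 + \<bar>y\<bar>)\<^sup>2 + ((1 + M)\<^sup>2 / (2 * s1\<^sup>2)) * (1 + \<bar>y\<bar>)\<^sup>2"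
    proof (rule add_mono)
      have "- ln ?c \<le> \<bar>ln ?c\<bar> * 1" by simp
      also have "\<dots> \<le> \<bar>ln ?c\<bar> * (1 + \<bar>y\<bar>)\<^sup>2" by (intro mult_left_mono v1) auto
      finally show "- ln ?c \<le> \<bar>ln ?c\<bar> * (1 + \<bar>y\<bar>)\<^sup>2" .
      have "\<bar>y\<bar> + M \<le> (1 + M) * (1 + \<bar>y\<bar>)" using M_pos by (simp add: algebra_simps)
      then have "(\<bar>y\<bar> + M)\<^sup>2 \<le> (1 + M)\<^sup>2 * (1 + \<bar>y\<bar>)\<^sup>2"
        using M_pos unfolding power_mult_distrib[symmetric] by (intro power_mono) auto
      then show "(\<bar>y\<bar> + M)\<^sup>2 / (2 * s1\<^sup>2) \<le> ((1 + M)\<^sup>2 / (2 * s1\<^sup>2)) * (1 + \<bar>y\<bar>)\<^sup>2"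
        by (simp add: divide_right_mono)
    qed
    also have "\<dots> \<le> ?C0 * (1 + \<bar>y\<bar>)\<^sup>2" by (simp add: algebra_simps)
    finally show ?thesis using up by (simp add: log_density_def md_0[symmetric] abs_le_iff)
  qed
  have b1: "\<bar>l1 \<eta> y\<bar> \<le> C1 * (1 + \<bar>y\<bar>)" if "\<eta> \<in> HH" for \<eta> y
    using C1 that by (simp add: l1_def)
  have b2: "\<bar>l2 \<eta> y\<bar> \<le> CA * (1 + \<bar>y\<bar>)\<^sup>2" if "\<eta> \<in> HH" for \<eta> y
  proof -
    have "\<bar>l2 \<eta> y\<bar> \<le> \<bar>md 2 \<eta> y / md 0 \<eta> y\<bar> + \<bar>l1 \<eta> y\<bar>\<^sup>2" unfolding l2_def by (rule order_trans[OF abs_triangle_ineq4]) simp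
    also have "\<dots> \<le> C2 * (1 + \<bar>y\<bar>)\<^sup>2 + (C1 * (1 + \<bar>y\<bar>))\<^sup>2"
      using C2 that b1[OF that] by (intro add_mono power_mono) auto
    finally show ?thesis by (simp add: CA_def power_mult_distrib distrib_right)
  qed
  have b3: "\<bar>l3 \<eta> y\<bar> \<le> CB * (1 + \<bar>y\<bar>) ^ 3" if "\<eta> \<in> HH" for \<eta> y
  proof -
    let ?v = "1 + \<bar>y\<bar>"
    have "l3 \<eta> y = md 3 \<eta> y / md 0 \<eta> y - l1 \<eta> y * (md 2 \<eta> y / md 0 \<eta> y) - 2 * (l1 \<eta> y * l2 \<eta> y)"
      by (simp add: l3_def l1_def power2_eq_square)
    also have "\<bar>\<dots>\<bar> \<le> \<bar>md 3 \<eta> y / md 0 \<eta> y\<bar> + \<bar>l1 \<eta> y\<bar> * \<bar>md 2 \<eta> y / md 0 \<eta> y\<bar> + 2 * (\<bar>l1 \<eta> y\<bar> * \<bar>l2 \<eta> y\<bar>)"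
      unfolding abs_mult[symmetric] by linarith
    also have "\<dots> \<le> C3 * ?v ^ 3 + (C1 * ?v) * (C2 * ?v\<^sup>2) + 2 * ((C1 * ?v) * (CA * ?v\<^sup>2))"
      using C3 C2 C1 that b1[OF that] b2[OF that] by (intro add_mono mult_mono mult_left_mono) auto
    also have "\<dots> = CB * ?v ^ 3" by (simp add: CB_def power2_eq_square power3_eq_cube algebra_simps)
    finally show ?thesis .
  qed
  define C where "C = 1 + ?C0 + C1 + CA + CB"
  have nn: "?C0 \<ge> 0" "CA \<ge> 0" "CB \<ge> 0" using C1 C2 C3 by (auto simp: CA_def CB_def)
  have le: "?C0 \<le> C" "C1 \<le> C" "CA \<le> C" "CB \<le> C" "C \<ge> 1" using nn C1 by (auto simp: C_def)
  show ?thesis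
  proof (intro exI[of _ C] conjI ballI allI le)
    fix \<eta> y assume \<eta>: "\<eta> \<in> HH"
    show "\<bar>log_density \<eta> y\<bar> \<le> C * (1 + \<bar>y\<bar>)\<^sup>2"
      by (rule order_trans[OF b0[OF \<eta>]]) (intro mult_right_mono le; simp)
    show "\<bar>l1 \<eta> y\<bar> \<le> C * (1 + \<bar>y\<bar>)"
      by (rule order_trans[OF b1[OF \<eta>]]) (intro mult_right_mono le; simp)
    show "\<bar>l2 \<eta> y\<bar> \<le> C * (1 + \<bar>y\<bar>)\<^sup>2"
      by (rule order_trans[OF b2[OF \<eta>]]) (intro mult_right_mono le; simp)
    show "\<bar>l3 \<eta> y\<bar> \<le> C * (1 + \<bar>y\<bar>) ^ 3"
      by (rule order_trans[OF b3[OF \<eta>]]) (intro mult_right_mono le; simp)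
  qed
qed

text \<open>One constant for the whole class and all four bounds. The largest power, 3, fixes the
  weight (1 + |s|)^3 in which derivatives are measured from here on.\<close>

definition KC :: real where
  "KC = (SOME C. C \<ge> 1 \<and> (\<forall>\<eta>\<in>HH. \<forall>y. \<bar>log_density \<eta> y\<bar> \<le> C * (1 + \<bar>y\<bar>)\<^sup>2 \<and> \<bar>l1 \<eta> y\<bar> \<le> C * (1 + \<bar>y\<bar>) \<and>
     \<bar>l2 \<eta> y\<bar> \<le> C * (1 + \<bar>y\<bar>)\<^sup>2 \<and> \<bar>l3 \<eta> y\<bar> \<le> C * (1 + \<bar>y\<bar>) ^ 3))"

lemma KC_ge_1: "KC \<ge> 1"
  and l0_bound: "\<eta> \<in> HH \<Longrightarrow> \<bar>log_density \<eta> y\<bar> \<le> KC * (1 + \<bar>y\<bar>)\<^sup>2"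
  and l1_bound: "\<eta> \<in> HH \<Longrightarrow> \<bar>l1 \<eta> y\<bar> \<le> KC * (1 + \<bar>y\<bar>)"
  and l2_bound: "\<eta> \<in> HH \<Longrightarrow> \<bar>l2 \<eta> y\<bar> \<le> KC * (1 + \<bar>y\<bar>)\<^sup>2"
  and l3_bound: "\<eta> \<in> HH \<Longrightarrow> \<bar>l3 \<eta> y\<bar> \<le> KC * (1 + \<bar>y\<bar>) ^ 3"
  using someI_ex[OF log_density_bounds[unfolded Bex_def], folded KC_def] by auto

lemma l_measurable[measurable]:
  assumes "\<eta> \<in> HH"
  shows "log_density \<eta> \<in> borel_measurable borel" "l1 \<eta> \<in> borel_measurable borel"
    "l2 \<eta> \<in> borel_measurable borel"  "l3 \<eta> \<in> borel_measurable borel"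
proof -
  note [measurable] = md_measurable[OF assms]
  show "log_density \<eta> \<in> borel_measurable borel" "l1 \<eta> \<in> borel_measurable borel"
     "l2 \<eta> \<in> borel_measurable borel"  "l3 \<eta> \<in> borel_measurable borel"
    unfolding log_density_def[abs_def] l1_def[abs_def] l2_def[abs_def] l3_def[abs_def] md_0[symmetric]
    by measurable
qed

lemma md0_neq_0: "\<eta> \<in> HH \<Longrightarrow> md 0 \<eta> y \<noteq> 0"
  using md0_pos by (metis less_irrefl)

lemma l3_continuous: "\<eta> \<in> HH \<Longrightarrow> continuous_on A (l3 \<eta>)"
  unfolding l3_def l2_def l1_def
  by (intro continuous_intros md_continuous) (auto simp: md0_neq_0)

lemma l2_continuous: "\<eta> \<in> HH \<Longrightarrow> continuous_on A (l2 \<eta>)"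
  by (meson DERIV_continuous_on has_field_derivative_at_within l2_has_derivative)

lemma l1_continuous: "\<eta> \<in> HH \<Longrightarrow> continuous_on A (l1 \<eta>)"
  by (meson DERIV_continuous_on has_field_derivative_at_within l1_has_derivative)

text \<open>Neighbourhoods are taken in the sup distance of the densities: it controls the Taylor
  coefficients and separates in Kullback-Leibler divergence, and by \<open>near_weak_nbhd\<close> it
  is still coarse enough for the weak topology.\<close>

definition near :: "real \<Rightarrow> (real \<times> real) measure \<Rightarrow> (real \<times> real) measure set" where
  "near \<kappa> \<eta>0 = {\<eta> \<in> HH. \<forall>y. \<bar>md 0 \<eta> y - md 0 \<eta>0 y\<bar> \<le> \<kappa>}"

text \<open>\<open>derivative_interpolation\<close> is applied twice, from order 0 to 1 and from 1
  to 2; the constants are chosen backwards, starting with order 2.\<close>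

lemma near_md:
  assumes \<eta>0: "\<eta>0 \<in> HH" and "\<delta> > 0"
  shows "\<exists>\<kappa>>0. \<forall>\<eta>\<in>near \<kappa> \<eta>0. \<forall>y. \<bar>md 0 \<eta> y - md 0 \<eta>0 y\<bar> \<le> \<delta> \<and> \<bar>md 1 \<eta> y - md 1 \<eta>0 y\<bar> \<le> \<delta>
     \<and> \<bar>md 2 \<eta> y - md 2 \<eta>0 y\<bar> \<le> \<delta>"
proof -
  obtain B2 where B2: "B2 \<ge> 0" "\<forall>\<eta>\<in>HH. \<forall>y. \<bar>md 2 \<eta> y\<bar> \<le> B2" using md_bounded by blast
  obtain B3 where B3: "B3 \<ge> 0" "\<forall>\<eta>\<in>HH. \<forall>y. \<bar>md 3 \<eta> y\<bar> \<le> B3" using md_bounded by blast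
  have step: "\<exists>\<kappa>>0. \<forall>\<eta>\<in>HH. (\<forall>y. \<bar>md k \<eta> y - md k \<eta>0 y\<bar> \<le> \<kappa>) \<longrightarrow> (\<forall>y. \<bar>md (Suc k) \<eta> y - md (Suc k) \<eta>0 y\<bar> \<le> \<epsilon>)"
    if "\<epsilon> > 0" for k \<epsilon>
  proof -
    obtain B where B: "B \<ge> 0" "\<forall>\<eta>\<in>HH. \<forall>y. \<bar>md (Suc (Suc k)) \<eta> y\<bar> \<le> B" using md_bounded by blast
    have "2 * B \<ge> 0" using B by simp
    from derivative_interpolation[OF that this] obtain \<kappa> where \<kappa>: "\<kappa> > 0"
      "\<And>f f' f''. (\<forall>x::real. (f has_real_derivative f' x) (at x)) \<Longrightarrow>
      (\<forall>x. (f' has_real_derivative f'' x) (at x)) \<Longrightarrow> (\<forall>x. \<bar>f x\<bar> \<le> \<kappa>) \<Longrightarrow> (\<forall>x. \<bar>f'' x\<bar> \<le> 2 * B) \<Longrightarrow>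
      (\<forall>x. \<bar>f' x\<bar> \<le> \<epsilon>)" by blast
    show ?thesis
    proof (intro exI[of _ \<kappa>] conjI \<kappa>(1) ballI impI)
      fix \<eta> assume \<eta>: "\<eta> \<in> HH" and n: "\<forall>y. \<bar>md k \<eta> y - md k \<eta>0 y\<bar> \<le> \<kappa>"
      show "\<forall>y. \<bar>md (Suc k) \<eta> y - md (Suc k) \<eta>0 y\<bar> \<le> \<epsilon>"
      proof -
        have d: "\<forall>x. ((\<lambda>y. md k \<eta> y - md k \<eta>0 y) has_real_derivative md (Suc k) \<eta> x - md (Suc k) \<eta>0 x) (at x)"
          "\<forall>x. ((\<lambda>y. md (Suc k) \<eta> y - md (Suc k) \<eta>0 y) has_real_derivative
            md (Suc (Suc k)) \<eta> x - md (Suc (Suc k)) \<eta>0 x) (at x)"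
          using \<eta> \<eta>0 by (auto intro!: derivative_intros md_has_derivative)
        have b: "\<forall>x. \<bar>md (Suc (Suc k)) \<eta> x - md (Suc (Suc k)) \<eta>0 x\<bar> \<le> 2 * B"
        proof
          fix x show "\<bar>md (Suc (Suc k)) \<eta> x - md (Suc (Suc k)) \<eta>0 x\<bar> \<le> 2 * B"
          using B(2)[rule_format, OF \<eta>, of x] B(2)[rule_format, OF \<eta>0, of x] by linarith
        qed
        show ?thesis by (rule \<kappa>(2)[OF d n b])
      qed
    qed
  qed
  obtain k1 where k1: "k1 > 0" "\<forall>\<eta>\<in>HH. (\<forall>y. \<bar>md 1 \<eta> y - md 1 \<eta>0 y\<bar> \<le> k1) \<longrightarrow> (\<forall>y. \<bar>md 2 \<eta> y - md 2 \<eta>0 y\<bar> \<le> \<delta>)"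
    using step[OF assms(2), of 1] by (auto simp: numeral_2_eq_2)
  have "min k1 \<delta> > 0" using k1 assms by simp
  then obtain k0 where k0: "k0 > 0"
    "\<forall>\<eta>\<in>HH. (\<forall>y. \<bar>md 0 \<eta> y - md 0 \<eta>0 y\<bar> \<le> k0) \<longrightarrow> (\<forall>y. \<bar>md 1 \<eta> y - md 1 \<eta>0 y\<bar> \<le> min k1 \<delta>)"
    using step[of "min k1 \<delta>" 0] by auto
  show ?thesis
    using k0 k1 assms by (intro exI[of _ "min k0 \<delta>"]) (auto simp: near_def)
qed

text \<open>The weight is one power above the growth of either function, so beyond a radius T the
  crude growth bound is already below \<delta> times the weight. On [- T, T] all densities are
  bounded away from 0, and closeness of \<open>md 0\<close>, \<open>md 1\<close>,
  \<open>md 2\<close> carries over to logarithms and quotients.\<close>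

lemma near_log_density:
  assumes \<eta>0: "\<eta>0 \<in> HH" and "\<delta> > 0"
  shows "\<exists>\<kappa>>0. \<forall>\<eta>\<in>near \<kappa> \<eta>0. \<forall>y. \<bar>log_density \<eta> y - log_density \<eta>0 y\<bar> \<le> \<delta> * (1 + \<bar>y\<bar>) ^ 3
     \<and> \<bar>l2 \<eta> y - l2 \<eta>0 y\<bar> \<le> \<delta> * (1 + \<bar>y\<bar>) ^ 3"
proof -
  obtain B1 where B1: "B1 \<ge> 0" "\<forall>\<eta>\<in>HH. \<forall>y. \<bar>md 1 \<eta> y\<bar> \<le> B1" using md_bounded by blast
  obtain B2 where B2: "B2 \<ge> 0" "\<forall>\<eta>\<in>HH. \<forall>y. \<bar>md 2 \<eta> y\<bar> \<le> B2" using md_bounded by blast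
  obtain B0 where B0: "B0 \<ge> 0" "\<forall>\<eta>\<in>HH. \<forall>y. \<bar>md 0 \<eta> y\<bar> \<le> B0" using md_bounded by blast
  define B where "B = B0 + B1 + B2"
  have B: "B \<ge> 0" "\<bar>md 0 \<eta> y\<bar> \<le> B" "\<bar>md 1 \<eta> y\<bar> \<le> B" "\<bar>md 2 \<eta> y\<bar> \<le> B" if "\<eta> \<in> HH" for \<eta> y
    using B0(1) B1(1) B2(1) B0(2)[rule_format, OF that, of y] B1(2)[rule_format, OF that, of y]
      B2(2)[rule_format, OF that, of y] unfolding B_def by linarith+
  \<comment> \<open>Beyond |y| = T, \<delta> (1 + |y|) exceeds 2 KC, the sum of the two growth
    constants.\<close>
  define T where "T = 2 * KC / \<delta>"
  have T: "T \<ge> 0" using assms KC_ge_1 by (simp add: T_def)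
  define m where "m = 1 / sqrt (2 * pi * s2\<^sup>2) * exp (- ((T + M)\<^sup>2 / (2 * s1\<^sup>2)))"
  have m: "m > 0" using s1_pos s12 by (simp add: m_def)
  have mle: "m \<le> md 0 \<eta> y" if "\<eta> \<in> HH" "\<bar>y\<bar> \<le> T" for \<eta> y
  proof (rule order_trans[OF _ md0_lower[OF that(1)]])
    have "(\<bar>y\<bar> + M)\<^sup>2 \<le> (T + M)\<^sup>2" using that M_pos by (intro power_mono) auto
    then show "m \<le> 1 / sqrt (2 * pi * s2\<^sup>2) * exp (- ((\<bar>y\<bar> + M)\<^sup>2 / (2 * s1\<^sup>2)))"
      unfolding m_def by (intro mult_left_mono) (auto intro!: divide_right_mono)
  qed
  \<comment> \<open>A dominates the factor by which changes of the \<open>md k\<close> are amplified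
    on [- T, T]: 1 / m for the logarithm and (2 B / m^2)(1 + 2 B / m) for \<open>l2\<close>, whose
    squared term contributes the 2 B / m.\<close>
  define A where "A = 1 / m + (2 * B / m\<^sup>2) * (1 + 2 * B / m)"
  have A: "A > 0" "1 / m \<le> A" "(2 * B / m\<^sup>2) * (1 + 2 * B / m) \<le> A"
    using m B[OF \<eta>0] by (auto simp: A_def intro!: add_pos_nonneg)
  have "\<delta> / A > 0" using A assms by simp
  from near_md[OF \<eta>0 this] obtain \<kappa> where \<kappa>: "\<kappa> > 0"
    "\<And>\<eta> y. \<eta> \<in> near \<kappa> \<eta>0 \<Longrightarrow> \<bar>md 0 \<eta> y - md 0 \<eta>0 y\<bar> \<le> \<delta> / A \<and> \<bar>md 1 \<eta> y - md 1 \<eta>0 y\<bar> \<le> \<delta> / A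
     \<and> \<bar>md 2 \<eta> y - md 2 \<eta>0 y\<bar> \<le> \<delta> / A" by blast
  have ratio: "\<bar>a / p - a0 / p0\<bar> \<le> (\<delta> / A) * (2 * B / m\<^sup>2)"
    if "\<bar>a - a0\<bar> \<le> \<delta> / A" "\<bar>p - p0\<bar> \<le> \<delta> / A" "\<bar>a0\<bar> \<le> B" "\<bar>p0\<bar> \<le> B" "m \<le> p" "m \<le> p0" for a a0 p p0 :: real
  proof -
    have pp: "p > 0" "p0 > 0" using that m by auto
    have "\<bar>a / p - a0 / p0\<bar> = \<bar>(a - a0) * p0 + a0 * (p0 - p)\<bar> / (p * p0)"
      using pp by (simp add: field_simps abs_div)
    also have "\<dots> \<le> ((\<delta> / A) * B + B * (\<delta> / A)) / (m * m)"
    proof (intro frac_le mult_mono)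
      have "\<bar>(a - a0) * p0 + a0 * (p0 - p)\<bar> \<le> \<bar>a - a0\<bar> * \<bar>p0\<bar> + \<bar>a0\<bar> * \<bar>p0 - p\<bar>"
        unfolding abs_mult[symmetric] by (rule abs_triangle_ineq)
      also have "\<dots> \<le> (\<delta> / A) * B + B * (\<delta> / A)"
        using that \<open>\<delta> / A > 0\<close> by (intro add_mono mult_mono) auto
      finally show "\<bar>(a - a0) * p0 + a0 * (p0 - p)\<bar> \<le> (\<delta> / A) * B + B * (\<delta> / A)" .
      have "B \<ge> 0" using that by linarith
      then show "0 \<le> (\<delta> / A) * B + B * (\<delta> / A)" using \<open>\<delta> / A > 0\<close>
        by (intro add_nonneg_nonneg mult_nonneg_nonneg) auto
    qed (use that m pp in auto)
    also have "\<dots> = (\<delta> / A) * (2 * B / m\<^sup>2)" by (simp add: power2_eq_square)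
    finally show ?thesis .
  qed
  show ?thesis
  proof (intro exI[of _ \<kappa>] conjI \<kappa>(1) ballI allI)
    fix \<eta> and y :: real assume n: "\<eta> \<in> near \<kappa> \<eta>0"
    then have \<eta>: "\<eta> \<in> HH" by (simp add: near_def)
    have v: "(1 + \<bar>y\<bar>) ^ 3 \<ge> 1" by (rule one_le_power) simp
    have dv: "\<delta> \<le> \<delta> * (1 + \<bar>y\<bar>) ^ 3"
      using mult_left_mono[OF v, of \<delta>] assms by simp
    have far: "2 * (KC * (1 + \<bar>y\<bar>)\<^sup>2) \<le> \<delta> * (1 + \<bar>y\<bar>) ^ 3" if "\<not> \<bar>y\<bar> \<le> T"
    proof -
      have "2 * KC \<le> \<delta> * (1 + \<bar>y\<bar>)"
        using that assms by (simp add: T_def field_simps not_le)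
      then have "2 * KC * (1 + \<bar>y\<bar>)\<^sup>2 \<le> \<delta> * (1 + \<bar>y\<bar>) * (1 + \<bar>y\<bar>)\<^sup>2" by (intro mult_right_mono) auto
      then show ?thesis by (simp add: power3_eq_cube power2_eq_square mult.assoc)
    qed
    note nn = \<kappa>(2)[OF n, of y]
    show "\<bar>log_density \<eta> y - log_density \<eta>0 y\<bar> \<le> \<delta> * (1 + \<bar>y\<bar>) ^ 3"
    proof (cases "\<bar>y\<bar> \<le> T")
      case True
      have ln: "ln a - ln b \<le> \<delta>" if "m \<le> a" "m \<le> b" "\<bar>a - b\<bar> \<le> \<delta> / A" for a b
      proof -
        have "ln a - ln b = ln (a / b)" using that m by (simp add: ln_div)
        also have "\<dots> \<le> a / b - 1" using that m by (intro ln_le_minus_one) auto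
        also have "\<dots> = (a - b) / b" using that m by (simp add: diff_divide_distrib)
        also have "\<dots> \<le> (\<delta> / A) / m" using that m \<open>\<delta> / A > 0\<close> by (intro frac_le) auto
        also have "\<dots> = \<delta> * ((1 / m) / A)" by simp
        also have "\<dots> \<le> \<delta> * 1" using A assms
          by (intro mult_left_mono) (simp_all only: divide_le_eq_1_pos less_imp_le)
        finally show ?thesis by simp
      qed
      have "\<bar>ln (md 0 \<eta> y) - ln (md 0 \<eta>0 y)\<bar> \<le> \<delta>"
        using ln[of "md 0 \<eta> y" "md 0 \<eta>0 y"] ln[of "md 0 \<eta>0 y" "md 0 \<eta> y"] mle[OF \<eta> True] mle[OF \<eta>0 True] nn
        by (auto simp: abs_le_iff)
      then show ?thesis using dv by (simp add: log_density_def md_0[symmetric])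
    next
      case False
      show ?thesis using far[OF False] l0_bound[OF \<eta>, of y] l0_bound[OF \<eta>0, of y] by linarith
    qed
    show "\<bar>l2 \<eta> y - l2 \<eta>0 y\<bar> \<le> \<delta> * (1 + \<bar>y\<bar>) ^ 3"
    proof (cases "\<bar>y\<bar> \<le> T")
      case True
      let ?r = "(\<delta> / A) * (2 * B / m\<^sup>2)"
      have r0: "?r \<ge> 0" using assms A(1) B(1)[OF \<eta>0] m
        by (intro mult_nonneg_nonneg divide_nonneg_nonneg) auto
      have r2: "\<bar>md 2 \<eta> y / md 0 \<eta> y - md 2 \<eta>0 y / md 0 \<eta>0 y\<bar> \<le> ?r"
        using nn B(2-4)[OF \<eta>0, of y] B(1)[OF \<eta>0] mle[OF \<eta> True] mle[OF \<eta>0 True] by (intro ratio) auto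
      have r1: "\<bar>l1 \<eta> y - l1 \<eta>0 y\<bar> \<le> ?r" unfolding l1_def
        using nn B(2-4)[OF \<eta>0, of y] B(1)[OF \<eta>0] mle[OF \<eta> True] mle[OF \<eta>0 True] by (intro ratio) auto
      have b1: "\<bar>l1 \<zeta> y\<bar> \<le> B / m" if "\<zeta> \<in> HH" for \<zeta>
        unfolding l1_def abs_divide
        using B(2-4)[OF that, of y] B(1)[OF that] mle[OF that True] m by (intro frac_le) auto
      have "(l1 \<eta> y)\<^sup>2 - (l1 \<eta>0 y)\<^sup>2 = (l1 \<eta> y - l1 \<eta>0 y) * (l1 \<eta> y + l1 \<eta>0 y)"
        by (simp add: power2_eq_square algebra_simps)
      also have "\<bar>\<dots>\<bar> \<le> ?r * (2 * B / m)"
        unfolding abs_mult using r1 r0 b1[OF \<eta>] b1[OF \<eta>0] by (intro mult_mono) auto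
      finally have "\<bar>l2 \<eta> y - l2 \<eta>0 y\<bar> \<le> ?r + ?r * (2 * B / m)" using r2 unfolding l2_def by linarith
      also have "\<dots> = ?r * (1 + 2 * B / m)" by (simp only: distrib_left mult_1_right)
      also have "\<dots> = \<delta> * (((2 * B / m\<^sup>2) * (1 + 2 * B / m)) / A)" by (simp add: mult_ac)
      also have "\<dots> \<le> \<delta> * 1" using A assms
        by (intro mult_left_mono) (simp_all only: divide_le_eq_1_pos less_imp_le)
      finally show ?thesis using dv by simp
    next
      case False
      show ?thesis using far[OF False] l2_bound[OF \<eta>, of y] l2_bound[OF \<eta>0, of y] by linarith
    qed
  qed
qed

end

section \<open>Weak neighbourhoods\<close>

context normal_mixture
begin

lemma near_subset: "near \<kappa> \<eta>0 \<subseteq> HH"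
  by (auto simp: near_def)

lemma near_mono: "\<kappa> \<le> \<kappa>' \<Longrightarrow> near \<kappa> \<eta>0 \<subseteq> near \<kappa>' \<eta>0"
  by (auto simp: near_def intro: order_trans)

lemma mixing_space_to_subprob:
  assumes "sets N = sets (mixing_space M s1 s2)"
  shows "(\<lambda>\<eta>. \<eta>) \<in> N \<rightarrow>\<^sub>M subprob_algebra borel"
proof -
  have "(\<lambda>\<eta>. \<eta>) \<in> mixing_space M s1 s2 \<rightarrow>\<^sub>M prob_algebra borel"
    unfolding mixing_space_def by (rule measurable_restrict_space1) simp
  then show ?thesis
    using measurable_prob_algebraD measurable_cong_sets[OF assms refl] by blast
qed

lemma mixing_space_space:
  assumes "sets N = sets (mixing_space M s1 s2)"
  shows "space N = HH"
proof -
  have "HH \<subseteq> space (prob_algebra borel)"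
    by (auto simp: space_prob_algebra mixing_set_def)
  then show ?thesis
    using sets_eq_imp_space_eq[OF assms] by (auto simp: mixing_space_def space_restrict_space)
qed

text \<open>Joint measurability in the mixing distribution and the evaluation point comes from
  regarding \<eta> as a subprobability kernel and the mixture density as a nonnegative integral
  against it.\<close>

lemma md0_measurable_param:
  assumes N: "sets N = sets (mixing_space M s1 s2)"
    and g: "g \<in> borel_measurable K" and h: "h \<in> K \<rightarrow>\<^sub>M N"
  shows "(\<lambda>k. md 0 (h k) (g k)) \<in> borel_measurable K"
proof -
  have h': "h \<in> K \<rightarrow>\<^sub>M subprob_algebra borel"
    using measurable_compose[OF h mixing_space_to_subprob[OF N]] by simp
  note [measurable] = g
  have "(\<lambda>(x, y). ennreal (nd 0 (snd y) (g x - fst y))) \<in> borel_measurable (K \<Otimes>\<^sub>M (borel :: (real \<times> real) measure))"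
    unfolding borel_prod[symmetric] by measurable
  from nn_integral_measurable_subprob_algebra2[OF this h']
  have "(\<lambda>k. enn2real (\<integral>\<^sup>+y. ennreal (nd 0 (snd y) (g k - fst y)) \<partial>h k)) \<in> borel_measurable K"
    by measurable
  also have "?this \<longleftrightarrow> ?thesis"
  proof (rule measurable_cong)
    fix k assume "k \<in> space K"
    then have "h k \<in> HH" using measurable_space[OF h] mixing_space_space[OF N] by auto
    then show "enn2real (\<integral>\<^sup>+y. ennreal (nd 0 (snd y) (g k - fst y)) \<partial>h k) = md 0 (h k) (g k)"
      unfolding md_def by (intro integral_eq_nn_integral[symmetric])
        (auto simp: nd.simps intro: borel_measurable_integrable nd_integrable[of _ 0, unfolded nd.simps])
  qed
  finally show ?thesis .
qed

text \<open>Continuity of the densities reduces the uncountably many conditions to those at rational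
  y.\<close>

lemma near_sets:
  assumes N: "sets N = sets (mixing_space M s1 s2)" and \<eta>0: "\<eta>0 \<in> HH"
  shows "near \<kappa> \<eta>0 \<in> sets N"
proof -
  have eq: "near \<kappa> \<eta>0 = {\<eta> \<in> space N. \<forall>q\<in>\<rat>. \<bar>md 0 \<eta> q - md 0 \<eta>0 q\<bar> \<le> \<kappa>}"
  proof (intro subset_antisym subsetI)
    fix \<eta> assume "\<eta> \<in> {\<eta> \<in> space N. \<forall>q\<in>\<rat>. \<bar>md 0 \<eta> q - md 0 \<eta>0 q\<bar> \<le> \<kappa>}"
    then have \<eta>: "\<eta> \<in> HH" and q: "\<forall>q\<in>\<rat>. \<bar>md 0 \<eta> q - md 0 \<eta>0 q\<bar> \<le> \<kappa>"
      using mixing_space_space[OF N] by auto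
    have "\<bar>md 0 \<eta> y - md 0 \<eta>0 y\<bar> \<le> \<kappa>" for y
    proof (rule continuous_le_on_closure[of "\<rat>" "\<lambda>y. \<bar>md 0 \<eta> y - md 0 \<eta>0 y\<bar>"])
      show "continuous_on (closure \<rat>) (\<lambda>y. \<bar>md 0 \<eta> y - md 0 \<eta>0 y\<bar>)"
        using \<eta> \<eta>0 by (intro continuous_intros md_continuous)
    qed (use q in \<open>auto simp: Rats_closure_real\<close>)
    then show "\<eta> \<in> near \<kappa> \<eta>0" using \<eta> by (simp add: near_def)
  qed (auto simp: near_def mixing_space_space[OF N])
  have "{\<eta> \<in> space N. \<forall>q\<in>(\<rat>::real set). \<bar>md 0 \<eta> q - md 0 \<eta>0 q\<bar> \<le> \<kappa>} \<in> sets N"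
  proof (rule sets.sets_Collect_countable_All'[OF _ countable_rat])
    fix q :: real
    have [measurable]: "(\<lambda>\<eta>. md 0 \<eta> q) \<in> borel_measurable N"
      by (rule md0_measurable_param[OF N]) auto
    show "{\<eta> \<in> space N. \<bar>md 0 \<eta> q - md 0 \<eta>0 q\<bar> \<le> \<kappa>} \<in> sets N" by measurable
  qed
  then show ?thesis unfolding eq .
qed

text \<open>The test functions send (z, s) to \<phi>_s(g - z), for g in a finite net of [- T, T].
  Between net points the densities of the class share a Lipschitz constant, and outside [- T, T]
  they share an envelope below \<kappa>, so finitely many integrals control the sup
  distance.\<close>

lemma near_weak_nbhd:
  assumes \<eta>0: "\<eta>0 \<in> HH" and \<kappa>: "\<kappa> > 0"
  shows "weak_nbhd M s1 s2 \<eta>0 (near \<kappa> \<eta>0)"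
proof -
  obtain B where B: "B \<ge> 0" "\<forall>\<eta>\<in>HH. \<forall>y. \<bar>md (Suc 0) \<eta> y\<bar> \<le> B" using md_bounded by blast
  have "((\<lambda>y. Cup * exp (- (y\<^sup>2 / (4 * s2\<^sup>2)))) \<longlongrightarrow> 0) at_infinity"
  proof -
    have "filterlim (\<lambda>y::real. (norm y) ^ 2) at_top at_infinity"
      by (intro filterlim_pow_at_top filterlim_norm_at_top) simp
    then have "filterlim (\<lambda>y::real. y\<^sup>2) at_top at_infinity" by simp
    then have "filterlim (\<lambda>y::real. (1 / (4 * s2\<^sup>2)) * y\<^sup>2) at_top at_infinity"
      using s1_pos s12 by (intro filterlim_tendsto_pos_mult_at_top[OF tendsto_const]) auto
    then have "((\<lambda>y. Cup * exp (- ((1 / (4 * s2\<^sup>2)) * y\<^sup>2))) \<longlongrightarrow> Cup * 0) at_infinity"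
      by (intro tendsto_intros filterlim_compose[OF exp_at_bot])
        (auto simp: filterlim_uminus_at_bot)
    then show ?thesis by simp
  qed
  then have "\<forall>\<^sub>F y in at_infinity. \<bar>Cup * exp (- (y\<^sup>2 / (4 * s2\<^sup>2)))\<bar> < \<kappa>"
    using \<kappa> by (auto simp: tendsto_iff dist_real_def)
  then obtain T where T: "\<And>y. \<bar>y\<bar> \<ge> T \<Longrightarrow> \<bar>Cup * exp (- (y\<^sup>2 / (4 * s2\<^sup>2)))\<bar> < \<kappa>"
    by (auto simp: eventually_at_infinity)
  \<comment> \<open>The net point accounts for \<kappa> / 2 and the Lipschitz error for \<kappa> / 4
    in each of the two densities; B + 1 guards the quotient against B = 0.\<close>
  define e where "e = \<kappa> / (4 * (B + 1))"
  have e: "e > 0" using \<kappa> B by (simp add: e_def)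
  have "compact {-T..T}" by simp
  then obtain G where G: "finite G" "{-T..T} \<subseteq> (\<Union>g\<in>G. ball g e)"
    using e by (auto simp: compact_eq_totally_bounded)
  define F where "F = (\<lambda>g x. nd 0 (snd x) (g - fst x)) ` G"
  have cont: "continuous_on (rect M s1 s2) (\<lambda>x. nd 0 (snd x) (g - fst x))" for g
    using s1_pos unfolding nd.simps normal_density_def
    by (intro continuous_intros) (auto simp: rect_def)
  have "compact (rect M s1 s2)"
    unfolding rect_def by (intro compact_Times compact_Icc)
  then have bdd: "bounded ((\<lambda>x. nd 0 (snd x) (g - fst x)) ` rect M s1 s2)" for g
    by (intro compact_imp_bounded compact_continuous_image cont)
  have set_int: "(LINT x:rect M s1 s2|\<eta>. nd 0 (snd x) (g - fst x)) = md 0 \<eta> g" if "\<eta> \<in> HH" for \<eta> g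
    unfolding set_lebesgue_integral_def md_def
  proof (rule integral_cong_AE)
    have "rect M s1 s2 \<in> sets \<eta>"
      unfolding HH_sets[OF that] rect_def
      by (intro borel_closed closed_Times closed_atLeastAtMost)
    moreover have "(\<lambda>x. nd 0 (snd x) (g - fst x)) \<in> borel_measurable \<eta>"
      using nd_integrable[OF that] by (rule borel_measurable_integrable)
    ultimately show "(\<lambda>x. indicat_real (rect M s1 s2) x *\<^sub>R nd 0 (snd x) (g - fst x)) \<in> borel_measurable \<eta>"
      by measurable
    show "(\<lambda>x. nd 0 (snd x) (g - fst x)) \<in> borel_measurable \<eta>" by fact
    show "AE x in \<eta>. indicat_real (rect M s1 s2) x *\<^sub>R nd 0 (snd x) (g - fst x) = nd 0 (snd x) (g - fst x)"
      using AE_rect[OF that] by eventually_elim simp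
  qed
  show ?thesis
    unfolding weak_nbhd_def
  proof (intro conjI near_subset exI[of _ "\<kappa> / 2"] exI[of _ F])
    show "\<kappa> / 2 > 0" using \<kappa> by simp
    show "finite F" using G by (simp add: F_def)
    show "\<forall>f\<in>F. continuous_on (rect M s1 s2) f \<and> bounded (f ` rect M s1 s2)"
      using cont bdd by (auto simp: F_def)
    show "{\<eta> \<in> HH. \<forall>f\<in>F. \<bar>(LINT x:rect M s1 s2|\<eta>. f x) - (LINT x:rect M s1 s2|\<eta>0. f x)\<bar> < \<kappa> / 2} \<subseteq> near \<kappa> \<eta>0"
    proof
      fix \<eta> assume "\<eta> \<in> {\<eta> \<in> HH. \<forall>f\<in>F. \<bar>(LINT x:rect M s1 s2|\<eta>. f x) - (LINT x:rect M s1 s2|\<eta>0. f x)\<bar> < \<kappa> / 2}"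
      then have \<eta>: "\<eta> \<in> HH" and g: "\<And>g. g \<in> G \<Longrightarrow> \<bar>md 0 \<eta> g - md 0 \<eta>0 g\<bar> < \<kappa> / 2"
        using \<eta>0 by (auto simp: F_def set_int)
      have "\<bar>md 0 \<eta> y - md 0 \<eta>0 y\<bar> \<le> \<kappa>" for y
      proof (cases "y \<in> {-T..T}")
        case True
        then obtain g' where g': "g' \<in> G" "dist g' y < e" using G by auto
        have lip: "\<bar>md 0 \<zeta> y - md 0 \<zeta> g'\<bar> \<le> \<kappa> / 4" if "\<zeta> \<in> HH" for \<zeta>
        proof -
          have "\<bar>md 0 \<zeta> y - md 0 \<zeta> g'\<bar> \<le> B * \<bar>y - g'\<bar>"
            by (rule lipschitz_of_derivative[OF md_has_derivative[OF that]]) (use B that in auto)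
          also have "\<dots> \<le> (B + 1) * e"
            using B g' by (intro mult_mono) (auto simp: dist_real_def)
          also have "\<dots> = \<kappa> / 4"
            using B by (simp add: e_def del: distrib_left_numeral)
          finally show ?thesis .
        qed
        show ?thesis using lip[OF \<eta>] lip[OF \<eta>0] g[OF g'(1)] by linarith
      next
        case False
        then have "\<bar>y\<bar> \<ge> T" by auto
        then show ?thesis
          using T[of y] md0_upper[OF \<eta>, of y] md0_upper[OF \<eta>0, of y] md0_pos[OF \<eta>, of y] md0_pos[OF \<eta>0, of y]
          by linarith
      qed
      then show "\<eta> \<in> near \<kappa> \<eta>0" using \<eta> by (simp add: near_def)
    qed
  qed
qed

end

section \<open>Kullback--Leibler separation\<close>

text \<open>A variational lower bound for the Kullback--Leibler divergence: apply \<open>ln x \<le> x - 1\<close> to the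
  density \<open>q\<close> tilted by \<open>1 + a\<close> on \<open>A\<close>, with \<open>a\<close> a quarter of the discrepancy on \<open>A\<close>.\<close>

lemma kl_indicator_bound:
  fixes p q :: "real \<Rightarrow> real"
  assumes p: "integrable lborel p" "(\<integral>y. p y \<partial>lborel) = 1" "\<And>y. p y > 0"
    and q: "integrable lborel q" "(\<integral>y. q y \<partial>lborel) = 1" "\<And>y. q y > 0"
    and A[measurable]: "A \<in> sets borel"
    and int: "integrable lborel (\<lambda>y. p y * (ln (q y) - ln (p y)))"
  shows "(\<integral>y. p y * (ln (q y) - ln (p y)) \<partial>lborel)
    \<le> - ((\<integral>y. indicat_real A y * p y \<partial>lborel) - (\<integral>y. indicat_real A y * q y \<partial>lborel))\<^sup>2 / 8"
proof -
  note [measurable] = borel_measurable_integrable[OF p(1)] borel_measurable_integrable[OF q(1)]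
  have pA: "integrable lborel (\<lambda>y. indicat_real A y * p y)"
    by (rule Bochner_Integration.integrable_bound[OF p(1)]) (auto simp: indicator_def)
  have qA: "integrable lborel (\<lambda>y. indicat_real A y * q y)"
    by (rule Bochner_Integration.integrable_bound[OF q(1)]) (auto simp: indicator_def)
  define P where "P = (\<integral>y. indicat_real A y * p y \<partial>lborel)"
  define Q where "Q = (\<integral>y. indicat_real A y * q y \<partial>lborel)"
  have "P \<le> (\<integral>y. p y \<partial>lborel)" unfolding P_def
    using p by (intro integral_mono pA) (auto simp: indicator_def less_imp_le)
  then have P1: "P \<le> 1" using p by simp
  have P0: "P \<ge> 0" unfolding P_def using p(3) by (intro Bochner_Integration.integral_nonneg) (auto simp: less_imp_le)
  have "Q \<le> (\<integral>y. q y \<partial>lborel)" unfolding Q_def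
    using q by (intro integral_mono qA) (auto simp: indicator_def less_imp_le)
  then have Q1: "Q \<le> 1" using q by simp
  have Q0: "Q \<ge> 0" unfolding Q_def using q(3) by (intro Bochner_Integration.integral_nonneg) (auto simp: less_imp_le)
  \<comment> \<open>This is the minimiser of the final bound - a (P - Q) + 2 a^2. That |a| <= 1/4
    keeps 1 + a positive and ln (1 + a) within reach of its quadratic bound.\<close>
  define a where "a = (P - Q) / 4"
  have a: "\<bar>a\<bar> \<le> 1 / 4" using P0 P1 Q0 Q1 by (auto simp: a_def abs_le_iff)
  then have a1: "1 + a > 0" by linarith
  have "\<bar>ln (1 + a) - a\<bar> \<le> 2 * a\<^sup>2" using a by (intro abs_ln_one_plus_x_minus_x_bound) auto
  then have lna: "ln (1 + a) \<ge> a - 2 * a\<^sup>2" by linarith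
  have pt: "p y * (ln (q y) - ln (p y)) \<le> q y + a * (indicat_real A y * q y) - p y - ln (1 + a) * (indicat_real A y * p y)" for y
  proof -
    define w where "w = 1 + a * indicat_real A y"
    have w: "w > 0" using a1 by (simp add: w_def indicator_def)
    have lw: "ln w = ln (1 + a) * indicat_real A y" by (simp add: w_def indicator_def)
    have "ln (q y) + ln w - ln (p y) = ln (q y * w / p y)"
      using p(3)[of y] q(3)[of y] w by (simp add: ln_mult_pos ln_div)
    also have "\<dots> \<le> q y * w / p y - 1"
      using p(3)[of y] q(3)[of y] w by (intro ln_le_minus_one) auto
    finally have "p y * (ln (q y) + ln w - ln (p y)) \<le> p y * (q y * w / p y - 1)"
      using p(3)[of y] by (intro mult_left_mono) auto
    also have "\<dots> = q y * w - p y" using p(3)[of y] by (simp add: field_simps)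
    finally have "p y * (ln (q y) - ln (p y)) \<le> q y * w - p y - p y * ln w" by (simp add: algebra_simps)
    then show ?thesis unfolding lw by (simp add: w_def algebra_simps)
  qed
  have "(\<integral>y. p y * (ln (q y) - ln (p y)) \<partial>lborel)
      \<le> (\<integral>y. q y + a * (indicat_real A y * q y) - p y - ln (1 + a) * (indicat_real A y * p y) \<partial>lborel)"
    using p q pA qA int by (intro integral_mono pt) auto
  also have "\<dots> = 1 + a * Q - 1 - ln (1 + a) * P"
    using p q pA qA by (simp add: P_def Q_def)
  also have "\<dots> \<le> a * Q - (a - 2 * a\<^sup>2) * P"
    using mult_right_mono[OF lna P0] by simp
  also have "\<dots> = - a * (P - Q) + 2 * a\<^sup>2 * P" by (simp add: algebra_simps)
  also have "\<dots> \<le> - a * (P - Q) + 2 * a\<^sup>2 * 1" using P1 by (intro add_left_mono mult_left_mono) auto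
  also have "\<dots> = - (P - Q)\<^sup>2 / 8" by (simp add: a_def power2_eq_square field_simps)
  finally show ?thesis by (simp add: P_def Q_def)
qed

context normal_mixture
begin

lemma md0_shift_integral:
  assumes "\<eta> \<in> HH" and [measurable]: "f \<in> borel_measurable borel" and f: "\<And>y. \<bar>f y\<bar> \<le> C"
  shows "integrable lborel (\<lambda>y. f y * md 0 \<eta> (y - t))"
    "(\<integral>y. f y * md 0 \<eta> (y - t) \<partial>lborel) = (\<integral>y. f (y + t) * md 0 \<eta> y \<partial>lborel)"
proof -
  have i: "integrable lborel (\<lambda>y. f (y + t) * md 0 \<eta> y)"
    by (rule md0_weighted_integrable[OF assms(1), where C=C and k=0]) (use f in auto)
  have "integrable lborel (\<lambda>y. f (- t + 1 * y + t) * md 0 \<eta> (- t + 1 * y))"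
    by (rule lborel_integrable_real_affine[OF i]) simp
  then show "integrable lborel (\<lambda>y. f y * md 0 \<eta> (y - t))" by simp
  show "(\<integral>y. f y * md 0 \<eta> (y - t) \<partial>lborel) = (\<integral>y. f (y + t) * md 0 \<eta> y \<partial>lborel)"
    by (subst lborel_integral_real_affine[of 1 "\<lambda>y. f y * md 0 \<eta> (y - t)" t]) (simp_all add: add.commute)
qed

text \<open>Minus KL(p_\<eta>0 || p_\<eta>(. - t)), hence at most 0: the expected log-likelihood
  ratio of one observation whose regression function is off by t.\<close>

definition kl :: "(real \<times> real) measure \<Rightarrow> (real \<times> real) measure \<Rightarrow> real \<Rightarrow> real" where
  "kl \<eta>0 \<eta> t = (\<integral>y. md 0 \<eta>0 y * (log_density \<eta> (y - t) - log_density \<eta>0 y) \<partial>lborel)"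

lemma l0_shift_bound:
  assumes "\<eta> \<in> HH"
  shows "\<bar>log_density \<eta> (y - t)\<bar> \<le> KC * (1 + \<bar>t\<bar>)\<^sup>2 * (1 + \<bar>y\<bar>)\<^sup>2"
proof -
  have "\<bar>log_density \<eta> (y - t)\<bar> \<le> KC * (1 + \<bar>y - t\<bar>)\<^sup>2" by (rule l0_bound[OF assms])
  also have "\<dots> \<le> KC * ((1 + \<bar>t\<bar>) * (1 + \<bar>y\<bar>))\<^sup>2"
  proof (intro mult_left_mono power_mono)
    have "1 + \<bar>y - t\<bar> \<le> 1 + \<bar>y\<bar> + \<bar>t\<bar> + \<bar>t\<bar> * \<bar>y\<bar>" by (smt (verit) abs_ge_zero mult_nonneg_nonneg)
    then show "1 + \<bar>y - t\<bar> \<le> (1 + \<bar>t\<bar>) * (1 + \<bar>y\<bar>)" by (simp add: algebra_simps)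
  qed (use KC_ge_1 in auto)
  finally show ?thesis by (simp add: power_mult_distrib mult.assoc)
qed

lemma l0_shift_integrable:
  assumes "\<eta>0 \<in> HH" "\<eta> \<in> HH"
  shows "integrable lborel (\<lambda>y. log_density \<eta> (y - t) * md 0 \<eta>0 y)"
proof (rule md0_weighted_integrable[OF assms(1), where C="KC * (1 + \<bar>t\<bar>)\<^sup>2" and k=2])
  note [measurable] = l_measurable[OF assms(2)]
  show "(\<lambda>y. log_density \<eta> (y - t)) \<in> borel_measurable borel" by measurable
qed (rule l0_shift_bound[OF assms(2)])

lemma kl_integrable:
  assumes "\<eta>0 \<in> HH" "\<eta> \<in> HH"
  shows "integrable lborel (\<lambda>y. md 0 \<eta>0 y * (log_density \<eta> (y - t) - log_density \<eta>0 y))"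
  using Bochner_Integration.integrable_diff[OF l0_shift_integrable[OF assms, of t] l0_shift_integrable[OF assms(1,1), of 0]]
  by (simp add: algebra_simps)

lemma kl_le:
  assumes "\<eta>0 \<in> HH" "\<eta> \<in> HH" and [measurable]: "A \<in> sets borel"
  shows "kl \<eta>0 \<eta> t \<le> - ((\<integral>y. indicat_real A y * md 0 \<eta>0 y \<partial>lborel) - (\<integral>y. indicat_real A y * md 0 \<eta> (y - t) \<partial>lborel))\<^sup>2 / 8"
  unfolding kl_def log_density_def md_0[symmetric]
proof (rule kl_indicator_bound)
  show "integrable lborel (\<lambda>y. md 0 \<eta> (y - t))" "(\<integral>y. md 0 \<eta> (y - t) \<partial>lborel) = 1"
    using md0_shift_integral[OF assms(2), of "\<lambda>_. 1" 1 t] md0_integral[OF assms(2)] by auto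
  show "integrable lborel (\<lambda>y. md 0 \<eta>0 y * (ln (md 0 \<eta> (y - t)) - ln (md 0 \<eta>0 y)))"
    using kl_integrable[OF assms(1,2), of t] by (simp add: log_density_def md_0)
qed (use assms md0_pos md0_integral in auto)

text \<open>Reflection exchanges the two half lines, and the origin is a null set.\<close>

lemma md0_half:
  assumes "\<eta> \<in> HH"
  shows "(\<integral>y. indicat_real {0<..} y * md 0 \<eta> y \<partial>lborel) = 1 / 2"
proof -
  have int: "integrable lborel (\<lambda>y. indicat_real A y * md 0 \<eta> y)" if "A \<in> sets borel" for A
    by (rule md0_weighted_integrable[OF assms, where C=1 and k=0]) (use that in \<open>auto simp: indicator_def\<close>)
  have "(\<integral>y. indicat_real {0<..} y * md 0 \<eta> y \<partial>lborel) = (\<integral>y. indicat_real {0<..} (- y) * md 0 \<eta> (- y) \<partial>lborel)"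
    by (subst lborel_integral_real_affine[of "-1" _ 0]) auto
  also have "\<dots> = (\<integral>y. indicat_real {..<0} y * md 0 \<eta> y \<partial>lborel)"
    by (intro Bochner_Integration.integral_cong) (auto simp: indicator_def md0_even[OF assms])
  finally have sym: "(\<integral>y. indicat_real {0<..} y * md 0 \<eta> y \<partial>lborel) = (\<integral>y. indicat_real {..<0} y * md 0 \<eta> y \<partial>lborel)" .
  have "1 = (\<integral>y. md 0 \<eta> y \<partial>lborel)" using md0_integral[OF assms] by simp
  also have "\<dots> = (\<integral>y. indicat_real {0<..} y * md 0 \<eta> y + indicat_real {..<0} y * md 0 \<eta> y \<partial>lborel)"
  proof (rule integral_cong_AE)
    note [measurable] = md_measurable[OF assms]
    show "md 0 \<eta> \<in> borel_measurable lborel" by measurable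
    show "(\<lambda>y. indicat_real {0<..} y * md 0 \<eta> y + indicat_real {..<0} y * md 0 \<eta> y) \<in> borel_measurable lborel" by measurable
    show "AE y in lborel. md 0 \<eta> y = indicat_real {0<..} y * md 0 \<eta> y + indicat_real {..<0} y * md 0 \<eta> y"
      using AE_lborel_singleton[of 0] by eventually_elim (auto simp: indicator_def)
  qed
  also have "\<dots> = 2 * (\<integral>y. indicat_real {0<..} y * md 0 \<eta> y \<partial>lborel)"
    using int sym by simp
  finally show ?thesis by simp
qed

lemma md0_lower_interval:
  "\<exists>m>0. \<forall>\<eta>\<in>HH. \<forall>y. \<bar>y\<bar> \<le> T \<longrightarrow> m \<le> md 0 \<eta> y"
proof (intro exI conjI ballI allI impI)
  let ?m = "1 / sqrt (2 * pi * s2\<^sup>2) * exp (- ((\<bar>T\<bar> + M)\<^sup>2 / (2 * s1\<^sup>2)))"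
  show "?m > 0" using s1_pos s12 by simp
  fix \<eta> and y :: real assume "\<eta> \<in> HH" "\<bar>y\<bar> \<le> T"
  show "?m \<le> md 0 \<eta> y"
  proof (rule order_trans[OF _ md0_lower[OF \<open>\<eta> \<in> HH\<close>]])
    have "(\<bar>y\<bar> + M)\<^sup>2 \<le> (\<bar>T\<bar> + M)\<^sup>2" using \<open>\<bar>y\<bar> \<le> T\<close> M_pos by (intro power_mono) auto
    then show "?m \<le> 1 / sqrt (2 * pi * s2\<^sup>2) * exp (- ((\<bar>y\<bar> + M)\<^sup>2 / (2 * s1\<^sup>2)))"
      by (intro mult_left_mono) (auto intro!: divide_right_mono)
  qed
qed

text \<open>Symmetry of both densities makes the half line detect the shift \<open>t\<close>, whatever \<open>\<eta>\<close> is.\<close>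

lemma kl_shift:
  assumes "T \<ge> 0"
  shows "\<exists>c>0. \<forall>\<eta>0\<in>HH. \<forall>\<eta>\<in>HH. \<forall>t. \<bar>t\<bar> \<le> T \<longrightarrow> kl \<eta>0 \<eta> t \<le> - c * t\<^sup>2"
proof -
  obtain m where m: "m > 0" "\<And>\<eta> y. \<eta> \<in> HH \<Longrightarrow> \<bar>y\<bar> \<le> T \<Longrightarrow> m \<le> md 0 \<eta> y"
    using md0_lower_interval by blast
  have "kl \<eta>0 \<eta> t \<le> - (m\<^sup>2 / 8) * t\<^sup>2" if \<eta>0: "\<eta>0 \<in> HH" and \<eta>: "\<eta> \<in> HH" and t: "\<bar>t\<bar> \<le> T" for \<eta>0 \<eta> t
  proof -
    let ?I = "\<lambda>A. (\<integral>y. indicat_real A y * md 0 \<eta> y \<partial>lborel)"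
    have int: "integrable lborel (\<lambda>y. indicat_real A y * md 0 \<eta> y)" if "A \<in> sets borel" for A
      by (rule md0_weighted_integrable[OF \<eta>, where C=1 and k=0]) (use that in \<open>auto simp: indicator_def\<close>)
    have low: "m * (b - a) \<le> ?I {a<..b}" if "a \<le> b" "- T \<le> a" "b \<le> T" for a b
    proof -
      have "m * (b - a) = (\<integral>y. indicat_real {a<..b} y * m \<partial>lborel)" using that by (simp add: measure_def)
      also have "\<dots> \<le> ?I {a<..b}"
      proof (rule integral_mono)
        show "integrable lborel (\<lambda>y. indicat_real {a<..b} y * m)" by (intro integrable_mult_left integrable_real_indicator) (use that in auto)
        show "integrable lborel (\<lambda>y. indicat_real {a<..b} y * md 0 \<eta> y)" by (rule int) simp
        show "indicat_real {a<..b} y * m \<le> indicat_real {a<..b} y * md 0 \<eta> y" for y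
          using that m(2)[OF \<eta>, of y] by (auto simp: indicator_def)
      qed
      finally show ?thesis .
    qed
    have "(\<integral>y. indicat_real {0<..} y * md 0 \<eta> (y - t) \<partial>lborel)
        = (\<integral>y. indicat_real {0<..} (y + t) * md 0 \<eta> y \<partial>lborel)"
      by (rule md0_shift_integral[OF \<eta>, where C=1]) (auto simp: indicator_def)
    also have "\<dots> = ?I {-t<..}"
      by (intro Bochner_Integration.integral_cong) (auto simp: indicator_def)
    finally have Q: "(\<integral>y. indicat_real {0<..} y * md 0 \<eta> (y - t) \<partial>lborel) = ?I {-t<..}" .
    \<comment> \<open>The shift changes the mass 1/2 of the half line by the mass of the interval
      between 0 and - t. This interval lies in [- T, T], where the density is at least m.\<close>
    have "\<bar>1 / 2 - ?I {-t<..}\<bar> \<ge> m * \<bar>t\<bar>"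
    proof (cases "t \<ge> 0")
      case True
      have "?I {-t<..} = (\<integral>y. indicat_real {0<..} y * md 0 \<eta> y + indicat_real {-t<..0} y * md 0 \<eta> y \<partial>lborel)"
        using True by (intro Bochner_Integration.integral_cong) (auto simp: indicator_def)
      also have "\<dots> = 1 / 2 + ?I {-t<..0}" using int md0_half[OF \<eta>] by simp
      finally show ?thesis using low[of "-t" 0] True t assms by auto
    next
      case False
      have "?I {0<..} = (\<integral>y. indicat_real {-t<..} y * md 0 \<eta> y + indicat_real {0<..-t} y * md 0 \<eta> y \<partial>lborel)"
        using False by (intro Bochner_Integration.integral_cong) (auto simp: indicator_def)
      also have "\<dots> = ?I {-t<..} + ?I {0<..-t}" using int by simp
      finally show ?thesis using low[of 0 "-t"] False t assms md0_half[OF \<eta>] by auto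
    qed
    then have "(m * \<bar>t\<bar>)\<^sup>2 \<le> (1 / 2 - ?I {-t<..})\<^sup>2"
      using m by (subst abs_le_square_iff[symmetric]) (auto simp: abs_mult)
    moreover have "kl \<eta>0 \<eta> t \<le> - (1 / 2 - ?I {-t<..})\<^sup>2 / 8"
      using kl_le[OF \<eta>0 \<eta>, of "{0<..}" t] by (simp add: Q md0_half[OF \<eta>0])
    ultimately show ?thesis by (simp add: power_mult_distrib)
  qed
  then show ?thesis using m by (intro exI[of _ "m\<^sup>2 / 8"]) auto
qed

text \<open>A gap \<kappa> at one point y persists as \<kappa> / 2 on an interval of length 2h,
  since each density varies by at most \<kappa> / 4 within distance h. The indicator of this
  interval in \<open>kl_le\<close> detects a mass difference of at least \<kappa> h, whatever the
  shift t is.\<close>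

lemma kl_separated:
  assumes "\<kappa> > 0"
  shows "\<exists>c>0. \<forall>\<eta>0\<in>HH. \<forall>\<eta>\<in>HH. \<forall>t. (\<exists>y. \<kappa> \<le> \<bar>md 0 \<eta> (y - t) - md 0 \<eta>0 y\<bar>) \<longrightarrow> kl \<eta>0 \<eta> t \<le> - c"
proof -
  obtain B where B: "B \<ge> 0" "\<forall>\<eta>\<in>HH. \<forall>y. \<bar>md (Suc 0) \<eta> y\<bar> \<le> B" using md_bounded by blast
  define h where "h = \<kappa> / (4 * (B + 1))"
  have h: "h > 0" "B * h \<le> \<kappa> / 4" using assms B by (auto simp: h_def field_simps)
  have "kl \<eta>0 \<eta> t \<le> - ((\<kappa> * h)\<^sup>2 / 8)" if \<eta>0: "\<eta>0 \<in> HH" and \<eta>: "\<eta> \<in> HH"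
    and y: "\<kappa> \<le> \<bar>md 0 \<eta> (y - t) - md 0 \<eta>0 y\<bar>" for \<eta>0 \<eta> t y
  proof -
    let ?A = "{y-h..y+h}"
    let ?f = "\<lambda>x. md 0 \<eta> (x - t) - md 0 \<eta>0 x"
    have lip: "\<bar>md 0 \<zeta> a - md 0 \<zeta> b\<bar> \<le> \<kappa> / 4" if "\<zeta> \<in> HH" "\<bar>a - b\<bar> \<le> h" for \<zeta> a b
    proof -
      have "\<bar>md 0 \<zeta> a - md 0 \<zeta> b\<bar> \<le> B * \<bar>a - b\<bar>"
        by (rule lipschitz_of_derivative[OF md_has_derivative[OF that(1)]]) (use B that in auto)
      also have "\<dots> \<le> B * h" using B that by (intro mult_left_mono) auto
      finally show ?thesis using h by linarith
    qed
    have near: "\<bar>?f x - ?f y\<bar> \<le> \<kappa> / 2" if "x \<in> ?A" for x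
    proof -
      have "\<bar>x - y\<bar> \<le> h" using that by (auto simp: abs_le_iff)
      then have "\<bar>md 0 \<eta> (x - t) - md 0 \<eta> (y - t)\<bar> \<le> \<kappa> / 4" "\<bar>md 0 \<eta>0 x - md 0 \<eta>0 y\<bar> \<le> \<kappa> / 4"
        using lip[OF \<eta>, of "x - t" "y - t"] lip[OF \<eta>0, of x y] by simp_all
      then show ?thesis unfolding abs_le_iff by linarith
    qed
    have i1: "integrable lborel (\<lambda>x. indicat_real ?A x * md 0 \<eta> (x - t))"
      by (rule md0_shift_integral[OF \<eta>, where C=1]) (auto simp: indicator_def)
    have i2: "integrable lborel (\<lambda>x. indicat_real ?A x * md 0 \<eta>0 x)"
      using md0_shift_integral(1)[OF \<eta>0, of "indicator ?A" 1 0] by (auto simp: indicator_def)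
    let ?P = "\<integral>x. indicat_real ?A x * md 0 \<eta>0 x \<partial>lborel"
    let ?Q = "\<integral>x. indicat_real ?A x * md 0 \<eta> (x - t) \<partial>lborel"
    have QP: "?Q - ?P = (\<integral>x. indicat_real ?A x * ?f x \<partial>lborel)"
      using i1 i2 by (simp add: algebra_simps)
    have i3: "integrable lborel (\<lambda>x. indicat_real ?A x * ?f x)"
      using Bochner_Integration.integrable_diff[OF i1 i2] by (simp add: algebra_simps)
    have c: "(\<integral>x. indicat_real ?A x * (\<kappa> / 2) \<partial>lborel) = \<kappa> * h" using h by (simp add: measure_def)
    have ic: "integrable lborel (\<lambda>x. indicat_real ?A x * (\<kappa> / 2))"
      by (intro integrable_mult_left integrable_real_indicator) (use h in auto)
    have "\<kappa> * h \<le> \<bar>?Q - ?P\<bar>"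
    proof (cases "?f y \<ge> 0")
      case True
      have "(\<integral>x. indicat_real ?A x * (\<kappa> / 2) \<partial>lborel) \<le> (\<integral>x. indicat_real ?A x * ?f x \<partial>lborel)"
      proof (intro integral_mono ic i3)
        fix x show "indicat_real ?A x * (\<kappa> / 2) \<le> indicat_real ?A x * ?f x"
          using near[of x, unfolded abs_le_iff] y True by (cases "x \<in> ?A") auto
      qed
      then show ?thesis using c QP by linarith
    next
      case False
      have "(\<integral>x. indicat_real ?A x * (\<kappa> / 2) \<partial>lborel) \<le> (\<integral>x. - (indicat_real ?A x * ?f x) \<partial>lborel)"
      proof (intro integral_mono ic Bochner_Integration.integrable_minus i3)
        fix x show "indicat_real ?A x * (\<kappa> / 2) \<le> - (indicat_real ?A x * ?f x)"
          using near[of x, unfolded abs_le_iff] y False by (cases "x \<in> ?A") auto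
      qed
      also have "\<dots> = - (\<integral>x. indicat_real ?A x * ?f x \<partial>lborel)"
        by (rule Bochner_Integration.integral_minus)
      finally show ?thesis using c QP by linarith
    qed
    then have "(\<kappa> * h)\<^sup>2 \<le> (?P - ?Q)\<^sup>2"
      using assms h by (subst abs_le_square_iff[symmetric]) (auto simp: abs_mult)
    then show ?thesis using kl_le[OF \<eta>0 \<eta>, of ?A t] by simp
  qed
  then show ?thesis using h assms by (intro exI[of _ "(\<kappa> * h)\<^sup>2 / 8"]) auto
qed

end

section \<open>Centred sums of smooth functions\<close>

text \<open>The signed indicator of the segment between 0 and z; for s = z = 0 the two parts cancel.
  As a function of s it is the kernel that recovers g(z) - g(0) from g'.\<close>

definition layer :: "real \<Rightarrow> real \<Rightarrow> real" where
  "layer s z = (if 0 \<le> s \<and> s \<le> z then 1 else 0) - (if z \<le> s \<and> s \<le> 0 then 1 else 0)"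

lemma layer_measurable[measurable]:
  assumes [measurable]: "f \<in> borel_measurable N" "g \<in> borel_measurable N"
  shows "(\<lambda>x. layer (f x) (g x)) \<in> borel_measurable N"
  unfolding layer_def by measurable

lemma layer_bound: "\<bar>layer s z\<bar> \<le> (if \<bar>s\<bar> \<le> \<bar>z\<bar> then 1 else 0)"
  by (auto simp: layer_def)

lemma layer_le_1: "\<bar>layer s z\<bar> \<le> 1"
  by (auto simp: layer_def)

lemma layer_representation:
  fixes g g' :: "real \<Rightarrow> real"
  assumes g: "\<And>x. (g has_real_derivative g' x) (at x)" and cont: "continuous_on UNIV g'"
  shows "has_bochner_integral lborel (\<lambda>s. g' s * layer s z) (g z - g 0)"
proof -
  have c: "isCont g' x" for x using cont by (simp add: continuous_on_eq_continuous_at)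
  consider "z > 0" | "z < 0" | "z = 0" by linarith
  then show ?thesis
  proof cases
    case 1
    have "has_bochner_integral lborel (\<lambda>x. g' x * indicator {0 .. z} x) (g z - g 0)"
      using 1 g c by (intro has_bochner_integral_FTC_Icc_real) auto
    moreover have "(\<lambda>s. g' s * layer s z) = (\<lambda>x. g' x * indicator {0 .. z} x)"
      using 1 by (auto simp: layer_def indicator_def fun_eq_iff)
    ultimately show ?thesis by simp
  next
    case 2
    have "has_bochner_integral lborel (\<lambda>x. g' x * indicator {z .. 0} x) (g 0 - g z)"
      using 2 g c by (intro has_bochner_integral_FTC_Icc_real) auto
    then have "has_bochner_integral lborel (\<lambda>x. - (g' x * indicator {z .. 0} x)) (- (g 0 - g z))"
      by (rule has_bochner_integral_minus)
    moreover have "(\<lambda>s. g' s * layer s z) = (\<lambda>x. - (g' x * indicator {z .. 0} x))"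
      using 2 by (auto simp: layer_def indicator_def fun_eq_iff)
    ultimately show ?thesis by simp
  next
    case 3
    have "(\<lambda>s. g' s * layer s z) = (\<lambda>s. 0)" by (auto simp: layer_def 3)
    then show ?thesis by (simp add: 3 has_bochner_integral_iff)
  qed
qed

text \<open>The constant that is left when the weight (1 + |s|)^3 is integrated against the decay (1
  + |s|)^(-5) of the process below.\<close>

definition tail_int :: real where
  "tail_int = (\<integral>s. 1 / (1 + \<bar>s\<bar>)\<^sup>2 \<partial>lborel)"

lemma tail_integrable:
  assumes "k \<ge> 2"
  shows "integrable lborel (\<lambda>s::real. 1 / (1 + \<bar>s\<bar>) ^ k)"
proof (rule Bochner_Integration.integrable_bound)
  show "integrable lborel (\<lambda>s::real. inverse (1 + s\<^sup>2))"
    using integrable_inverse_1_plus_square by (simp add: set_integrable_def einterval_def)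
  show "AE s in lborel. norm (1 / (1 + \<bar>s::real\<bar>) ^ k) \<le> norm (inverse (1 + s\<^sup>2))"
  proof (rule AE_I2)
    fix s :: real
    have "1 + s\<^sup>2 \<le> (1 + \<bar>s\<bar>)\<^sup>2" by (simp add: power2_sum)
    also have "\<dots> \<le> (1 + \<bar>s\<bar>) ^ k" using assms by (intro power_increasing) auto
    finally have "1 / (1 + \<bar>s\<bar>) ^ k \<le> 1 / (1 + s\<^sup>2)"
      by (intro divide_left_mono) (auto intro!: mult_pos_pos add_pos_nonneg)
    then show "norm (1 / (1 + \<bar>s\<bar>) ^ k) \<le> norm (inverse (1 + s\<^sup>2))"
      by (simp add: inverse_eq_divide)
  qed
qed measurable

lemma tail_int_nonneg: "tail_int \<ge> 0"
  unfolding tail_int_def by (intro Bochner_Integration.integral_nonneg) auto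

context prob_space
begin

text \<open>In the expanded square, independence and centring remove all terms off the diagonal;
  boundedness makes the products integrable.\<close>

lemma sum_centered_norm_square:
  fixes a :: "'i \<Rightarrow> 'c::euclidean_space" and \<xi> :: "'i \<Rightarrow> 'a \<Rightarrow> real"
  assumes I: "finite I" and indep: "indep_vars (\<lambda>_. borel) \<xi> I"
    and bdd: "\<And>i \<omega>. i \<in> I \<Longrightarrow> \<omega> \<in> space M \<Longrightarrow> \<bar>\<xi> i \<omega>\<bar> \<le> b"
    and mean: "\<And>i. i \<in> I \<Longrightarrow> expectation (\<xi> i) = 0"
  shows "integrable M (\<lambda>\<omega>. (norm (\<Sum>i\<in>I. \<xi> i \<omega> *\<^sub>R a i))\<^sup>2)"
    "expectation (\<lambda>\<omega>. (norm (\<Sum>i\<in>I. \<xi> i \<omega> *\<^sub>R a i))\<^sup>2)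
      = (\<Sum>i\<in>I. (norm (a i))\<^sup>2 * expectation (\<lambda>\<omega>. (\<xi> i \<omega>)\<^sup>2))"
proof -
  have rv: "\<xi> i \<in> borel_measurable M" if "i \<in> I" for i
    using indep that by (auto simp: indep_vars_def)
  have int: "integrable M (\<xi> i)" if "i \<in> I" for i
    using bdd[OF that] rv[OF that] by (intro integrable_const_bound[where B=b]) auto
  have int2: "integrable M (\<lambda>\<omega>. \<xi> i \<omega> * \<xi> j \<omega>)" if "i \<in> I" "j \<in> I" for i j
  proof (rule integrable_const_bound[where B="b * b"])
    show "AE \<omega> in M. norm (\<xi> i \<omega> * \<xi> j \<omega>) \<le> b * b"
    proof (rule AE_I2)
      fix \<omega> assume "\<omega> \<in> space M"
      then show "norm (\<xi> i \<omega> * \<xi> j \<omega>) \<le> b * b"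
        using bdd[OF that(1), of \<omega>] bdd[OF that(2), of \<omega>] unfolding real_norm_def abs_mult
        by (intro mult_mono) auto
    qed
    note [measurable] = rv[OF that(1)] rv[OF that(2)]
    show "(\<lambda>\<omega>. \<xi> i \<omega> * \<xi> j \<omega>) \<in> borel_measurable M" by measurable
  qed
  have cross: "expectation (\<lambda>\<omega>. \<xi> i \<omega> * \<xi> j \<omega>) = (if i = j then expectation (\<lambda>\<omega>. (\<xi> i \<omega>)\<^sup>2) else 0)"
    if "i \<in> I" "j \<in> I" for i j
  proof (cases "i = j")
    case False
    have "expectation (\<lambda>\<omega>. \<Prod>k\<in>{i, j}. \<xi> k \<omega>) = (\<Prod>k\<in>{i, j}. expectation (\<xi> k))"
      using that int by (intro indep_vars_lebesgue_integral indep_vars_subset[OF indep]) auto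
    then show ?thesis using False mean that by simp
  qed (simp add: power2_eq_square)
  have eq: "(norm (\<Sum>i\<in>I. \<xi> i \<omega> *\<^sub>R a i))\<^sup>2 = (\<Sum>i\<in>I. \<Sum>j\<in>I. (a i \<bullet> a j) * (\<xi> i \<omega> * \<xi> j \<omega>))" for \<omega>
    by (simp add: power2_norm_eq_inner inner_sum_left inner_sum_right mult_ac sum_distrib_left)
      (subst sum.swap, simp add: inner_commute mult_ac)
  show "integrable M (\<lambda>\<omega>. (norm (\<Sum>i\<in>I. \<xi> i \<omega> *\<^sub>R a i))\<^sup>2)"
    unfolding eq by (intro Bochner_Integration.integrable_sum integrable_mult_right int2)
  have "expectation (\<lambda>\<omega>. (norm (\<Sum>i\<in>I. \<xi> i \<omega> *\<^sub>R a i))\<^sup>2)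
      = (\<Sum>i\<in>I. \<Sum>j\<in>I. (a i \<bullet> a j) * expectation (\<lambda>\<omega>. \<xi> i \<omega> * \<xi> j \<omega>))"
    unfolding eq using int2 by (simp add: Bochner_Integration.integral_sum)
  also have "\<dots> = (\<Sum>i\<in>I. \<Sum>j\<in>I. if i = j then (norm (a i))\<^sup>2 * expectation (\<lambda>\<omega>. (\<xi> i \<omega>)\<^sup>2) else 0)"
    by (intro sum.cong refl) (simp add: cross power2_norm_eq_inner)
  also have "\<dots> = (\<Sum>i\<in>I. (norm (a i))\<^sup>2 * expectation (\<lambda>\<omega>. (\<xi> i \<omega>)\<^sup>2))"
    using I by simp
  finally show "expectation (\<lambda>\<omega>. (norm (\<Sum>i\<in>I. \<xi> i \<omega> *\<^sub>R a i))\<^sup>2)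
      = (\<Sum>i\<in>I. (norm (a i))\<^sup>2 * expectation (\<lambda>\<omega>. (\<xi> i \<omega>)\<^sup>2))" .
qed

text \<open>Writing \<open>g(z) = g(0) + \<integral> g'(s) layer s z ds\<close> bounds the centred sums of \<open>g\<close> simultaneously for
  all \<open>g\<close> with controlled derivative by a single random variable; no entropy condition is needed.\<close>

lemma empirical_process_bound:
  fixes Z :: "nat \<Rightarrow> 'a \<Rightarrow> real" and a :: "nat \<Rightarrow> 'c::euclidean_space"
  assumes n: "n \<ge> 1" and indep: "indep_vars (\<lambda>_. borel) Z {1..n}"
    and mom: "\<And>i. i \<in> {1..n} \<Longrightarrow> integrable M (\<lambda>\<omega>. (1 + \<bar>Z i \<omega>\<bar>) ^ 10)"
      "\<And>i. i \<in> {1..n} \<Longrightarrow> expectation (\<lambda>\<omega>. (1 + \<bar>Z i \<omega>\<bar>) ^ 10) \<le> C"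
    and a: "\<And>i. i \<in> {1..n} \<Longrightarrow> norm (a i) \<le> A"
  shows "\<exists>S. S \<in> borel_measurable M \<and> (\<integral>\<^sup>+\<omega>. S \<omega> \<partial>M) \<le> ennreal ((1 + A\<^sup>2 * C) * tail_int) \<and>
    (\<forall>\<omega>\<in>space M. \<forall>g g' \<delta> K. (\<forall>x. (g has_real_derivative g' x) (at x)) \<longrightarrow> continuous_on UNIV g' \<longrightarrow>
      (\<forall>s. \<bar>g' s\<bar> \<le> \<delta> * (1 + \<bar>s\<bar>) ^ 3) \<longrightarrow> 0 \<le> K \<longrightarrow> S \<omega> \<le> ennreal K \<longrightarrow>
      norm ((1 / sqrt (real n)) *\<^sub>R (\<Sum>i=1..n. (g (Z i \<omega>) - expectation (\<lambda>\<omega>. g (Z i \<omega>))) *\<^sub>R a i)) \<le> \<delta> * K)"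
proof -
  let ?I = "{1..n}"
  have rv: "Z i \<in> borel_measurable M" if "i \<in> ?I" for i
    using indep that by (auto simp: indep_vars_def)
  have "0 \<le> expectation (\<lambda>\<omega>. (1 + \<bar>Z 1 \<omega>\<bar>) ^ 10)" by (intro Bochner_Integration.integral_nonneg) auto
  from order_trans[OF this mom(2)[of 1]] have C0: "C \<ge> 0" using n by simp
  define m where "m i s = expectation (\<lambda>\<omega>. layer s (Z i \<omega>))" for i s
  have lay_int: "integrable M (\<lambda>\<omega>. layer s (Z i \<omega>))" if "i \<in> ?I" for i s
  proof -
    note [measurable] = rv[OF that]
    show ?thesis by (intro integrable_const_bound[where B=1]) (auto simp: layer_le_1)
  qed
  \<comment> \<open>Markov's inequality with the tenth moment, as the kernel vanishes for |s| > |Z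
    i|. The tenth moment makes the standard deviation decay like (1 + |s|)^(-5), which leaves an
    integrable (1 + |s|)^(-2) after multiplication by the weight (1 + |s|)^3.\<close>
  have tail: "expectation (\<lambda>\<omega>. \<bar>layer s (Z i \<omega>)\<bar>) \<le> C / (1 + \<bar>s\<bar>) ^ 10" if i: "i \<in> ?I" for i s
  proof -
    have "expectation (\<lambda>\<omega>. \<bar>layer s (Z i \<omega>)\<bar>) \<le> expectation (\<lambda>\<omega>. (1 + \<bar>Z i \<omega>\<bar>) ^ 10 / (1 + \<bar>s\<bar>) ^ 10)"
    proof (rule integral_mono)
      show "integrable M (\<lambda>\<omega>. \<bar>layer s (Z i \<omega>)\<bar>)" using lay_int[OF i] by simp
      show "integrable M (\<lambda>\<omega>. (1 + \<bar>Z i \<omega>\<bar>) ^ 10 / (1 + \<bar>s\<bar>) ^ 10)" using mom(1)[OF i] by simp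
      fix \<omega>
      show "\<bar>layer s (Z i \<omega>)\<bar> \<le> (1 + \<bar>Z i \<omega>\<bar>) ^ 10 / (1 + \<bar>s\<bar>) ^ 10"
      proof (cases "\<bar>s\<bar> \<le> \<bar>Z i \<omega>\<bar>")
        case True
        then have "(1 + \<bar>s\<bar>) ^ 10 \<le> (1 + \<bar>Z i \<omega>\<bar>) ^ 10" by (intro power_mono) auto
        moreover have "(1 + \<bar>s\<bar>) ^ 10 > 0" by (intro zero_less_power) auto
        ultimately have "1 \<le> (1 + \<bar>Z i \<omega>\<bar>) ^ 10 / (1 + \<bar>s\<bar>) ^ 10" by simp
        then show ?thesis using layer_le_1[of s "Z i \<omega>"] by linarith
      next
        case False
        then have "layer s (Z i \<omega>) = 0" using layer_bound[of s "Z i \<omega>"] by simp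
        then show ?thesis by simp
      qed
    qed
    also have "\<dots> = expectation (\<lambda>\<omega>. (1 + \<bar>Z i \<omega>\<bar>) ^ 10) / (1 + \<bar>s\<bar>) ^ 10" using mom(1)[OF i] by simp
    also have "\<dots> \<le> C / (1 + \<bar>s\<bar>) ^ 10" using mom(2)[OF i] by (intro divide_right_mono) auto
    finally show ?thesis .
  qed
  have m_le1: "\<bar>m i s\<bar> \<le> 1" if "i \<in> ?I" for i s
  proof -
    have "\<bar>m i s\<bar> \<le> expectation (\<lambda>\<omega>. \<bar>layer s (Z i \<omega>)\<bar>)" unfolding m_def by (rule integral_abs_bound)
    also have "\<dots> \<le> expectation (\<lambda>\<omega>. 1)" using lay_int[OF that] by (intro integral_mono) (auto simp: layer_le_1)
    finally show ?thesis by (simp add: prob_space)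
  qed
  have m_meas[measurable]: "m i \<in> borel_measurable borel" if "i \<in> ?I" for i
  proof -
    note [measurable] = rv[OF that]
    show ?thesis unfolding m_def by measurable
  qed
  \<comment> \<open>The random function in question: the normalised centred sum of the kernels at
    level s. It does not involve g.\<close>
  define D where "D s \<omega> = (1 / sqrt (real n)) *\<^sub>R (\<Sum>i\<in>?I. (layer s (Z i \<omega>) - m i s) *\<^sub>R a i)" for s \<omega>
  have D_meas[measurable]: "(\<lambda>(s, \<omega>). D s \<omega>) \<in> borel_measurable (lborel \<Otimes>\<^sub>M M)"
  proof -
    have "(\<lambda>p. (layer (fst p) (Z i (snd p)) - m i (fst p)) *\<^sub>R a i) \<in> borel_measurable (lborel \<Otimes>\<^sub>M M)" if "i \<in> ?I" for i
    proof -
      note [measurable] = rv[OF that] m_meas[OF that]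
      show ?thesis by measurable
    qed
    then show ?thesis unfolding D_def case_prod_beta
      by (rule borel_measurable_scaleR[OF borel_measurable_const borel_measurable_sum])
  qed
  have D_norm: "(\<integral>\<^sup>+\<omega>. ennreal (norm (D s \<omega>)) \<partial>M) \<le> ennreal ((1 + A\<^sup>2 * C) / (1 + \<bar>s\<bar>) ^ 5)" for s
  proof -
    let ?\<xi> = "\<lambda>i \<omega>. layer s (Z i \<omega>) - m i s"
    let ?l = "(1 + \<bar>s\<bar>) ^ 5"
    have l: "?l > 0" by (intro zero_less_power) auto
    have ind: "indep_vars (\<lambda>_. borel) ?\<xi> ?I"
      by (rule indep_vars_compose2[OF indep]) measurable
    have bd: "\<bar>?\<xi> i \<omega>\<bar> \<le> 2" if "i \<in> ?I" for i \<omega>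
      using m_le1[OF that, of s] layer_le_1[of s "Z i \<omega>"] by linarith
    have mean: "expectation (?\<xi> i) = 0" if "i \<in> ?I" for i
      using lay_int[OF that] by (simp add: m_def prob_space)
    have sq: "expectation (\<lambda>\<omega>. (?\<xi> i \<omega>)\<^sup>2) \<le> C / (1 + \<bar>s\<bar>) ^ 10" if i: "i \<in> ?I" for i
    proof -
      have i2: "integrable M (\<lambda>\<omega>. (layer s (Z i \<omega>))\<^sup>2)"
      proof -
        note [measurable] = rv[OF that]
        show ?thesis by (intro integrable_const_bound[where B=1]) (auto simp: layer_le_1 abs_square_le_1)
      qed
      have "expectation (\<lambda>\<omega>. (?\<xi> i \<omega>)\<^sup>2) = expectation (\<lambda>\<omega>. (layer s (Z i \<omega>))\<^sup>2) - (m i s)\<^sup>2"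
        unfolding m_def by (rule variance_eq[OF lay_int[OF i] i2])
      also have "\<dots> \<le> expectation (\<lambda>\<omega>. (layer s (Z i \<omega>))\<^sup>2)" by simp
      also have "\<dots> \<le> expectation (\<lambda>\<omega>. \<bar>layer s (Z i \<omega>)\<bar>)"
        using lay_int[OF i] i2 by (intro integral_mono) (auto simp: layer_def)
      finally show ?thesis using tail[OF i, of s] by linarith
    qed
    have N: "(norm (D s \<omega>))\<^sup>2 = (norm (\<Sum>i\<in>?I. ?\<xi> i \<omega> *\<^sub>R a i))\<^sup>2 / n" for \<omega>
      unfolding D_def norm_scaleR using n by (simp add: power_mult_distrib power_divide)
    have i1: "integrable M (\<lambda>\<omega>. (norm (D s \<omega>))\<^sup>2)"
      unfolding N using sum_centered_norm_square(1)[OF _ ind bd mean, of a] by simp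
    have "expectation (\<lambda>\<omega>. (norm (D s \<omega>))\<^sup>2) = (\<Sum>i\<in>?I. (norm (a i))\<^sup>2 * expectation (\<lambda>\<omega>. (?\<xi> i \<omega>)\<^sup>2)) / n"
      unfolding N using sum_centered_norm_square[OF _ ind bd mean, of a] by simp
    also have "\<dots> \<le> (\<Sum>i\<in>?I. A\<^sup>2 * (C / (1 + \<bar>s\<bar>) ^ 10)) / n"
      using a sq by (intro divide_right_mono sum_mono mult_mono power_mono) auto
    also have "\<dots> = A\<^sup>2 * C / (?l * ?l)" using n by (simp add: power_add[symmetric])
    finally have E2: "expectation (\<lambda>\<omega>. (norm (D s \<omega>))\<^sup>2) \<le> A\<^sup>2 * C / (?l * ?l)" .
    \<comment> \<open>This plays the part of the Cauchy-Schwarz inequality: with l the inverse order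
      of the standard deviation, both summands have the order of the standard deviation after
      integration.\<close>
    have amgm: "x \<le> 1 / ?l + ?l * x\<^sup>2" for x :: real
    proof -
      have "0 \<le> (?l * x - 1 / 2)\<^sup>2" by simp
      then have "?l * x \<le> 1 + ?l\<^sup>2 * x\<^sup>2" by (simp add: power2_diff power_mult_distrib power_divide)
      then show ?thesis using l by (simp add: field_simps power2_eq_square)
    qed
    have "(\<integral>\<^sup>+\<omega>. ennreal (norm (D s \<omega>)) \<partial>M) \<le> (\<integral>\<^sup>+\<omega>. ennreal (1 / ?l + ?l * (norm (D s \<omega>))\<^sup>2) \<partial>M)"
      by (intro nn_integral_mono ennreal_leI amgm)
    also have "\<dots> = ennreal (expectation (\<lambda>\<omega>. 1 / ?l + ?l * (norm (D s \<omega>))\<^sup>2))"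
      using i1 l by (intro nn_integral_eq_integral) auto
    also have "expectation (\<lambda>\<omega>. 1 / ?l + ?l * (norm (D s \<omega>))\<^sup>2) = 1 / ?l + ?l * expectation (\<lambda>\<omega>. (norm (D s \<omega>))\<^sup>2)"
      using i1 by (simp add: prob_space)
    also have "\<dots> \<le> 1 / ?l + ?l * (A\<^sup>2 * C / (?l * ?l))"
      using l by (intro add_left_mono mult_left_mono E2) auto
    also have "\<dots> = (1 + A\<^sup>2 * C) / ?l"
    proof -
      have "1 / l + l * (c / (l * l)) = (1 + c) / l" if "l > 0" for l c :: real
        using that by (simp add: field_simps)
      then show ?thesis using l .
    qed
    finally show ?thesis by (simp add: ennreal_leI)
  qed
  \<comment> \<open>A weighted L1 norm of D. It bounds the pairing of D with every g' of size
    \<delta> (1 + |s|)^3, so its expectation is all that has to be estimated.\<close>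
  define S where "S \<omega> = (\<integral>\<^sup>+s. ennreal ((1 + \<bar>s\<bar>) ^ 3 * norm (D s \<omega>)) \<partial>lborel)" for \<omega>
  interpret P: pair_sigma_finite lborel M ..
  have [measurable]: "(\<lambda>s. D s \<omega>) \<in> borel_measurable lborel" if "\<omega> \<in> space M" for \<omega>
    using measurable_Pair1[OF D_meas that] by simp
  have [measurable]: "D s \<in> borel_measurable M" for s
    using measurable_Pair2[OF D_meas, of s] by simp
  have S_meas: "S \<in> borel_measurable M"
    unfolding S_def using D_meas
    by (intro sigma_finite_measure.borel_measurable_nn_integral lborel.sigma_finite_measure_axioms)
      (auto simp: case_prod_beta intro!: measurable_compose[OF measurable_pair_swap'] borel_measurable_times)
  have S_int: "(\<integral>\<^sup>+\<omega>. S \<omega> \<partial>M) \<le> ennreal ((1 + A\<^sup>2 * C) * tail_int)"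
  proof -
    have "(\<integral>\<^sup>+\<omega>. S \<omega> \<partial>M) = (\<integral>\<^sup>+s. (\<integral>\<^sup>+\<omega>. ennreal ((1 + \<bar>s\<bar>) ^ 3 * norm (D s \<omega>)) \<partial>M) \<partial>lborel)"
      unfolding S_def by (rule P.Fubini') (use D_meas in \<open>simp add: case_prod_beta'\<close>)
    also have "\<dots> = (\<integral>\<^sup>+s. ennreal ((1 + \<bar>s\<bar>) ^ 3) * (\<integral>\<^sup>+\<omega>. ennreal (norm (D s \<omega>)) \<partial>M) \<partial>lborel)"
      by (simp add: ennreal_mult nn_integral_cmult)
    also have "\<dots> \<le> (\<integral>\<^sup>+s. ennreal ((1 + A\<^sup>2 * C) * (1 / (1 + \<bar>s\<bar>)\<^sup>2)) \<partial>lborel)"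
    proof (rule nn_integral_mono)
      fix s :: real
      have "ennreal ((1 + \<bar>s\<bar>) ^ 3) * (\<integral>\<^sup>+\<omega>. ennreal (norm (D s \<omega>)) \<partial>M)
          \<le> ennreal ((1 + \<bar>s\<bar>) ^ 3) * ennreal ((1 + A\<^sup>2 * C) / (1 + \<bar>s\<bar>) ^ 5)"
        by (intro mult_left_mono D_norm) auto
      also have "\<dots> = ennreal ((1 + \<bar>s\<bar>) ^ 3 * ((1 + A\<^sup>2 * C) / (1 + \<bar>s\<bar>) ^ 5))"
        using C0 by (subst ennreal_mult) auto
      also have "(1 + \<bar>s\<bar>) ^ 3 * ((1 + A\<^sup>2 * C) / (1 + \<bar>s\<bar>) ^ 5) = (1 + A\<^sup>2 * C) * (1 / (1 + \<bar>s\<bar>)\<^sup>2)"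
      proof -
        have "v ^ 3 * (c / v ^ 5) = c * (1 / v\<^sup>2)" if "v \<noteq> 0" for v c :: real
          using that by (simp add: eval_nat_numeral field_simps)
        moreover have "1 + \<bar>s\<bar> \<noteq> 0" by linarith
        ultimately show ?thesis by blast
      qed
      finally show "ennreal ((1 + \<bar>s\<bar>) ^ 3) * (\<integral>\<^sup>+\<omega>. ennreal (norm (D s \<omega>)) \<partial>M)
          \<le> ennreal ((1 + A\<^sup>2 * C) * (1 / (1 + \<bar>s\<bar>)\<^sup>2))" .
    qed
    also have "\<dots> = ennreal (\<integral>s. (1 + A\<^sup>2 * C) * (1 / (1 + \<bar>s\<bar>)\<^sup>2) \<partial>lborel)"
      using C0 by (intro nn_integral_eq_integral integrable_mult_right tail_integrable AE_I2)
        (auto intro!: divide_nonneg_nonneg)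
    also have "\<dots> = ennreal ((1 + A\<^sup>2 * C) * tail_int)"
      unfolding tail_int_def by (subst integral_mult_right_zero) simp
    finally show ?thesis .
  qed
  have main: "norm ((1 / sqrt (real n)) *\<^sub>R (\<Sum>i=1..n. (g (Z i \<omega>) - expectation (\<lambda>\<omega>. g (Z i \<omega>))) *\<^sub>R a i)) \<le> \<delta> * K"
    if \<omega>: "\<omega> \<in> space M" and g: "\<And>x. (g has_real_derivative g' x) (at x)" and cont: "continuous_on UNIV g'"
      and g': "\<And>s. \<bar>g' s\<bar> \<le> \<delta> * (1 + \<bar>s\<bar>) ^ 3" and K: "0 \<le> K" "S \<omega> \<le> ennreal K" for \<omega> g g' \<delta> K
  proof -
    have \<delta>: "\<delta> \<ge> 0" using g'[of 0] by auto
    have [measurable]: "g' \<in> borel_measurable borel" using cont by (rule borel_measurable_continuous_onI)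
    have [measurable]: "g \<in> borel_measurable borel"
      using g by (intro borel_measurable_continuous_onI) (meson DERIV_continuous_on has_field_derivative_at_within)
    \<comment> \<open>The expectation of g is represented by the mean kernel \<open>m i\<close>.
      Fubini applies because the weight of power 3 meets a tail of power 10.\<close>
    have Eg: "has_bochner_integral lborel (\<lambda>s. g' s * m i s) (expectation (\<lambda>\<omega>. g (Z i \<omega>)) - g 0)" if i: "i \<in> ?I" for i
    proof -
      note [measurable] = rv[OF i] m_meas[OF i]
      have int: "integrable (lborel \<Otimes>\<^sub>M M) (\<lambda>(s, \<omega>). g' s * layer s (Z i \<omega>))"
      proof (rule P.Fubini_integrable)
        show "(\<lambda>(s, \<omega>). g' s * layer s (Z i \<omega>)) \<in> borel_measurable (lborel \<Otimes>\<^sub>M M)" by measurable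
        show "AE s in lborel. integrable M (\<lambda>\<omega>. case (s, \<omega>) of (s, \<omega>) \<Rightarrow> g' s * layer s (Z i \<omega>))"
          using lay_int[OF i] by simp
        have bnd: "\<bar>g' s\<bar> * expectation (\<lambda>\<omega>. \<bar>layer s (Z i \<omega>)\<bar>) \<le> \<delta> * C * (1 / (1 + \<bar>s\<bar>) ^ 7)" for s
        proof -
          have "\<bar>g' s\<bar> * expectation (\<lambda>\<omega>. \<bar>layer s (Z i \<omega>)\<bar>) \<le> (\<delta> * (1 + \<bar>s\<bar>) ^ 3) * (C / (1 + \<bar>s\<bar>) ^ 10)"
            using g' tail[OF i, of s] \<delta> by (intro mult_mono) auto
          also have "\<dots> = \<delta> * C * (1 / (1 + \<bar>s\<bar>) ^ 7)"
          proof -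
            have "(d * v ^ 3) * (c / v ^ 10) = d * c * (1 / v ^ 7)" if "v \<noteq> 0" for v c d :: real
              using that by (simp add: eval_nat_numeral field_simps)
            moreover have "1 + \<bar>s\<bar> \<noteq> 0" by linarith
            ultimately show ?thesis by blast
          qed
          finally show ?thesis .
        qed
        have "integrable lborel (\<lambda>s. \<bar>g' s\<bar> * expectation (\<lambda>\<omega>. \<bar>layer s (Z i \<omega>)\<bar>))"
        proof (rule Bochner_Integration.integrable_bound)
          show "integrable lborel (\<lambda>s. \<delta> * C * (1 / (1 + \<bar>s\<bar>) ^ 7))"
            by (intro integrable_mult_right tail_integrable) simp
          show "AE s in lborel. norm (\<bar>g' s\<bar> * expectation (\<lambda>\<omega>. \<bar>layer s (Z i \<omega>)\<bar>)) \<le> norm (\<delta> * C * (1 / (1 + \<bar>s\<bar>) ^ 7))"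
            using bnd by (intro AE_I2) (simp add: abs_mult \<delta> C0)
          show "(\<lambda>s. \<bar>g' s\<bar> * expectation (\<lambda>\<omega>. \<bar>layer s (Z i \<omega>)\<bar>)) \<in> borel_measurable lborel" by measurable
        qed
        then show "integrable lborel (\<lambda>s. \<integral>\<omega>. norm (case (s, \<omega>) of (s, \<omega>) \<Rightarrow> g' s * layer s (Z i \<omega>)) \<partial>M)"
          by (simp add: abs_mult)
      qed
      have 1: "(\<integral>s. g' s * m i s \<partial>lborel) = (\<integral>\<omega>. (\<integral>s. g' s * layer s (Z i \<omega>) \<partial>lborel) \<partial>M)"
        using P.Fubini_integral[OF int] by (simp add: m_def)
      have 2: "(\<integral>s. g' s * layer s z \<partial>lborel) = g z - g 0" for z
        using layer_representation[OF g cont, of z] by (rule has_bochner_integral_integral_eq)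
      have "integrable M (\<lambda>\<omega>. \<integral>s. g' s * layer s (Z i \<omega>) \<partial>lborel)"
        using P.integrable_snd[of "\<lambda>s \<omega>. g' s * layer s (Z i \<omega>)"] int by simp
      then have "integrable M (\<lambda>\<omega>. (g (Z i \<omega>) - g 0) + g 0)" unfolding 2 by (intro Bochner_Integration.integrable_add) auto
      then have gi: "integrable M (\<lambda>\<omega>. g (Z i \<omega>))" by simp
      have "integrable lborel (\<lambda>s. g' s * m i s)"
        using P.integrable_fst[of "\<lambda>s \<omega>. g' s * layer s (Z i \<omega>)"] int by (simp add: m_def)
      then show ?thesis unfolding has_bochner_integral_iff using gi by (simp add: 1 2 prob_space)
    qed
    have h: "has_bochner_integral lborel (\<lambda>s. (1 / sqrt (real n)) *\<^sub>R (\<Sum>i\<in>?I. (g' s * layer s (Z i \<omega>) - g' s * m i s) *\<^sub>R a i))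
        ((1 / sqrt (real n)) *\<^sub>R (\<Sum>i\<in>?I. ((g (Z i \<omega>) - g 0) - (expectation (\<lambda>\<omega>. g (Z i \<omega>)) - g 0)) *\<^sub>R a i))"
      by (intro has_bochner_integral_scaleR_right has_bochner_integral_sum has_bochner_integral_scaleR_left
          has_bochner_integral_diff layer_representation[OF g cont] Eg)
    have eqD: "(1 / sqrt (real n)) *\<^sub>R (\<Sum>i\<in>?I. (g' s * layer s (Z i \<omega>) - g' s * m i s) *\<^sub>R a i) = g' s *\<^sub>R D s \<omega>" for s
      unfolding D_def by (simp add: scaleR_sum_right algebra_simps)
    have "norm ((1 / sqrt (real n)) *\<^sub>R (\<Sum>i=1..n. (g (Z i \<omega>) - expectation (\<lambda>\<omega>. g (Z i \<omega>))) *\<^sub>R a i))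
        = norm (\<integral>s. g' s *\<^sub>R D s \<omega> \<partial>lborel)"
      using has_bochner_integral_integral_eq[OF h] unfolding eqD by simp
    also have "ennreal \<dots> \<le> (\<integral>\<^sup>+s. ennreal (norm (g' s *\<^sub>R D s \<omega>)) \<partial>lborel)"
      using h unfolding eqD has_bochner_integral_iff by (intro integral_norm_bound_ennreal) auto
    also have "\<dots> \<le> (\<integral>\<^sup>+s. ennreal \<delta> * ennreal ((1 + \<bar>s\<bar>) ^ 3 * norm (D s \<omega>)) \<partial>lborel)"
    proof (rule nn_integral_mono)
      fix s
      have "norm (g' s *\<^sub>R D s \<omega>) \<le> (\<delta> * (1 + \<bar>s\<bar>) ^ 3) * norm (D s \<omega>)"
        unfolding norm_scaleR using g' by (intro mult_right_mono) auto
      then have "ennreal (norm (g' s *\<^sub>R D s \<omega>)) \<le> ennreal (\<delta> * ((1 + \<bar>s\<bar>) ^ 3 * norm (D s \<omega>)))"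
        by (intro ennreal_leI) (simp add: mult.assoc)
      then show "ennreal (norm (g' s *\<^sub>R D s \<omega>)) \<le> ennreal \<delta> * ennreal ((1 + \<bar>s\<bar>) ^ 3 * norm (D s \<omega>))"
        using \<delta> by (subst ennreal_mult[symmetric]) auto
    qed
    also have "\<dots> = ennreal \<delta> * S \<omega>"
      unfolding S_def using \<omega> by (intro nn_integral_cmult) measurable
    also have "\<dots> \<le> ennreal \<delta> * ennreal K" using K by (intro mult_left_mono) auto
    also have "\<dots> = ennreal (\<delta> * K)" using \<delta> K by (simp add: ennreal_mult)
    finally show ?thesis using \<delta> K by (simp add: ennreal_le_iff)
  qed
  show ?thesis
    using S_meas S_int main by (intro exI[of _ S]) blast
qed

text \<open>Markov's inequality for S. The order of the quantifiers is the point: K is fixed before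
  n, Z and a, and the event before g, so that one event serves all \<eta>.\<close>

corollary empirical_process_whp:
  fixes A C \<xi> :: real
  assumes \<xi>: "\<xi> > 0" and C: "C \<ge> 0"
  shows "\<exists>K>0. \<forall>n\<ge>1. \<forall>Z. \<forall>a::nat \<Rightarrow> 'c::euclidean_space. indep_vars (\<lambda>_. borel) Z {1..n} \<longrightarrow>
    (\<forall>i\<in>{1..n}. integrable M (\<lambda>\<omega>. (1 + \<bar>Z i \<omega>\<bar>) ^ 10) \<and> expectation (\<lambda>\<omega>. (1 + \<bar>Z i \<omega>\<bar>) ^ 10) \<le> C) \<longrightarrow>
    (\<forall>i\<in>{1..n}. norm (a i) \<le> A) \<longrightarrow>
    (\<exists>E\<in>events. prob E \<ge> 1 - \<xi> \<and> (\<forall>\<omega>\<in>E. \<forall>g g' \<delta>. (\<forall>x. (g has_real_derivative g' x) (at x)) \<longrightarrow>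
      continuous_on UNIV g' \<longrightarrow> (\<forall>s. \<bar>g' s\<bar> \<le> \<delta> * (1 + \<bar>s\<bar>) ^ 3) \<longrightarrow>
      norm ((1 / sqrt (real n)) *\<^sub>R (\<Sum>i=1..n. (g (Z i \<omega>) - expectation (\<lambda>\<omega>. g (Z i \<omega>))) *\<^sub>R a i)) \<le> \<delta> * K))"
proof -
  define J where "J = (1 + A\<^sup>2 * C) * tail_int"
  have J: "J \<ge> 0" using C tail_int_nonneg by (simp add: J_def)
  \<comment> \<open>The summand 1 keeps K positive if J = 0.\<close>
  define K where "K = (J + 1) / \<xi>"
  have K: "K > 0" using J \<xi> by (simp add: K_def)
  show ?thesis
  proof (intro exI[of _ K] conjI K allI impI)
    fix n :: nat and Z and a :: "nat \<Rightarrow> 'c"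
    assume n: "1 \<le> n" and Z: "indep_vars (\<lambda>_. borel) Z {1..n}"
      and mom: "\<forall>i\<in>{1..n}. integrable M (\<lambda>\<omega>. (1 + \<bar>Z i \<omega>\<bar>) ^ 10) \<and> expectation (\<lambda>\<omega>. (1 + \<bar>Z i \<omega>\<bar>) ^ 10) \<le> C"
      and a: "\<forall>i\<in>{1..n}. norm (a i) \<le> A"
    obtain S where [measurable]: "S \<in> borel_measurable M" and S1: "(\<integral>\<^sup>+\<omega>. S \<omega> \<partial>M) \<le> ennreal J" and
      S2: "\<And>\<omega> g g' \<delta> K. \<omega> \<in> space M \<Longrightarrow> (\<forall>x. (g has_real_derivative g' x) (at x)) \<Longrightarrow> continuous_on UNIV g' \<Longrightarrow>
      (\<forall>s. \<bar>g' s\<bar> \<le> \<delta> * (1 + \<bar>s\<bar>) ^ 3) \<Longrightarrow> 0 \<le> K \<Longrightarrow> S \<omega> \<le> ennreal K \<Longrightarrow>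
      norm ((1 / sqrt (real n)) *\<^sub>R (\<Sum>i=1..n. (g (Z i \<omega>) - expectation (\<lambda>\<omega>. g (Z i \<omega>))) *\<^sub>R a i)) \<le> \<delta> * K"
      using empirical_process_bound[OF n Z, of C a A] mom a unfolding J_def by blast
    define E where "E = {\<omega> \<in> space M. S \<omega> \<le> ennreal K}"
    have E[measurable]: "E \<in> events" unfolding E_def by measurable
    have "emeasure M {\<omega> \<in> space M. 1 \<le> ennreal (1 / K) * S \<omega>} \<le> ennreal (1 / K) * (\<integral>\<^sup>+\<omega>. S \<omega> * indicator (space M) \<omega> \<partial>M)"
      by (rule nn_integral_Markov_inequality) auto
    also have "(\<integral>\<^sup>+\<omega>. S \<omega> * indicator (space M) \<omega> \<partial>M) = (\<integral>\<^sup>+\<omega>. S \<omega> \<partial>M)"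
      by (intro nn_integral_cong) auto
    also have "ennreal (1 / K) * (\<integral>\<^sup>+\<omega>. S \<omega> \<partial>M) \<le> ennreal (1 / K) * ennreal J" by (intro mult_left_mono S1) auto
    also have "\<dots> = ennreal (J / K)" using J K by (simp add: ennreal_mult[symmetric])
    also have "\<dots> \<le> ennreal \<xi>"
    proof (rule ennreal_leI)
      show "J / K \<le> \<xi>" unfolding K_def using J \<xi> by (simp add: field_simps)
    qed
    finally have *: "emeasure M {\<omega> \<in> space M. 1 \<le> ennreal (1 / K) * S \<omega>} \<le> ennreal \<xi>" .
    have "space M - E \<subseteq> {\<omega> \<in> space M. 1 \<le> ennreal (1 / K) * S \<omega>}"
    proof
      fix \<omega> assume "\<omega> \<in> space M - E"
      then have "\<omega> \<in> space M" "ennreal K \<le> S \<omega>" by (auto simp: E_def)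
      then have "ennreal (1 / K) * ennreal K \<le> ennreal (1 / K) * S \<omega>" by (intro mult_left_mono) auto
      also have "ennreal (1 / K) * ennreal K = 1" using K by (simp add: ennreal_mult[symmetric])
      finally show "\<omega> \<in> {\<omega> \<in> space M. 1 \<le> ennreal (1 / K) * S \<omega>}" using \<open>\<omega> \<in> space M\<close> by simp
    qed
    moreover have "{\<omega> \<in> space M. 1 \<le> ennreal (1 / K) * S \<omega>} \<in> events" by measurable
    ultimately have "emeasure M (space M - E) \<le> ennreal \<xi>"
      using * by (blast intro: order_trans[OF emeasure_mono])
    then have "prob (space M - E) \<le> \<xi>" using \<xi> by (simp add: emeasure_eq_measure)
    then have "prob E \<ge> 1 - \<xi>" using prob_compl[OF E] by linarith
    moreover have "\<omega> \<in> E \<Longrightarrow> \<omega> \<in> space M \<and> S \<omega> \<le> ennreal K" for \<omega> by (simp add: E_def)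
    ultimately show "\<exists>E\<in>events. prob E \<ge> 1 - \<xi> \<and> (\<forall>\<omega>\<in>E. \<forall>g g' \<delta>. (\<forall>x. (g has_real_derivative g' x) (at x)) \<longrightarrow>
      continuous_on UNIV g' \<longrightarrow> (\<forall>s. \<bar>g' s\<bar> \<le> \<delta> * (1 + \<bar>s\<bar>) ^ 3) \<longrightarrow>
      norm ((1 / sqrt (real n)) *\<^sub>R (\<Sum>i=1..n. (g (Z i \<omega>) - expectation (\<lambda>\<omega>. g (Z i \<omega>))) *\<^sub>R a i)) \<le> \<delta> * K)"
      using E K S2 by (intro bexI[of _ E]) (auto simp: less_imp_le)
  qed
qed

end

section \<open>Quadratic forms and Gaussian integrals\<close>

lemma quadratic_symmetric:
  fixes A :: "real^'n^'n"
  assumes "transpose A = A"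
  shows "x \<bullet> (A *v y) = y \<bullet> (A *v x)"
  by (metis assms dot_lmul_matrix inner_commute transpose_matrix_vector)

text \<open>Minimise the quadratic form on the unit sphere of W. If the residual d = A w - \<rho> w
  were nonzero, moving w against d would lower the form to first order; d stays in W by
  invariance.\<close>

lemma rayleigh_eigenvector:
  fixes A :: "real^'n^'n"
  assumes sym: "transpose A = A" and W: "subspace W" and inv: "\<And>w. w \<in> W \<Longrightarrow> A *v w \<in> W"
    and x0: "x0 \<in> W" "x0 \<noteq> 0"
  shows "\<exists>w \<rho>. w \<in> W \<and> norm w = 1 \<and> A *v w = \<rho> *\<^sub>R w \<and> (\<forall>x\<in>W. \<rho> * (norm x)\<^sup>2 \<le> x \<bullet> (A *v x))"
proof -
  let ?S = "W \<inter> sphere 0 1"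
  have "closed W" using W by (rule closed_subspace)
  then have "compact ?S" by (simp add: closed_Int_compact)
  moreover have "(1 / norm x0) *\<^sub>R x0 \<in> ?S" using x0 W by (auto intro: subspace_scale)
  moreover have "continuous_on ?S (\<lambda>x. x \<bullet> (A *v x))"
    by (intro continuous_intros linear_continuous_on_compose[OF continuous_on_id]) simp
  ultimately obtain w where w: "w \<in> ?S" "\<And>x. x \<in> ?S \<Longrightarrow> w \<bullet> (A *v w) \<le> x \<bullet> (A *v x)"
    using continuous_attains_inf[of ?S "\<lambda>x. x \<bullet> (A *v x)"] by blast
  define \<rho> where "\<rho> = w \<bullet> (A *v w)"
  have wW: "w \<in> W" and nw: "norm w = 1" using w by auto
  have min: "\<rho> * (norm x)\<^sup>2 \<le> x \<bullet> (A *v x)" if "x \<in> W" for x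
  proof (cases "x = 0")
    case False
    have "(1 / norm x) *\<^sub>R x \<in> ?S" using that False W by (auto intro: subspace_scale)
    from w(2)[OF this] have "\<rho> \<le> (1 / norm x) * ((1 / norm x) * (x \<bullet> (A *v x)))"
      by (simp add: \<rho>_def matrix_vector_mult_scaleR)
    then show ?thesis using False by (simp add: field_simps power2_eq_square)
  qed simp
  define d where "d = A *v w - \<rho> *\<^sub>R w"
  have dW: "d \<in> W" unfolding d_def by (intro subspace_diff subspace_scale W wW inv)
  have "d = 0"
  proof (rule ccontr)
    assume "d \<noteq> 0"
    define D where "D = (norm d)\<^sup>2"
    have D: "D > 0" using \<open>d \<noteq> 0\<close> by (simp add: D_def)
    define c where "c = d \<bullet> (A *v d) - \<rho> * D"
    \<comment> \<open>Minimality tested at w + t d. The linear coefficient is 2 |d|^2 because d is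
      the residual, and a small negative t then gives a contradiction if d is nonzero.\<close>
    have poly: "0 \<le> 2 * t * D + t\<^sup>2 * c" for t
    proof -
      have wd: "w \<bullet> w = 1" using nw by (simp add: dot_square_norm)
      have dd: "d \<bullet> d = D" by (simp add: D_def dot_square_norm)
      have Dd: "D = d \<bullet> (A *v w) - \<rho> * (d \<bullet> w)"
        unfolding dd[symmetric] by (subst (2) d_def) (simp add: inner_diff_right)
      have "w + t *\<^sub>R d \<in> W" by (intro subspace_add subspace_scale W wW dW)
      from min[OF this] have "\<rho> * ((w + t *\<^sub>R d) \<bullet> (w + t *\<^sub>R d)) \<le> (w + t *\<^sub>R d) \<bullet> (A *v (w + t *\<^sub>R d))"
        by (simp add: dot_square_norm)
      also have "(w + t *\<^sub>R d) \<bullet> (A *v (w + t *\<^sub>R d)) = \<rho> + 2 * t * (d \<bullet> (A *v w)) + t\<^sup>2 * (d \<bullet> (A *v d))"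
        using quadratic_symmetric[OF sym, of w d]
        by (simp add: matrix_vector_right_distrib matrix_vector_mult_scaleR inner_add_left inner_add_right \<rho>_def
            power2_eq_square algebra_simps)
      also have "(w + t *\<^sub>R d) \<bullet> (w + t *\<^sub>R d) = 1 + 2 * t * (d \<bullet> w) + t\<^sup>2 * D"
        by (simp add: inner_add_left inner_add_right wd dd inner_commute power2_eq_square algebra_simps)
      finally show ?thesis unfolding c_def by (subst Dd) (simp add: algebra_simps)
    qed
    define k where "k = \<bar>c\<bar> + 1"
    have k: "k > 0" "c \<le> k" by (auto simp: k_def)
    have "0 \<le> 2 * (- D / k) * D + (- D / k)\<^sup>2 * c" by (rule poly)
    also have "\<dots> \<le> 2 * (- D / k) * D + (- D / k)\<^sup>2 * k" using k by (intro add_left_mono mult_left_mono) auto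
    also have "\<dots> = - (D * D / k)" using k by (simp add: field_simps power2_eq_square)
    also have "\<dots> < 0" using D k by simp
    finally show False by simp
  qed
  then show ?thesis using wW nw min by (intro exI[of _ w] exI[of _ \<rho>]) (auto simp: d_def)
qed

text \<open>Eigenvectors of distinct eigenvalues are orthogonal, hence independent. Finiteness makes
  the \<open>Min\<close> in \<open>min_eigenvalue\<close> an actual minimum.\<close>

lemma finite_eigenvalues:
  fixes A :: "real^'n^'n"
  assumes sym: "transpose A = A"
  shows "finite {r. \<exists>v. v \<noteq> 0 \<and> A *v v = r *\<^sub>R v}"
proof -
  let ?E = "{r. \<exists>v. v \<noteq> 0 \<and> A *v v = r *\<^sub>R v}"
  obtain f where f: "\<And>r. r \<in> ?E \<Longrightarrow> f r \<noteq> 0 \<and> A *v f r = r *\<^sub>R f r"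
    using bchoice[of ?E "\<lambda>r v. v \<noteq> 0 \<and> A *v v = r *\<^sub>R v"] by blast
  have orth: "f r \<bullet> f s = 0" if "r \<in> ?E" "s \<in> ?E" "r \<noteq> s" for r s
  proof -
    have "s * (f r \<bullet> f s) = r * (f r \<bullet> f s)"
      using quadratic_symmetric[OF sym, of "f r" "f s"] f[OF that(1)] f[OF that(2)] by (simp add: inner_commute)
    then show ?thesis using that by simp
  qed
  have inj: "inj_on f ?E"
  proof (rule inj_onI, rule ccontr)
    fix r s assume *: "r \<in> ?E" "s \<in> ?E" "f r = f s" "r \<noteq> s"
    then show False using orth[OF *(1,2,4)] f[OF *(2)] by simp
  qed
  have "independent (f ` ?E)"
  proof (rule pairwise_orthogonal_independent)
    show "pairwise orthogonal (f ` ?E)"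
    proof (rule pairwiseI)
      fix x y assume "x \<in> f ` ?E" "y \<in> f ` ?E" "x \<noteq> y"
      then show "orthogonal x y" using orth unfolding orthogonal_def by blast
    qed
    show "0 \<notin> f ` ?E"
    proof
      assume "0 \<in> f ` ?E"
      then obtain r where "0 = f r" "r \<in> ?E" by (rule imageE)
      then show False using f[of r] by simp
    qed
  qed
  then have "finite (f ` ?E)" using independent_bound by blast
  then show ?thesis using finite_imageD[OF _ inj] by blast
qed

text \<open>The minimum \<rho> of the Rayleigh quotient is itself an eigenvalue, so it is at least
  \<open>min_eigenvalue A\<close>.\<close>

lemma min_eigenvalue_le:
  fixes A :: "real^'n^'n"
  assumes sym: "transpose A = A"
  shows "min_eigenvalue A * (norm x)\<^sup>2 \<le> x \<bullet> (A *v x)"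
proof -
  have "(axis undefined 1 :: real^'n) \<noteq> 0" by simp
  then obtain w \<rho> where w: "norm w = 1" "A *v w = \<rho> *\<^sub>R w" "\<rho> * (norm x)\<^sup>2 \<le> x \<bullet> (A *v x)"
    using rayleigh_eigenvector[OF sym subspace_UNIV, of "axis undefined 1"] by auto
  have "min_eigenvalue A \<le> \<rho>"
    unfolding min_eigenvalue_def using w(1,2) by (intro Min_le finite_eigenvalues[OF sym]) (auto intro!: exI[of _ w])
  then show ?thesis using w(3) mult_right_mono[of "min_eigenvalue A" \<rho> "(norm x)\<^sup>2"] by simp
qed

text \<open>Take an orthonormal set S of eigenvectors of maximal cardinality. Its orthogonal
  complement is invariant under A, and a nonzero complement would contain a further
  eigenvector.\<close>

lemma orthonormal_eigenbasis:
  fixes A :: "real^'n^'n"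
  assumes sym: "transpose A = A"
  shows "\<exists>(f :: 'n \<Rightarrow> real^'n) d. (\<forall>i j. f i \<bullet> f j = (if i = j then 1 else 0)) \<and> (\<forall>i. A *v f i = d i *\<^sub>R f i)"
proof -
  define P where "P S \<longleftrightarrow> pairwise orthogonal S \<and> (\<forall>s\<in>S. norm s = 1 \<and> (\<exists>r. A *v s = r *\<^sub>R s))" for S
  have ind: "independent S" if "P S" for S
    using that by (intro pairwise_orthogonal_independent) (auto simp: P_def)
  then have bnd: "finite S" "card S \<le> CARD('n)" if "P S" for S
    using that independent_bound[of S] by auto
  have "P {}" by (simp add: P_def)
  then have "\<exists>k. (\<exists>S. P S \<and> card S = k) \<and> (\<forall>k'. (\<exists>S. P S \<and> card S = k') \<longrightarrow> k' \<le> k)"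
    using bnd by (intro Nat.ex_has_greatest_nat[of "\<lambda>k. \<exists>S. P S \<and> card S = k" 0 "CARD('n)"]) auto
  then obtain S where S: "P S" "\<And>S'. P S' \<Longrightarrow> card S' \<le> card S" by blast
  define W where "W = {w. \<forall>s\<in>S. orthogonal w s}"
  have W: "subspace W"
    unfolding W_def by (auto simp: subspace_def orthogonal_def inner_add_left)
  have inv: "A *v w \<in> W" if "w \<in> W" for w
    unfolding W_def
  proof (intro CollectI ballI)
    fix s assume s: "s \<in> S"
    then obtain r where "A *v s = r *\<^sub>R s" using S by (auto simp: P_def)
    moreover have "w \<bullet> s = 0" using that s by (simp add: W_def orthogonal_def)
    ultimately show "orthogonal (A *v w) s"
      using quadratic_symmetric[OF sym, of s w] by (simp add: orthogonal_def inner_commute)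
  qed
  have "W = {0}"
  proof (rule ccontr)
    assume "W \<noteq> {0}"
    then obtain x0 where "x0 \<in> W" "x0 \<noteq> 0" using subspace_0[OF W] by blast
    from rayleigh_eigenvector[OF sym W inv this] obtain w r where
      w: "w \<in> W" "norm w = 1" "A *v w = r *\<^sub>R w" by blast
    have "P (insert w S)"
      using S w unfolding P_def by (auto simp: pairwise_insert W_def orthogonal_commute)
    moreover have "w \<notin> S"
    proof
      assume "w \<in> S"
      then have "w \<bullet> w = 0" using w by (simp add: W_def orthogonal_def)
      then show False using w by simp
    qed
    ultimately show False using S(2)[of "insert w S"] bnd[OF S(1)] by simp
  qed
  have "span S = UNIV"
  proof (rule ccontr)
    assume "span S \<noteq> UNIV"
    then obtain a where "a \<noteq> 0" "\<And>x. x \<in> span S \<Longrightarrow> orthogonal a x"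
      using orthogonal_to_subspace_exists_gen[of S UNIV] by (auto simp: psubset_eq span_UNIV)
    then have "a \<in> W" by (auto simp: W_def intro: span_base)
    then show False using \<open>W = {0}\<close> \<open>a \<noteq> 0\<close> by simp
  qed
  then have "card S = CARD('n)"
    using dim_eq_card[of S UNIV] ind[OF S(1)] by (simp add: dim_UNIV)
  then obtain f :: "'n \<Rightarrow> real^'n" where f: "bij_betw f UNIV S"
    using finite_same_card_bij[of "UNIV :: 'n set" S] bnd[OF S(1)] by auto
  have fS: "f i \<in> S" for i using f by (auto simp: bij_betw_def)
  have "f i \<bullet> f j = (if i = j then 1 else 0)" for i j
  proof (cases "i = j")
    case True
    then show ?thesis using fS[of j] S by (simp add: P_def dot_square_norm)
  next
    case False
    then have "f i \<noteq> f j" using f by (auto simp: bij_betw_def inj_on_def)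
    then have "orthogonal (f i) (f j)" using fS[of i] fS[of j] S by (auto simp: P_def pairwise_def)
    then show ?thesis using False by (simp add: orthogonal_def)
  qed
  moreover have "\<exists>r. A *v f i = r *\<^sub>R f i" for i using fS S by (auto simp: P_def)
  then obtain d where "\<And>i. A *v f i = d i *\<^sub>R f i" by metis
  ultimately show ?thesis by blast
qed

text \<open>Uniqueness of Haar measure via Tonelli: a translation-invariant measure giving the unit ball
  the same mass as Lebesgue measure integrates like Lebesgue measure.\<close>

lemma lborel_orthogonal_invariant:
  fixes T :: "'a::euclidean_space \<Rightarrow> 'a"
  assumes T: "orthogonal_transformation T" and [measurable]: "f \<in> borel_measurable borel"
  shows "(\<integral>\<^sup>+x. f (T x) \<partial>lborel) = (\<integral>\<^sup>+x. f x \<partial>(lborel :: 'a measure))"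
proof -
  have lin: "linear T" using T by (rule orthogonal_transformation_linear)
  have [measurable]: "T \<in> borel_measurable borel"
    by (intro borel_measurable_continuous_onI linear_continuous_on linear_conv_bounded_linear[THEN iffD1] lin)
  have surj: "\<exists>x. T x = y" for y using orthogonal_transformation_surj[OF T] by (metis surjD)
  have trans_l: "(\<integral>\<^sup>+x. g (c + x) \<partial>lborel) = (\<integral>\<^sup>+x. g x \<partial>lborel)"
    if [measurable]: "g \<in> borel_measurable borel" for g :: "'a \<Rightarrow> ennreal" and c
    using nn_integral_distr[of "(+) c" lborel borel g] by (simp add: lborel_distr_plus)
  have trans: "(\<integral>\<^sup>+x. g (c + T x) \<partial>lborel) = (\<integral>\<^sup>+x. g (T x) \<partial>lborel)"
    if [measurable]: "g \<in> borel_measurable borel" for g :: "'a \<Rightarrow> ennreal" and c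
  proof -
    obtain b where b: "T b = c" using surj by blast
    have "(\<integral>\<^sup>+x. g (c + T x) \<partial>lborel) = (\<integral>\<^sup>+x. g (T (b + x)) \<partial>lborel)"
      by (simp add: b linear_add[OF lin])
    also have "\<dots> = (\<integral>\<^sup>+x. g (T x) \<partial>lborel)" by (rule trans_l[of "\<lambda>x. g (T x)"]) measurable
    finally show ?thesis .
  qed
  let ?b = "indicator (ball (0::'a) 1) :: 'a \<Rightarrow> ennreal"
  have [measurable]: "ball (0::'a) 1 \<in> sets borel" by simp
  have [measurable]: "?b \<in> borel_measurable borel" by measurable
  have b_neg: "?b (- x) = ?b x" and b_T: "?b (T x) = ?b x" for x
    using orthogonal_transformation_norm[OF T, of x] by (auto simp: indicator_def)
  let ?v = "\<integral>\<^sup>+x. ?b x \<partial>lborel"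
  have v: "?v = ennreal (unit_ball_vol (DIM('a)))" by (simp add: emeasure_ball)
  have meas: "(\<lambda>(x, y). f (T y) * ?b (- T y + x)) \<in> borel_measurable (lborel \<Otimes>\<^sub>M lborel)"
    "(\<lambda>(y, x). f (x + T y) * ?b (T y)) \<in> borel_measurable (lborel \<Otimes>\<^sub>M lborel)"
    by measurable
  \<comment> \<open>The integral of f(T y) over all pairs with |x - T y| < 1 is evaluated in both
    orders. In between, the variable T y is translated by x. The unit ball is symmetric and
    T-invariant, and its volume is positive and finite, hence can be cancelled.\<close>
  have "(\<integral>\<^sup>+x. f (T x) \<partial>lborel) * ?v = (\<integral>\<^sup>+y. (\<integral>\<^sup>+x. f (T y) * ?b (- T y + x) \<partial>lborel) \<partial>lborel)"
  proof -
    have "(\<integral>\<^sup>+x. f (T y) * ?b (- T y + x) \<partial>lborel) = f (T y) * ?v" for y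
    proof -
      have "(\<integral>\<^sup>+x. f (T y) * ?b (- T y + x) \<partial>lborel) = f (T y) * (\<integral>\<^sup>+x. ?b (- T y + x) \<partial>lborel)"
        by (rule nn_integral_cmult) measurable
      also have "(\<integral>\<^sup>+x. ?b (- T y + x) \<partial>lborel) = ?v" by (rule trans_l) measurable
      finally show ?thesis .
    qed
    then have "(\<integral>\<^sup>+y. (\<integral>\<^sup>+x. f (T y) * ?b (- T y + x) \<partial>lborel) \<partial>lborel) = (\<integral>\<^sup>+y. f (T y) * ?v \<partial>lborel)"
      by presburger
    also have "\<dots> = (\<integral>\<^sup>+x. f (T x) \<partial>lborel) * ?v" by (rule nn_integral_multc) measurable
    finally show ?thesis ..
  qed
  also have "\<dots> = (\<integral>\<^sup>+x. (\<integral>\<^sup>+y. f (T y) * ?b (- T y + x) \<partial>lborel) \<partial>lborel)"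
    by (rule lborel_pair.Fubini'[OF meas(1)])
  also have "\<dots> = (\<integral>\<^sup>+x. (\<integral>\<^sup>+y. f (x + T y) * ?b (T y) \<partial>lborel) \<partial>lborel)"
  proof (rule nn_integral_cong)
    fix x
    have "(\<integral>\<^sup>+y. f (T y) * ?b (- T y + x) \<partial>lborel) = (\<integral>\<^sup>+y. f (x + T y) * ?b (- (x + T y) + x) \<partial>lborel)"
      by (rule trans[of "\<lambda>z. f z * ?b (- z + x)" x, symmetric]) measurable
    then show "(\<integral>\<^sup>+y. f (T y) * ?b (- T y + x) \<partial>lborel) = (\<integral>\<^sup>+y. f (x + T y) * ?b (T y) \<partial>lborel)"
      using b_neg[of "T _"] by simp
  qed
  also have "\<dots> = (\<integral>\<^sup>+y. (\<integral>\<^sup>+x. f (x + T y) * ?b (T y) \<partial>lborel) \<partial>lborel)"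
    by (rule lborel_pair.Fubini'[OF meas(2)])
  also have "\<dots> = (\<integral>\<^sup>+y. (\<integral>\<^sup>+x. f x \<partial>lborel) * ?b y \<partial>lborel)"
  proof -
    have "(\<integral>\<^sup>+x. f (x + T y) \<partial>lborel) = (\<integral>\<^sup>+x. f x \<partial>lborel)" for y
      using trans_l[of f "T y"] by (simp add: add.commute)
    then show ?thesis by (simp add: nn_integral_multc b_T)
  qed
  also have "\<dots> = (\<integral>\<^sup>+x. f x \<partial>lborel) * ?v" by (simp add: nn_integral_cmult)
  finally have "(\<integral>\<^sup>+x. f (T x) \<partial>lborel) * ?v = (\<integral>\<^sup>+x. f x \<partial>lborel) * ?v" .
  moreover have "?v \<noteq> 0" "?v \<noteq> \<top>"
    unfolding v using order_less_imp_not_eq2[OF unit_ball_vol_pos, of "real DIM('a)"] by (auto simp: ennreal_eq_0_iff not_le)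
  ultimately show ?thesis by (metis ennreal_mult_cancel_left mult.commute)
qed

section \<open>Gaussian integrals and the normal law in information form\<close>

lemma gaussian_integral_real:
  assumes "d > 0"
  shows "(\<integral>\<^sup>+x. ennreal (exp (- (d * x\<^sup>2 / 2))) \<partial>lborel) = ennreal (sqrt (2 * pi / d))"
proof -
  let ?s = "sqrt (1 / d)"
  have s: "?s > 0" "?s\<^sup>2 = 1 / d" using assms by auto
  have eq: "exp (- (d * x\<^sup>2 / 2)) = sqrt (2 * pi / d) * normal_density 0 ?s x" for x
    unfolding normal_density_def s(2) using assms by (simp add: field_simps)
  have "(\<integral>\<^sup>+x. ennreal (normal_density 0 ?s x) \<partial>lborel) = 1"
    using s(1) by (subst nn_integral_eq_integral) auto
  then show ?thesis using assms unfolding eq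
    by (subst ennreal_mult) (auto simp: nn_integral_cmult)
qed

text \<open>In an orthonormal eigenbasis the form is diagonal, so the integral factorises into
  one-dimensional ones, and the determinant is the product of the eigenvalues.\<close>

lemma gaussian_integral:
  fixes A :: "real^'n^'n"
  assumes sym: "transpose A = A" and pos: "\<And>x. x \<noteq> 0 \<Longrightarrow> 0 < x \<bullet> (A *v x)"
  shows "det A > 0" "(\<integral>\<^sup>+x. ennreal (exp (- (x \<bullet> (A *v x) / 2))) \<partial>lborel) = ennreal (sqrt ((2 * pi) ^ CARD('n) / det A))"
proof -
  obtain f :: "'n \<Rightarrow> real^'n" and d where f: "\<And>i j. f i \<bullet> f j = (if i = j then 1 else 0)" "\<And>i. A *v f i = d i *\<^sub>R f i"
    using orthonormal_eigenbasis[OF sym] by blast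
  have d: "d i > 0" for i
  proof -
    have "f i \<noteq> 0" using f(1)[of i i] by auto
    from pos[OF this] show ?thesis by (simp add: f)
  qed
  define U :: "real^'n^'n" where "U = (\<chi> i j. f j $ i)"
  have colU: "U *v y = (\<Sum>j\<in>UNIV. y $ j *\<^sub>R f j)" for y
    by (simp add: U_def vec_eq_iff matrix_vector_mult_def mult.commute)
  have UU: "transpose U ** U = mat 1"
    by (simp add: vec_eq_iff matrix_matrix_mult_def transpose_def U_def mat_def f(1)[unfolded inner_vec_def inner_real_def] )
  have orth: "orthogonal_transformation ((*v) U)"
    using UU by (simp add: orthogonal_transformation_matrix orthogonal_matrix)
  have quad: "(U *v y) \<bullet> (A *v (U *v y)) = (\<Sum>j\<in>UNIV. d j * (y $ j)\<^sup>2)" for y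
  proof -
    have "A *v (U *v y) = (\<Sum>j\<in>UNIV. (y $ j * d j) *\<^sub>R f j)"
      unfolding colU by (simp add: matrix_vector_mul_linear[THEN linear_sum] matrix_vector_mult_scaleR f(2))
    then have "(U *v y) \<bullet> (A *v (U *v y)) = (\<Sum>i\<in>UNIV. \<Sum>j\<in>UNIV. y $ i * (y $ j * d j) * (f i \<bullet> f j))"
      unfolding colU by (simp only: inner_sum_left) (simp add: inner_sum_right sum_distrib_left mult_ac)
    also have "\<dots> = (\<Sum>i\<in>UNIV. \<Sum>j\<in>UNIV. if i = j then d i * (y $ i)\<^sup>2 else 0)"
      by (intro sum.cong refl) (simp add: f(1) power2_eq_square mult_ac)
    also have "\<dots> = (\<Sum>j\<in>UNIV. d j * (y $ j)\<^sup>2)" by simp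
    finally show ?thesis .
  qed
  define Dm :: "real^'n^'n" where "Dm = transpose U ** A ** U"
  have Dm: "Dm $ i $ j = (if i = j then d i else 0)" for i j
  proof -
    have "Dm *v axis j 1 = transpose U *v (A *v (U *v axis j 1))"
      by (simp add: Dm_def matrix_vector_mul_assoc matrix_mul_assoc)
    also have "U *v axis j 1 = f j"
      by (simp add: matrix_vector_mult_basis column_def U_def vec_eq_iff)
    also have "transpose U *v (A *v f j) = d j *\<^sub>R (transpose U *v f j)"
      by (simp add: f(2) matrix_vector_mult_scaleR)
    finally have "(Dm *v axis j 1) $ i = d j * (\<Sum>k\<in>UNIV. f i $ k * f j $ k)"
      by (simp add: matrix_vector_mult_def transpose_def U_def)
    also have "(\<Sum>k\<in>UNIV. f i $ k * f j $ k) = f i \<bullet> f j" by (simp add: inner_vec_def)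
    finally show ?thesis by (simp add: matrix_vector_mult_basis column_def f(1))
  qed
  have "det Dm = (\<Prod>i\<in>UNIV. d i)" using Dm by (subst det_diagonal) auto
  moreover have "det U * det U = 1"
    using arg_cong[OF UU, of det] by (simp add: det_mul det_transpose)
  moreover have "det Dm = det A * (det U * det U)" by (simp add: Dm_def det_mul det_transpose)
  ultimately have detA: "det A = (\<Prod>i\<in>UNIV. d i)" by simp
  then show "det A > 0" using d by (simp add: prod_pos)
  \<comment> \<open>The eigenvalues re-indexed by the basis vectors, over which Lebesgue measure
    factorises.\<close>
  define dd where "dd b = (\<chi> i. d i) \<bullet> b" for b :: "real^'n"
  have dd: "dd (axis i 1) = d i" for i by (simp add: dd_def inner_axis)
  have Bas: "(Basis :: (real^'n) set) = (\<lambda>i. axis i 1) ` UNIV" by (auto simp: Basis_vec_def)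
  have inj: "inj (\<lambda>i::'n. axis i (1::real))" by (auto simp: inj_on_def axis_eq_axis)
  have [measurable]: "(\<lambda>x. ennreal (exp (- (x \<bullet> (A *v x) / 2)))) \<in> borel_measurable borel"
    by (intro measurable_compose[OF _ measurable_ennreal] borel_measurable_continuous_onI continuous_intros
        linear_continuous_on_compose[OF continuous_on_id]) simp
  have "(\<integral>\<^sup>+x. ennreal (exp (- (x \<bullet> (A *v x) / 2))) \<partial>lborel)
      = (\<integral>\<^sup>+y. ennreal (exp (- ((U *v y) \<bullet> (A *v (U *v y)) / 2))) \<partial>lborel)"
    by (rule lborel_orthogonal_invariant[OF orth, symmetric]) measurable
  also have "\<dots> = (\<integral>\<^sup>+y. (\<Prod>b\<in>Basis. ennreal (exp (- (dd b * (y \<bullet> b)\<^sup>2 / 2)))) \<partial>lborel)"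
  proof (rule nn_integral_cong)
    fix y :: "real^'n"
    have "exp (- ((\<Sum>j\<in>UNIV. d j * (y $ j)\<^sup>2) / 2)) = (\<Prod>j\<in>UNIV. exp (- (d j * (y $ j)\<^sup>2 / 2)))"
      by (simp add: exp_sum[symmetric] sum_negf sum_divide_distrib)
    then show "ennreal (exp (- ((U *v y) \<bullet> (A *v (U *v y)) / 2)))
        = (\<Prod>b\<in>Basis. ennreal (exp (- (dd b * (y \<bullet> b)\<^sup>2 / 2))))"
      unfolding quad by (simp add: Bas prod.reindex[OF inj] dd inner_axis prod_ennreal)
  qed
  also have "\<dots> = (\<Prod>b\<in>Basis. (\<integral>\<^sup>+x. ennreal (exp (- (dd b * x\<^sup>2 / 2))) \<partial>lborel))"
    by (rule nn_integral_lborel_prod) auto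
  also have "\<dots> = (\<Prod>i\<in>UNIV. ennreal (sqrt (2 * pi / d i)))"
    by (simp add: Bas prod.reindex[OF inj] dd gaussian_integral_real d)
  also have "\<dots> = ennreal (\<Prod>i\<in>UNIV. sqrt (2 * pi / d i))" by (simp add: prod_ennreal d less_imp_le)
  also have "(\<Prod>i\<in>UNIV. sqrt (2 * pi / d i)) = sqrt ((2 * pi) ^ CARD('n) / det A)"
  proof -
    have "(\<Prod>i\<in>I. sqrt (g i)) = sqrt (\<Prod>i\<in>I. g i)" for I :: "'n set" and g
      by (induction I rule: infinite_finite_induct) (auto simp: real_sqrt_mult)
    then show ?thesis by (simp add: prod_dividef detA)
  qed
  finally show "(\<integral>\<^sup>+x. ennreal (exp (- (x \<bullet> (A *v x) / 2))) \<partial>lborel) = ennreal (sqrt ((2 * pi) ^ CARD('n) / det A))" .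
qed

text \<open>Completing the square about A^(-1) G. The exponent on the right is the one produced by
  expanding a log-likelihood with gradient G and curvature A; total mass one determines c.\<close>

lemma mv_normal_canonical:
  fixes A :: "real^'n^'n" and G :: "real^'n"
  assumes sym: "transpose A = A" and pos: "\<And>x. x \<noteq> 0 \<Longrightarrow> 0 < x \<bullet> (A *v x)"
  shows "\<exists>c>0. mv_normal (matrix_inv A *v G) (matrix_inv A)
      = density lborel (\<lambda>x. ennreal (c * exp (x \<bullet> G - x \<bullet> (A *v x) / 2)))"
    "emeasure (mv_normal (matrix_inv A *v G) (matrix_inv A)) UNIV = 1"
proof -
  define \<mu> where "\<mu> = matrix_inv A *v G"
  have detA: "det A > 0" by (rule gaussian_integral(1)[OF sym pos])
  then have inv: "invertible A" by (simp add: invertible_det_nz)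
  have inv1: "A ** matrix_inv A = mat 1" "matrix_inv A ** A = mat 1"
    using someI_ex[OF inv[unfolded invertible_def], folded matrix_inv_def] by auto
  have inv2: "invertible (matrix_inv A)" unfolding invertible_def using inv1 by blast
  have "matrix_inv A ** matrix_inv (matrix_inv A) = mat 1"
    using someI_ex[OF inv2[unfolded invertible_def], folded matrix_inv_def] by auto
  then have invinv: "matrix_inv (matrix_inv A) = A"
    by (metis inv1(1) matrix_mul_assoc matrix_mul_lid matrix_mul_rid)
  have A\<mu>: "A *v \<mu> = G" by (simp add: \<mu>_def matrix_vector_mul_assoc inv1)
  have "det A * det (matrix_inv A) = 1" using arg_cong[OF inv1(1), of det] by (simp add: det_mul)
  then have detI: "det (matrix_inv A) = 1 / det A" using detA by (simp add: field_simps)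
  define k where "k = 1 / sqrt ((2 * pi) ^ CARD('n) * det (matrix_inv A))"
  have k: "k > 0" using detA by (simp add: detI k_def)
  have sq: "(x - \<mu>) \<bullet> (A *v (x - \<mu>)) = x \<bullet> (A *v x) - 2 * (x \<bullet> G) + \<mu> \<bullet> G" for x
    using quadratic_symmetric[OF sym, of \<mu> x]
    by (simp add: matrix_vector_mult_diff_distrib inner_diff_left inner_diff_right A\<mu>)
  have mv: "mv_normal \<mu> (matrix_inv A) = density lborel (\<lambda>x. ennreal (k * exp (- ((x - \<mu>) \<bullet> (A *v (x - \<mu>))) / 2)))"
    by (simp add: mv_normal_def invinv k_def)
  show "\<exists>c>0. mv_normal (matrix_inv A *v G) (matrix_inv A)
      = density lborel (\<lambda>x. ennreal (c * exp (x \<bullet> G - x \<bullet> (A *v x) / 2)))"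
  proof (intro exI[of _ "k * exp (- (\<mu> \<bullet> G) / 2)"] conjI)
    show "k * exp (- (\<mu> \<bullet> G) / 2) > 0" using k by simp
    have "exp (- ((x - \<mu>) \<bullet> (A *v (x - \<mu>))) / 2) = exp (- (\<mu> \<bullet> G) / 2) * exp (x \<bullet> G - x \<bullet> (A *v x) / 2)" for x
      unfolding sq exp_add[symmetric] by (rule arg_cong[where f=exp]) (simp add: field_simps)
    then show "mv_normal (matrix_inv A *v G) (matrix_inv A)
      = density lborel (\<lambda>x. ennreal (k * exp (- (\<mu> \<bullet> G) / 2) * exp (x \<bullet> G - x \<bullet> (A *v x) / 2)))"
      unfolding \<mu>_def[symmetric] mv by (simp only: mult.assoc)
  qed
  have q: "(\<lambda>x. exp (- (x \<bullet> (A *v x) / 2))) \<in> borel_measurable borel"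
    by (intro borel_measurable_continuous_onI continuous_intros
        linear_continuous_on_compose[OF continuous_on_id]) simp
  then have [measurable]: "(\<lambda>x. exp (- (x \<bullet> (A *v x) / 2))) \<in> borel_measurable lborel" by simp
  have [measurable]: "(\<lambda>x. exp (- ((x - \<mu>) \<bullet> (A *v (x - \<mu>)) / 2))) \<in> borel_measurable lborel"
    using measurable_compose[OF _ q, of "\<lambda>x. x - \<mu>" lborel] by simp
  have "emeasure (mv_normal \<mu> (matrix_inv A)) UNIV = (\<integral>\<^sup>+x. ennreal k * ennreal (exp (- ((x - \<mu>) \<bullet> (A *v (x - \<mu>)) / 2))) \<partial>lborel)"
    using k unfolding mv by (subst emeasure_density) (simp_all add: ennreal_mult)
  also have "\<dots> = ennreal k * (\<integral>\<^sup>+x. ennreal (exp (- ((x - \<mu>) \<bullet> (A *v (x - \<mu>)) / 2))) \<partial>lborel)"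
    by (rule nn_integral_cmult) measurable
  also have "(\<integral>\<^sup>+x. ennreal (exp (- ((x - \<mu>) \<bullet> (A *v (x - \<mu>)) / 2))) \<partial>lborel)
      = (\<integral>\<^sup>+x. ennreal (exp (- (x \<bullet> (A *v x) / 2))) \<partial>lborel)"
    using nn_integral_distr[of "(+) (- \<mu>)" lborel borel "\<lambda>x. ennreal (exp (- (x \<bullet> (A *v x) / 2)))"]
    by (simp add: lborel_distr_plus)
  also have "\<dots> = ennreal (sqrt ((2 * pi) ^ CARD('n) / det A))" by (rule gaussian_integral(2)[OF sym pos])
  also have "ennreal k * \<dots> = ennreal (k * sqrt ((2 * pi) ^ CARD('n) / det A))"
    using k detA by (subst ennreal_mult) auto
  also have "k * sqrt ((2 * pi) ^ CARD('n) / det A) = 1"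
    using detA by (simp add: detI k_def)
  finally show "emeasure (mv_normal (matrix_inv A *v G) (matrix_inv A)) UNIV = 1" by (simp add: \<mu>_def)
qed

section \<open>The quadratic form of the design\<close>

lemma design_matrix_transpose: "transpose (design_matrix X n) = design_matrix X n"
  by (simp add: design_matrix_def transpose_def vec_eq_iff sum_component mult.commute)

lemma design_matrix_quadratic:
  fixes X :: "nat \<Rightarrow> real^'n"
  shows "x \<bullet> (design_matrix X n *v x) = (\<Sum>i=1..n. (x \<bullet> X i)\<^sup>2) / real n"
proof -
  have "x \<bullet> ((\<chi> j k. v $ j * v $ k) *v x) = (x \<bullet> v)\<^sup>2" for v :: "real^'n"
    by (simp add: inner_vec_def matrix_vector_mult_def power2_eq_square sum_product sum_distrib_left mult_ac)
  moreover have "(\<Sum>i\<in>I. B i) *v x = (\<Sum>i\<in>I. B i *v x)" for I :: "nat set" and B :: "nat \<Rightarrow> real^'n^'n"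
    by (induction I rule: infinite_finite_induct) (auto simp: matrix_vector_mult_add_rdistrib)
  ultimately show ?thesis
    unfolding design_matrix_def scaleR_matrix_vector_assoc[symmetric]
    by (simp add: inner_sum_right divide_inverse mult.commute)
qed

section \<open>The regression model\<close>

lemma taylor_second_order:
  fixes f f' f'' :: "real \<Rightarrow> real"
  assumes "\<And>x. (f has_real_derivative f' x) (at x)" "\<And>x. (f' has_real_derivative f'' x) (at x)"
  obtains \<xi> where "\<bar>\<xi> - e\<bar> \<le> \<bar>t\<bar>" "f (e + t) = f e + t * f' e + t\<^sup>2 / 2 * f'' \<xi>"
proof (cases "t = 0")
  case True
  then show ?thesis using that[of e] by simp
next
  case False
  define diff where "diff = (\<lambda>m::nat. if m = 0 then f else if m = 1 then f' else f'')"
  have "\<exists>\<xi>. (if e + t < e then e + t < \<xi> \<and> \<xi> < e else e < \<xi> \<and> \<xi> < e + t) \<and>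
      f (e + t) = (\<Sum>m<2. (diff m e / fact m) * (e + t - e)^m) + (diff 2 \<xi> / fact 2) * (e + t - e)^2"
    using assms False
    by (intro Taylor[where a="e - \<bar>t\<bar>" and b="e + \<bar>t\<bar>"]) (auto simp: diff_def less_2_cases_iff)
  then obtain \<xi> where \<xi>: "if e + t < e then e + t < \<xi> \<and> \<xi> < e else e < \<xi> \<and> \<xi> < e + t"
    "f (e + t) = (\<Sum>m<2. (diff m e / fact m) * (e + t - e)^m) + (diff 2 \<xi> / fact 2) * (e + t - e)^2" by blast
  have "\<bar>\<xi> - e\<bar> \<le> \<bar>t\<bar>" using \<xi>(1) by (auto split: if_splits)
  moreover have "f (e + t) = f e + t * f' e + t\<^sup>2 / 2 * f'' \<xi>"
    using \<xi>(2) by (simp add: diff_def numeral_2_eq_2 algebra_simps)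
  ultimately show ?thesis by (rule that)
qed

text \<open>The matrix v v^T, viewed as a vector of a Euclidean space. Since the square of
  \<open>h \<bullet> X i\<close> is \<open>outer h \<bullet> outer (X i)\<close>, quadratic terms
  become linear in \<open>outer (X i)\<close> and fall under the bound for vector-valued
  sums.\<close>

definition outer :: "real^'n \<Rightarrow> real^'n^'n" where
  "outer v = (\<chi> j k. v $ j * v $ k)"

lemma inner_outer: "outer v \<bullet> outer w = (v \<bullet> w)\<^sup>2"
  by (simp add: outer_def inner_vec_def power2_eq_square sum_product mult_ac)

lemma norm_outer: "norm (outer v) = (norm v)\<^sup>2"
  by (simp add: norm_eq_sqrt_inner inner_outer)

section \<open>Score and Fisher information of the mixtures\<close>

context normal_mixture
begin

lemma md1_tendsto_0:
  assumes "\<eta> \<in> HH"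
  shows "(md 1 \<eta> \<longlongrightarrow> 0) at_infinity"
proof -
  obtain C where C: "C \<ge> 0" "\<forall>\<eta>\<in>HH. \<forall>y. \<bar>md 1 \<eta> y\<bar> \<le> C * (1 + \<bar>y\<bar>) ^ 1 * md 0 \<eta> y"
    using md_ratio by blast
  let ?w = "2 * s2\<^sup>2"
  define A where "A = C * Cup * (fact 2 * exp (1 + ?w / 2))"
  have w: "?w > 0" using s1_pos s12 by simp
  have "norm (md 1 \<eta> y) \<le> A / (1 + norm y)" for y
  proof -
    have "\<bar>md 1 \<eta> y\<bar> \<le> C * (1 + \<bar>y\<bar>) ^ 1 * md 0 \<eta> y" using C assms by blast
    also have "\<dots> \<le> C * (1 + \<bar>y\<bar>) ^ 1 * (Cup * exp (- (y\<^sup>2 / (4 * s2\<^sup>2))))"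
      using C by (intro mult_left_mono md0_upper[OF assms]) auto
    also have "\<dots> = C * Cup * ((1 + \<bar>y\<bar>) ^ 2 * exp (- (y\<^sup>2 / (2 * ?w)))) / (1 + \<bar>y\<bar>)"
      by (simp add: power2_eq_square)
    also have "\<dots> \<le> A / (1 + \<bar>y\<bar>)"
      unfolding A_def using C Cup_pos power_exp_bound[OF w, of y 2]
      by (intro divide_right_mono mult_left_mono) auto
    finally show ?thesis by simp
  qed
  moreover have "((\<lambda>y::real. A / (1 + norm y)) \<longlongrightarrow> 0) at_infinity"
  proof -
    have "filterlim (\<lambda>y::real. 1 + norm y) at_top at_infinity"
      by (intro filterlim_tendsto_add_at_top[OF tendsto_const] filterlim_norm_at_top)
    then show ?thesis by (intro tendsto_divide_0[OF tendsto_const] filterlim_at_top_imp_at_infinity)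
  qed
  ultimately show ?thesis by (intro Lim_null_comparison[of "md 1 \<eta>"]) auto
qed

text \<open>The fundamental theorem of calculus, with p_\<eta>' vanishing at both ends of the line
  by \<open>md1_tendsto_0\<close>; this yields the information identity.\<close>

lemma md2_integral:
  assumes "\<eta> \<in> HH"
  shows "integrable lborel (md 2 \<eta>)" "(\<integral>y. md 2 \<eta> y \<partial>lborel) = 0"
proof -
  obtain C where C: "C \<ge> 0" "\<forall>\<eta>\<in>HH. \<forall>y. \<bar>md 2 \<eta> y\<bar> \<le> C * (1 + \<bar>y\<bar>) ^ 2 * md 0 \<eta> y"
    using md_ratio by blast
  note [measurable] = md_measurable[OF assms]
  have "integrable lborel (\<lambda>y. (md 2 \<eta> y / md 0 \<eta> y) * md 0 \<eta> y)"
    by (rule md0_weighted_integrable[OF assms, where C=C and k=2])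
      (use C assms md0_pos[OF assms] in \<open>auto simp: divide_le_eq abs_of_pos\<close>)
  then show int: "integrable lborel (md 2 \<eta>)" using md0_neq_0[OF assms] by simp
  have l: "((md 1 \<eta> \<circ> real_of_ereal) \<longlongrightarrow> 0) (at_right (-\<infinity>))" "((md 1 \<eta> \<circ> real_of_ereal) \<longlongrightarrow> 0) (at_left \<infinity>)"
    unfolding ereal_tendsto_simps
    using md1_tendsto_0[OF assms] tendsto_mono[OF at_top_le_at_infinity] tendsto_mono[OF at_bot_le_at_infinity] by blast+
  have "(LBINT x=-\<infinity>..\<infinity>. md 2 \<eta> x) = 0 - 0"
  proof (rule interval_integral_FTC_integrable[OF _ _ _ _ l])
    show "(md 1 \<eta> has_vector_derivative md 2 \<eta> x) (at x)" for x
      using md_has_derivative[OF assms, of 1 x] by (simp add: numeral_2_eq_2 has_real_derivative_iff_has_vector_derivative)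
    show "isCont (md 2 \<eta>) x" for x
      using md_continuous[OF assms, of UNIV 2] by (simp add: continuous_on_eq_continuous_at)
    show "set_integrable lborel (einterval (-\<infinity>) \<infinity>) (md 2 \<eta>)"
      using int by (simp add: set_integrable_def einterval_def)
  qed simp
  then show "(\<integral>y. md 2 \<eta> y \<partial>lborel) = 0"
    by (simp add: interval_lebesgue_integral_def set_lebesgue_integral_def einterval_def)
qed

lemma info_integrable:
  assumes "\<eta> \<in> HH"
  shows "integrable lborel (\<lambda>y. (l1 \<eta> y)\<^sup>2 * md 0 \<eta> y)"
proof (rule md0_weighted_integrable[OF assms, where C="KC\<^sup>2" and k=2])
  note [measurable] = l_measurable[OF assms]
  show "(\<lambda>y. (l1 \<eta> y)\<^sup>2) \<in> borel_measurable borel" by measurable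
  show "\<bar>(l1 \<eta> y)\<^sup>2\<bar> \<le> KC\<^sup>2 * (1 + \<bar>y\<bar>)\<^sup>2" for y
    using power_mono[OF l1_bound[OF assms, of y], of 2] by (simp add: power_mult_distrib)
qed

lemma info_eq: "\<eta> \<in> HH \<Longrightarrow> info \<eta> \<eta> = (\<integral>y. (l1 \<eta> y)\<^sup>2 * md 0 \<eta> y \<partial>lborel)"
  by (simp add: info_def score_eq md_0 power2_eq_square)

text \<open>Beyond M every kernel of the mixture is strictly decreasing, so p_\<eta>' < 0 there and
  the score cannot vanish almost everywhere.\<close>

lemma info_pos:
  assumes \<eta>: "\<eta> \<in> HH"
  shows "info \<eta> \<eta> > 0"
proof -
  interpret N: prob_space \<eta> using \<eta> by (rule HH_prob)
  have neg: "md 1 \<eta> y < 0" if "y > M" for y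
  proof -
    have "(\<integral>x. nd 1 (snd x) (y - fst x) \<partial>\<eta>) < (\<integral>x. 0 \<partial>\<eta>)"
    proof (rule N.integral_less_AE_space)
      show "AE x in \<eta>. nd 1 (snd x) (y - fst x) < 0"
        using AE_rect[OF \<eta>]
      proof eventually_elim
        case (elim x)
        then have "snd x > 0" "fst x \<le> M" using s1_pos by (auto simp: rect_def)
        then show ?case using that normal_density_pos[of "snd x" 0 "y - fst x"]
          by (auto simp: nd.simps(2) One_nat_def intro!: mult_pos_pos divide_pos_pos)
      qed
      show "emeasure \<eta> (space \<eta>) \<noteq> 0" by (simp add: N.emeasure_space_1)
    qed (use nd_integrable[OF \<eta>] in auto)
    then show ?thesis by (simp add: md_def)
  qed
  have nn: "info \<eta> \<eta> \<ge> 0" unfolding info_eq[OF \<eta>]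
    by (intro Bochner_Integration.integral_nonneg mult_nonneg_nonneg) (auto simp: less_imp_le md0_pos[OF \<eta>])
  have "info \<eta> \<eta> \<noteq> 0"
  proof
    assume "info \<eta> \<eta> = 0"
    then have "AE y in lborel. (l1 \<eta> y)\<^sup>2 * md 0 \<eta> y = 0"
      unfolding info_eq[OF \<eta>]
      by (subst (asm) integral_nonneg_eq_0_iff_AE[OF info_integrable[OF \<eta>]])
        (auto intro!: mult_nonneg_nonneg simp: less_imp_le md0_pos[OF \<eta>])
    then have "AE y in lborel. y \<notin> {M<..M+1}"
    proof eventually_elim
      case (elim y)
      then have "l1 \<eta> y = 0" using md0_neq_0[OF \<eta>, of y] by simp
      then have "md 1 \<eta> y = 0" using md0_neq_0[OF \<eta>, of y] by (simp add: l1_def)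
      then show ?case using neg[of y] by auto
    qed
    then have "{M<..M+1} \<in> null_sets lborel" by (subst AE_iff_null_sets) auto
    then show False by (auto simp: null_sets_def)
  qed
  then show ?thesis using nn by simp
qed

text \<open>The information identity: \<open>l2\<close> is p''/p minus the squared score, and p''
  integrates to 0.\<close>

lemma l2_integral:
  assumes \<eta>: "\<eta> \<in> HH"
  shows "(\<integral>y. l2 \<eta> y * md 0 \<eta> y \<partial>lborel) = - info \<eta> \<eta>"
proof -
  have "(\<integral>y. l2 \<eta> y * md 0 \<eta> y \<partial>lborel) = (\<integral>y. md 2 \<eta> y - (l1 \<eta> y)\<^sup>2 * md 0 \<eta> y \<partial>lborel)"
    using md0_neq_0[OF \<eta>] by (intro Bochner_Integration.integral_cong) (auto simp: l2_def left_diff_distrib)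
  also have "\<dots> = - info \<eta> \<eta>"
    using md2_integral[OF \<eta>] info_integrable[OF \<eta>] by (simp add: info_eq[OF \<eta>])
  finally show ?thesis .
qed

lemma l1_odd:
  assumes \<eta>: "\<eta> \<in> HH"
  shows "l1 \<eta> (- y) = - l1 \<eta> y"
proof -
  have "(log_density \<eta> has_real_derivative l1 \<eta> (- y)) (at (- y))" by (rule l0_has_derivative[OF \<eta>])
  from DERIV_chain2[where f="log_density \<eta>" and g=uminus, OF this DERIV_minus[OF DERIV_ident]]
  have "((\<lambda>x. log_density \<eta> (- x)) has_real_derivative - l1 \<eta> (- y)) (at y)" by simp
  moreover have "(\<lambda>x. log_density \<eta> (- x)) = log_density \<eta>"
    by (simp add: log_density_def md_0[symmetric] md0_even[OF \<eta>] fun_eq_iff)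
  ultimately show ?thesis using DERIV_unique[OF _ l0_has_derivative[OF \<eta>, of y]] by fastforce
qed

text \<open>This is where symmetry removes the bias: the score of every symmetric \<open>\<eta>\<close> is centred
  under \<open>\<eta>0\<close>.\<close>

lemma l1_integral:
  assumes \<eta>: "\<eta> \<in> HH" and \<eta>0: "\<eta>0 \<in> HH"
  shows "(\<integral>y. l1 \<eta> y * md 0 \<eta>0 y \<partial>lborel) = 0"
proof -
  have "(\<integral>y. l1 \<eta> y * md 0 \<eta>0 y \<partial>lborel) = (\<integral>y. l1 \<eta> (- y) * md 0 \<eta>0 (- y) \<partial>lborel)"
    by (subst lborel_integral_real_affine[of "-1" _ 0]) auto
  also have "\<dots> = (\<integral>y. - (l1 \<eta> y * md 0 \<eta>0 y) \<partial>lborel)"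
    by (intro Bochner_Integration.integral_cong) (auto simp: l1_odd[OF \<eta>] md0_even[OF \<eta>0])
  also have "\<dots> = - (\<integral>y. l1 \<eta> y * md 0 \<eta>0 y \<partial>lborel)" by (rule Bochner_Integration.integral_minus)
  finally show ?thesis by linarith
qed

end

text \<open>The eigenvalue condition appears in quantitative form: c0 lies below the limit inferior,
  and N0 is an index from which the bound holds. In the log-likelihood u stands for \<beta> -
  \<beta>0, so that the residuals are \<open>err i \<omega> - u \<bullet> X i\<close>.\<close>

locale symmetric_regression = normal_mixture M s1 s2 + prob_space P
  for M s1 s2 :: real and P :: "'w measure" +
  fixes X :: "nat \<Rightarrow> real^'p" and err :: "nat \<Rightarrow> 'w \<Rightarrow> real" and \<eta>0 :: "(real \<times> real) measure"
    and L c0 :: real and N0 :: nat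
  assumes \<eta>0: "\<eta>0 \<in> mixing_set M s1 s2"
    and indep: "indep_vars (\<lambda>_. borel) err {1..}"
    and distr: "\<And>i. i \<ge> 1 \<Longrightarrow> distributed P lborel (err i) (\<lambda>y. ennreal (mix_density \<eta>0 y))"
    and L_pos: "L > 0" and X_bound: "\<And>i. i \<ge> 1 \<Longrightarrow> norm (X i) \<le> L"
    and c0_pos: "c0 > 0" and N0: "N0 \<ge> 1"
    and design: "\<And>n v. n \<ge> N0 \<Longrightarrow> c0 * (norm v)\<^sup>2 \<le> (\<Sum>i=1..n. (v \<bullet> X i)\<^sup>2) / real n"
begin

section \<open>Moments and centred sums of the errors\<close>

lemma err_measurable[measurable]: "i \<ge> 1 \<Longrightarrow> err i \<in> borel_measurable P"
  using indep by (auto simp: indep_vars_def)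

lemma err_expectation:
  assumes i: "i \<ge> 1" and g[measurable]: "g \<in> borel_measurable borel"
    and b: "\<And>y. \<bar>g y\<bar> \<le> C * (1 + \<bar>y\<bar>) ^ k"
  shows "integrable P (\<lambda>\<omega>. g (err i \<omega>))"
    "expectation (\<lambda>\<omega>. g (err i \<omega>)) = (\<integral>y. g y * md 0 \<eta>0 y \<partial>lborel)"
proof -
  have d: "distributed P lborel (err i) (\<lambda>y. ennreal (md 0 \<eta>0 y))"
    using distr[OF i] by (simp add: md_0)
  have int: "integrable lborel (\<lambda>y. g y * md 0 \<eta>0 y)"
    by (rule md0_weighted_integrable[OF \<eta>0 g b])
  show "integrable P (\<lambda>\<omega>. g (err i \<omega>))"
    using distributed_integrable[OF d, of g] int md0_pos[OF \<eta>0] by (simp add: less_imp_le mult.commute)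
  show "expectation (\<lambda>\<omega>. g (err i \<omega>)) = (\<integral>y. g y * md 0 \<eta>0 y \<partial>lborel)"
    using distributed_integral[OF d, of g] md0_pos[OF \<eta>0] by (simp add: less_imp_le mult.commute)
qed

definition mom10 :: real where
  "mom10 = (\<integral>y. (1 + \<bar>y\<bar>) ^ 10 * md 0 \<eta>0 y \<partial>lborel)"

lemma mom10_nonneg: "mom10 \<ge> 0"
  unfolding mom10_def
  by (intro Bochner_Integration.integral_nonneg mult_nonneg_nonneg) (auto simp: less_imp_le md0_pos[OF \<eta>0])

lemma shifted_moment:
  assumes i: "i \<ge> 1" and t: "\<bar>t\<bar> \<le> T"
  shows "integrable P (\<lambda>\<omega>. (1 + \<bar>err i \<omega> - t\<bar>) ^ 10)"
    "expectation (\<lambda>\<omega>. (1 + \<bar>err i \<omega> - t\<bar>) ^ 10) \<le> (1 + T) ^ 10 * mom10"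
proof -
  have b: "(1 + \<bar>y - t\<bar>) ^ 10 \<le> (1 + T) ^ 10 * (1 + \<bar>y\<bar>) ^ 10" for y
  proof -
    have "0 \<le> T * \<bar>y\<bar>" using t by (intro mult_nonneg_nonneg) auto
    moreover have "\<bar>y - t\<bar> \<le> \<bar>y\<bar> + T" using t abs_triangle_ineq4[of y t] by linarith
    ultimately have "1 + \<bar>y - t\<bar> \<le> (1 + T) * (1 + \<bar>y\<bar>)" by (simp add: algebra_simps)
    then show ?thesis unfolding power_mult_distrib[symmetric] by (intro power_mono) auto
  qed
  show int: "integrable P (\<lambda>\<omega>. (1 + \<bar>err i \<omega> - t\<bar>) ^ 10)"
    using err_expectation(1)[OF i, of "\<lambda>y. (1 + \<bar>y - t\<bar>) ^ 10" "(1 + T) ^ 10" 10] b by simp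
  have int2: "integrable P (\<lambda>\<omega>. (1 + T) ^ 10 * (1 + \<bar>err i \<omega>\<bar>) ^ 10)"
    using err_expectation(1)[OF i, of "\<lambda>y. (1 + \<bar>y\<bar>) ^ 10" 1 10] by simp
  have "expectation (\<lambda>\<omega>. (1 + \<bar>err i \<omega> - t\<bar>) ^ 10) \<le> expectation (\<lambda>\<omega>. (1 + T) ^ 10 * (1 + \<bar>err i \<omega>\<bar>) ^ 10)"
    by (intro integral_mono int int2 b)
  also have "\<dots> = (1 + T) ^ 10 * mom10"
    using err_expectation(2)[OF i, of "\<lambda>y. (1 + \<bar>y\<bar>) ^ 10" 1 10] by (simp add: mom10_def)
  finally show "expectation (\<lambda>\<omega>. (1 + \<bar>err i \<omega> - t\<bar>) ^ 10) \<le> (1 + T) ^ 10 * mom10" .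
qed

text \<open>For a fixed u the residuals are independent, with tenth moments bounded uniformly in i.
  The bound is uniform in g only; the local expansion uses u = 0, and the exterior a finite net of
  u.\<close>

lemma shifted_process_whp:
  fixes a :: "nat \<Rightarrow> 'c::euclidean_space"
  assumes \<xi>: "\<xi> > 0" and a: "\<And>i. i \<ge> 1 \<Longrightarrow> norm (a i) \<le> A" and u: "norm u \<le> R"
  shows "\<exists>K>0. \<forall>n\<ge>1. \<exists>E\<in>events. prob E \<ge> 1 - \<xi> \<and> (\<forall>\<omega>\<in>E. \<forall>g g' \<delta>.
      (\<forall>x. (g has_real_derivative g' x) (at x)) \<longrightarrow> continuous_on UNIV g' \<longrightarrow> (\<forall>s. \<bar>g' s\<bar> \<le> \<delta> * (1 + \<bar>s\<bar>) ^ 3) \<longrightarrow>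
      norm ((1 / sqrt (real n)) *\<^sub>R (\<Sum>i=1..n. (g (err i \<omega> - u \<bullet> X i) - expectation (\<lambda>\<omega>. g (err i \<omega> - u \<bullet> X i))) *\<^sub>R a i)) \<le> \<delta> * K)"
proof -
  let ?C = "(1 + R * L) ^ 10 * mom10"
  have R: "R \<ge> 0" using u norm_ge_zero order_trans by blast
  have C: "?C \<ge> 0" using mom10_nonneg R L_pos by simp
  have t: "\<bar>u \<bullet> X i\<bar> \<le> R * L" if "i \<ge> 1" for i
  proof -
    have "\<bar>u \<bullet> X i\<bar> \<le> norm u * norm (X i)" by (rule Cauchy_Schwarz_ineq2)
    also have "\<dots> \<le> R * L" using u X_bound[OF that] R by (intro mult_mono) auto
    finally show ?thesis .
  qed
  obtain K where K: "K > 0" and KK: "\<forall>n\<ge>1. \<forall>Z. \<forall>a::nat \<Rightarrow> 'c. indep_vars (\<lambda>_. borel) Z {1..n} \<longrightarrow>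
    (\<forall>i\<in>{1..n}. integrable P (\<lambda>\<omega>. (1 + \<bar>Z i \<omega>\<bar>) ^ 10) \<and> expectation (\<lambda>\<omega>. (1 + \<bar>Z i \<omega>\<bar>) ^ 10) \<le> ?C) \<longrightarrow>
    (\<forall>i\<in>{1..n}. norm (a i) \<le> A) \<longrightarrow>
    (\<exists>E\<in>events. prob E \<ge> 1 - \<xi> \<and> (\<forall>\<omega>\<in>E. \<forall>g g' \<delta>. (\<forall>x. (g has_real_derivative g' x) (at x)) \<longrightarrow>
      continuous_on UNIV g' \<longrightarrow> (\<forall>s. \<bar>g' s\<bar> \<le> \<delta> * (1 + \<bar>s\<bar>) ^ 3) \<longrightarrow>
      norm ((1 / sqrt (real n)) *\<^sub>R (\<Sum>i=1..n. (g (Z i \<omega>) - expectation (\<lambda>\<omega>. g (Z i \<omega>))) *\<^sub>R a i)) \<le> \<delta> * K))"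
    using empirical_process_whp[OF \<xi> C, where A=A and 'c='c] by (elim exE conjE) (rule that)
  show ?thesis
  proof (intro exI[of _ K] conjI K allI impI)
    fix n :: nat assume n: "n \<ge> 1"
    show "\<exists>E\<in>events. prob E \<ge> 1 - \<xi> \<and> (\<forall>\<omega>\<in>E. \<forall>g g' \<delta>.
      (\<forall>x. (g has_real_derivative g' x) (at x)) \<longrightarrow> continuous_on UNIV g' \<longrightarrow> (\<forall>s. \<bar>g' s\<bar> \<le> \<delta> * (1 + \<bar>s\<bar>) ^ 3) \<longrightarrow>
      norm ((1 / sqrt (real n)) *\<^sub>R (\<Sum>i=1..n. (g (err i \<omega> - u \<bullet> X i) - expectation (\<lambda>\<omega>. g (err i \<omega> - u \<bullet> X i))) *\<^sub>R a i)) \<le> \<delta> * K)"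
    proof (rule KK[THEN spec, THEN mp, OF n, THEN spec, of "\<lambda>i \<omega>. err i \<omega> - u \<bullet> X i", THEN spec, of a, THEN mp, THEN mp, THEN mp])
      show "indep_vars (\<lambda>_. borel) (\<lambda>i \<omega>. err i \<omega> - u \<bullet> X i) {1..n}"
        by (rule indep_vars_compose2[where X=err, OF indep_vars_subset[OF indep]]) auto
      show "\<forall>i\<in>{1..n}. integrable P (\<lambda>\<omega>. (1 + \<bar>err i \<omega> - u \<bullet> X i\<bar>) ^ 10) \<and>
          expectation (\<lambda>\<omega>. (1 + \<bar>err i \<omega> - u \<bullet> X i\<bar>) ^ 10) \<le> ?C"
        by (intro ballI conjI shifted_moment t) auto
    qed (use a in auto)
  qed
qed

text \<open>Pointwise errors are estimated below by small multiples of (1 + |err i|)^3; on this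
  event their sum is a small multiple of n.\<close>

lemma error_average_whp:
  assumes \<xi>: "\<xi> > 0"
  shows "\<exists>K>0. \<forall>n\<ge>1. \<exists>E\<in>events. prob E \<ge> 1 - \<xi> \<and> (\<forall>\<omega>\<in>E. (\<Sum>i=1..n. (1 + \<bar>err i \<omega>\<bar>) ^ 3) \<le> K * real n)"
proof -
  define K where "K = (mom10 + 1) / \<xi>"
  have K: "K > 0" using mom10_nonneg \<xi> by (simp add: K_def)
  show ?thesis
  proof (intro exI[of _ K] conjI K allI impI)
    fix n :: nat assume n: "n \<ge> 1"
    let ?T = "\<lambda>\<omega>. \<Sum>i=1..n. (1 + \<bar>err i \<omega>\<bar>) ^ 3"
    have i3: "integrable P (\<lambda>\<omega>. (1 + \<bar>err i \<omega>\<bar>) ^ 3)" if "i \<ge> 1" for i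
      using err_expectation(1)[OF that, of "\<lambda>y. (1 + \<bar>y\<bar>) ^ 3" 1 3] by simp
    have E3: "expectation (\<lambda>\<omega>. (1 + \<bar>err i \<omega>\<bar>) ^ 3) \<le> mom10" if "i \<ge> 1" for i
    proof -
      have "expectation (\<lambda>\<omega>. (1 + \<bar>err i \<omega>\<bar>) ^ 3) \<le> expectation (\<lambda>\<omega>. (1 + \<bar>err i \<omega> - 0\<bar>) ^ 10)"
        using shifted_moment(1)[OF that, of 0 0] by (intro integral_mono i3 that) (auto intro!: power_increasing)
      also have "\<dots> \<le> mom10" using shifted_moment(2)[OF that, of 0 0] by simp
      finally show ?thesis .
    qed
    have int: "integrable P ?T" by (intro Bochner_Integration.integrable_sum i3) auto
    have "expectation ?T = (\<Sum>i=1..n. expectation (\<lambda>\<omega>. (1 + \<bar>err i \<omega>\<bar>) ^ 3))"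
      by (intro Bochner_Integration.integral_sum i3) auto
    also have "\<dots> \<le> (\<Sum>i=1..n. mom10)" by (intro sum_mono E3) auto
    finally have ET: "expectation ?T \<le> real n * mom10" by simp
    have Kn: "K * real n > 0" using K n by simp
    have "prob {\<omega>\<in>space P. ?T \<omega> \<ge> K * real n} \<le> expectation ?T / (K * real n)"
      by (rule integral_Markov_inequality_measure[OF int _ _ Kn, of "{}"]) (auto intro!: AE_I2 sum_nonneg)
    also have "\<dots> \<le> (real n * mom10) / (K * real n)" using ET Kn by (intro divide_right_mono) auto
    also have "\<dots> = \<xi> * (mom10 / (mom10 + 1))" using n by (simp add: K_def)
    also have "\<dots> \<le> \<xi> * 1" using \<xi> mom10_nonneg by (intro mult_left_mono) auto
    also have "\<dots> = \<xi>" by simp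
    finally have pr: "prob {\<omega>\<in>space P. ?T \<omega> \<ge> K * real n} \<le> \<xi>" .
    have [measurable]: "?T \<in> borel_measurable P" using int by (rule borel_measurable_integrable)
    have ev: "{\<omega>\<in>space P. ?T \<omega> \<ge> K * real n} \<in> events" by measurable
    show "\<exists>E\<in>events. prob E \<ge> 1 - \<xi> \<and> (\<forall>\<omega>\<in>E. ?T \<omega> \<le> K * real n)"
    proof (intro bexI[of _ "space P - {\<omega>\<in>space P. ?T \<omega> \<ge> K * real n}"] conjI ballI)
      show "prob (space P - {\<omega>\<in>space P. ?T \<omega> \<ge> K * real n}) \<ge> 1 - \<xi>"
        using pr prob_compl[OF ev] by linarith
    qed (use ev in auto)
  qed
qed

end

section \<open>Likelihood expansions in probability\<close>

context symmetric_regression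
begin

text \<open>Expressed in the errors and the deviation u = \<beta> - \<beta>0, so that u = 0 is the
  true regression vector; \<open>likelihood_eq\<close> connects it with the data.\<close>

definition loglik :: "nat \<Rightarrow> 'w \<Rightarrow> real^'p \<Rightarrow> (real \<times> real) measure \<Rightarrow> real" where
  "loglik n \<omega> u \<eta> = (\<Sum>i=1..n. log_density \<eta> (err i \<omega> - u \<bullet> X i))"

text \<open>The normalised score at (\<beta>0, \<eta>0); the centring of the limit is the inverse
  information times this vector.\<close>

definition grad :: "nat \<Rightarrow> 'w \<Rightarrow> real^'p" where
  "grad n \<omega> = (1 / sqrt (real n)) *\<^sub>R (\<Sum>i=1..n. (- l1 \<eta>0 (err i \<omega>)) *\<^sub>R X i)"

text \<open>Large inner probability: the properties concerned quantify over uncountably many \<eta>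
  and u, so they are asserted on a measurable subset.\<close>

definition likely :: "real \<Rightarrow> ('w \<Rightarrow> bool) \<Rightarrow> bool" where
  "likely \<xi> A \<longleftrightarrow> (\<exists>E\<in>events. prob E \<ge> 1 - \<xi> \<and> (\<forall>\<omega>\<in>E. A \<omega>))"

section \<open>Combining statements of large probability\<close>

lemma likely_mono: "likely \<xi> A \<Longrightarrow> \<xi> \<le> \<xi>' \<Longrightarrow> (\<And>\<omega>. \<omega> \<in> space P \<Longrightarrow> A \<omega> \<Longrightarrow> B \<omega>) \<Longrightarrow> likely \<xi>' B"
  unfolding likely_def using sets.sets_into_space by (smt (verit, best) in_mono)

lemma likely_conj:
  assumes "likely \<xi>1 A" "likely \<xi>2 B"
  shows "likely (\<xi>1 + \<xi>2) (\<lambda>\<omega>. A \<omega> \<and> B \<omega>)"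
proof -
  obtain E F where E: "E \<in> events" "prob E \<ge> 1 - \<xi>1" "\<forall>\<omega>\<in>E. A \<omega>"
    and F: "F \<in> events" "prob F \<ge> 1 - \<xi>2" "\<forall>\<omega>\<in>F. B \<omega>"
    using assms by (auto simp: likely_def)
  have "prob E + prob F = prob (E \<union> F) + prob (E \<inter> F)"
    using finite_measure_Union' [of E "F - E"] finite_measure_Diff'[of F E] E F
    by (simp add: Int_commute Diff_disjoint measure_Un3 fmeasurable_eq_sets)
  then have "prob (E \<inter> F) \<ge> 1 - (\<xi>1 + \<xi>2)" using prob_le_1[of "E \<union> F"] E F by linarith
  then show ?thesis unfolding likely_def using E F by (intro bexI[of _ "E \<inter> F"]) auto
qed

lemma likely_finite:
  assumes "finite F" "F \<noteq> {}" "\<And>f. f \<in> F \<Longrightarrow> likely (\<xi> / card F) (A f)"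
  shows "likely \<xi> (\<lambda>\<omega>. \<forall>f\<in>F. A f \<omega>)"
proof -
  have "likely (card G * (\<xi> / card F)) (\<lambda>\<omega>. \<forall>f\<in>G. A f \<omega>)" if "finite G" "G \<subseteq> F" for G
    using that
  proof (induction G)
    case empty
    show ?case unfolding likely_def by (intro bexI[of _ "space P"]) (auto simp: prob_space)
  next
    case (insert x G)
    have "likely (\<xi> / card F + card G * (\<xi> / card F)) (\<lambda>\<omega>. A x \<omega> \<and> (\<forall>f\<in>G. A f \<omega>))"
      using insert assms(3) by (intro likely_conj) auto
    then show ?case using insert by (simp add: algebra_simps add_divide_distrib)
  qed
  from this[OF assms(1) order_refl] show ?thesis using assms by simp
qed

lemma process_likely:
  fixes a :: "nat \<Rightarrow> 'c::euclidean_space"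
  assumes "\<xi> > 0" "\<And>i. i \<ge> 1 \<Longrightarrow> norm (a i) \<le> A" "norm u \<le> R"
  shows "\<exists>K>0. \<forall>n\<ge>1. likely \<xi> (\<lambda>\<omega>. \<forall>g g' \<delta>.
      (\<forall>x. (g has_real_derivative g' x) (at x)) \<longrightarrow> continuous_on UNIV g' \<longrightarrow> (\<forall>s. \<bar>g' s\<bar> \<le> \<delta> * (1 + \<bar>s\<bar>) ^ 3) \<longrightarrow>
      norm ((1 / sqrt (real n)) *\<^sub>R (\<Sum>i=1..n. (g (err i \<omega> - u \<bullet> X i) - expectation (\<lambda>\<omega>. g (err i \<omega> - u \<bullet> X i))) *\<^sub>R a i)) \<le> \<delta> * K)"
  using shifted_process_whp[of \<xi> a A u R] assms unfolding likely_def by blast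

lemma process_likely_0:
  fixes a :: "nat \<Rightarrow> 'c::euclidean_space"
  assumes "\<xi> > 0" "\<And>i. i \<ge> 1 \<Longrightarrow> norm (a i) \<le> A"
  shows "\<exists>K>0. \<forall>n\<ge>1. likely \<xi> (\<lambda>\<omega>. \<forall>g g' \<delta>.
      (\<forall>x. (g has_real_derivative g' x) (at x)) \<longrightarrow> continuous_on UNIV g' \<longrightarrow> (\<forall>s. \<bar>g' s\<bar> \<le> \<delta> * (1 + \<bar>s\<bar>) ^ 3) \<longrightarrow>
      norm ((1 / sqrt (real n)) *\<^sub>R (\<Sum>i=1..n. (g (err i \<omega>) - expectation (\<lambda>\<omega>. g (err i \<omega>))) *\<^sub>R a i)) \<le> \<delta> * K)"
  using process_likely[of \<xi> a A 0 0] assms by simp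

lemma error_average_likely:
  "\<xi> > 0 \<Longrightarrow> \<exists>K>0. \<forall>n\<ge>1. likely \<xi> (\<lambda>\<omega>. (\<Sum>i=1..n. (1 + \<bar>err i \<omega>\<bar>) ^ 3) \<le> K * real n)"
  using error_average_whp unfolding likely_def by blast

lemma l1_expectation: "\<eta> \<in> HH \<Longrightarrow> i \<ge> 1 \<Longrightarrow> expectation (\<lambda>\<omega>. l1 \<eta> (err i \<omega>)) = 0"
  using err_expectation(2)[of i "l1 \<eta>" KC 1] l1_bound l_measurable(2) l1_integral[OF _ \<eta>0] by simp

lemma l2_expectation: "i \<ge> 1 \<Longrightarrow> expectation (\<lambda>\<omega>. l2 \<eta>0 (err i \<omega>)) = - info \<eta>0 \<eta>0"
  using err_expectation(2)[of i "l2 \<eta>0" KC 2] l2_bound[OF \<eta>0] l_measurable(3)[OF \<eta>0] l2_integral[OF \<eta>0] by simp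

text \<open>\<open>l1 \<eta>0\<close> is centred, so the bound for centred sums applies with g' =
  \<open>l2 \<eta>0\<close> and \<delta> = KC.\<close>

lemma grad_tight:
  assumes "\<xi> > 0"
  shows "\<exists>K>0. \<forall>n\<ge>1. likely \<xi> (\<lambda>\<omega>. norm (grad n \<omega>) \<le> K)"
proof -
  obtain K where K: "K > 0" "\<forall>n\<ge>1. likely \<xi> (\<lambda>\<omega>. \<forall>g g' \<delta>.
      (\<forall>x. (g has_real_derivative g' x) (at x)) \<longrightarrow> continuous_on UNIV g' \<longrightarrow> (\<forall>s. \<bar>g' s\<bar> \<le> \<delta> * (1 + \<bar>s\<bar>) ^ 3) \<longrightarrow>
      norm ((1 / sqrt (real n)) *\<^sub>R (\<Sum>i=1..n. (g (err i \<omega>) - expectation (\<lambda>\<omega>. g (err i \<omega>))) *\<^sub>R X i)) \<le> \<delta> * K)"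
    using process_likely_0[where a=X and A=L, OF assms X_bound] by blast
  show ?thesis
  proof (intro exI[of _ "KC * K"] conjI allI impI)
    show "KC * K > 0" using K KC_ge_1 by simp
    fix n :: nat assume n: "n \<ge> 1"
    show "likely \<xi> (\<lambda>\<omega>. norm (grad n \<omega>) \<le> KC * K)"
    proof (rule likely_mono[OF K(2)[rule_format, OF n] order_refl])
      fix \<omega> assume *: "\<forall>g g' \<delta>.
      (\<forall>x. (g has_real_derivative g' x) (at x)) \<longrightarrow> continuous_on UNIV g' \<longrightarrow> (\<forall>s. \<bar>g' s\<bar> \<le> \<delta> * (1 + \<bar>s\<bar>) ^ 3) \<longrightarrow>
      norm ((1 / sqrt (real n)) *\<^sub>R (\<Sum>i=1..n. (g (err i \<omega>) - expectation (\<lambda>\<omega>. g (err i \<omega>))) *\<^sub>R X i)) \<le> \<delta> * K"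
      have b: "\<bar>l2 \<eta>0 s\<bar> \<le> KC * (1 + \<bar>s\<bar>) ^ 3" for s
        by (rule order_trans[OF l2_bound[OF \<eta>0]]) (use KC_ge_1 in \<open>auto intro!: mult_left_mono power_increasing\<close>)
      have "norm ((1 / sqrt (real n)) *\<^sub>R (\<Sum>i=1..n. (l1 \<eta>0 (err i \<omega>) - expectation (\<lambda>\<omega>. l1 \<eta>0 (err i \<omega>))) *\<^sub>R X i)) \<le> KC * K"
        by (rule *[rule_format, where g'="l2 \<eta>0"]) (use l1_has_derivative[OF \<eta>0] l2_continuous[OF \<eta>0] b in auto)
      also have "(\<Sum>i=1..n. (l1 \<eta>0 (err i \<omega>) - expectation (\<lambda>\<omega>. l1 \<eta>0 (err i \<omega>))) *\<^sub>R X i) = (\<Sum>i=1..n. l1 \<eta>0 (err i \<omega>) *\<^sub>R X i)"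
        by (intro sum.cong) (auto simp: l1_expectation[OF \<eta>0])
      finally show "norm (grad n \<omega>) \<le> KC * K" by (simp add: grad_def sum_negf)
    qed
  qed
qed

text \<open>With h = \<open>sqrt n *\<^sub>R u\<close>, three errors arise: replacing the second
  derivative for \<eta> at an intermediate point by that for \<eta>0 at the error; replacing the
  gradient at \<eta> by \<open>grad\<close>, a centred sum of \<open>l1 \<eta> - l1 \<eta>0\<close>,
  whose derivative is at most \<delta> times the weight; and replacing \<open>l2 \<eta>0\<close> by
  its mean, of relative order n^(-1/2). None of them requires u to shrink with n.\<close>

lemma local_expansion:
  assumes \<gamma>: "\<gamma> > 0" and \<xi>: "\<xi> > 0"
  shows "\<exists>\<kappa>>0. \<exists>r>0. \<exists>N. \<forall>n\<ge>N. likely \<xi> (\<lambda>\<omega>. \<forall>\<eta>\<in>near \<kappa> \<eta>0. \<forall>u. norm u \<le> r \<longrightarrow>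
    \<bar>loglik n \<omega> u \<eta> - loglik n \<omega> 0 \<eta> - ((sqrt n *\<^sub>R u) \<bullet> grad n \<omega> - info \<eta>0 \<eta>0 * (\<Sum>i=1..n. ((sqrt n *\<^sub>R u) \<bullet> X i)\<^sup>2) / real n / 2)\<bar>
      \<le> \<gamma> * (norm (sqrt n *\<^sub>R u) + (norm (sqrt n *\<^sub>R u))\<^sup>2))"
proof -
  have \<xi>3: "\<xi> / 3 > 0" using \<xi> by simp
  let ?V = "info \<eta>0 \<eta>0"
  obtain K1 where K1: "K1 > 0" "\<forall>n\<ge>1. likely (\<xi> / 3) (\<lambda>\<omega>. \<forall>g g' \<delta>.
      (\<forall>x. (g has_real_derivative g' x) (at x)) \<longrightarrow> continuous_on UNIV g' \<longrightarrow> (\<forall>s. \<bar>g' s\<bar> \<le> \<delta> * (1 + \<bar>s\<bar>) ^ 3) \<longrightarrow>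
      norm ((1 / sqrt (real n)) *\<^sub>R (\<Sum>i=1..n. (g (err i \<omega>) - expectation (\<lambda>\<omega>. g (err i \<omega>))) *\<^sub>R X i)) \<le> \<delta> * K1)"
    using process_likely_0[where a=X and A=L, OF \<xi>3 X_bound] by blast
  have outer_bound: "norm (outer (X i)) \<le> L\<^sup>2" if "i \<ge> 1" for i
    unfolding norm_outer using X_bound[OF that] by (intro power_mono) auto
  obtain K2 where K2: "K2 > 0" "\<forall>n\<ge>1. likely (\<xi> / 3) (\<lambda>\<omega>. \<forall>g g' \<delta>.
      (\<forall>x. (g has_real_derivative g' x) (at x)) \<longrightarrow> continuous_on UNIV g' \<longrightarrow> (\<forall>s. \<bar>g' s\<bar> \<le> \<delta> * (1 + \<bar>s\<bar>) ^ 3) \<longrightarrow>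
      norm ((1 / sqrt (real n)) *\<^sub>R (\<Sum>i=1..n. (g (err i \<omega>) - expectation (\<lambda>\<omega>. g (err i \<omega>))) *\<^sub>R outer (X i))) \<le> \<delta> * K2)"
    using process_likely_0[where a="\<lambda>i. outer (X i)" and A="L\<^sup>2", OF \<xi>3 outer_bound] by blast
  obtain K3 where K3: "K3 > 0" "\<forall>n\<ge>1. likely (\<xi> / 3) (\<lambda>\<omega>. (\<Sum>i=1..n. (1 + \<bar>err i \<omega>\<bar>) ^ 3) \<le> K3 * real n)"
    using error_average_likely[OF \<xi>3] by blast
  \<comment> \<open>The first entry keeps the gradient error \<delta> K1 below \<gamma>, the second
    keeps the Taylor error 8 \<delta> L^2 K3 below \<gamma> / 2.\<close>
  define \<delta> where "\<delta> = min (\<gamma> / K1) (\<gamma> / (16 * L\<^sup>2 * K3))"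
  have \<delta>: "\<delta> > 0" "\<delta> * K1 \<le> \<gamma>" "4 * L\<^sup>2 * \<delta> * K3 \<le> \<gamma> / 4"
  proof -
    show "\<delta> > 0" using \<gamma> K1 K3 L_pos by (simp add: \<delta>_def)
    show "\<delta> * K1 \<le> \<gamma>" using K1 by (simp add: \<delta>_def min_def field_simps)
    have "\<delta> \<le> \<gamma> / (16 * L\<^sup>2 * K3)" by (simp add: \<delta>_def)
    then have "4 * L\<^sup>2 * \<delta> * K3 \<le> 4 * L\<^sup>2 * (\<gamma> / (16 * L\<^sup>2 * K3)) * K3"
      using K3 by (intro mult_right_mono mult_left_mono) auto
    also have "\<dots> = \<gamma> / 4" using K3 L_pos by (simp add: field_simps)
    finally show "4 * L\<^sup>2 * \<delta> * K3 \<le> \<gamma> / 4" .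
  qed
  obtain \<kappa> where \<kappa>: "\<kappa> > 0" "\<forall>\<eta>\<in>near \<kappa> \<eta>0. \<forall>y. \<bar>log_density \<eta> y - log_density \<eta>0 y\<bar> \<le> \<delta> * (1 + \<bar>y\<bar>) ^ 3
     \<and> \<bar>l2 \<eta> y - l2 \<eta>0 y\<bar> \<le> \<delta> * (1 + \<bar>y\<bar>) ^ 3"
    using near_log_density[OF \<eta>0 \<delta>(1)] by blast
  \<comment> \<open>r L <= 1 keeps all shifts at most 1, so the weight changes by a factor of at
    most 2^3; KC r L <= \<delta> bounds the variation of \<open>l2 \<eta>0\<close> over a
    shift.\<close>
  define r where "r = min (1 / L) (\<delta> / (KC * L))"
  have r: "r > 0" "r * L \<le> 1" "KC * (r * L) \<le> \<delta>"
  proof -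
    show "r > 0" using L_pos \<delta> KC_ge_1 by (simp add: r_def)
    show "r * L \<le> 1" using L_pos by (simp add: r_def min_def field_simps)
    have "r \<le> \<delta> / (KC * L)" by (simp add: r_def)
    then have "KC * (r * L) \<le> KC * ((\<delta> / (KC * L)) * L)" using KC_ge_1 L_pos by (intro mult_left_mono mult_right_mono) auto
    then show "KC * (r * L) \<le> \<delta>" using KC_ge_1 L_pos by simp
  qed
  obtain N where N: "\<And>n. n \<ge> N \<Longrightarrow> KC * K2 / \<gamma> \<le> sqrt (real n)"
  proof -
    obtain N :: nat where "(KC * K2 / \<gamma>)\<^sup>2 \<le> real N" using real_arch_simple by blast
    then have "KC * K2 / \<gamma> \<le> sqrt (real n)" if "n \<ge> N" for n
      using that by (intro real_le_rsqrt) linarith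
    then show ?thesis by (rule that)
  qed
  show ?thesis
  proof (rule exI[of _ \<kappa>], rule conjI[OF \<kappa>(1)], rule exI[of _ r], rule conjI[OF r(1)], rule exI[of _ "max N 1"],
      intro allI impI)
    fix n assume "n \<ge> max N 1"
    then have n: "n \<ge> 1" "n \<ge> N" by auto
    define sn where "sn = sqrt (real n)"
    have sn: "sn > 0" "sn * sn = real n" "KC * K2 / \<gamma> \<le> sn" using n N by (auto simp: sn_def)
    note lk = likely_conj[OF likely_conj[OF K1(2)[rule_format, OF n(1)] K2(2)[rule_format, OF n(1)]] K3(2)[rule_format, OF n(1)]]
    show "likely \<xi> (\<lambda>\<omega>. \<forall>\<eta>\<in>near \<kappa> \<eta>0. \<forall>u. norm u \<le> r \<longrightarrow>
    \<bar>loglik n \<omega> u \<eta> - loglik n \<omega> 0 \<eta> - ((sqrt n *\<^sub>R u) \<bullet> grad n \<omega> - ?V * (\<Sum>i=1..n. ((sqrt n *\<^sub>R u) \<bullet> X i)\<^sup>2) / real n / 2)\<bar>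
      \<le> \<gamma> * (norm (sqrt n *\<^sub>R u) + (norm (sqrt n *\<^sub>R u))\<^sup>2))"
    proof (rule likely_mono[OF lk], goal_cases)
      case (2 \<omega>)
      then have ep1: "\<And>g g' \<delta>.
      (\<And>x. (g has_real_derivative g' x) (at x)) \<Longrightarrow> continuous_on UNIV g' \<Longrightarrow> (\<And>s. \<bar>g' s\<bar> \<le> \<delta> * (1 + \<bar>s\<bar>) ^ 3) \<Longrightarrow>
      norm ((1 / sqrt (real n)) *\<^sub>R (\<Sum>i=1..n. (g (err i \<omega>) - expectation (\<lambda>\<omega>. g (err i \<omega>))) *\<^sub>R X i)) \<le> \<delta> * K1"
      and ep2: "\<And>g g' \<delta>.
      (\<And>x. (g has_real_derivative g' x) (at x)) \<Longrightarrow> continuous_on UNIV g' \<Longrightarrow> (\<And>s. \<bar>g' s\<bar> \<le> \<delta> * (1 + \<bar>s\<bar>) ^ 3) \<Longrightarrow>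
      norm ((1 / sqrt (real n)) *\<^sub>R (\<Sum>i=1..n. (g (err i \<omega>) - expectation (\<lambda>\<omega>. g (err i \<omega>))) *\<^sub>R outer (X i))) \<le> \<delta> * K2"
      and av: "(\<Sum>i=1..n. (1 + \<bar>err i \<omega>\<bar>) ^ 3) \<le> K3 * real n"
        by blast+
      show ?case
      proof (intro ballI allI impI)
        fix \<eta> and u :: "real^'p" assume nr: "\<eta> \<in> near \<kappa> \<eta>0" and u: "norm u \<le> r"
        then have \<eta>: "\<eta> \<in> HH" by (simp add: near_def)
        have d2: "\<bar>l2 \<eta> y - l2 \<eta>0 y\<bar> \<le> \<delta> * (1 + \<bar>y\<bar>) ^ 3" for y using \<kappa> nr by blast
        define h where "h = sqrt n *\<^sub>R u"
        have u_h: "u = (1 / sn) *\<^sub>R h" using sn by (simp add: h_def sn_def)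
        define t where "t i = u \<bullet> X i" for i
        define e where "e i = err i \<omega>" for i
        let ?I = "{1..n}"
        have t_r: "\<bar>t i\<bar> \<le> r * L" if "i \<in> ?I" for i
        proof -
          have "\<bar>t i\<bar> \<le> norm u * norm (X i)" unfolding t_def by (rule Cauchy_Schwarz_ineq2)
          also have "\<dots> \<le> r * L" using u X_bound[of i] that r by (intro mult_mono) auto
          finally show ?thesis .
        qed
        have t_sq: "(t i)\<^sup>2 \<le> (norm h)\<^sup>2 * L\<^sup>2 / real n" if "i \<in> ?I" for i
        proof -
          have "\<bar>h \<bullet> X i\<bar> \<le> norm h * L"
            using Cauchy_Schwarz_ineq2[of h "X i"] mult_left_mono[OF X_bound[of i], of "norm h"] that by fastforce
          then have "(h \<bullet> X i)\<^sup>2 \<le> (norm h * L)\<^sup>2" by (metis abs_ge_zero power2_abs power_mono)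
          moreover have "(t i)\<^sup>2 = (h \<bullet> X i)\<^sup>2 / real n"
            using sn by (simp add: t_def u_h power_divide) (simp add: power2_eq_square)
          ultimately show ?thesis using n by (simp add: divide_right_mono power_mult_distrib)
        qed
        \<comment> \<open>The linear coefficient is still that of \<eta>, while the quadratic one is
          already that of \<eta>0.\<close>
        define \<rho> where "\<rho> i = log_density \<eta> (e i - t i) - log_density \<eta> (e i) + t i * l1 \<eta> (e i) - (t i)\<^sup>2 / 2 * l2 \<eta>0 (e i)" for i
        have rho: "\<bar>\<rho> i\<bar> \<le> 8 * \<delta> * ((norm h)\<^sup>2 * L\<^sup>2 / real n) * (1 + \<bar>e i\<bar>) ^ 3" if i: "i \<in> ?I" for i
        proof -
          obtain \<zeta> where z: "\<bar>\<zeta> - e i\<bar> \<le> \<bar>- t i\<bar>"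
            "log_density \<eta> (e i + - t i) = log_density \<eta> (e i) + (- t i) * l1 \<eta> (e i) + (- t i)\<^sup>2 / 2 * l2 \<eta> \<zeta>"
            using taylor_second_order[OF l0_has_derivative[OF \<eta>] l1_has_derivative[OF \<eta>]] by metis
          have ti1: "\<bar>t i\<bar> \<le> 1" using t_r[OF i] r by linarith
          have cube: "(1 + \<bar>x\<bar>) ^ 3 \<le> 8 * (1 + \<bar>e i\<bar>) ^ 3" if "\<bar>x - e i\<bar> \<le> \<bar>t i\<bar>" for x
          proof -
            have "1 + \<bar>x\<bar> \<le> 2 * (1 + \<bar>e i\<bar>)"
            proof -
              have "\<bar>x\<bar> \<le> \<bar>e i\<bar> + \<bar>x - e i\<bar>"
                using abs_triangle_ineq[of "e i" "x - e i"] by simp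
              moreover have "0 \<le> \<bar>e i\<bar>" by simp
              ultimately show ?thesis using that ti1 by argo
            qed
            then have "(1 + \<bar>x\<bar>) ^ 3 \<le> (2 * (1 + \<bar>e i\<bar>)) ^ 3" by (intro power_mono) auto
            then show ?thesis unfolding power_mult_distrib by simp
          qed
          obtain \<zeta>' where z': "\<bar>\<zeta>' - e i\<bar> \<le> \<bar>\<zeta> - e i\<bar>" "l2 \<eta>0 (e i + (\<zeta> - e i)) - l2 \<eta>0 (e i) = (\<zeta> - e i) * l3 \<eta>0 \<zeta>'"
            using mvt_abs[OF l2_has_derivative[OF \<eta>0]] by blast
          have "\<bar>l2 \<eta>0 \<zeta> - l2 \<eta>0 (e i)\<bar> = \<bar>\<zeta> - e i\<bar> * \<bar>l3 \<eta>0 \<zeta>'\<bar>" using z'(2) by (simp add: abs_mult)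
          also have "\<dots> \<le> (r * L) * (KC * (8 * (1 + \<bar>e i\<bar>) ^ 3))"
          proof (rule mult_mono)
            show "\<bar>\<zeta> - e i\<bar> \<le> r * L" using z t_r[OF i] by linarith
            have "\<bar>l3 \<eta>0 \<zeta>'\<bar> \<le> KC * (1 + \<bar>\<zeta>'\<bar>) ^ 3" by (rule l3_bound[OF \<eta>0])
            also have "\<dots> \<le> KC * (8 * (1 + \<bar>e i\<bar>) ^ 3)" using z z' KC_ge_1 by (intro mult_left_mono cube) auto
            finally show "\<bar>l3 \<eta>0 \<zeta>'\<bar> \<le> KC * (8 * (1 + \<bar>e i\<bar>) ^ 3)" .
          qed (use r L_pos in auto)
          also have "\<dots> = (KC * (r * L)) * (8 * (1 + \<bar>e i\<bar>) ^ 3)" by simp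
          also have "\<dots> \<le> \<delta> * (8 * (1 + \<bar>e i\<bar>) ^ 3)" using r by (intro mult_right_mono) auto
          finally have A: "\<bar>l2 \<eta>0 \<zeta> - l2 \<eta>0 (e i)\<bar> \<le> \<delta> * (8 * (1 + \<bar>e i\<bar>) ^ 3)" .
          have "\<bar>l2 \<eta> \<zeta> - l2 \<eta>0 \<zeta>\<bar> \<le> \<delta> * (1 + \<bar>\<zeta>\<bar>) ^ 3" by (rule d2)
          also have "\<dots> \<le> \<delta> * (8 * (1 + \<bar>e i\<bar>) ^ 3)" using z \<delta> by (intro mult_left_mono cube) auto
          finally have B: "\<bar>l2 \<eta> \<zeta> - l2 \<eta>0 (e i)\<bar> \<le> 2 * (\<delta> * (8 * (1 + \<bar>e i\<bar>) ^ 3))" using A by linarith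
          have "\<rho> i = (t i)\<^sup>2 / 2 * (l2 \<eta> \<zeta> - l2 \<eta>0 (e i))" unfolding \<rho>_def using z(2) by (simp add: algebra_simps)
          also have "\<bar>\<dots>\<bar> = (t i)\<^sup>2 / 2 * \<bar>l2 \<eta> \<zeta> - l2 \<eta>0 (e i)\<bar>" by (simp add: abs_mult)
          also have "\<dots> \<le> (t i)\<^sup>2 / 2 * (2 * (\<delta> * (8 * (1 + \<bar>e i\<bar>) ^ 3)))" using B by (intro mult_left_mono) auto
          also have "\<dots> = 8 * \<delta> * (t i)\<^sup>2 * (1 + \<bar>e i\<bar>) ^ 3" by simp
          also have "\<dots> \<le> 8 * \<delta> * ((norm h)\<^sup>2 * L\<^sup>2 / real n) * (1 + \<bar>e i\<bar>) ^ 3"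
            using \<delta> t_sq[OF i] by (intro mult_right_mono mult_left_mono) auto
          finally show ?thesis .
        qed
        have R1: "\<bar>\<Sum>i\<in>?I. \<rho> i\<bar> \<le> \<gamma> / 2 * (norm h)\<^sup>2"
        proof -
          have "\<bar>\<Sum>i\<in>?I. \<rho> i\<bar> \<le> (\<Sum>i\<in>?I. \<bar>\<rho> i\<bar>)" by (rule sum_abs)
          also have "\<dots> \<le> (\<Sum>i\<in>?I. 8 * \<delta> * ((norm h)\<^sup>2 * L\<^sup>2 / real n) * (1 + \<bar>e i\<bar>) ^ 3)" by (intro sum_mono rho)
          also have "\<dots> = 8 * \<delta> * ((norm h)\<^sup>2 * L\<^sup>2 / real n) * (\<Sum>i\<in>?I. (1 + \<bar>e i\<bar>) ^ 3)" by (simp add: sum_distrib_left)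
          also have "\<dots> \<le> 8 * \<delta> * ((norm h)\<^sup>2 * L\<^sup>2 / real n) * (K3 * real n)"
            using av \<delta> by (intro mult_left_mono) (auto simp: e_def)
          also have "\<dots> = 2 * (4 * L\<^sup>2 * \<delta> * K3) * (norm h)\<^sup>2" using n by (simp add: field_simps)
          also have "\<dots> \<le> 2 * (\<gamma> / 4) * (norm h)\<^sup>2" using \<delta> by (intro mult_right_mono mult_left_mono) auto
          finally show ?thesis by simp
        qed
        \<comment> \<open>The gradient error. Both scores are centred under \<eta>0 because both
          mixtures are symmetric, so the expectations subtracted in \<open>ep1\<close>
          vanish.\<close>
        define Dg where "Dg = (1 / sn) *\<^sub>R (\<Sum>i\<in>?I. (l1 \<eta> (e i) - l1 \<eta>0 (e i)) *\<^sub>R X i)"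
        have Dg: "norm Dg \<le> \<gamma>"
        proof -
          have "norm ((1 / sqrt (real n)) *\<^sub>R (\<Sum>i=1..n. ((\<lambda>y. l1 \<eta> y - l1 \<eta>0 y) (err i \<omega>) - expectation (\<lambda>\<omega>. (\<lambda>y. l1 \<eta> y - l1 \<eta>0 y) (err i \<omega>))) *\<^sub>R X i)) \<le> \<delta> * K1"
          proof (rule ep1)
            show "((\<lambda>y. l1 \<eta> y - l1 \<eta>0 y) has_real_derivative l2 \<eta> x - l2 \<eta>0 x) (at x)" for x
              by (intro derivative_intros l1_has_derivative \<eta> \<eta>0)
            show "continuous_on UNIV (\<lambda>y. l2 \<eta> y - l2 \<eta>0 y)"
              by (intro continuous_intros l2_continuous \<eta> \<eta>0)
          qed (rule d2)
          also have "(\<Sum>i=1..n. ((\<lambda>y. l1 \<eta> y - l1 \<eta>0 y) (err i \<omega>) - expectation (\<lambda>\<omega>. (\<lambda>y. l1 \<eta> y - l1 \<eta>0 y) (err i \<omega>))) *\<^sub>R X i)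
              = (\<Sum>i\<in>?I. (l1 \<eta> (e i) - l1 \<eta>0 (e i)) *\<^sub>R X i)"
          proof (intro sum.cong refl)
            fix i assume "i \<in> ?I"
            then have i: "i \<ge> 1" by simp
            have "expectation (\<lambda>\<omega>. l1 \<eta> (err i \<omega>) - l1 \<eta>0 (err i \<omega>)) = 0"
              using err_expectation(1)[OF i l_measurable(2)[OF \<eta>], of KC 1] err_expectation(1)[OF i l_measurable(2)[OF \<eta>0], of KC 1]
                l1_bound[OF \<eta>] l1_bound[OF \<eta>0] l1_expectation[OF \<eta> i] l1_expectation[OF \<eta>0 i] by simp
            then show "((\<lambda>y. l1 \<eta> y - l1 \<eta>0 y) (err i \<omega>) - expectation (\<lambda>\<omega>. (\<lambda>y. l1 \<eta> y - l1 \<eta>0 y) (err i \<omega>))) *\<^sub>R X i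
              = (l1 \<eta> (e i) - l1 \<eta>0 (e i)) *\<^sub>R X i" by (simp add: e_def)
          qed
          finally show ?thesis using \<delta> by (simp add: Dg_def sn_def)
        qed
        \<comment> \<open>Fluctuation of the Hessian: \<open>l2 \<eta>0\<close> minus its mean - V.
          It is bounded on the event and enters with the factor 1 / (2 sn).\<close>
        define B where "B = (1 / sn) *\<^sub>R (\<Sum>i\<in>?I. (l2 \<eta>0 (e i) + ?V) *\<^sub>R outer (X i))"
        have B: "norm B \<le> KC * K2"
        proof -
          have "norm ((1 / sqrt (real n)) *\<^sub>R (\<Sum>i=1..n. (l2 \<eta>0 (err i \<omega>) - expectation (\<lambda>\<omega>. l2 \<eta>0 (err i \<omega>))) *\<^sub>R outer (X i))) \<le> KC * K2"
            by (rule ep2[OF l2_has_derivative[OF \<eta>0] l3_continuous[OF \<eta>0] l3_bound[OF \<eta>0]])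
          also have "(\<Sum>i=1..n. (l2 \<eta>0 (err i \<omega>) - expectation (\<lambda>\<omega>. l2 \<eta>0 (err i \<omega>))) *\<^sub>R outer (X i)) = (\<Sum>i\<in>?I. (l2 \<eta>0 (e i) + ?V) *\<^sub>R outer (X i))"
            by (intro sum.cong) (auto simp: l2_expectation e_def)
          finally show ?thesis by (simp add: B_def sn_def)
        qed
        have T1: "(\<Sum>i\<in>?I. - t i * l1 \<eta> (e i)) = h \<bullet> grad n \<omega> - h \<bullet> Dg"
        proof -
          have "h \<bullet> grad n \<omega> - h \<bullet> Dg = (\<Sum>i\<in>?I. (1 / sn) * (- l1 \<eta>0 (e i) * (h \<bullet> X i)) - (1 / sn) * ((l1 \<eta> (e i) - l1 \<eta>0 (e i)) * (h \<bullet> X i)))"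
            unfolding grad_def Dg_def sn_def[symmetric] e_def[symmetric]
            by (simp only: inner_scaleR_right inner_sum_right sum_distrib_left sum_subtractf)
          also have "\<dots> = (\<Sum>i\<in>?I. - t i * l1 \<eta> (e i))"
            by (intro sum.cong refl) (simp add: t_def u_h algebra_simps diff_divide_distrib)
          finally show ?thesis by simp
        qed
        have T2: "(\<Sum>i\<in>?I. (t i)\<^sup>2 / 2 * l2 \<eta>0 (e i)) = (1 / (2 * sn)) * (B \<bullet> outer h) - ?V * (\<Sum>i=1..n. (h \<bullet> X i)\<^sup>2) / real n / 2"
        proof -
          have "(1 / (2 * sn)) * (B \<bullet> outer h) = (\<Sum>i\<in>?I. (1 / (2 * sn)) * ((1 / sn) * ((l2 \<eta>0 (e i) + ?V) * (h \<bullet> X i)\<^sup>2)))"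
            unfolding B_def by (simp only: inner_scaleR_left inner_sum_left sum_distrib_left inner_outer inner_commute[of _ h])
          also have "\<dots> = (\<Sum>i\<in>?I. (h \<bullet> X i)\<^sup>2 / real n / 2 * l2 \<eta>0 (e i) + ?V * (h \<bullet> X i)\<^sup>2 / real n / 2)"
            using sn by (intro sum.cong refl) (simp add: sn(2)[symmetric] field_simps)
          also have "\<dots> = (\<Sum>i\<in>?I. (h \<bullet> X i)\<^sup>2 / real n / 2 * l2 \<eta>0 (e i)) + ?V * (\<Sum>i=1..n. (h \<bullet> X i)\<^sup>2) / real n / 2"
            by (simp add: sum.distrib sum_distrib_left sum_divide_distrib)
          also have "(\<Sum>i\<in>?I. (h \<bullet> X i)\<^sup>2 / real n / 2 * l2 \<eta>0 (e i)) = (\<Sum>i\<in>?I. (t i)\<^sup>2 / 2 * l2 \<eta>0 (e i))"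
            by (intro sum.cong refl) (simp add: t_def u_h sn(2)[symmetric] power2_eq_square)
          finally show ?thesis by simp
        qed
        have "loglik n \<omega> u \<eta> - loglik n \<omega> 0 \<eta> = (\<Sum>i\<in>?I. \<rho> i + - t i * l1 \<eta> (e i) + (t i)\<^sup>2 / 2 * l2 \<eta>0 (e i))"
          unfolding loglik_def sum_subtractf[symmetric]
          by (intro sum.cong refl) (simp add: \<rho>_def e_def t_def)
        also have "\<dots> = (\<Sum>i\<in>?I. \<rho> i) + (h \<bullet> grad n \<omega> - h \<bullet> Dg) + ((1 / (2 * sn)) * (B \<bullet> outer h) - ?V * (\<Sum>i=1..n. (h \<bullet> X i)\<^sup>2) / real n / 2)"
          unfolding sum.distrib T1 T2 ..
        finally have eq: "loglik n \<omega> u \<eta> - loglik n \<omega> 0 \<eta> - (h \<bullet> grad n \<omega> - ?V * (\<Sum>i=1..n. (h \<bullet> X i)\<^sup>2) / real n / 2)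
            = (\<Sum>i\<in>?I. \<rho> i) - h \<bullet> Dg + (1 / (2 * sn)) * (B \<bullet> outer h)" by simp
        have b1: "\<bar>h \<bullet> Dg\<bar> \<le> \<gamma> * norm h"
          using Cauchy_Schwarz_ineq2[of h Dg] mult_left_mono[OF Dg, of "norm h"] by (simp add: mult.commute)
        have b2: "\<bar>(1 / (2 * sn)) * (B \<bullet> outer h)\<bar> \<le> \<gamma> / 2 * (norm h)\<^sup>2"
        proof -
          have "\<bar>B \<bullet> outer h\<bar> \<le> norm B * (norm h)\<^sup>2" using Cauchy_Schwarz_ineq2[of B "outer h"] by (simp add: norm_outer)
          also have "\<dots> \<le> KC * K2 * (norm h)\<^sup>2" using B by (intro mult_right_mono) auto
          also have "\<dots> \<le> (sn * \<gamma>) * (norm h)\<^sup>2" using sn \<gamma> by (intro mult_right_mono) (auto simp: field_simps)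
          finally have "(1 / (2 * sn)) * \<bar>B \<bullet> outer h\<bar> \<le> (1 / (2 * sn)) * ((sn * \<gamma>) * (norm h)\<^sup>2)"
            using sn by (intro mult_left_mono) auto
          then show ?thesis using sn by (simp add: abs_mult)
        qed
        have "\<bar>loglik n \<omega> u \<eta> - loglik n \<omega> 0 \<eta> - (h \<bullet> grad n \<omega> - ?V * (\<Sum>i=1..n. (h \<bullet> X i)\<^sup>2) / real n / 2)\<bar>
            \<le> \<gamma> * (norm h + (norm h)\<^sup>2)"
          unfolding eq using R1 b1 b2 unfolding distrib_left by linarith
        then show "\<bar>loglik n \<omega> u \<eta> - loglik n \<omega> 0 \<eta> - ((sqrt n *\<^sub>R u) \<bullet> grad n \<omega> - ?V * (\<Sum>i=1..n. ((sqrt n *\<^sub>R u) \<bullet> X i)\<^sup>2) / real n / 2)\<bar>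
      \<le> \<gamma> * (norm (sqrt n *\<^sub>R u) + (norm (sqrt n *\<^sub>R u))\<^sup>2)" by (simp add: h_def)
      qed
    qed simp
  qed
qed

text \<open>Serves to bound the denominator of Bayes' rule from below: mixing distributions close to
  \<eta>0 lose at most a factor exp (- c n), for any prescribed rate c. The rate will be half the
  rate of decay in the exterior.\<close>

lemma lower_likely:
  assumes c: "c > 0" and \<xi>: "\<xi> > 0"
  shows "\<exists>\<kappa>>0. \<forall>n\<ge>1. likely \<xi> (\<lambda>\<omega>. \<forall>\<eta>\<in>near \<kappa> \<eta>0. loglik n \<omega> 0 \<eta> - loglik n \<omega> 0 \<eta>0 \<ge> - c * real n)"
proof -
  obtain K3 where K3: "K3 > 0" "\<forall>n\<ge>1. likely \<xi> (\<lambda>\<omega>. (\<Sum>i=1..n. (1 + \<bar>err i \<omega>\<bar>) ^ 3) \<le> K3 * real n)"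
    using error_average_likely[OF \<xi>] by blast
  have "c / K3 > 0" using c K3 by simp
  from near_log_density[OF \<eta>0 this] obtain \<kappa> where \<kappa>: "\<kappa> > 0"
    "\<And>\<eta> y. \<eta> \<in> near \<kappa> \<eta>0 \<Longrightarrow> \<bar>log_density \<eta> y - log_density \<eta>0 y\<bar> \<le> c / K3 * (1 + \<bar>y\<bar>) ^ 3" by blast
  show ?thesis
  proof (intro exI[of _ \<kappa>] conjI \<kappa>(1) allI impI)
    fix n :: nat assume n: "n \<ge> 1"
    show "likely \<xi> (\<lambda>\<omega>. \<forall>\<eta>\<in>near \<kappa> \<eta>0. loglik n \<omega> 0 \<eta> - loglik n \<omega> 0 \<eta>0 \<ge> - c * real n)"
    proof (rule likely_mono[OF K3(2)[rule_format, OF n] order_refl], intro ballI)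
      fix \<omega> \<eta> assume av: "(\<Sum>i=1..n. (1 + \<bar>err i \<omega>\<bar>) ^ 3) \<le> K3 * real n" and \<eta>: "\<eta> \<in> near \<kappa> \<eta>0"
      have "loglik n \<omega> 0 \<eta>0 - loglik n \<omega> 0 \<eta> = (\<Sum>i=1..n. log_density \<eta>0 (err i \<omega>) - log_density \<eta> (err i \<omega>))"
        by (simp add: loglik_def sum_subtractf)
      also have "\<dots> \<le> (\<Sum>i=1..n. c / K3 * (1 + \<bar>err i \<omega>\<bar>) ^ 3)"
      proof (rule sum_mono)
        fix i show "log_density \<eta>0 (err i \<omega>) - log_density \<eta> (err i \<omega>) \<le> c / K3 * (1 + \<bar>err i \<omega>\<bar>) ^ 3"
          using \<kappa>(2)[OF \<eta>, of "err i \<omega>"] by linarith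
      qed
      also have "\<dots> = c / K3 * (\<Sum>i=1..n. (1 + \<bar>err i \<omega>\<bar>) ^ 3)" by (simp add: sum_distrib_left)
      also have "\<dots> \<le> c / K3 * (K3 * real n)" using av c K3 by (intro mult_left_mono) auto
      also have "\<dots> = c * real n" using K3 by simp
      finally show "loglik n \<omega> 0 \<eta> - loglik n \<omega> 0 \<eta>0 \<ge> - c * real n" by simp
    qed
  qed
qed

end

section \<open>Decay of the likelihood away from the truth\<close>

context symmetric_regression
begin

lemma shift_bound: "i \<ge> 1 \<Longrightarrow> norm u \<le> R \<Longrightarrow> \<bar>u \<bullet> X i\<bar> \<le> R * L"
proof -
  assume i: "i \<ge> 1" and u: "norm u \<le> R"
  have "\<bar>u \<bullet> X i\<bar> \<le> norm u * norm (X i)" by (rule Cauchy_Schwarz_ineq2)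
  also have "\<dots> \<le> R * L"
    using u X_bound[OF i] order_trans[OF norm_ge_zero u] by (intro mult_mono) auto
  finally show ?thesis .
qed

lemma kl_expectation:
  assumes i: "i \<ge> 1" and \<eta>: "\<eta> \<in> HH"
  shows "expectation (\<lambda>\<omega>. log_density \<eta> (err i \<omega> - t)) - expectation (\<lambda>\<omega>. log_density \<eta>0 (err i \<omega>)) = kl \<eta>0 \<eta> t"
proof -
  note [measurable] = l_measurable[OF \<eta>]
  have "expectation (\<lambda>\<omega>. log_density \<eta> (err i \<omega> - t)) = (\<integral>y. log_density \<eta> (y - t) * md 0 \<eta>0 y \<partial>lborel)"
    by (rule err_expectation(2)[OF i _ l0_shift_bound[OF \<eta>]]) measurable
  moreover have "expectation (\<lambda>\<omega>. log_density \<eta>0 (err i \<omega>)) = (\<integral>y. log_density \<eta>0 y * md 0 \<eta>0 y \<partial>lborel)"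
    by (rule err_expectation(2)[OF i l_measurable(1)[OF \<eta>0] l0_bound[OF \<eta>0]])
  moreover have "kl \<eta>0 \<eta> t = (\<integral>y. log_density \<eta> (y - t) * md 0 \<eta>0 y - log_density \<eta>0 y * md 0 \<eta>0 y \<partial>lborel)"
    unfolding kl_def by (intro Bochner_Integration.integral_cong) (auto simp: algebra_simps)
  ultimately show ?thesis
    using l0_shift_integrable[OF \<eta>0 \<eta>, of t] l0_shift_integrable[OF \<eta>0 \<eta>0, of 0] by simp
qed

text \<open>If u is not small, \<open>kl_shift\<close> and the lower bound on the design form give a
  divergence of order n for any \<eta>. If u is small, \<eta> must be far from \<eta>0, and the
  shifts are too small to close the gap between the densities.\<close>

lemma kl_sum_bound:
  assumes \<kappa>: "\<kappa> > 0" and r: "r > 0" and R: "R \<ge> 0"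
  shows "\<exists>c>0. \<forall>n\<ge>N0. \<forall>\<eta>\<in>HH. \<forall>u. norm u \<le> R \<longrightarrow> (r \<le> norm u \<or> \<eta> \<notin> near \<kappa> \<eta>0) \<longrightarrow>
    (\<Sum>i=1..n. kl \<eta>0 \<eta> (u \<bullet> X i)) \<le> - c * real n"
proof -
  obtain c1 where c1: "c1 > 0" "\<forall>\<eta>0\<in>HH. \<forall>\<eta>\<in>HH. \<forall>t. \<bar>t\<bar> \<le> R * L \<longrightarrow> kl \<eta>0 \<eta> t \<le> - c1 * t\<^sup>2"
    using kl_shift[of "R * L"] R L_pos by auto
  have "\<kappa> / 2 > 0" using \<kappa> by simp
  then obtain c2 where c2: "c2 > 0"
    "\<forall>\<eta>0\<in>HH. \<forall>\<eta>\<in>HH. \<forall>t. (\<exists>y. \<kappa> / 2 \<le> \<bar>md 0 \<eta> (y - t) - md 0 \<eta>0 y\<bar>) \<longrightarrow> kl \<eta>0 \<eta> t \<le> - c2"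
    using kl_separated by blast
  obtain B where B: "B \<ge> 0" "\<forall>\<eta>\<in>HH. \<forall>y. \<bar>md (Suc 0) \<eta> y\<bar> \<le> B" using md_bounded by blast
  \<comment> \<open>A shift by at most r' L changes a density by at most \<kappa> / 2; r' <= r
    leaves only the second alternative when |u| < r'.\<close>
  define r' where "r' = min r (\<kappa> / (2 * (B + 1) * L))"
  have r': "r' > 0" "r' \<le> r" using r \<kappa> B L_pos by (auto simp: r'_def)
  have Br: "B * (r' * L) \<le> \<kappa> / 2"
  proof -
    have "B * (r' * L) \<le> (B + 1) * ((\<kappa> / (2 * (B + 1) * L)) * L)"
      using B L_pos r' by (intro mult_mono) (auto simp: r'_def)
    also have "\<dots> = \<kappa> / 2" using B L_pos by (simp add: divide_simps)
    finally show ?thesis .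
  qed
  define c where "c = min (c1 * c0 * r'\<^sup>2) c2"
  show ?thesis
  proof (intro exI[of _ c] conjI allI ballI impI)
    show "c > 0" using c1 c2 c0_pos r' by (simp add: c_def)
    fix n \<eta> and u :: "real^'p"
    assume n: "n \<ge> N0" and \<eta>: "\<eta> \<in> HH" and u: "norm u \<le> R" "r \<le> norm u \<or> \<eta> \<notin> near \<kappa> \<eta>0"
    then have n1: "real n > 0" using N0 by simp
    show "(\<Sum>i=1..n. kl \<eta>0 \<eta> (u \<bullet> X i)) \<le> - c * real n"
    proof (cases "r' \<le> norm u")
      case True
      have "(\<Sum>i=1..n. kl \<eta>0 \<eta> (u \<bullet> X i)) \<le> (\<Sum>i=1..n. - c1 * (u \<bullet> X i)\<^sup>2)"
        using c1 \<eta>0 \<eta> shift_bound[OF _ u(1)] by (intro sum_mono) auto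
      also have "\<dots> = - c1 * (\<Sum>i=1..n. (u \<bullet> X i)\<^sup>2)" by (simp add: sum_distrib_left)
      also have "\<dots> \<le> - c1 * (c0 * (norm u)\<^sup>2 * real n)"
        using design[OF n, of u] n1 c1 by (simp add: pos_le_divide_eq)
      also have "\<dots> \<le> - c1 * (c0 * r'\<^sup>2 * real n)"
        using True c1 c0_pos r' n1 by (auto intro!: mult_left_mono mult_right_mono power_mono)
      also have "\<dots> = - (c1 * c0 * r'\<^sup>2) * real n" by simp
      also have "\<dots> \<le> - c * real n" using n1 by (intro mult_right_mono) (auto simp: c_def)
      finally show ?thesis .
    next
      case False
      then have "\<eta> \<notin> near \<kappa> \<eta>0" using u r' by auto
      then obtain y where y: "\<kappa> < \<bar>md 0 \<eta> y - md 0 \<eta>0 y\<bar>" using \<eta> by (auto simp: near_def not_le)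
      have "kl \<eta>0 \<eta> (u \<bullet> X i) \<le> - c2" if "i \<in> {1..n}" for i
      proof -
        let ?t = "u \<bullet> X i"
        have t: "\<bar>?t\<bar> \<le> r' * L" using shift_bound[of i u r'] that False by auto
        have "\<bar>md 0 \<eta> (y - ?t) - md 0 \<eta> y\<bar> \<le> B * \<bar>(y - ?t) - y\<bar>"
          by (rule lipschitz_of_derivative[OF md_has_derivative[OF \<eta>]]) (use B \<eta> in auto)
        also have "\<dots> \<le> B * (r' * L)" using t B by (intro mult_left_mono) auto
        finally have "\<bar>md 0 \<eta> (y - ?t) - md 0 \<eta> y\<bar> \<le> \<kappa> / 2" using Br by linarith
        then have "\<kappa> / 2 \<le> \<bar>md 0 \<eta> (y - ?t) - md 0 \<eta>0 y\<bar>" using y by linarith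
        then show ?thesis using c2 \<eta> \<eta>0 by blast
      qed
      then have "(\<Sum>i=1..n. kl \<eta>0 \<eta> (u \<bullet> X i)) \<le> (\<Sum>i=1..n. - c2)" by (intro sum_mono)
      also have "\<dots> = - c2 * real n" by simp
      also have "\<dots> \<le> - c * real n" using n1 by (intro mult_right_mono) (auto simp: c_def)
      finally show ?thesis .
    qed
  qed
qed

text \<open>Far away the Gaussian tails of the mixtures beat the sample second moment.\<close>

lemma far_bound:
  assumes K: "K > 0"
  shows "\<exists>R>0. \<forall>n\<ge>N0. \<forall>\<omega>. (\<Sum>i=1..n. (1 + \<bar>err i \<omega>\<bar>) ^ 3) \<le> K * real n \<longrightarrow>
    (\<forall>\<eta>\<in>HH. \<forall>u. R \<le> norm u \<longrightarrow> loglik n \<omega> u \<eta> - loglik n \<omega> 0 \<eta>0 \<le> - real n)"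
proof -
  define a where "a = 1 / (4 * s2\<^sup>2)"
  have a: "a > 0" using s1_pos s12 by (simp add: a_def)
  \<comment> \<open>A collects the coefficients of n; its last summand 1 is the rate that survives.
    R is chosen so that a c0 R^2 / 2 >= A, with R >= 1 giving R <= R^2.\<close>
  define A where "A = \<bar>ln Cup\<bar> + (a + KC) * K + 1"
  have A: "A > 0" using a K KC_ge_1 by (simp add: A_def add_nonneg_pos)
  define R where "R = max 1 (2 * A / (a * c0))"
  have R: "R \<ge> 1" "2 * A \<le> a * c0 * R\<^sup>2"
  proof -
    show R1: "R \<ge> 1" by (simp add: R_def)
    have "2 * A = a * c0 * (2 * A / (a * c0))" using a c0_pos by simp
    also have "\<dots> \<le> a * c0 * R" using a c0_pos by (intro mult_left_mono) (auto simp: R_def)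
    also have "\<dots> \<le> a * c0 * R\<^sup>2"
      using R1 a c0_pos by (intro mult_left_mono) (auto simp: power2_eq_square)
    finally show "2 * A \<le> a * c0 * R\<^sup>2" .
  qed
  show ?thesis
  proof (intro exI[of _ R] conjI allI impI ballI)
    show "R > 0" using R by simp
    fix n \<omega> \<eta> and u :: "real^'p"
    assume n: "n \<ge> N0" and av: "(\<Sum>i=1..n. (1 + \<bar>err i \<omega>\<bar>) ^ 3) \<le> K * real n" and \<eta>: "\<eta> \<in> HH" and u: "R \<le> norm u"
    then have n1: "real n > 0" using N0 by simp
    have pt: "log_density \<eta> (err i \<omega> - u \<bullet> X i) - log_density \<eta>0 (err i \<omega>)
        \<le> \<bar>ln Cup\<bar> - a / 2 * (u \<bullet> X i)\<^sup>2 + (a + KC) * (1 + \<bar>err i \<omega>\<bar>) ^ 3" for i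
    proof -
      let ?e = "err i \<omega>" and ?t = "u \<bullet> X i"
      have "ln (md 0 \<eta> (?e - ?t)) \<le> ln (Cup * exp (- ((?e - ?t)\<^sup>2 / (4 * s2\<^sup>2))))"
        using md0_pos[OF \<eta>] md0_upper[OF \<eta>] Cup_pos by (subst ln_le_cancel_iff) auto
      also have "\<dots> = ln Cup - a * (?e - ?t)\<^sup>2" using Cup_pos by (simp add: ln_mult a_def)
      also have "\<dots> \<le> ln Cup - a * (?t\<^sup>2 / 2 - ?e\<^sup>2)"
      proof -
        have "0 \<le> (2 * ?e - ?t)\<^sup>2" by simp
        then have "?t\<^sup>2 / 2 - ?e\<^sup>2 \<le> (?e - ?t)\<^sup>2" by (simp add: power2_eq_square algebra_simps)
        then show ?thesis using a by simp
      qed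
      finally have 1: "log_density \<eta> (?e - ?t) \<le> \<bar>ln Cup\<bar> - a / 2 * ?t\<^sup>2 + a * ?e\<^sup>2"
        by (simp add: log_density_def md_0[symmetric] algebra_simps)
      have v: "(1 + \<bar>?e\<bar>)\<^sup>2 \<le> (1 + \<bar>?e\<bar>) ^ 3" by (intro power_increasing) auto
      have "?e\<^sup>2 \<le> (1 + \<bar>?e\<bar>)\<^sup>2" by (simp add: power2_sum)
      then have 2: "a * ?e\<^sup>2 \<le> a * (1 + \<bar>?e\<bar>) ^ 3" using v a by (intro mult_left_mono) auto
      have "- log_density \<eta>0 ?e \<le> KC * (1 + \<bar>?e\<bar>)\<^sup>2" using l0_bound[OF \<eta>0, of ?e] by linarith
      also have "\<dots> \<le> KC * (1 + \<bar>?e\<bar>) ^ 3" using v KC_ge_1 by (intro mult_left_mono) auto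
      finally show ?thesis using 1 2 by (simp add: distrib_right)
    qed
    have "loglik n \<omega> u \<eta> - loglik n \<omega> 0 \<eta>0 = (\<Sum>i=1..n. log_density \<eta> (err i \<omega> - u \<bullet> X i) - log_density \<eta>0 (err i \<omega>))"
      by (simp add: loglik_def sum_subtractf)
    also have "\<dots> \<le> (\<Sum>i=1..n. \<bar>ln Cup\<bar> - a / 2 * (u \<bullet> X i)\<^sup>2 + (a + KC) * (1 + \<bar>err i \<omega>\<bar>) ^ 3)"
      by (intro sum_mono pt)
    also have "\<dots> = \<bar>ln Cup\<bar> * real n - a / 2 * (\<Sum>i=1..n. (u \<bullet> X i)\<^sup>2) + (a + KC) * (\<Sum>i=1..n. (1 + \<bar>err i \<omega>\<bar>) ^ 3)"
      by (simp add: sum.distrib sum_subtractf sum_distrib_left)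
    also have "\<dots> \<le> \<bar>ln Cup\<bar> * real n - A * real n + (a + KC) * (K * real n)"
    proof (intro add_mono diff_mono order_refl mult_left_mono av)
      have "2 * A * real n \<le> a * c0 * R\<^sup>2 * real n" using R n1 by (intro mult_right_mono) auto
      also have "\<dots> = a * (c0 * R\<^sup>2 * real n)" by simp
      also have "\<dots> \<le> a * (c0 * (norm u)\<^sup>2 * real n)"
        using a c0_pos n1 R u by (intro mult_left_mono mult_right_mono power_mono) auto
      also have "\<dots> \<le> a * (\<Sum>i=1..n. (u \<bullet> X i)\<^sup>2)"
        using design[OF n, of u] n1 a by (intro mult_left_mono) (auto simp: pos_le_divide_eq)
      finally show "A * real n \<le> a / 2 * (\<Sum>i=1..n. (u \<bullet> X i)\<^sup>2)" by simp
      show "0 \<le> a + KC" using a KC_ge_1 by simp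
    qed
    also have "\<dots> = - real n" by (simp add: A_def algebra_simps)
    finally show "loglik n \<omega> u \<eta> - loglik n \<omega> 0 \<eta>0 \<le> - real n" .
  qed
qed

text \<open>On the event \<open>av\<close> the Lipschitz constant in u is of order n and the same
  for all \<eta>, which carries a bound from the points of a net to the whole ball.\<close>

lemma loglik_lipschitz:
  assumes \<eta>: "\<eta> \<in> HH" and f: "norm f \<le> R" and uf: "norm (u - f) \<le> \<tau>" and \<tau>: "\<tau> \<le> 1" and K: "K \<ge> 0"
    and av: "(\<Sum>i=1..n. (1 + \<bar>err i \<omega>\<bar>) ^ 3) \<le> K * real n"
  shows "loglik n \<omega> u \<eta> - loglik n \<omega> f \<eta> \<le> \<tau> * (L * KC * (1 + (R + 1) * L) * K) * real n"
proof -
  let ?T = "(R + 1) * L"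
  have R0: "R \<ge> 0" using f norm_ge_zero[of f] by linarith
  then have T0: "?T \<ge> 0" using L_pos by simp
  have \<tau>0: "\<tau> \<ge> 0" using uf norm_ge_zero[of "u - f"] by linarith
  have pt: "log_density \<eta> (err i \<omega> - u \<bullet> X i) - log_density \<eta> (err i \<omega> - f \<bullet> X i)
      \<le> \<tau> * (L * KC * (1 + ?T)) * (1 + \<bar>err i \<omega>\<bar>) ^ 3" if i: "i \<in> {1..n}" for i
  proof -
    let ?e = "err i \<omega>"
    define y where "y = ?e - f \<bullet> X i"
    define h where "h = (f - u) \<bullet> X i"
    have yh: "?e - u \<bullet> X i = y + h" by (simp add: y_def h_def inner_diff_left)
    have h: "\<bar>h\<bar> \<le> \<tau> * L" unfolding h_def
      using shift_bound[of i "f - u" \<tau>] i uf by (simp add: norm_minus_commute)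
    obtain \<zeta> where z: "\<bar>\<zeta> - y\<bar> \<le> \<bar>h\<bar>" "log_density \<eta> (y + h) - log_density \<eta> y = h * l1 \<eta> \<zeta>"
      using mvt_abs[OF l0_has_derivative[OF \<eta>]] by blast
    have "\<tau> * L \<le> 1 * L" using \<tau> L_pos by (intro mult_right_mono) auto
    moreover have "\<bar>f \<bullet> X i\<bar> \<le> R * L" using shift_bound[of i f R] i f by simp
    moreover have "\<bar>\<zeta>\<bar> \<le> \<bar>\<zeta> - y\<bar> + \<bar>?e\<bar> + \<bar>f \<bullet> X i\<bar>"
      using abs_triangle_ineq[of "\<zeta> - y" y] abs_triangle_ineq4[of ?e "f \<bullet> X i"] by (simp add: y_def)
    ultimately have "\<bar>\<zeta>\<bar> \<le> \<bar>?e\<bar> + ?T" using z h by (simp add: algebra_simps)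
    moreover have "0 \<le> ?T * \<bar>?e\<bar>" by (rule mult_nonneg_nonneg[OF T0 abs_ge_zero])
    ultimately have "1 + \<bar>\<zeta>\<bar> \<le> (1 + ?T) * (1 + \<bar>?e\<bar>)" by (simp add: distrib_left distrib_right)
    also have "\<dots> \<le> (1 + ?T) * (1 + \<bar>?e\<bar>) ^ 3" using T0 by (intro mult_left_mono self_le_power) auto
    finally have z1: "1 + \<bar>\<zeta>\<bar> \<le> (1 + ?T) * (1 + \<bar>?e\<bar>) ^ 3" .
    have "h * l1 \<eta> \<zeta> \<le> \<bar>h\<bar> * \<bar>l1 \<eta> \<zeta>\<bar>" by (metis abs_ge_self abs_mult)
    also have "\<dots> \<le> (\<tau> * L) * (KC * ((1 + ?T) * (1 + \<bar>?e\<bar>) ^ 3))"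
    proof (intro mult_mono h)
      have "\<bar>l1 \<eta> \<zeta>\<bar> \<le> KC * (1 + \<bar>\<zeta>\<bar>)" by (rule l1_bound[OF \<eta>])
      also have "\<dots> \<le> KC * ((1 + ?T) * (1 + \<bar>?e\<bar>) ^ 3)" using z1 KC_ge_1 by (intro mult_left_mono) auto
      finally show "\<bar>l1 \<eta> \<zeta>\<bar> \<le> KC * ((1 + ?T) * (1 + \<bar>?e\<bar>) ^ 3)" .
    qed (use \<tau>0 L_pos in auto)
    finally show ?thesis using z(2) yh unfolding y_def[symmetric] by (simp add: mult_ac)
  qed
  have "loglik n \<omega> u \<eta> - loglik n \<omega> f \<eta> = (\<Sum>i=1..n. log_density \<eta> (err i \<omega> - u \<bullet> X i) - log_density \<eta> (err i \<omega> - f \<bullet> X i))"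
    by (simp add: loglik_def sum_subtractf)
  also have "\<dots> \<le> (\<Sum>i=1..n. \<tau> * (L * KC * (1 + ?T)) * (1 + \<bar>err i \<omega>\<bar>) ^ 3)" by (intro sum_mono pt)
  also have "\<dots> = \<tau> * (L * KC * (1 + ?T)) * (\<Sum>i=1..n. (1 + \<bar>err i \<omega>\<bar>) ^ 3)" by (simp add: sum_distrib_left)
  also have "\<dots> \<le> \<tau> * (L * KC * (1 + ?T)) * (K * real n)"
    using \<tau>0 L_pos KC_ge_1 R0 by (intro mult_left_mono av mult_nonneg_nonneg add_nonneg_nonneg) auto
  finally show ?thesis by (simp add: mult_ac)
qed

text \<open>The bound for centred sums with scalar weights a i = 1, g = log p_\<eta> and g' =
  \<open>l1 \<eta>\<close>; the finitely many f are joined by a union bound. An error of order sqrt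
  n is negligible against divergences of order n.\<close>

lemma uniform_lln:
  assumes \<xi>: "\<xi> > 0" and F: "finite F" "F \<noteq> {}"
  shows "\<exists>K>0. \<forall>n\<ge>1. likely \<xi> (\<lambda>\<omega>. \<forall>f\<in>F. \<forall>\<eta>\<in>HH.
    \<bar>loglik n \<omega> f \<eta> - (\<Sum>i=1..n. expectation (\<lambda>\<omega>. log_density \<eta> (err i \<omega> - f \<bullet> X i)))\<bar> \<le> K * sqrt (real n))"
proof -
  have \<xi>F: "\<xi> / card F > 0" using \<xi> F by (simp add: card_gt_0_iff)
  let ?P = "\<lambda>f K n \<omega>. \<forall>g g' \<delta>.
      (\<forall>x. (g has_real_derivative g' x) (at x)) \<longrightarrow> continuous_on UNIV g' \<longrightarrow> (\<forall>s. \<bar>g' s\<bar> \<le> \<delta> * (1 + \<bar>s\<bar>) ^ 3) \<longrightarrow>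
      norm ((1 / sqrt (real n)) *\<^sub>R (\<Sum>i=1..n. (g (err i \<omega> - f \<bullet> X i) - expectation (\<lambda>\<omega>. g (err i \<omega> - f \<bullet> X i))) *\<^sub>R (1::real))) \<le> \<delta> * K"
  have ex: "\<exists>K>0. \<forall>n\<ge>1. likely (\<xi> / card F) (?P f K n)" for f
    by (rule process_likely[where R="norm f" and A=1, OF \<xi>F]) auto
  define Kf where "Kf f = (SOME K. K > 0 \<and> (\<forall>n\<ge>1. likely (\<xi> / card F) (?P f K n)))" for f
  have Kf': "Kf f > 0 \<and> (\<forall>n\<ge>1. likely (\<xi> / card F) (?P f (Kf f) n))" for f
    unfolding Kf_def by (rule someI_ex[OF ex])
  have Kf1: "Kf f > 0" for f by (rule Kf'[THEN conjunct1])
  have Kf2: "likely (\<xi> / card F) (?P f (Kf f) n)" if "n \<ge> 1" for f n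
    by (rule Kf'[THEN conjunct2, THEN spec, THEN mp, OF that])
  define K where "K = (\<Sum>f\<in>F. Kf f)"
  have KF: "Kf f \<le> K" if "f \<in> F" for f
    unfolding K_def using F Kf1 that by (intro member_le_sum) (auto simp: less_imp_le)
  have K: "K > 0" unfolding K_def using F Kf1 by (intro sum_pos) auto
  show ?thesis
  proof (intro exI[of _ "KC * K"] conjI allI impI)
    show "KC * K > 0" using K KC_ge_1 by simp
    fix n :: nat assume n: "n \<ge> 1"
    have "likely \<xi> (\<lambda>\<omega>. \<forall>f\<in>F. ?P f (Kf f) n \<omega>)"
      by (rule likely_finite[OF F Kf2[OF n]])
    then show "likely \<xi> (\<lambda>\<omega>. \<forall>f\<in>F. \<forall>\<eta>\<in>HH.
    \<bar>loglik n \<omega> f \<eta> - (\<Sum>i=1..n. expectation (\<lambda>\<omega>. log_density \<eta> (err i \<omega> - f \<bullet> X i)))\<bar> \<le> KC * K * sqrt (real n))"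
    proof (rule likely_mono[OF _ order_refl], intro ballI)
      fix \<omega> f \<eta> assume *: "\<forall>f\<in>F. ?P f (Kf f) n \<omega>" and f: "f \<in> F" and \<eta>: "\<eta> \<in> HH"
      let ?D = "loglik n \<omega> f \<eta> - (\<Sum>i=1..n. expectation (\<lambda>\<omega>. log_density \<eta> (err i \<omega> - f \<bullet> X i)))"
      have b: "\<bar>l1 \<eta> s\<bar> \<le> KC * (1 + \<bar>s\<bar>) ^ 3" for s
        by (rule order_trans[OF l1_bound[OF \<eta>]]) (use KC_ge_1 in \<open>auto intro!: mult_left_mono self_le_power\<close>)
      have P: "?P f (Kf f) n \<omega>" using * f by blast
      have "norm ((1 / sqrt (real n)) *\<^sub>R (\<Sum>i=1..n. (log_density \<eta> (err i \<omega> - f \<bullet> X i) - expectation (\<lambda>\<omega>. log_density \<eta> (err i \<omega> - f \<bullet> X i))) *\<^sub>R (1::real))) \<le> KC * Kf f"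
        by (rule P[THEN spec, of "log_density \<eta>", THEN spec, of "l1 \<eta>", THEN spec, of KC, THEN mp, THEN mp, THEN mp])
          (use l0_has_derivative[OF \<eta>] l1_continuous[OF \<eta>] b in auto)
      also have "\<dots> \<le> KC * K" using KF[OF f] KC_ge_1 by (intro mult_left_mono) auto
      finally have "\<bar>?D\<bar> / sqrt (real n) \<le> KC * K"
        by (simp add: loglik_def sum_subtractf abs_mult)
      then show "\<bar>?D\<bar> \<le> KC * K * sqrt (real n)" using n by (simp add: divide_le_eq)
    qed
  qed
qed

text \<open>Beyond a radius R \<open>far_bound\<close> applies. Inside, the divergence c3 n at a net
  point pays c3 n / 4 for the step from the net point to u and c3 n / 4 for the law of large
  numbers, used at (f, \<eta>) and at (0, \<eta>0); c3 n / 2 remains.\<close>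

lemma outside_likely:
  assumes \<kappa>: "\<kappa> > 0" and r: "r > 0" and \<xi>: "\<xi> > 0"
  shows "\<exists>c>0. \<exists>N. \<forall>n\<ge>N. likely \<xi> (\<lambda>\<omega>. \<forall>\<eta>\<in>HH. \<forall>u. (r \<le> norm u \<or> \<eta> \<notin> near \<kappa> \<eta>0) \<longrightarrow>
    loglik n \<omega> u \<eta> - loglik n \<omega> 0 \<eta>0 \<le> - c * real n)"
proof -
  have \<xi>2: "\<xi> / 2 > 0" using \<xi> by simp
  obtain K3 where K3: "K3 > 0" "\<forall>n\<ge>1. likely (\<xi> / 2) (\<lambda>\<omega>. (\<Sum>i=1..n. (1 + \<bar>err i \<omega>\<bar>) ^ 3) \<le> K3 * real n)"
    using error_average_likely[OF \<xi>2] by blast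
  obtain R where R: "R > 0" "\<forall>n\<ge>N0. \<forall>\<omega>. (\<Sum>i=1..n. (1 + \<bar>err i \<omega>\<bar>) ^ 3) \<le> K3 * real n \<longrightarrow>
    (\<forall>\<eta>\<in>HH. \<forall>u. R \<le> norm u \<longrightarrow> loglik n \<omega> u \<eta> - loglik n \<omega> 0 \<eta>0 \<le> - real n)"
    using far_bound[OF K3(1)] by blast
  have r2: "r / 2 > 0" using r by simp
  obtain c3 where c3: "c3 > 0" "\<forall>n\<ge>N0. \<forall>\<eta>\<in>HH. \<forall>u. norm u \<le> R \<longrightarrow> (r / 2 \<le> norm u \<or> \<eta> \<notin> near \<kappa> \<eta>0) \<longrightarrow>
    (\<Sum>i=1..n. kl \<eta>0 \<eta> (u \<bullet> X i)) \<le> - c3 * real n"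
    using kl_sum_bound[OF \<kappa> r2 less_imp_le[OF R(1)]] by blast
  define C4 where "C4 = L * KC * (1 + (R + 1) * L) * K3"
  have C4: "C4 > 0" unfolding C4_def using L_pos KC_ge_1 R K3 by (intro mult_pos_pos add_pos_nonneg) auto
  \<comment> \<open>A mesh of at most r / 2 keeps the net point of any u with |u| >= r at distance
    at least r / 2 from 0; the last entry pays for the Lipschitz step.\<close>
  define \<tau> where "\<tau> = min 1 (min (r / 2) (c3 / (4 * C4)))"
  have \<tau>: "\<tau> > 0" "\<tau> \<le> 1" "\<tau> \<le> r / 2" "\<tau> * C4 \<le> c3 / 4"
  proof -
    show "\<tau> > 0" "\<tau> \<le> 1" "\<tau> \<le> r / 2" using r c3 C4 by (auto simp: \<tau>_def)
    have "\<tau> * C4 \<le> (c3 / (4 * C4)) * C4" using C4 by (intro mult_right_mono) (auto simp: \<tau>_def)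
    then show "\<tau> * C4 \<le> c3 / 4" using C4 by simp
  qed
  obtain F' where F': "F' \<subseteq> cball (0::real^'p) R" "finite F'" "cball 0 R \<subseteq> (\<Union>f\<in>F'. ball f \<tau>)"
  proof (rule compactE_image[of "cball (0::real^'p) R" "cball 0 R" "\<lambda>f. ball f \<tau>"])
    show "cball (0::real^'p) R \<subseteq> (\<Union>f\<in>cball 0 R. ball f \<tau>)" using \<tau>(1) centre_in_ball by blast
  qed auto
  \<comment> \<open>The origin is added because the reference log-likelihood, at (0, \<eta>0), has
    to be compared with its mean as well.\<close>
  define F where "F = insert 0 F'"
  have F: "finite F" "F \<noteq> {}" "0 \<in> F" "\<And>f. f \<in> F \<Longrightarrow> norm f \<le> R"
    using F' R by (auto simp: F_def)
  obtain K where K: "K > 0" "\<forall>n\<ge>1. likely (\<xi> / 2) (\<lambda>\<omega>. \<forall>f\<in>F. \<forall>\<eta>\<in>HH.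
    \<bar>loglik n \<omega> f \<eta> - (\<Sum>i=1..n. expectation (\<lambda>\<omega>. log_density \<eta> (err i \<omega> - f \<bullet> X i)))\<bar> \<le> K * sqrt (real n))"
    using uniform_lln[OF \<xi>2 F(1,2)] by blast
  obtain N :: nat where N: "(8 * K / c3)\<^sup>2 \<le> real N" using real_arch_simple by blast
  \<comment> \<open>1 is the rate of \<open>far_bound\<close>, c3 / 2 the rate inside the
    ball.\<close>
  define c where "c = min 1 (c3 / 2)"
  show ?thesis
  proof (rule exI[of _ c], rule conjI, goal_cases)
    case 1 show ?case using c3 by (simp add: c_def)
  next
    case 2
    show ?case
    proof (rule exI[of _ "max N0 N"], intro allI impI)
      fix n assume "n \<ge> max N0 N"
      then have n: "n \<ge> N0" "n \<ge> N" "n \<ge> 1" using N0 by auto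
      then have rn: "real n > 0" by simp
      have sq: "2 * (K * sqrt (real n)) \<le> c3 / 4 * real n"
      proof -
        have "8 * K / c3 \<le> sqrt (real n)" using N n by (intro real_le_rsqrt) linarith
        then have "8 * K \<le> c3 * sqrt (real n)" using c3 by (simp add: divide_le_eq mult.commute)
        then have "8 * K * sqrt (real n) \<le> c3 * sqrt (real n) * sqrt (real n)" by (intro mult_right_mono) auto
        then show ?thesis by (simp add: mult.assoc)
      qed
      show "likely \<xi> (\<lambda>\<omega>. \<forall>\<eta>\<in>HH. \<forall>u. (r \<le> norm u \<or> \<eta> \<notin> near \<kappa> \<eta>0) \<longrightarrow>
        loglik n \<omega> u \<eta> - loglik n \<omega> 0 \<eta>0 \<le> - c * real n)"
      proof (rule likely_mono[OF likely_conj[OF K3(2)[rule_format, OF n(3)] K(2)[rule_format, OF n(3)]]])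
        show "\<xi> / 2 + \<xi> / 2 \<le> \<xi>" by simp
        fix \<omega> assume *: "(\<Sum>i=1..n. (1 + \<bar>err i \<omega>\<bar>) ^ 3) \<le> K3 * real n \<and> (\<forall>f\<in>F. \<forall>\<eta>\<in>HH.
          \<bar>loglik n \<omega> f \<eta> - (\<Sum>i=1..n. expectation (\<lambda>\<omega>. log_density \<eta> (err i \<omega> - f \<bullet> X i)))\<bar> \<le> K * sqrt (real n))"
        then have av: "(\<Sum>i=1..n. (1 + \<bar>err i \<omega>\<bar>) ^ 3) \<le> K3 * real n"
          and lln: "\<And>f \<eta>. f \<in> F \<Longrightarrow> \<eta> \<in> HH \<Longrightarrow>
          \<bar>loglik n \<omega> f \<eta> - (\<Sum>i=1..n. expectation (\<lambda>\<omega>. log_density \<eta> (err i \<omega> - f \<bullet> X i)))\<bar> \<le> K * sqrt (real n)"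
          by blast+
        show "\<forall>\<eta>\<in>HH. \<forall>u. (r \<le> norm u \<or> \<eta> \<notin> near \<kappa> \<eta>0) \<longrightarrow>
          loglik n \<omega> u \<eta> - loglik n \<omega> 0 \<eta>0 \<le> - c * real n"
        proof (intro ballI allI impI)
          fix \<eta> and u :: "real^'p" assume \<eta>: "\<eta> \<in> HH" and u: "r \<le> norm u \<or> \<eta> \<notin> near \<kappa> \<eta>0"
          show "loglik n \<omega> u \<eta> - loglik n \<omega> 0 \<eta>0 \<le> - c * real n"
          proof (cases "R \<le> norm u")
            case True
            then have "loglik n \<omega> u \<eta> - loglik n \<omega> 0 \<eta>0 \<le> - 1 * real n" using R(2) n(1) av \<eta> by auto
            also have "\<dots> \<le> - c * real n" using rn by (intro mult_right_mono) (auto simp: c_def)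
            finally show ?thesis .
          next
            case False
            then have "u \<in> cball 0 R" by simp
            then obtain f where f: "f \<in> F'" "dist f u < \<tau>" using F'(3) by auto
            then have fF: "f \<in> F" by (simp add: F_def)
            have uf: "norm (u - f) \<le> \<tau>" using f by (simp add: dist_norm norm_minus_commute)
            have "r / 2 \<le> norm f \<or> \<eta> \<notin> near \<kappa> \<eta>0"
            proof (cases "r \<le> norm u")
              case True
              have "norm u \<le> norm f + norm (u - f)" by (rule norm_triangle_sub)
              then show ?thesis using True uf \<tau>(3) by linarith
            qed (use u in blast)
            then have klf: "(\<Sum>i=1..n. kl \<eta>0 \<eta> (f \<bullet> X i)) \<le> - c3 * real n"
              using c3(2) n(1) \<eta> F(4)[OF fF] by blast
            have "loglik n \<omega> u \<eta> - loglik n \<omega> f \<eta> \<le> \<tau> * C4 * real n"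
              unfolding C4_def by (rule loglik_lipschitz[OF \<eta> F(4)[OF fF] uf \<tau>(2) _ av]) (use K3 in simp)
            also have "\<dots> \<le> c3 / 4 * real n" using \<tau> rn by (intro mult_right_mono) auto
            finally have 1: "loglik n \<omega> u \<eta> - loglik n \<omega> f \<eta> \<le> c3 / 4 * real n" .
            have 2: "(\<Sum>i=1..n. expectation (\<lambda>\<omega>. log_density \<eta> (err i \<omega> - f \<bullet> X i))) - (\<Sum>i=1..n. expectation (\<lambda>\<omega>. log_density \<eta>0 (err i \<omega> - 0 \<bullet> X i)))
                = (\<Sum>i=1..n. kl \<eta>0 \<eta> (f \<bullet> X i))"
              unfolding sum_subtractf[symmetric] using kl_expectation[OF _ \<eta>] by (intro sum.cong) auto
            have "loglik n \<omega> u \<eta> - loglik n \<omega> 0 \<eta>0 \<le> c3 / 4 * real n + - c3 * real n + 2 * (K * sqrt (real n))"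
              using 1 2 klf lln[OF fF \<eta>] lln[OF F(3) \<eta>0] by linarith
            also have "\<dots> \<le> - (c3 / 2) * real n" using sq by (simp add: algebra_simps)
            also have "\<dots> \<le> - c * real n" using rn by (intro mult_right_mono) (auto simp: c_def)
            finally show ?thesis .
          qed
        qed
      qed
    qed
  qed
qed

end

section \<open>Laplace approximation of the posterior\<close>

lemma nn_integral_lborel_rescale:
  fixes g :: "real^'p \<Rightarrow> ennreal"
  assumes [measurable]: "g \<in> borel_measurable borel" and s: "s > 0"
  shows "(\<integral>\<^sup>+\<beta>. g (s *\<^sub>R (\<beta> - \<beta>0)) \<partial>lborel) = ennreal (1 / s ^ CARD('p)) * (\<integral>\<^sup>+h. g h \<partial>lborel)"
proof -
  have c: "1 / s \<noteq> 0" using s by simp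
  have "(\<integral>\<^sup>+\<beta>. g (s *\<^sub>R (\<beta> - \<beta>0)) \<partial>lborel)
      = (\<integral>\<^sup>+x. ennreal (\<bar>1 / s\<bar> ^ DIM(real^'p)) * g (s *\<^sub>R ((\<beta>0 + (1 / s) *\<^sub>R x) - \<beta>0)) \<partial>lborel)"
    by (subst lborel_affine[OF c, of \<beta>0]) (simp add: nn_integral_density nn_integral_distr)
  also have "\<dots> = (\<integral>\<^sup>+x. ennreal (1 / s ^ CARD('p)) * g x \<partial>lborel)"
    using s by (simp add: power_divide)
  also have "\<dots> = ennreal (1 / s ^ CARD('p)) * (\<integral>\<^sup>+h. g h \<partial>lborel)"
    by (rule nn_integral_cmult) simp
  finally show ?thesis .
qed

text \<open>The density f describes the prior only inside U, and continuity on U makes it measurable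
  after a cutoff. Both measures are therefore cut down to W before they are compared.\<close>

lemma prior_density_integral:
  fixes PB :: "(real^'p) measure" and g :: "real^'p \<Rightarrow> ennreal"
  assumes sets: "sets PB = sets (restrict_space borel \<B>)" and U: "U \<subseteq> space PB"
    and f: "continuous_on U f"
    and dens: "\<And>A. A \<in> sets borel \<Longrightarrow> A \<subseteq> U \<Longrightarrow> emeasure PB A = (\<integral>\<^sup>+\<beta>. ennreal (f \<beta>) * indicator A \<beta> \<partial>lborel)"
    and W: "W \<in> sets borel" "W \<subseteq> U" and g[measurable]: "g \<in> borel_measurable borel"
  shows "(\<integral>\<^sup>+\<beta>. g \<beta> * indicator W \<beta> \<partial>PB) = (\<integral>\<^sup>+\<beta>. ennreal (f \<beta>) * g \<beta> * indicator W \<beta> \<partial>lborel)"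
proof -
  note [measurable] = W(1)
  have [measurable]: "(\<lambda>x. x) \<in> PB \<rightarrow>\<^sub>M borel"
    unfolding measurable_cong_sets[OF sets refl] by (rule measurable_restrict_space1) simp
  have fW: "(\<lambda>\<beta>. ennreal (f \<beta>) * indicator W \<beta>) \<in> borel_measurable borel"
  proof -
    have "(\<lambda>\<beta>. indicator W \<beta> *\<^sub>R f \<beta>) \<in> borel_measurable borel"
      by (rule borel_measurable_continuous_on_indicator[OF W(1) continuous_on_subset[OF f W(2)]])
    then have "(\<lambda>\<beta>. ennreal (indicator W \<beta> *\<^sub>R f \<beta>)) \<in> borel_measurable borel" by measurable
    also have "(\<lambda>\<beta>. ennreal (indicator W \<beta> *\<^sub>R f \<beta>)) = (\<lambda>\<beta>. ennreal (f \<beta>) * indicator W \<beta>)"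
      by (auto simp: indicator_def fun_eq_iff)
    finally show ?thesis .
  qed
  have "density (distr PB borel (\<lambda>x. x)) (indicator W) = density lborel (\<lambda>\<beta>. ennreal (f \<beta>) * indicator W \<beta>)"
  proof (rule measure_eqI)
    fix A assume "A \<in> sets (density (distr PB borel (\<lambda>x. x)) (indicator W))"
    then have A[measurable]: "A \<in> sets borel" by simp
    have "emeasure (density (distr PB borel (\<lambda>x. x)) (indicator W)) A = emeasure (distr PB borel (\<lambda>x. x)) (W \<inter> A)"
      by (simp add: emeasure_density indicator_inter_arith[symmetric])
    also have "\<dots> = emeasure PB ((W \<inter> A) \<inter> space PB)" by (subst emeasure_distr) (auto intro: arg_cong2[where f=emeasure])
    also have "(W \<inter> A) \<inter> space PB = W \<inter> A" using W U by auto
    also have "emeasure PB (W \<inter> A) = (\<integral>\<^sup>+\<beta>. ennreal (f \<beta>) * indicator (W \<inter> A) \<beta> \<partial>lborel)"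
      using W by (intro dens) auto
    also have "\<dots> = emeasure (density lborel (\<lambda>\<beta>. ennreal (f \<beta>) * indicator W \<beta>)) A"
      using fW by (simp add: emeasure_density indicator_inter_arith mult.assoc)
    finally show "emeasure (density (distr PB borel (\<lambda>x. x)) (indicator W)) A
        = emeasure (density lborel (\<lambda>\<beta>. ennreal (f \<beta>) * indicator W \<beta>)) A" .
  qed simp
  then have "(\<integral>\<^sup>+\<beta>. g \<beta> \<partial>density (distr PB borel (\<lambda>x. x)) (indicator W))
      = (\<integral>\<^sup>+\<beta>. g \<beta> \<partial>density lborel (\<lambda>\<beta>. ennreal (f \<beta>) * indicator W \<beta>))" by simp
  then show ?thesis using fW
    by (simp add: nn_integral_density nn_integral_distr mult_ac)
qed

text \<open>Domination at \<open>\<gamma> = c / 8\<close> turns both error terms of the Laplace approximation into a single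
  dominated convergence.\<close>

lemma laplace_error:
  fixes K c \<rho> :: real
  assumes c: "c > 0" and K: "K \<ge> 0" and \<rho>: "\<rho> > 0"
  shows "\<exists>\<gamma>>0. \<exists>T. (\<integral>\<^sup>+(h::real^'p). ennreal (exp (K * norm h - c * (norm h)\<^sup>2 / 2) *
      (exp (\<gamma> * (1 + norm h + (norm h)\<^sup>2)) - 1 + indicator {h. T \<le> norm h} h)) \<partial>lborel) < ennreal \<rho>"
proof -
  let ?E = "\<lambda>h::real^'p. exp (K * norm h - c * (norm h)\<^sup>2 / 2)"
  let ?w = "\<lambda>h::real^'p. 1 + norm h + (norm h)\<^sup>2"
  \<comment> \<open>The weight takes c / 8 and the linear terms another c / 8 of the curvature c /
    2, so exp (- c |h|^2 / 4) is left for domination.\<close>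
  define g0 where "g0 = c / 8"
  have g0: "g0 > 0" using c by (simp add: g0_def)
  \<comment> \<open>\<gamma> tends to 0 and the cutoff T = k to infinity along the same
    sequence.\<close>
  define \<gamma> where "\<gamma> k = g0 / real (Suc k)" for k
  define u where "u k h = ?E h * (exp (\<gamma> k * ?w h) - 1 + indicator {h. real k \<le> norm h} h)" for k :: nat and h :: "real^'p"
  have w0: "?w h \<ge> 0" for h by simp
  have \<gamma>k: "0 < \<gamma> k" "\<gamma> k \<le> g0" for k
    using g0 by (auto simp: \<gamma>_def divide_le_eq mult_le_cancel_left1)
  \<comment> \<open>From (K + g0) x <= c x^2 / 8 + 2 (K + g0)^2 / c.\<close>
  define D where "D = g0 + 2 * (K + g0)\<^sup>2 / c"
  let ?dom = "\<lambda>h::real^'p. 2 * (exp D * exp (- (c / 4 * (norm h)\<^sup>2)))"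
  have dom: "?E h * exp (g0 * ?w h) \<le> exp D * exp (- (c / 4 * (norm h)\<^sup>2))" for h
  proof -
    define x where "x = norm h"
    have "0 \<le> (c / 2 * x - 2 * (K + g0))\<^sup>2" by simp
    then have "2 * c * x * (K + g0) \<le> c\<^sup>2 / 4 * x\<^sup>2 + 4 * (K + g0)\<^sup>2"
      by (simp add: power2_eq_square algebra_simps)
    also have "c\<^sup>2 / 4 * x\<^sup>2 + 4 * (K + g0)\<^sup>2 = c * (c / 4 * x\<^sup>2 + 4 * (K + g0)\<^sup>2 / c)"
      unfolding distrib_left using c by (simp add: power2_eq_square[of c])
    finally have "c * (2 * x * (K + g0)) \<le> c * (c / 4 * x\<^sup>2 + 4 * (K + g0)\<^sup>2 / c)" by (simp add: mult_ac)
    then have "2 * x * (K + g0) \<le> c / 4 * x\<^sup>2 + 4 * (K + g0)\<^sup>2 / c" using c by simp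
    then have "2 * (x * K) + 2 * (x * g0) \<le> c / 4 * x\<^sup>2 + 2 * (2 * (K + g0)\<^sup>2 / c)" by (simp add: distrib_left)
    moreover have "g0 * x\<^sup>2 = c / 8 * x\<^sup>2" by (simp add: g0_def)
    ultimately have "K * x - c * x\<^sup>2 / 2 + (g0 * 1 + g0 * x + g0 * x\<^sup>2) \<le> D + - (c / 4 * x\<^sup>2)"
      unfolding D_def by (simp only: mult_1_right mult.commute[of x])
    then have "K * x - c * x\<^sup>2 / 2 + g0 * (1 + x + x\<^sup>2) \<le> D + - (c / 4 * x\<^sup>2)"
      by (simp only: distrib_left)
    then show ?thesis unfolding exp_add[symmetric] x_def by simp
  qed
  have u_dom: "u k h \<le> ?dom h" for k h
  proof -
    have "exp (\<gamma> k * ?w h) \<le> exp (g0 * ?w h)" using \<gamma>k[of k] w0[of h] by (simp add: mult_right_mono)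
    moreover have "1 \<le> exp (g0 * ?w h)" using g0 w0[of h] by (simp add: mult_nonneg_nonneg)
    moreover have "indicator {h. real k \<le> norm h} h \<le> (1::real)" by (simp add: indicator_def)
    ultimately have "exp (\<gamma> k * ?w h) - 1 + indicator {h. real k \<le> norm h} h \<le> 2 * exp (g0 * ?w h)"
      by linarith
    then have "u k h \<le> ?E h * (2 * exp (g0 * ?w h))" unfolding u_def by (intro mult_left_mono) auto
    also have "\<dots> = 2 * (?E h * exp (g0 * ?w h))" by simp
    also have "\<dots> \<le> ?dom h" by (intro mult_left_mono dom) auto
    finally show ?thesis .
  qed
  have fin: "(\<integral>\<^sup>+(h::real^'p). ennreal (?dom h) \<partial>lborel) < \<infinity>"
  proof -
    let ?A = "(c / 2) *\<^sub>R mat 1 :: real^'p^'p"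
    have q: "h \<bullet> (?A *v h) = c / 2 * (norm h)\<^sup>2" for h :: "real^'p"
      by (simp add: scaleR_matrix_vector_assoc[symmetric] dot_square_norm)
    have tA: "transpose ?A = ?A" by (simp add: transpose_def mat_def vec_eq_iff)
    have "(\<integral>\<^sup>+(h::real^'p). ennreal (exp (- (c / 4 * (norm h)\<^sup>2))) \<partial>lborel) < \<infinity>"
      using gaussian_integral(2)[of ?A] c tA by (simp add: q)
    then show ?thesis
      by (simp add: ennreal_mult nn_integral_cmult ennreal_mult_less_top)
  qed
  have [measurable]: "(\<lambda>h. u k h) \<in> borel_measurable borel" for k unfolding u_def by measurable
  have lim: "(\<lambda>k. u k h) \<longlonglongrightarrow> 0" for h
  proof -
    have "\<gamma> \<longlonglongrightarrow> 0" unfolding \<gamma>_def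
      using LIMSEQ_Suc[OF lim_const_over_n[of g0]] by simp
    then have "(\<lambda>k. ?E h * (exp (\<gamma> k * ?w h) - 1 + 0)) \<longlonglongrightarrow> ?E h * (exp (0 * ?w h) - 1 + 0)"
      by (intro tendsto_intros)
    then have "(\<lambda>k. ?E h * (exp (\<gamma> k * ?w h) - 1 + 0)) \<longlonglongrightarrow> 0" by simp
    moreover have "\<forall>\<^sub>F k in sequentially. u k h = ?E h * (exp (\<gamma> k * ?w h) - 1 + 0)"
    proof -
      obtain k0 :: nat where "norm h < real k0" using reals_Archimedean2 by blast
      then show ?thesis
        unfolding eventually_sequentially u_def by (intro exI[of _ k0]) (auto simp: indicator_def)
    qed
    ultimately show ?thesis by (simp add: tendsto_cong)
  qed
  have "(\<lambda>k. \<integral>\<^sup>+h. ennreal (u k h) \<partial>lborel) \<longlonglongrightarrow> (\<integral>\<^sup>+(h::real^'p). ennreal 0 \<partial>lborel)"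
  proof (rule nn_integral_dominated_convergence[where w="\<lambda>h. ennreal (?dom h)"])
    show "AE h in lborel. ennreal (u k h) \<le> ennreal (?dom h)" for k
      using u_dom by (intro AE_I2 ennreal_leI) auto
    show "AE h in lborel. (\<lambda>k. ennreal (u k h)) \<longlonglongrightarrow> ennreal 0"
      using lim by (intro AE_I2 tendsto_ennrealI) auto
  qed (use fin in auto)
  then have "(\<lambda>k. \<integral>\<^sup>+h. ennreal (u k h) \<partial>lborel) \<longlonglongrightarrow> 0" by simp
  then have "\<forall>\<^sub>F k in sequentially. (\<integral>\<^sup>+h. ennreal (u k h) \<partial>lborel) < ennreal \<rho>"
    using \<rho> by (intro order_tendstoD(2)) auto
  then obtain k where "(\<integral>\<^sup>+h. ennreal (u k h) \<partial>lborel) < ennreal \<rho>"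
    using eventually_sequentially by auto
  then show ?thesis using \<gamma>k(1)[of k] unfolding u_def by blast
qed

text \<open>To be used with b / b1 the normal probability and a / a1 the posterior one, rescaled to
  a common unit. Because b <= b1, the factor b1 cancels and only a lower bound m for the total
  Gaussian mass enters.\<close>

lemma ratio_difference_bound:
  fixes a a1 b b1 \<rho> m :: real
  assumes "\<bar>a - b\<bar> \<le> 2 * \<rho>" "\<bar>a1 - b1\<bar> \<le> 2 * \<rho>" "0 \<le> b" "b \<le> b1" "m \<le> b1" "2 * \<rho> < m" "0 \<le> \<rho>"
  shows "\<bar>a / a1 - b / b1\<bar> \<le> 4 * \<rho> / (m - 2 * \<rho>)"
proof -
  have pos: "b1 > 0" "a1 > 0" "m - 2 * \<rho> \<le> a1" "m - 2 * \<rho> > 0" using assms by linarith+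
  have "a / a1 - b / b1 = ((a - b) * b1 - b * (a1 - b1)) / (a1 * b1)"
    using pos by (simp add: field_simps)
  also have "\<bar>\<dots>\<bar> = \<bar>(a - b) * b1 - b * (a1 - b1)\<bar> / (a1 * b1)" using pos by (simp add: abs_mult)
  also have "\<dots> \<le> (4 * \<rho> * b1) / (a1 * b1)"
  proof (rule divide_right_mono)
    have "\<bar>(a - b) * b1 - b * (a1 - b1)\<bar> \<le> \<bar>a - b\<bar> * b1 + b * \<bar>a1 - b1\<bar>"
      using pos assms by (intro order_trans[OF abs_triangle_ineq4]) (simp add: abs_mult)
    also have "\<dots> \<le> (2 * \<rho>) * b1 + b1 * (2 * \<rho>)" using pos assms by (intro add_mono mult_mono) auto
    finally show "\<bar>(a - b) * b1 - b * (a1 - b1)\<bar> \<le> 4 * \<rho> * b1" by simp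
  qed (use pos in simp)
  also have "\<dots> = 4 * \<rho> / a1" using pos by simp
  also have "\<dots> \<le> 4 * \<rho> / (m - 2 * \<rho>)" using pos assms by (intro divide_left_mono) auto
  finally show ?thesis .
qed

lemma ennreal_le_add: "a \<le> b + c \<Longrightarrow> 0 \<le> b \<Longrightarrow> 0 \<le> c \<Longrightarrow> ennreal a \<le> ennreal b + ennreal c"
  by (metis ennreal_leI ennreal_plus)

locale symmetric_regression_prior = symmetric_regression M s1 s2 P X err \<eta>0 L c0 N0
  for M s1 s2 :: real and P :: "'w measure" and X :: "nat \<Rightarrow> real^'p" and err :: "nat \<Rightarrow> 'w \<Rightarrow> real"
    and \<eta>0 :: "(real \<times> real) measure" and L c0 :: real and N0 :: nat +
  fixes \<B> :: "(real^'p) set" and \<beta>0 :: "real^'p" and Y :: "nat \<Rightarrow> 'w \<Rightarrow> real"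
    and priorB :: "(real^'p) measure" and priorH :: "(real \<times> real) measure measure"
    and U0 :: "(real^'p) set" and f :: "real^'p \<Rightarrow> real"
  assumes Y: "\<And>i \<omega>. i \<ge> 1 \<Longrightarrow> \<omega> \<in> space P \<Longrightarrow> Y i \<omega> = \<beta>0 \<bullet> X i + err i \<omega>"
    and PB: "prob_space priorB" and PB_sets: "sets priorB = sets (restrict_space borel \<B>)"
    and PH: "prob_space priorH" and PH_sets: "sets priorH = sets (mixing_space M s1 s2)"
    and PH_pos: "\<And>U. weak_nbhd M s1 s2 \<eta>0 U \<Longrightarrow> U \<in> sets priorH \<Longrightarrow> emeasure priorH U > 0"
    and U0: "open U0" "\<beta>0 \<in> U0" "U0 \<subseteq> space priorB" and f_cont: "continuous_on U0 f"
    and f_pos: "\<And>\<beta>. \<beta> \<in> U0 \<Longrightarrow> f \<beta> > 0"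
    and f_dens: "\<And>A. A \<in> sets borel \<Longrightarrow> A \<subseteq> U0 \<Longrightarrow>
      emeasure priorB A = (\<integral>\<^sup>+\<beta>. ennreal (f \<beta>) * indicator A \<beta> \<partial>lborel)"
begin

section \<open>Bayes' rule in the rescaled parameter\<close>

sublocale PB: prob_space priorB by (rule PB)
sublocale PH: prob_space priorH by (rule PH)

lemma PH_space: "space priorH = HH" by (rule mixing_space_space[OF PH_sets])

lemma PB_id: "(\<lambda>x. x) \<in> priorB \<rightarrow>\<^sub>M borel"
  unfolding measurable_cong_sets[OF PB_sets refl] by (rule measurable_restrict_space1) simp

lemma fst_measurable[measurable]: "fst \<in> priorB \<Otimes>\<^sub>M priorH \<rightarrow>\<^sub>M borel"
  by (rule measurable_compose[OF measurable_fst PB_id])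

lemma likelihood_measurable[measurable]: "likelihood X n y \<in> borel_measurable (priorB \<Otimes>\<^sub>M priorH)"
proof -
  have "(\<lambda>\<theta>. md 0 (snd \<theta>) (y i - fst \<theta> \<bullet> X i)) \<in> borel_measurable (priorB \<Otimes>\<^sub>M priorH)" for i
    by (rule md0_measurable_param[OF PH_sets]) measurable
  then have "(\<lambda>\<theta>. \<Prod>i=1..n. md 0 (snd \<theta>) (y i - fst \<theta> \<bullet> X i)) \<in> borel_measurable (priorB \<Otimes>\<^sub>M priorH)"
    by (intro borel_measurable_prod)
  then show ?thesis by (simp add: likelihood_def case_prod_beta' md_0)
qed

lemma likelihood_eq:
  assumes "\<omega> \<in> space P" "\<eta> \<in> HH"
  shows "likelihood X n (\<lambda>i. Y i \<omega>) (\<beta>, \<eta>) = exp (loglik n \<omega> (\<beta> - \<beta>0) \<eta>)"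
proof -
  have "md 0 \<eta> (Y i \<omega> - \<beta> \<bullet> X i) = exp (log_density \<eta> (err i \<omega> - (\<beta> - \<beta>0) \<bullet> X i))" if "i \<in> {1..n}" for i
    using that assms Y[of i \<omega>] md0_pos[OF assms(2)]
    by (simp add: log_density_def md_0[symmetric] inner_diff_left add.commute algebra_simps)
  then show ?thesis by (simp add: likelihood_def loglik_def exp_sum md_0[symmetric])
qed

definition inf_mat :: "nat \<Rightarrow> real^'p^'p" where
  "inf_mat n = info_matrix X \<eta>0 n \<eta>0"

lemma inf_mat_quadratic: "h \<bullet> (inf_mat n *v h) = info \<eta>0 \<eta>0 * (\<Sum>i=1..n. (h \<bullet> X i)\<^sup>2) / real n"
  unfolding inf_mat_def info_matrix_def scaleR_matrix_vector_assoc[symmetric]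
  by (simp add: design_matrix_quadratic)

lemma inf_mat_transpose: "transpose (inf_mat n) = inf_mat n"
  using design_matrix_transpose[of X n]
  by (simp add: inf_mat_def info_matrix_def transpose_def vec_eq_iff)

lemma inf_mat_lower:
  assumes "n \<ge> N0"
  shows "info \<eta>0 \<eta>0 * c0 * (norm h)\<^sup>2 \<le> h \<bullet> (inf_mat n *v h)"
  using mult_left_mono[OF design[OF assms, of h], of "info \<eta>0 \<eta>0"] info_pos[OF \<eta>0]
  by (simp add: inf_mat_quadratic mult.assoc)

lemma inf_mat_upper:
  assumes "n \<ge> 1"
  shows "h \<bullet> (inf_mat n *v h) \<le> info \<eta>0 \<eta>0 * L\<^sup>2 * (norm h)\<^sup>2"
proof -
  have "(\<Sum>i=1..n. (h \<bullet> X i)\<^sup>2) \<le> (\<Sum>i=1..n. (norm h * L)\<^sup>2)"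
  proof (rule sum_mono)
    fix i assume "i \<in> {1..n}"
    then have "\<bar>h \<bullet> X i\<bar> \<le> \<bar>norm h * L\<bar>" using shift_bound[of i h "norm h"] by simp
    then show "(h \<bullet> X i)\<^sup>2 \<le> (norm h * L)\<^sup>2" by (simp only: abs_le_square_iff)
  qed
  then have "(\<Sum>i=1..n. (h \<bullet> X i)\<^sup>2) / real n \<le> (norm h * L)\<^sup>2" using assms by (simp add: divide_le_eq mult.commute)
  from mult_left_mono[OF this, of "info \<eta>0 \<eta>0"] show ?thesis
    using info_pos[OF \<eta>0] by (simp add: inf_mat_quadratic power_mult_distrib mult_ac)
qed

text \<open>Puts the centring into the form A^(-1) G of \<open>mv_normal_canonical\<close>.\<close>

lemma centering_eq:
  assumes "\<omega> \<in> space P"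
  shows "centering X \<beta>0 \<eta>0 n (\<lambda>i. Y i \<omega>) = matrix_inv (inf_mat n) *v grad n \<omega>"
proof -
  have "(\<Sum>i=1..n. matrix_inv (inf_mat n) *v score \<eta>0 \<beta>0 (X i) (Y i \<omega>))
      = matrix_inv (inf_mat n) *v (\<Sum>i=1..n. (- l1 \<eta>0 (err i \<omega>)) *\<^sub>R X i)"
    unfolding linear_sum[OF matrix_vector_mul_linear]
    using assms by (intro sum.cong refl) (simp add: score_def score_eq[OF \<eta>0] Y)
  then show ?thesis
    by (simp add: centering_def grad_def inf_mat_def[symmetric] matrix_vector_mult_scaleR del: scaleR_minus_left)
qed

text \<open>The weight of the error in \<open>local_expansion\<close>.\<close>

definition wgt :: "real^'p \<Rightarrow> real" where "wgt h = norm h + (norm h)\<^sup>2"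

lemma wgt_nonneg: "wgt h \<ge> 0" by (simp add: wgt_def)

lemma wgt_measurable[measurable]: "wgt \<in> borel_measurable borel"
  unfolding wgt_def by measurable

text \<open>Up to a factor free of h, the density of the approximating normal law.\<close>

definition quad_exp :: "nat \<Rightarrow> 'w \<Rightarrow> real^'p \<Rightarrow> real" where
  "quad_exp n \<omega> h = exp (h \<bullet> grad n \<omega> - h \<bullet> (inf_mat n *v h) / 2)"

lemma quad_exp_measurable[measurable]: "quad_exp n \<omega> \<in> borel_measurable borel"
  unfolding quad_exp_def
  by (intro borel_measurable_continuous_onI continuous_intros linear_continuous_on_compose[OF continuous_on_id]) simp

text \<open>\<open>num n \<omega> B\<close> is the numerator of Bayes' rule for the rescaled parameter; \<open>loc_mass\<close> is the factor
  by which it is proportional to the Gaussian integral up to small errors.\<close>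

definition num :: "nat \<Rightarrow> 'w \<Rightarrow> (real^'p) set \<Rightarrow> ennreal" where
  "num n \<omega> B = (\<integral>\<^sup>+\<theta>. ennreal (likelihood X n (\<lambda>i. Y i \<omega>) \<theta>)
     * indicator B (sqrt (real n) *\<^sub>R (fst \<theta> - \<beta>0)) \<partial>(priorB \<Otimes>\<^sub>M priorH))"

definition loc_mass :: "real \<Rightarrow> nat \<Rightarrow> 'w \<Rightarrow> ennreal" where
  "loc_mass \<kappa> n \<omega> = (\<integral>\<^sup>+\<eta>. ennreal (exp (loglik n \<omega> 0 \<eta>)) * indicator (near \<kappa> \<eta>0) \<eta> \<partial>priorH)"

lemma near_measurable[measurable]: "near \<kappa> \<eta>0 \<in> sets priorH"
  by (rule near_sets[OF PH_sets \<eta>0])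

lemma exp_loglik_measurable[measurable]:
  assumes "\<omega> \<in> space P" "\<beta> \<in> space priorB"
  shows "(\<lambda>\<eta>. exp (loglik n \<omega> (\<beta> - \<beta>0) \<eta>)) \<in> borel_measurable priorH"
proof -
  have "(\<lambda>\<eta>. likelihood X n (\<lambda>i. Y i \<omega>) (\<beta>, \<eta>)) \<in> borel_measurable priorH"
    using measurable_compose[OF measurable_Pair1'[OF assms(2)] likelihood_measurable] .
  then show ?thesis
    by (rule measurable_cong[THEN iffD1, rotated]) (simp add: PH_space likelihood_eq[OF assms(1)])
qed

lemma \<beta>0_space: "\<beta>0 \<in> space priorB" using U0 by blast

lemma num_eq:
  assumes "\<omega> \<in> space P" and [measurable]: "B \<in> sets borel"
  shows "num n \<omega> B = (\<integral>\<^sup>+\<beta>. (\<integral>\<^sup>+\<eta>. ennreal (exp (loglik n \<omega> (\<beta> - \<beta>0) \<eta>)) \<partial>priorH)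
     * indicator B (sqrt (real n) *\<^sub>R (\<beta> - \<beta>0)) \<partial>priorB)"
proof -
  have m: "(\<lambda>\<theta>. ennreal (likelihood X n (\<lambda>i. Y i \<omega>) \<theta>)
     * indicator B (sqrt (real n) *\<^sub>R (fst \<theta> - \<beta>0))) \<in> borel_measurable (priorB \<Otimes>\<^sub>M priorH)" by measurable
  have "num n \<omega> B = (\<integral>\<^sup>+\<beta>. (\<integral>\<^sup>+\<eta>. ennreal (likelihood X n (\<lambda>i. Y i \<omega>) (\<beta>, \<eta>))
     * indicator B (sqrt (real n) *\<^sub>R (\<beta> - \<beta>0)) \<partial>priorH) \<partial>priorB)"
    unfolding num_def using PH.nn_integral_fst[OF m, symmetric] by simp
  also have "\<dots> = (\<integral>\<^sup>+\<beta>. (\<integral>\<^sup>+\<eta>. ennreal (exp (loglik n \<omega> (\<beta> - \<beta>0) \<eta>)) \<partial>priorH)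
     * indicator B (sqrt (real n) *\<^sub>R (\<beta> - \<beta>0)) \<partial>priorB)"
  proof (rule nn_integral_cong)
    fix \<beta> assume \<beta>: "\<beta> \<in> space priorB"
    have "(\<integral>\<^sup>+\<eta>. ennreal (likelihood X n (\<lambda>i. Y i \<omega>) (\<beta>, \<eta>)) * indicator B (sqrt (real n) *\<^sub>R (\<beta> - \<beta>0)) \<partial>priorH)
      = (\<integral>\<^sup>+\<eta>. ennreal (exp (loglik n \<omega> (\<beta> - \<beta>0) \<eta>)) * indicator B (sqrt (real n) *\<^sub>R (\<beta> - \<beta>0)) \<partial>priorH)"
      by (intro nn_integral_cong) (simp add: PH_space likelihood_eq[OF assms(1)])
    also have "\<dots> = (\<integral>\<^sup>+\<eta>. ennreal (exp (loglik n \<omega> (\<beta> - \<beta>0) \<eta>)) \<partial>priorH) * indicator B (sqrt (real n) *\<^sub>R (\<beta> - \<beta>0))"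
      by (rule nn_integral_multc[OF measurable_compose[OF exp_loglik_measurable[OF assms(1) \<beta>] measurable_ennreal]])
    finally show "(\<integral>\<^sup>+\<eta>. ennreal (likelihood X n (\<lambda>i. Y i \<omega>) (\<beta>, \<eta>)) * indicator B (sqrt (real n) *\<^sub>R (\<beta> - \<beta>0)) \<partial>priorH)
      = (\<integral>\<^sup>+\<eta>. ennreal (exp (loglik n \<omega> (\<beta> - \<beta>0) \<eta>)) \<partial>priorH) * indicator B (sqrt (real n) *\<^sub>R (\<beta> - \<beta>0))" .
  qed
  finally show ?thesis .
qed

section \<open>Deterministic bounds at a fixed sample point of the good event\<close>

context
  fixes n :: nat and \<omega> :: 'w and \<kappa> r \<gamma> c :: real
  assumes n: "n \<ge> 1" and \<omega>: "\<omega> \<in> space P" and r: "r > 0" and \<gamma>: "\<gamma> > 0"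
    and loc: "\<And>\<eta> u. \<eta> \<in> near \<kappa> \<eta>0 \<Longrightarrow> norm u \<le> r \<Longrightarrow>
      \<bar>loglik n \<omega> u \<eta> - loglik n \<omega> 0 \<eta> - ((sqrt n *\<^sub>R u) \<bullet> grad n \<omega> - info \<eta>0 \<eta>0 * (\<Sum>i=1..n. ((sqrt n *\<^sub>R u) \<bullet> X i)\<^sup>2) / real n / 2)\<bar>
      \<le> \<gamma> * (norm (sqrt n *\<^sub>R u) + (norm (sqrt n *\<^sub>R u))\<^sup>2)"
    and out: "\<And>\<eta> u. \<eta> \<in> HH \<Longrightarrow> r \<le> norm u \<or> \<eta> \<notin> near \<kappa> \<eta>0 \<Longrightarrow> loglik n \<omega> u \<eta> - loglik n \<omega> 0 \<eta>0 \<le> - c * real n"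
    and ball_U0: "ball \<beta>0 r \<subseteq> U0"
    and f_bounds: "\<And>\<beta>. \<beta> \<in> ball \<beta>0 r \<Longrightarrow> f \<beta>0 * exp (- \<gamma>) \<le> f \<beta> \<and> f \<beta> \<le> f \<beta>0 * exp \<gamma>"
begin

abbreviation "sn \<equiv> sqrt (real n)"

lemma sn_pos: "sn > 0" using n by simp

lemma f0_pos: "f \<beta>0 > 0" using f_pos U0 by blast

lemma loc_sandwich:
  assumes "\<eta> \<in> near \<kappa> \<eta>0" "norm u \<le> r"
  shows "exp (loglik n \<omega> u \<eta>) \<le> exp (loglik n \<omega> 0 \<eta>) * (quad_exp n \<omega> (sn *\<^sub>R u) * exp (\<gamma> * wgt (sn *\<^sub>R u)))"
    "exp (loglik n \<omega> 0 \<eta>) * (quad_exp n \<omega> (sn *\<^sub>R u) * exp (- (\<gamma> * wgt (sn *\<^sub>R u)))) \<le> exp (loglik n \<omega> u \<eta>)"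
  using loc[OF assms] unfolding quad_exp_def inf_mat_quadratic wgt_def exp_add[symmetric] abs_le_iff
  by simp_all

text \<open>The expansion is used only for \<beta> in the ball and \<eta> in
  \<open>near \<kappa> \<eta>0\<close>. All other pairs have a likelihood below one exponentially
  small number, and since the prior has mass one they add at most that number. The 1 in
  \<open>1 + wgt h\<close> comes from bounding the prior density by f \<beta>0 exp \<gamma>.\<close>

lemma num_upper:
  assumes [measurable]: "B \<in> sets borel"
  shows "num n \<omega> B \<le> loc_mass \<kappa> n \<omega> * ennreal (f \<beta>0 / sn ^ CARD('p))
      * (\<integral>\<^sup>+h. ennreal (quad_exp n \<omega> h * exp (\<gamma> * (1 + wgt h))) * indicator B h \<partial>lborel)
      + ennreal (exp (loglik n \<omega> 0 \<eta>0 - c * real n))"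
proof -
  let ?Z = "loc_mass \<kappa> n \<omega>" and ?e = "ennreal (exp (loglik n \<omega> 0 \<eta>0 - c * real n))"
  let ?q = "\<lambda>h. quad_exp n \<omega> h * exp (\<gamma> * wgt h)"
  let ?g = "\<lambda>\<beta>. ennreal (?q (sn *\<^sub>R (\<beta> - \<beta>0))) * indicator B (sn *\<^sub>R (\<beta> - \<beta>0))"
  let ?W = "ball \<beta>0 r"
  have small: "ennreal (exp (loglik n \<omega> u \<eta>)) \<le> ?e" if "\<eta> \<in> HH" "r \<le> norm u \<or> \<eta> \<notin> near \<kappa> \<eta>0" for u \<eta>
    using out[OF that] by (intro ennreal_leI) simp
  have [measurable]: "(\<lambda>\<eta>. exp (loglik n \<omega> 0 \<eta>)) \<in> borel_measurable priorH"
    using exp_loglik_measurable[OF \<omega> \<beta>0_space] by simp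
  have inner: "(\<integral>\<^sup>+\<eta>. ennreal (exp (loglik n \<omega> (\<beta> - \<beta>0) \<eta>)) \<partial>priorH)
      \<le> indicator ?W \<beta> * ennreal (?q (sn *\<^sub>R (\<beta> - \<beta>0))) * ?Z + ?e" for \<beta>
  proof (cases "\<beta> \<in> ?W")
    case True
    then have u: "norm (\<beta> - \<beta>0) \<le> r" by (simp add: dist_norm norm_minus_commute)
    have "(\<integral>\<^sup>+\<eta>. ennreal (exp (loglik n \<omega> (\<beta> - \<beta>0) \<eta>)) \<partial>priorH)
      \<le> (\<integral>\<^sup>+\<eta>. ennreal (?q (sn *\<^sub>R (\<beta> - \<beta>0))) * (ennreal (exp (loglik n \<omega> 0 \<eta>)) * indicator (near \<kappa> \<eta>0) \<eta>) + ?e \<partial>priorH)"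
    proof (rule nn_integral_mono)
      fix \<eta> assume "\<eta> \<in> space priorH"
      then have \<eta>: "\<eta> \<in> HH" by (simp add: PH_space)
      show "ennreal (exp (loglik n \<omega> (\<beta> - \<beta>0) \<eta>))
        \<le> ennreal (?q (sn *\<^sub>R (\<beta> - \<beta>0))) * (ennreal (exp (loglik n \<omega> 0 \<eta>)) * indicator (near \<kappa> \<eta>0) \<eta>) + ?e"
      proof (cases "\<eta> \<in> near \<kappa> \<eta>0")
        case True
        have "ennreal (exp (loglik n \<omega> (\<beta> - \<beta>0) \<eta>)) \<le> ennreal (exp (loglik n \<omega> 0 \<eta>) * ?q (sn *\<^sub>R (\<beta> - \<beta>0)))"
          using loc_sandwich(1)[OF True u] by (rule ennreal_leI)
        also have "\<dots> = ennreal (?q (sn *\<^sub>R (\<beta> - \<beta>0))) * (ennreal (exp (loglik n \<omega> 0 \<eta>)) * indicator (near \<kappa> \<eta>0) \<eta>)"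
          using True by (simp add: ennreal_mult quad_exp_def mult_ac)
        finally show ?thesis by (rule order_trans) simp
      next
        case False
        then show ?thesis using small[OF \<eta>, of "\<beta> - \<beta>0"] by simp
      qed
    qed
    also have "\<dots> = ennreal (?q (sn *\<^sub>R (\<beta> - \<beta>0))) * ?Z + ?e"
      unfolding loc_mass_def by (simp add: nn_integral_add nn_integral_cmult PH.emeasure_space_1)
    finally show ?thesis using True by simp
  next
    case False
    then have u: "r \<le> norm (\<beta> - \<beta>0)" by (simp add: dist_norm norm_minus_commute)
    have "(\<integral>\<^sup>+\<eta>. ennreal (exp (loglik n \<omega> (\<beta> - \<beta>0) \<eta>)) \<partial>priorH) \<le> (\<integral>\<^sup>+\<eta>. ?e \<partial>priorH)"
      using u by (intro nn_integral_mono small) (auto simp: PH_space)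
    then show ?thesis using False by (simp add: PH.emeasure_space_1)
  qed
  have "num n \<omega> B \<le> (\<integral>\<^sup>+\<beta>. ?Z * (?g \<beta> * indicator ?W \<beta>) + ?e \<partial>priorB)"
    unfolding num_eq[OF \<omega> assms]
  proof (rule nn_integral_mono)
    fix \<beta>
    have "(\<integral>\<^sup>+\<eta>. ennreal (exp (loglik n \<omega> (\<beta> - \<beta>0) \<eta>)) \<partial>priorH) * indicator B (sn *\<^sub>R (\<beta> - \<beta>0))
      \<le> (indicator ?W \<beta> * ennreal (?q (sn *\<^sub>R (\<beta> - \<beta>0))) * ?Z + ?e) * indicator B (sn *\<^sub>R (\<beta> - \<beta>0))"
      by (intro mult_right_mono inner) simp
    also have "\<dots> \<le> ?Z * (?g \<beta> * indicator ?W \<beta>) + ?e"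
      by (auto simp: indicator_def mult_ac)
    finally show "(\<integral>\<^sup>+\<eta>. ennreal (exp (loglik n \<omega> (\<beta> - \<beta>0) \<eta>)) \<partial>priorH) * indicator B (sn *\<^sub>R (\<beta> - \<beta>0))
      \<le> ?Z * (?g \<beta> * indicator ?W \<beta>) + ?e" .
  qed
  also have "\<dots> = ?Z * (\<integral>\<^sup>+\<beta>. ?g \<beta> * indicator ?W \<beta> \<partial>priorB) + ?e"
  proof -
    have [measurable]: "?W \<in> sets borel" by simp
    have gW: "(\<lambda>\<beta>. ?g \<beta> * indicator ?W \<beta>) \<in> borel_measurable borel" by measurable
    have [measurable]: "(\<lambda>\<beta>. ?g \<beta> * indicator ?W \<beta>) \<in> borel_measurable priorB"
      using measurable_compose[OF PB_id gW] .
    show ?thesis by (simp add: nn_integral_add nn_integral_cmult PB.emeasure_space_1)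
  qed
  also have "(\<integral>\<^sup>+\<beta>. ?g \<beta> * indicator ?W \<beta> \<partial>priorB) = (\<integral>\<^sup>+\<beta>. ennreal (f \<beta>) * ?g \<beta> * indicator ?W \<beta> \<partial>lborel)"
    by (rule prior_density_integral[OF PB_sets U0(3) f_cont f_dens _ ball_U0]; (assumption | (simp; fail) | measurable))
  also have "\<dots> \<le> (\<integral>\<^sup>+\<beta>. ennreal (f \<beta>0 * exp \<gamma>) * ?g \<beta> \<partial>lborel)"
    using f_bounds by (intro nn_integral_mono) (auto simp: indicator_def intro!: mult_right_mono ennreal_leI)
  also have "\<dots> = ennreal (f \<beta>0 * exp \<gamma>) * (\<integral>\<^sup>+\<beta>. ?g \<beta> \<partial>lborel)"
    by (rule nn_integral_cmult) measurable
  also have "(\<integral>\<^sup>+\<beta>. ?g \<beta> \<partial>lborel) = ennreal (1 / sn ^ CARD('p)) * (\<integral>\<^sup>+h. ennreal (?q h) * indicator B h \<partial>lborel)"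
    by (rule nn_integral_lborel_rescale[OF _ sn_pos, where g="\<lambda>h. ennreal (?q h) * indicator B h"]) measurable
  also have "ennreal (f \<beta>0 * exp \<gamma>) * (ennreal (1 / sn ^ CARD('p)) * (\<integral>\<^sup>+h. ennreal (?q h) * indicator B h \<partial>lborel))
      = ennreal (f \<beta>0 / sn ^ CARD('p)) * (\<integral>\<^sup>+h. ennreal (exp \<gamma>) * (ennreal (?q h) * indicator B h) \<partial>lborel)"
  proof -
    have "ennreal (f \<beta>0 * exp \<gamma>) * ennreal (1 / sn ^ CARD('p)) = ennreal (f \<beta>0 / sn ^ CARD('p)) * ennreal (exp \<gamma>)"
      using f0_pos sn_pos by (simp add: ennreal_mult[symmetric] field_simps)
    moreover have "(\<integral>\<^sup>+h. ennreal (exp \<gamma>) * (ennreal (?q h) * indicator B h) \<partial>lborel)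
        = ennreal (exp \<gamma>) * (\<integral>\<^sup>+h. ennreal (?q h) * indicator B h \<partial>lborel)"
      by (rule nn_integral_cmult) measurable
    ultimately show ?thesis by (simp add: mult.assoc[symmetric])
  qed
  also have "(\<integral>\<^sup>+h. ennreal (exp \<gamma>) * (ennreal (?q h) * indicator B h) \<partial>lborel)
      = (\<integral>\<^sup>+h. ennreal (quad_exp n \<omega> h * exp (\<gamma> * (1 + wgt h))) * indicator B h \<partial>lborel)"
  proof (rule nn_integral_cong)
    fix h
    have "quad_exp n \<omega> h * exp (\<gamma> * (1 + wgt h)) = exp \<gamma> * ?q h"
      by (simp add: distrib_left exp_add)
    then show "ennreal (exp \<gamma>) * (ennreal (?q h) * indicator B h)
      = ennreal (quad_exp n \<omega> h * exp (\<gamma> * (1 + wgt h))) * indicator B h"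
      by (simp add: ennreal_mult quad_exp_def mult_ac)
  qed
  finally show ?thesis by (simp add: mult_left_mono add_right_mono mult.assoc)
qed

text \<open>Pairs outside the ball or outside \<open>near \<kappa> \<eta>0\<close> are dropped; in
  the variable h the ball of radius r around \<beta>0 becomes the ball of radius r sn around
  0.\<close>

lemma num_lower:
  assumes [measurable]: "B \<in> sets borel"
  shows "loc_mass \<kappa> n \<omega> * ennreal (f \<beta>0 / sn ^ CARD('p))
      * (\<integral>\<^sup>+h. ennreal (quad_exp n \<omega> h * exp (- (\<gamma> * (1 + wgt h)))) * indicator (B \<inter> ball 0 (r * sn)) h \<partial>lborel)
      \<le> num n \<omega> B"
proof -
  let ?Z = "loc_mass \<kappa> n \<omega>"
  let ?q = "\<lambda>h. quad_exp n \<omega> h * exp (- \<gamma> * wgt h)"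
  let ?g = "\<lambda>\<beta>. ennreal (?q (sn *\<^sub>R (\<beta> - \<beta>0))) * indicator B (sn *\<^sub>R (\<beta> - \<beta>0))"
  let ?W = "ball \<beta>0 r"
  have [measurable]: "?W \<in> sets borel" "ball (0::real^'p) (r * sn) \<in> sets borel" by simp_all
  have [measurable]: "(\<lambda>\<eta>. exp (loglik n \<omega> 0 \<eta>)) \<in> borel_measurable priorH"
    using exp_loglik_measurable[OF \<omega> \<beta>0_space] by simp
  have inner: "indicator ?W \<beta> * ennreal (?q (sn *\<^sub>R (\<beta> - \<beta>0))) * ?Z
      \<le> (\<integral>\<^sup>+\<eta>. ennreal (exp (loglik n \<omega> (\<beta> - \<beta>0) \<eta>)) \<partial>priorH)" for \<beta>
  proof (cases "\<beta> \<in> ?W")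
    case True
    then have u: "norm (\<beta> - \<beta>0) \<le> r" by (simp add: dist_norm norm_minus_commute)
    have "ennreal (?q (sn *\<^sub>R (\<beta> - \<beta>0))) * ?Z
      = (\<integral>\<^sup>+\<eta>. ennreal (?q (sn *\<^sub>R (\<beta> - \<beta>0))) * (ennreal (exp (loglik n \<omega> 0 \<eta>)) * indicator (near \<kappa> \<eta>0) \<eta>) \<partial>priorH)"
      unfolding loc_mass_def by (rule nn_integral_cmult[symmetric]) measurable
    also have "\<dots> \<le> (\<integral>\<^sup>+\<eta>. ennreal (exp (loglik n \<omega> (\<beta> - \<beta>0) \<eta>)) \<partial>priorH)"
    proof (rule nn_integral_mono)
      fix \<eta>
      show "ennreal (?q (sn *\<^sub>R (\<beta> - \<beta>0))) * (ennreal (exp (loglik n \<omega> 0 \<eta>)) * indicator (near \<kappa> \<eta>0) \<eta>)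
        \<le> ennreal (exp (loglik n \<omega> (\<beta> - \<beta>0) \<eta>))"
      proof (cases "\<eta> \<in> near \<kappa> \<eta>0")
        case True
        have "ennreal (?q (sn *\<^sub>R (\<beta> - \<beta>0))) * (ennreal (exp (loglik n \<omega> 0 \<eta>)) * indicator (near \<kappa> \<eta>0) \<eta>)
          = ennreal (exp (loglik n \<omega> 0 \<eta>) * ?q (sn *\<^sub>R (\<beta> - \<beta>0)))"
          using True by (simp add: ennreal_mult quad_exp_def mult_ac)
        also have "\<dots> \<le> ennreal (exp (loglik n \<omega> (\<beta> - \<beta>0) \<eta>))"
          using loc_sandwich(2)[OF True u] by (intro ennreal_leI) simp
        finally show ?thesis .
      qed simp
    qed
    finally show ?thesis using True by simp
  qed simp
  have gW: "(\<lambda>\<beta>. ?g \<beta> * indicator ?W \<beta>) \<in> borel_measurable borel" by measurable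
  have [measurable]: "(\<lambda>\<beta>. ?g \<beta> * indicator ?W \<beta>) \<in> borel_measurable priorB"
    using measurable_compose[OF PB_id gW] .
  have eq: "(\<integral>\<^sup>+h. ennreal (exp (- \<gamma>)) * (ennreal (?q h) * indicator (B \<inter> ball 0 (r * sn)) h) \<partial>lborel)
      = (\<integral>\<^sup>+h. ennreal (quad_exp n \<omega> h * exp (- (\<gamma> * (1 + wgt h)))) * indicator (B \<inter> ball 0 (r * sn)) h \<partial>lborel)"
  proof (rule nn_integral_cong)
    fix h
    have "quad_exp n \<omega> h * exp (- (\<gamma> * (1 + wgt h))) = exp (- \<gamma>) * ?q h"
      by (simp add: distrib_left exp_add[symmetric] mult.left_commute)
    then show "ennreal (exp (- \<gamma>)) * (ennreal (?q h) * indicator (B \<inter> ball 0 (r * sn)) h)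
      = ennreal (quad_exp n \<omega> h * exp (- (\<gamma> * (1 + wgt h)))) * indicator (B \<inter> ball 0 (r * sn)) h"
      by (simp add: ennreal_mult quad_exp_def mult_ac)
  qed
  have "ennreal (f \<beta>0 / sn ^ CARD('p))
      * (\<integral>\<^sup>+h. ennreal (quad_exp n \<omega> h * exp (- (\<gamma> * (1 + wgt h)))) * indicator (B \<inter> ball 0 (r * sn)) h \<partial>lborel)
      = ennreal (f \<beta>0 * exp (- \<gamma>)) * (ennreal (1 / sn ^ CARD('p)) * (\<integral>\<^sup>+h. ennreal (?q h) * indicator (B \<inter> ball 0 (r * sn)) h \<partial>lborel))"
  proof -
    have "ennreal (f \<beta>0 * exp (- \<gamma>)) * ennreal (1 / sn ^ CARD('p)) = ennreal (f \<beta>0 / sn ^ CARD('p)) * ennreal (exp (- \<gamma>))"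
      using f0_pos sn_pos by (simp add: ennreal_mult[symmetric] field_simps)
    moreover have "(\<integral>\<^sup>+h. ennreal (exp (- \<gamma>)) * (ennreal (?q h) * indicator (B \<inter> ball 0 (r * sn)) h) \<partial>lborel)
        = ennreal (exp (- \<gamma>)) * (\<integral>\<^sup>+h. ennreal (?q h) * indicator (B \<inter> ball 0 (r * sn)) h \<partial>lborel)"
      by (rule nn_integral_cmult) measurable
    ultimately show ?thesis unfolding eq[symmetric] by (simp add: mult.assoc[symmetric])
  qed
  also have "ennreal (1 / sn ^ CARD('p)) * (\<integral>\<^sup>+h. ennreal (?q h) * indicator (B \<inter> ball 0 (r * sn)) h \<partial>lborel)
      = (\<integral>\<^sup>+\<beta>. ennreal (?q (sn *\<^sub>R (\<beta> - \<beta>0))) * indicator (B \<inter> ball 0 (r * sn)) (sn *\<^sub>R (\<beta> - \<beta>0)) \<partial>lborel)"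
    by (rule nn_integral_lborel_rescale[OF _ sn_pos, symmetric]) measurable
  also have "\<dots> = (\<integral>\<^sup>+\<beta>. ?g \<beta> * indicator ?W \<beta> \<partial>lborel)"
  proof (rule nn_integral_cong)
    fix \<beta>
    have "sn *\<^sub>R (\<beta> - \<beta>0) \<in> ball 0 (r * sn) \<longleftrightarrow> \<beta> \<in> ?W"
      using sn_pos by (simp add: dist_norm norm_minus_commute mult.commute[of r])
    then show "ennreal (?q (sn *\<^sub>R (\<beta> - \<beta>0))) * indicator (B \<inter> ball 0 (r * sn)) (sn *\<^sub>R (\<beta> - \<beta>0)) = ?g \<beta> * indicator ?W \<beta>"
      by (auto simp: indicator_def)
  qed
  also have "ennreal (f \<beta>0 * exp (- \<gamma>)) * \<dots> = (\<integral>\<^sup>+\<beta>. ennreal (f \<beta>0 * exp (- \<gamma>)) * (?g \<beta> * indicator ?W \<beta>) \<partial>lborel)"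
    by (rule nn_integral_cmult[symmetric]) measurable
  also have "\<dots> \<le> (\<integral>\<^sup>+\<beta>. ennreal (f \<beta>) * ?g \<beta> * indicator ?W \<beta> \<partial>lborel)"
    using f_bounds by (intro nn_integral_mono) (auto simp: indicator_def intro!: mult_right_mono ennreal_leI)
  also have "\<dots> = (\<integral>\<^sup>+\<beta>. ?g \<beta> * indicator ?W \<beta> \<partial>priorB)"
    by (rule prior_density_integral[OF PB_sets U0(3) f_cont f_dens _ ball_U0, symmetric]; (assumption | (simp; fail) | measurable))
  finally have *: "ennreal (f \<beta>0 / sn ^ CARD('p))
      * (\<integral>\<^sup>+h. ennreal (quad_exp n \<omega> h * exp (- (\<gamma> * (1 + wgt h)))) * indicator (B \<inter> ball 0 (r * sn)) h \<partial>lborel)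
      \<le> (\<integral>\<^sup>+\<beta>. ?g \<beta> * indicator ?W \<beta> \<partial>priorB)" .
  have "?Z * (\<integral>\<^sup>+\<beta>. ?g \<beta> * indicator ?W \<beta> \<partial>priorB) = (\<integral>\<^sup>+\<beta>. ?Z * (?g \<beta> * indicator ?W \<beta>) \<partial>priorB)"
    by (rule nn_integral_cmult[symmetric]) measurable
  also have "\<dots> \<le> num n \<omega> B"
    unfolding num_eq[OF \<omega> assms]
  proof (rule nn_integral_mono)
    fix \<beta>
    have "?Z * (?g \<beta> * indicator ?W \<beta>) = (indicator ?W \<beta> * ennreal (?q (sn *\<^sub>R (\<beta> - \<beta>0))) * ?Z) * indicator B (sn *\<^sub>R (\<beta> - \<beta>0))"
      by (simp add: mult_ac)
    also have "\<dots> \<le> (\<integral>\<^sup>+\<eta>. ennreal (exp (loglik n \<omega> (\<beta> - \<beta>0) \<eta>)) \<partial>priorH) * indicator B (sn *\<^sub>R (\<beta> - \<beta>0))"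
      by (intro mult_right_mono inner) simp
    finally show "?Z * (?g \<beta> * indicator ?W \<beta>)
      \<le> (\<integral>\<^sup>+\<eta>. ennreal (exp (loglik n \<omega> (\<beta> - \<beta>0) \<eta>)) \<partial>priorH) * indicator B (sn *\<^sub>R (\<beta> - \<beta>0))" .
  qed
  finally show ?thesis using mult_left_mono[OF *, of ?Z] by (simp add: mult.assoc)
qed

text \<open>In units of S = Z f0 the numerator of Bayes' rule is within 2 \<rho> of the Gaussian
  integral Q B, for every Borel B by the same estimate. Taking the whole space as B gives the
  denominator, and the random factor S cancels in the quotient.\<close>

lemma posterior_tv:
  fixes K T \<rho> \<kappa>' m :: real
  assumes nN: "n \<ge> N0" and G: "norm (grad n \<omega>) \<le> K" and K: "K \<ge> 0"
    and low: "\<And>\<eta>. \<eta> \<in> near \<kappa>' \<eta>0 \<Longrightarrow> - (c / 2) * real n \<le> loglik n \<omega> 0 \<eta> - loglik n \<omega> 0 \<eta>0"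
    and \<kappa>': "\<kappa>' \<le> \<kappa>" and \<rho>: "\<rho> > 0"
    and err: "(\<integral>\<^sup>+(h::real^'p). ennreal (exp (K * norm h - (info \<eta>0 \<eta>0 * c0) * (norm h)\<^sup>2 / 2) *
      (exp (\<gamma> * (1 + norm h + (norm h)\<^sup>2)) - 1 + indicator {h. T \<le> norm h} h)) \<partial>lborel) \<le> ennreal \<rho>"
    and T: "T \<le> r * sn"
    and big: "sn ^ CARD('p) * exp (- (c / 2) * real n) \<le> \<rho> * f \<beta>0 * measure priorH (near \<kappa>' \<eta>0)"
    and m: "m = exp (- (K + info \<eta>0 \<eta>0 * L\<^sup>2 / 2)) * measure lborel (ball (0::real^'p) 1)" "2 * \<rho> < m"
    and B[measurable]: "B \<in> sets borel"
  shows "\<bar>measure (posterior (priorB \<Otimes>\<^sub>M priorH) X n (\<lambda>i. Y i \<omega>))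
          {\<theta> \<in> space (priorB \<Otimes>\<^sub>M priorH). sqrt (real n) *\<^sub>R (fst \<theta> - \<beta>0) \<in> B}
        - measure (mv_normal (centering X \<beta>0 \<eta>0 n (\<lambda>i. Y i \<omega>)) (matrix_inv (info_matrix X \<eta>0 n \<eta>0))) B\<bar>
      \<le> 4 * \<rho> / (m - 2 * \<rho>)"
proof -
  let ?V = "info \<eta>0 \<eta>0"
  let ?q = "quad_exp n \<omega>"
  let ?E = "\<lambda>h::real^'p. exp (K * norm h - (?V * c0) * (norm h)\<^sup>2 / 2)"
  let ?I = "\<lambda>h::real^'p. indicator {h. T \<le> norm h} h :: real"
  let ?err = "\<lambda>h. ?E h * (exp (\<gamma> * (1 + wgt h)) - 1 + ?I h)"
  define Q where "Q B = (\<integral>\<^sup>+h. ennreal (?q h) * indicator B h \<partial>lborel)" for B :: "(real^'p) set"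
  define Z where "Z = loc_mass \<kappa> n \<omega>"
  define f0 where "f0 = f \<beta>0 / sn ^ CARD('p)"
  have V: "?V > 0" by (rule info_pos[OF \<eta>0])
  have f0: "f0 > 0" using f0_pos sn_pos by (simp add: f0_def)
  have wgt_eq: "1 + wgt h = 1 + norm h + (norm h)\<^sup>2" for h by (simp add: wgt_def)
  have err': "(\<integral>\<^sup>+h. ennreal (?err h) \<partial>lborel) \<le> ennreal \<rho>" using err unfolding wgt_eq .
  have ex1: "exp (\<gamma> * (1 + wgt h)) \<ge> 1" for h using \<gamma> wgt_nonneg[of h] by simp
  have hG: "\<bar>h \<bullet> grad n \<omega>\<bar> \<le> K * norm h" for h
    using Cauchy_Schwarz_ineq2[of h "grad n \<omega>"] mult_left_mono[OF G, of "norm h"] by (simp add: mult.commute)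
  have q_le: "?q h \<le> ?E h" for h
    unfolding quad_exp_def using hG[of h] inf_mat_lower[OF nN, of h] by (simp add: abs_le_iff)
  have q_pos: "?q h > 0" for h by (simp add: quad_exp_def)
  have [measurable]: "(\<lambda>h. ennreal (?err h)) \<in> borel_measurable lborel" by measurable
  have [measurable]: "ball (0::real^'p) (r * sn) \<in> sets borel" by simp
  have up_q: "(\<integral>\<^sup>+h. ennreal (?q h * exp (\<gamma> * (1 + wgt h))) * indicator A h \<partial>lborel) \<le> Q A + ennreal \<rho>"
    if [measurable]: "A \<in> sets borel" for A
  proof -
    have "(\<integral>\<^sup>+h. ennreal (?q h * exp (\<gamma> * (1 + wgt h))) * indicator A h \<partial>lborel)
      \<le> (\<integral>\<^sup>+h. ennreal (?q h) * indicator A h + ennreal (?err h) \<partial>lborel)"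
    proof (rule nn_integral_mono)
      fix h
      have "?q h * (exp (\<gamma> * (1 + wgt h)) - 1) \<le> ?err h"
        using q_le[of h] ex1[of h] by (intro mult_mono) auto
      then have "?q h * exp (\<gamma> * (1 + wgt h)) \<le> ?q h + ?err h" by (simp add: right_diff_distrib)
      then have "ennreal (?q h * exp (\<gamma> * (1 + wgt h))) \<le> ennreal (?q h) + ennreal (?err h)"
        using q_pos[of h] ex1[of h] by (intro ennreal_le_add mult_nonneg_nonneg add_nonneg_nonneg) auto
      then show "ennreal (?q h * exp (\<gamma> * (1 + wgt h))) * indicator A h \<le> ennreal (?q h) * indicator A h + ennreal (?err h)"
        by (simp add: indicator_def)
    qed
    also have "\<dots> = Q A + (\<integral>\<^sup>+h. ennreal (?err h) \<partial>lborel)"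
      unfolding Q_def by (rule nn_integral_add) measurable
    also have "\<dots> \<le> Q A + ennreal \<rho>" by (intro add_left_mono err')
    finally show ?thesis .
  qed
  have lo_q: "Q A \<le> (\<integral>\<^sup>+h. ennreal (?q h * exp (- (\<gamma> * (1 + wgt h)))) * indicator (A \<inter> ball 0 (r * sn)) h \<partial>lborel) + ennreal \<rho>"
    if [measurable]: "A \<in> sets borel" for A
  proof -
    have "Q A \<le> (\<integral>\<^sup>+h. ennreal (?q h * exp (- (\<gamma> * (1 + wgt h)))) * indicator (A \<inter> ball 0 (r * sn)) h + ennreal (?err h) \<partial>lborel)"
      unfolding Q_def
    proof (rule nn_integral_mono)
      fix h
      let ?x = "\<gamma> * (1 + wgt h)"
      have e0: "?err h \<ge> 0" using ex1[of h] by (auto intro!: mult_nonneg_nonneg add_nonneg_nonneg)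
      consider "h \<notin> A" | "h \<in> A" "h \<in> ball 0 (r * sn)" | "h \<in> A" "h \<notin> ball 0 (r * sn)" by blast
      then show "ennreal (?q h) * indicator A h \<le> ennreal (?q h * exp (- ?x)) * indicator (A \<inter> ball 0 (r * sn)) h + ennreal (?err h)"
      proof cases
        case 2
        \<comment> \<open>exp x + exp (- x) >= 2: the relative error from below is dominated by the
          one from above, so \<open>?err\<close> serves both directions.\<close>
        have "0 \<le> (exp (?x / 2) - exp (- ?x / 2))\<^sup>2" by simp
        also have "\<dots> = exp ?x - 2 + exp (- ?x)"
          by (simp add: power2_diff exp_double[symmetric] mult_exp_exp)
        finally have "1 - exp (- ?x) \<le> exp ?x - 1" by linarith
        then have "?q h * (1 - exp (- ?x)) \<le> ?q h * (exp ?x - 1)" using q_pos[of h] by (intro mult_left_mono) auto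
        also have "\<dots> \<le> ?err h" using q_le[of h] ex1[of h] by (intro mult_mono) auto
        finally have "?q h \<le> ?q h * exp (- ?x) + ?err h" by (simp add: right_diff_distrib)
        then have "ennreal (?q h) \<le> ennreal (?q h * exp (- ?x)) + ennreal (?err h)"
          using q_pos[of h] e0 by (intro ennreal_le_add) auto
        then show ?thesis using 2 by simp
      next
        case 3
        \<comment> \<open>Outside the ball the indicator in \<open>?err\<close> contributes the
          whole envelope, which dominates \<open>?q h\<close>.\<close>
        then have "T \<le> norm h" using T by simp
        then have "?E h * 1 \<le> ?err h" using ex1[of h] by (intro mult_left_mono) auto
        then have "ennreal (?q h) \<le> ennreal (?err h)" using q_le[of h] by (intro ennreal_leI) linarith
        then show ?thesis using 3 by simp
      qed simp
    qed
    also have "\<dots> = (\<integral>\<^sup>+h. ennreal (?q h * exp (- (\<gamma> * (1 + wgt h)))) * indicator (A \<inter> ball 0 (r * sn)) h \<partial>lborel) + (\<integral>\<^sup>+h. ennreal (?err h) \<partial>lborel)"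
      by (rule nn_integral_add) measurable
    also have "\<dots> \<le> (\<integral>\<^sup>+h. ennreal (?q h * exp (- (\<gamma> * (1 + wgt h)))) * indicator (A \<inter> ball 0 (r * sn)) h \<partial>lborel) + ennreal \<rho>"
      by (intro add_left_mono err')
    finally show ?thesis .
  qed
  let ?\<mu> = "measure priorH (near \<kappa>' \<eta>0)"
  have \<mu>: "?\<mu> > 0"
  proof -
    have "0 < sn ^ CARD('p) * exp (- (c / 2) * real n)" using sn_pos by simp
    then have "0 < (\<rho> * f \<beta>0) * ?\<mu>" using big by linarith
    then show ?thesis using \<rho> f0_pos by (simp add: zero_less_mult_iff)
  qed
  have [measurable]: "(\<lambda>\<eta>. exp (loglik n \<omega> 0 \<eta>)) \<in> borel_measurable priorH"
    using exp_loglik_measurable[OF \<omega> \<beta>0_space] by simp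
  have Z_low: "ennreal (exp (loglik n \<omega> 0 \<eta>0 - (c / 2) * real n) * ?\<mu>) \<le> Z"
  proof -
    have "ennreal (exp (loglik n \<omega> 0 \<eta>0 - (c / 2) * real n) * ?\<mu>)
      = (\<integral>\<^sup>+\<eta>. ennreal (exp (loglik n \<omega> 0 \<eta>0 - (c / 2) * real n)) * indicator (near \<kappa>' \<eta>0) \<eta> \<partial>priorH)"
      by (simp add: nn_integral_cmult_indicator PH.emeasure_eq_measure ennreal_mult)
    also have "\<dots> \<le> Z" unfolding Z_def loc_mass_def
    proof (rule nn_integral_mono)
      fix \<eta>
      show "ennreal (exp (loglik n \<omega> 0 \<eta>0 - (c / 2) * real n)) * indicator (near \<kappa>' \<eta>0) \<eta>
        \<le> ennreal (exp (loglik n \<omega> 0 \<eta>)) * indicator (near \<kappa> \<eta>0) \<eta>"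
      proof (cases "\<eta> \<in> near \<kappa>' \<eta>0")
        case True
        then have "\<eta> \<in> near \<kappa> \<eta>0" using near_mono[OF \<kappa>'] by blast
        then show ?thesis using True low[OF True] by (auto intro!: ennreal_leI)
      qed simp
    qed
    finally show ?thesis .
  qed
  \<comment> \<open>Finiteness of Z, from the growth bound on log-densities that is uniform in
    \<eta>; it allows passing to the real number z.\<close>
  have "Z \<le> (\<integral>\<^sup>+\<eta>. ennreal (exp (\<Sum>i=1..n. KC * (1 + \<bar>err i \<omega>\<bar>)\<^sup>2)) \<partial>priorH)"
    unfolding Z_def loc_mass_def
  proof (rule nn_integral_mono)
    fix \<eta> assume "\<eta> \<in> space priorH"
    then have \<eta>: "\<eta> \<in> HH" by (simp add: PH_space)
    have "loglik n \<omega> 0 \<eta> \<le> (\<Sum>i=1..n. KC * (1 + \<bar>err i \<omega>\<bar>)\<^sup>2)"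
      unfolding loglik_def using l0_bound[OF \<eta>] by (intro sum_mono) (auto simp: abs_le_iff)
    then show "ennreal (exp (loglik n \<omega> 0 \<eta>)) * indicator (near \<kappa> \<eta>0) \<eta> \<le> ennreal (exp (\<Sum>i=1..n. KC * (1 + \<bar>err i \<omega>\<bar>)\<^sup>2))"
      by (auto simp: indicator_def intro!: ennreal_leI)
  qed
  also have "\<dots> < \<infinity>" by (simp add: PH.emeasure_space_1)
  finally have Z_fin: "Z < \<infinity>" .
  define z where "z = enn2real Z"
  have Zz: "Z = ennreal z" using Z_fin by (simp add: z_def)
  have z_low: "exp (loglik n \<omega> 0 \<eta>0 - (c / 2) * real n) * ?\<mu> \<le> z"
    using Z_low unfolding Zz by (subst (asm) ennreal_le_iff) (simp_all add: z_def)
  moreover have "0 < exp (loglik n \<omega> 0 \<eta>0 - (c / 2) * real n) * ?\<mu>" using \<mu> by simp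
  ultimately have z: "z > 0" by linarith
  define S where "S = z * f0"
  have S: "S > 0" using z f0 by (simp add: S_def)
  have ZS: "Z * ennreal f0 = ennreal S" using z f0 by (simp add: Zz S_def ennreal_mult)
  \<comment> \<open>The exterior term decays with rate c, whereas Z has lost at most the rate c / 2.
    By \<open>big\<close> the remaining exp (- c n / 2) absorbs the Jacobian power of sn.\<close>
  have e1: "ennreal (exp (loglik n \<omega> 0 \<eta>0 - c * real n)) \<le> ennreal (S * \<rho>)"
  proof (rule ennreal_leI)
    have "exp (loglik n \<omega> 0 \<eta>0 - c * real n) = exp (loglik n \<omega> 0 \<eta>0 - (c / 2) * real n) * exp (- (c / 2) * real n)"
      by (simp add: exp_add[symmetric])
    also have "\<dots> \<le> exp (loglik n \<omega> 0 \<eta>0 - (c / 2) * real n) * (\<rho> * f0 * ?\<mu>)"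
    proof (rule mult_left_mono)
      show "exp (- (c / 2) * real n) \<le> \<rho> * f0 * ?\<mu>"
        using big sn_pos by (simp add: f0_def pos_le_divide_eq mult.commute)
    qed simp
    also have "\<dots> = (exp (loglik n \<omega> 0 \<eta>0 - (c / 2) * real n) * ?\<mu>) * (\<rho> * f0)" by simp
    also have "\<dots> \<le> z * (\<rho> * f0)" using z_low \<rho> f0 by (intro mult_right_mono) auto
    finally show "exp (loglik n \<omega> 0 \<eta>0 - c * real n) \<le> S * \<rho>" by (simp add: S_def mult_ac)
  qed
  have N_up: "num n \<omega> A \<le> ennreal S * (Q A + ennreal (2 * \<rho>))" if A: "A \<in> sets borel" for A
  proof -
    have "num n \<omega> A \<le> ennreal S * (Q A + ennreal \<rho>) + ennreal (S * \<rho>)"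
      using order_trans[OF num_upper[OF A, folded Z_def f0_def, unfolded ZS]
          add_mono[OF mult_left_mono[OF up_q[OF A], of "ennreal S"] e1]] by simp
    also have "\<dots> = ennreal S * (Q A + (ennreal \<rho> + ennreal \<rho>))"
      using S \<rho> by (simp add: distrib_left ennreal_mult add.assoc)
    also have "ennreal \<rho> + ennreal \<rho> = ennreal (2 * \<rho>)" using \<rho> by (subst ennreal_plus[symmetric]) auto
    finally show ?thesis .
  qed
  have N_lo: "ennreal S * Q A \<le> num n \<omega> A + ennreal (S * \<rho>)" if A: "A \<in> sets borel" for A
  proof -
    have "ennreal S * Q A \<le> ennreal S * ((\<integral>\<^sup>+h. ennreal (?q h * exp (- (\<gamma> * (1 + wgt h)))) * indicator (A \<inter> ball 0 (r * sn)) h \<partial>lborel) + ennreal \<rho>)"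
      by (intro mult_left_mono lo_q A) simp
    also have "\<dots> = ennreal S * (\<integral>\<^sup>+h. ennreal (?q h * exp (- (\<gamma> * (1 + wgt h)))) * indicator (A \<inter> ball 0 (r * sn)) h \<partial>lborel) + ennreal (S * \<rho>)"
      using S \<rho> by (simp add: distrib_left ennreal_mult)
    also have "\<dots> \<le> num n \<omega> A + ennreal (S * \<rho>)"
      using num_lower[OF A] unfolding Z_def[symmetric] f0_def[symmetric] ZS by (intro add_right_mono)
    finally show ?thesis .
  qed
  have posdef: "0 < h \<bullet> (inf_mat n *v h)" if "h \<noteq> 0" for h
  proof -
    have "0 < ?V * c0 * (norm h)\<^sup>2" using V c0_pos that by simp
    then show ?thesis using inf_mat_lower[OF nN, of h] by linarith
  qed
  define NN where "NN = mv_normal (centering X \<beta>0 \<eta>0 n (\<lambda>i. Y i \<omega>)) (matrix_inv (info_matrix X \<eta>0 n \<eta>0))"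
  have NN: "NN = mv_normal (matrix_inv (inf_mat n) *v grad n \<omega>) (matrix_inv (inf_mat n))"
    by (simp add: NN_def centering_eq[OF \<omega>] inf_mat_def)
  obtain cc where cc: "cc > 0" "NN = density lborel (\<lambda>h. ennreal (cc * ?q h))"
    using mv_normal_canonical(1)[OF inf_mat_transpose posdef, of "grad n \<omega>"] unfolding NN quad_exp_def by blast
  have NN_em: "emeasure NN A = ennreal cc * Q A" if [measurable]: "A \<in> sets borel" for A
  proof -
    have "emeasure NN A = (\<integral>\<^sup>+h. ennreal cc * (ennreal (?q h) * indicator A h) \<partial>lborel)"
      unfolding cc(2) using cc(1) q_pos by (subst emeasure_density) (simp_all add: ennreal_mult less_imp_le mult.assoc)
    also have "\<dots> = ennreal cc * Q A" unfolding Q_def by (rule nn_integral_cmult) measurable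
    finally show ?thesis .
  qed
  have NN1: "ennreal cc * Q UNIV = 1"
    using NN_em[of UNIV] mv_normal_canonical(2)[OF inf_mat_transpose posdef, of "grad n \<omega>"] by (simp add: NN)
  have Q_fin: "Q A < \<infinity>" for A
  proof -
    have "Q UNIV \<noteq> \<infinity>" using NN1 cc(1) by (auto simp: ennreal_mult_top)
    moreover have "Q A \<le> Q UNIV" unfolding Q_def by (intro nn_integral_mono) (auto simp: indicator_def)
    ultimately show ?thesis by (metis infinity_ennreal_def less_top order_le_less_trans)
  qed
  define qr where "qr A = enn2real (Q A)" for A
  have Qr: "Q A = ennreal (qr A)" "qr A \<ge> 0" for A using Q_fin[of A] by (simp_all add: qr_def)
  have qr_mono: "qr A \<le> qr UNIV" for A
  proof -
    have "Q A \<le> Q UNIV" unfolding Q_def by (intro nn_integral_mono) (auto simp: indicator_def)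
    then show ?thesis unfolding Qr using Qr(2) by (simp add: ennreal_le_iff)
  qed
  have ccq: "cc * qr UNIV = 1" using NN1 cc(1) Qr(2)[of UNIV] unfolding Qr(1)
    by (simp add: ennreal_mult[symmetric] ennreal_eq_1)
  have normal_ratio: "measure NN B = qr B / qr UNIV"
  proof -
    have "measure NN B = cc * qr B"
      using NN_em[OF B] cc(1) Qr(2)[of B] unfolding Qr(1) measure_def by (simp add: ennreal_mult[symmetric])
    moreover have "cc = 1 / qr UNIV"
    proof -
      have "qr UNIV \<noteq> 0" using ccq by auto
      then show ?thesis using ccq by (simp add: eq_divide_eq)
    qed
    ultimately show ?thesis by simp
  qed
  \<comment> \<open>On the unit ball the exponent is at least - (K + V L^2 / 2), which bounds the
    total Gaussian integral from below by a number that involves neither n nor \<omega>.\<close>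
  have m_le: "m \<le> qr UNIV"
  proof -
    let ?b = "exp (- (K + ?V * L\<^sup>2 / 2))"
    have fb: "emeasure lborel (ball (0::real^'p) 1) = ennreal (measure lborel (ball (0::real^'p) 1))"
      using emeasure_lborel_ball_finite[of "0::real^'p" 1] by (simp add: emeasure_eq_ennreal_measure less_top)
    have "ennreal m = (\<integral>\<^sup>+h. ennreal ?b * indicator (ball 0 1) h \<partial>(lborel :: (real^'p) measure))"
      unfolding m(1) by (subst nn_integral_cmult_indicator) (simp_all add: fb ennreal_mult)
    also have "\<dots> \<le> Q UNIV" unfolding Q_def
    proof (rule nn_integral_mono)
      fix h :: "real^'p"
      show "ennreal ?b * indicator (ball 0 1) h \<le> ennreal (?q h) * indicator UNIV h"
      proof (cases "h \<in> ball 0 1")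
        case True
        then have h1: "norm h \<le> 1" by simp
        have "K * norm h \<le> K" using h1 K by (simp add: mult_left_le)
        then have 1: "- K \<le> h \<bullet> grad n \<omega>" using hG[of h] by (simp add: abs_le_iff)
        have "(norm h)\<^sup>2 \<le> 1" using h1 by (simp add: power_le_one)
        then have "?V * L\<^sup>2 * (norm h)\<^sup>2 \<le> ?V * L\<^sup>2" using V by (intro mult_left_le) auto
        then have "h \<bullet> (inf_mat n *v h) \<le> ?V * L\<^sup>2" using inf_mat_upper[OF n, of h] by linarith
        then have "?b \<le> ?q h" unfolding quad_exp_def using 1 by simp
        then show ?thesis by (auto simp: indicator_def intro!: ennreal_leI)
      qed simp
    qed
    finally show ?thesis unfolding Qr using Qr(2) by (simp add: ennreal_le_iff)
  qed
  define nr where "nr A = enn2real (num n \<omega> A)" for A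
  have Nr: "num n \<omega> A = ennreal (nr A)" "nr A \<ge> 0" "nr A \<le> S * (qr A + 2 * \<rho>)" "S * qr A \<le> nr A + S * \<rho>"
    if A: "A \<in> sets borel" for A
  proof -
    have up: "num n \<omega> A \<le> ennreal (S * (qr A + 2 * \<rho>))"
    proof -
      have "ennreal (S * (qr A + 2 * \<rho>)) = ennreal S * ennreal (qr A + 2 * \<rho>)"
        using S \<rho> Qr(2)[of A] by (intro ennreal_mult) auto
      moreover have "ennreal (qr A + 2 * \<rho>) = ennreal (qr A) + ennreal (2 * \<rho>)"
        using \<rho> Qr(2)[of A] by (intro ennreal_plus) auto
      ultimately show ?thesis using N_up[OF A] unfolding Qr(1) by simp
    qed
    then have "num n \<omega> A < \<infinity>" by (rule order_le_less_trans) simp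
    then show eq: "num n \<omega> A = ennreal (nr A)" by (simp add: nr_def)
    show nn: "nr A \<ge> 0" by (simp add: nr_def)
    have "0 \<le> S * (qr A + 2 * \<rho>)" using S \<rho> Qr(2)[of A] by simp
    then show "nr A \<le> S * (qr A + 2 * \<rho>)" using up unfolding eq by (simp add: ennreal_le_iff)
    have "ennreal (S * qr A) \<le> ennreal (nr A + S * \<rho>)"
    proof -
      have "ennreal (S * qr A) = ennreal S * ennreal (qr A)"
        using S Qr(2)[of A] by (intro ennreal_mult) auto
      moreover have "ennreal (nr A + S * \<rho>) = ennreal (nr A) + ennreal (S * \<rho>)"
        using nn S \<rho> by (intro ennreal_plus) auto
      ultimately show ?thesis using N_lo[OF A] unfolding eq Qr(1) by simp
    qed
    then show "S * qr A \<le> nr A + S * \<rho>" using S \<rho> nn by (subst (asm) ennreal_le_iff) auto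
  qed
  have diff: "\<bar>nr A / S - qr A\<bar> \<le> 2 * \<rho>" if A: "A \<in> sets borel" for A
  proof -
    have "nr A / S \<le> qr A + 2 * \<rho>" using Nr(3)[OF A] S by (simp add: divide_le_eq mult.commute)
    moreover have "qr A \<le> (nr A + S * \<rho>) / S" using Nr(4)[OF A] S by (simp add: pos_le_divide_eq mult.commute)
    then have "qr A - \<rho> \<le> nr A / S" using S by (simp add: add_divide_distrib)
    ultimately show ?thesis using \<rho> unfolding abs_le_iff by linarith
  qed
  have bound: "\<bar>(nr B / S) / (nr UNIV / S) - qr B / qr UNIV\<bar> \<le> 4 * \<rho> / (m - 2 * \<rho>)"
    by (rule ratio_difference_bound[OF diff[OF B] diff Qr(2) qr_mono m_le m(2)]) (use \<rho> in auto)
  have nU: "nr UNIV > 0"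
  proof -
    have "qr UNIV - 2 * \<rho> \<le> nr UNIV / S" using diff[of UNIV] by (auto simp: abs_le_iff)
    then have "0 < nr UNIV / S" using m_le m(2) by linarith
    then show ?thesis using S by (simp add: zero_less_divide_iff)
  qed
  have post: "measure (posterior (priorB \<Otimes>\<^sub>M priorH) X n (\<lambda>i. Y i \<omega>))
      {\<theta> \<in> space (priorB \<Otimes>\<^sub>M priorH). sqrt (real n) *\<^sub>R (fst \<theta> - \<beta>0) \<in> B} = nr B / nr UNIV"
  proof -
    let ?P = "priorB \<Otimes>\<^sub>M priorH" and ?l = "\<lambda>\<theta>. ennreal (likelihood X n (\<lambda>i. Y i \<omega>) \<theta>)"
    let ?A = "{\<theta> \<in> space ?P. sqrt (real n) *\<^sub>R (fst \<theta> - \<beta>0) \<in> B}"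
    have A[measurable]: "?A \<in> sets ?P" by measurable
    have den: "(\<integral>\<^sup>+\<theta>. ?l \<theta> \<partial>?P) = ennreal (nr UNIV)" using Nr(1)[of UNIV] by (simp add: num_def)
    have "emeasure (posterior ?P X n (\<lambda>i. Y i \<omega>)) ?A = (\<integral>\<^sup>+\<theta>. ?l \<theta> / ennreal (nr UNIV) * indicator ?A \<theta> \<partial>?P)"
      unfolding posterior_def den by (subst emeasure_density) simp_all
    also have "\<dots> = (\<integral>\<^sup>+\<theta>. (?l \<theta> * indicator B (sqrt (real n) *\<^sub>R (fst \<theta> - \<beta>0))) / ennreal (nr UNIV) \<partial>?P)"
      by (intro nn_integral_cong) (auto simp: indicator_def)
    also have "\<dots> = num n \<omega> B / ennreal (nr UNIV)"
      unfolding num_def by (rule nn_integral_divide) measurable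
    also have "\<dots> = ennreal (nr B / nr UNIV)" using Nr(1,2)[OF B] nU by (simp add: divide_ennreal)
    finally show ?thesis using Nr(2)[OF B] nU unfolding measure_def by simp
  qed
  show ?thesis using bound S unfolding post NN_def[symmetric] normal_ratio by simp
qed

end

end

section \<open>The Bernstein--von Mises theorem\<close>

context symmetric_regression_prior
begin

lemma power_exp_sqrt_tendsto:
  assumes "c > 0"
  shows "(\<lambda>n. sqrt (real n) ^ k * exp (- c * real n)) \<longlonglongrightarrow> 0"
proof -
  have "filterlim (\<lambda>n. c * real n) at_top sequentially"
    using assms by (intro filterlim_tendsto_pos_mult_at_top[OF tendsto_const _ filterlim_real_sequentially])
  then have "(\<lambda>n. (c * real n) ^ k / exp (c * real n)) \<longlonglongrightarrow> 0"
    by (rule filterlim_compose[OF tendsto_power_div_exp_0])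
  then have "(\<lambda>n. (1 / c ^ k) * ((c * real n) ^ k / exp (c * real n))) \<longlonglongrightarrow> (1 / c ^ k) * 0"
    by (intro tendsto_intros)
  then have lim: "(\<lambda>n. real n ^ k * exp (- c * real n)) \<longlonglongrightarrow> 0"
    using assms by (simp add: power_mult_distrib exp_minus field_simps)
  show ?thesis
  proof (rule Lim_null_comparison[OF _ lim])
    show "\<forall>\<^sub>F n in sequentially. norm (sqrt (real n) ^ k * exp (- c * real n)) \<le> real n ^ k * exp (- c * real n)"
      using eventually_ge_at_top[of 1]
    proof eventually_elim
      case (elim n)
      have "sqrt (real n) \<le> real n" using elim by (intro real_le_lsqrt) (auto simp: self_le_power)
      then have "sqrt (real n) ^ k \<le> real n ^ k" by (intro power_mono) auto
      then show ?case by (simp add: mult_right_mono)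
    qed
  qed
qed

text \<open>The bounds are multiplicative so that they merge with the exponential error of the
  expansion.\<close>

lemma prior_density_near:
  assumes "\<gamma> > 0"
  shows "\<exists>r>0. ball \<beta>0 r \<subseteq> U0 \<and> (\<forall>\<beta>\<in>ball \<beta>0 r. f \<beta>0 * exp (- \<gamma>) \<le> f \<beta> \<and> f \<beta> \<le> f \<beta>0 * exp \<gamma>)"
proof -
  have f0: "f \<beta>0 > 0" using f_pos U0 by blast
  have "isCont f \<beta>0" using f_cont U0 by (simp add: continuous_on_eq_continuous_at)
  then have lim: "(f \<longlongrightarrow> f \<beta>0) (nhds \<beta>0)" by (simp add: continuous_at tendsto_nhds_iff)
  have "f \<beta>0 * exp (- \<gamma>) < f \<beta>0" "f \<beta>0 < f \<beta>0 * exp \<gamma>" using f0 assms by auto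
  then have "\<forall>\<^sub>F \<beta> in nhds \<beta>0. f \<beta>0 * exp (- \<gamma>) < f \<beta> \<and> f \<beta> < f \<beta>0 * exp \<gamma> \<and> \<beta> \<in> U0"
    using order_tendstoD[OF lim] U0 by (intro eventually_conj eventually_nhds_in_open) auto
  then obtain r where "r > 0" "\<And>\<beta>. dist \<beta> \<beta>0 < r \<Longrightarrow> f \<beta>0 * exp (- \<gamma>) < f \<beta> \<and> f \<beta> < f \<beta>0 * exp \<gamma> \<and> \<beta> \<in> U0"
    by (auto simp: eventually_nhds_metric)
  then show ?thesis by (intro exI[of _ r]) (auto simp: dist_commute intro: less_imp_le)
qed

text \<open>The order of the choices matters. Tightness of the gradient fixes K, hence m and \<rho>;
  these fix \<gamma> and T; the expansion at \<gamma> fixes \<kappa> and r; their exterior fixes the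
  rate c; only then can the lower bound of the likelihood be asked for at rate c / 2. Each of the
  four events takes a quarter of \<xi>.\<close>

lemma total_variation_likely:
  assumes \<epsilon>: "\<epsilon> > 0" and \<xi>: "\<xi> > 0"
  shows "\<exists>N. \<forall>n\<ge>N. likely \<xi> (\<lambda>\<omega>. \<forall>B\<in>sets borel.
    \<bar>measure (posterior (priorB \<Otimes>\<^sub>M priorH) X n (\<lambda>i. Y i \<omega>))
          {\<theta> \<in> space (priorB \<Otimes>\<^sub>M priorH). sqrt (real n) *\<^sub>R (fst \<theta> - \<beta>0) \<in> B}
        - measure (mv_normal (centering X \<beta>0 \<eta>0 n (\<lambda>i. Y i \<omega>)) (matrix_inv (info_matrix X \<eta>0 n \<eta>0))) B\<bar> \<le> \<epsilon>)"
proof -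
  let ?V = "info \<eta>0 \<eta>0"
  have V: "?V > 0" by (rule info_pos[OF \<eta>0])
  have \<xi>4: "\<xi> / 4 > 0" using \<xi> by simp
  obtain K where K: "K > 0" "\<forall>n\<ge>1. likely (\<xi> / 4) (\<lambda>\<omega>. norm (grad n \<omega>) \<le> K)"
    using grad_tight[OF \<xi>4] by blast
  define m where "m = exp (- (K + ?V * L\<^sup>2 / 2)) * measure lborel (ball (0::real^'p) 1)"
  have "measure lborel (ball (0::real^'p) 1) > 0" by (simp add: content_ball_pos)
  then have m: "m > 0" by (simp add: m_def)
  \<comment> \<open>m / 4 keeps m - 2 \<rho> at least m / 2, and \<epsilon> m / 8 then brings 4
    \<rho> / (m / 2) down to \<epsilon>.\<close>
  define \<rho> where "\<rho> = min (m / 4) (\<epsilon> * m / 8)"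
  have \<rho>: "\<rho> > 0" "2 * \<rho> \<le> m / 2" "8 * \<rho> \<le> \<epsilon> * m" using m \<epsilon> by (auto simp: \<rho>_def)
  have tv: "4 * \<rho> / (m - 2 * \<rho>) \<le> \<epsilon>"
  proof -
    have "4 * \<rho> / (m - 2 * \<rho>) \<le> 4 * \<rho> / (m / 2)" using \<rho> m by (intro divide_left_mono mult_pos_pos) auto
    also have "\<dots> \<le> \<epsilon>" using \<rho> m by (simp add: divide_le_eq)
    finally show ?thesis .
  qed
  have "?V * c0 > 0" using V c0_pos by simp
  from laplace_error[OF this less_imp_le[OF K(1)] \<rho>(1), where 'p='p] obtain \<gamma> T where \<gamma>: "\<gamma> > 0"
    "(\<integral>\<^sup>+(h::real^'p). ennreal (exp (K * norm h - (?V * c0) * (norm h)\<^sup>2 / 2) *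
      (exp (\<gamma> * (1 + norm h + (norm h)\<^sup>2)) - 1 + indicator {h. T \<le> norm h} h)) \<partial>lborel) < ennreal \<rho>"
    by blast
  obtain \<kappa> r1 N1 where loc: "\<kappa> > 0" "r1 > 0" "\<forall>n\<ge>N1. likely (\<xi> / 4) (\<lambda>\<omega>. \<forall>\<eta>\<in>near \<kappa> \<eta>0. \<forall>u. norm u \<le> r1 \<longrightarrow>
    \<bar>loglik n \<omega> u \<eta> - loglik n \<omega> 0 \<eta> - ((sqrt n *\<^sub>R u) \<bullet> grad n \<omega> - ?V * (\<Sum>i=1..n. ((sqrt n *\<^sub>R u) \<bullet> X i)\<^sup>2) / real n / 2)\<bar>
      \<le> \<gamma> * (norm (sqrt n *\<^sub>R u) + (norm (sqrt n *\<^sub>R u))\<^sup>2))"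
    using local_expansion[OF \<gamma>(1) \<xi>4] by blast
  obtain r2 where r2: "r2 > 0" "ball \<beta>0 r2 \<subseteq> U0"
    "\<forall>\<beta>\<in>ball \<beta>0 r2. f \<beta>0 * exp (- \<gamma>) \<le> f \<beta> \<and> f \<beta> \<le> f \<beta>0 * exp \<gamma>"
    using prior_density_near[OF \<gamma>(1)] by blast
  define r where "r = min r1 r2"
  have r: "r > 0" "r \<le> r1" "ball \<beta>0 r \<subseteq> ball \<beta>0 r2" using loc r2 by (auto simp: r_def)
  obtain c N2 where out: "c > 0" "\<forall>n\<ge>N2. likely (\<xi> / 4) (\<lambda>\<omega>. \<forall>\<eta>\<in>HH. \<forall>u. (r \<le> norm u \<or> \<eta> \<notin> near \<kappa> \<eta>0) \<longrightarrow>
    loglik n \<omega> u \<eta> - loglik n \<omega> 0 \<eta>0 \<le> - c * real n)"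
    using outside_likely[OF loc(1) r(1) \<xi>4] by blast
  have c2: "c / 2 > 0" using out by simp
  obtain \<kappa>1 where low: "\<kappa>1 > 0" "\<forall>n\<ge>1. likely (\<xi> / 4) (\<lambda>\<omega>. \<forall>\<eta>\<in>near \<kappa>1 \<eta>0. loglik n \<omega> 0 \<eta> - loglik n \<omega> 0 \<eta>0 \<ge> - (c / 2) * real n)"
    using lower_likely[OF c2 \<xi>4] by blast
  \<comment> \<open>Inside \<open>near \<kappa> \<eta>0\<close> so that its prior mass is part of
    \<open>loc_mass\<close>, and inside \<open>near \<kappa>1 \<eta>0\<close> so that the likelihood
    there has lost at most the rate c / 2.\<close>
  define \<kappa>' where "\<kappa>' = min \<kappa> \<kappa>1"
  have \<kappa>': "\<kappa>' > 0" "\<kappa>' \<le> \<kappa>" "near \<kappa>' \<eta>0 \<subseteq> near \<kappa>1 \<eta>0"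
    using loc low near_mono[of \<kappa>' \<kappa>1] by (auto simp: \<kappa>'_def)
  \<comment> \<open>The support condition on the prior enters here, as a positive mass that does not
    depend on n.\<close>
  have "emeasure priorH (near \<kappa>' \<eta>0) > 0"
    by (rule PH_pos[OF near_weak_nbhd[OF \<eta>0 \<kappa>'(1)] near_measurable])
  then have \<mu>: "measure priorH (near \<kappa>' \<eta>0) > 0" by (simp add: PH.emeasure_eq_measure)
  have "f \<beta>0 > 0" using f_pos U0 by blast
  then have "\<rho> * f \<beta>0 * measure priorH (near \<kappa>' \<eta>0) > 0" using \<rho> \<mu> by simp
  from order_tendstoD(2)[OF power_exp_sqrt_tendsto[OF c2, of "CARD('p)"] this]
  obtain N3 where N3: "\<And>n. n \<ge> N3 \<Longrightarrow> sqrt (real n) ^ CARD('p) * exp (- (c / 2) * real n) < \<rho> * f \<beta>0 * measure priorH (near \<kappa>' \<eta>0)"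
    by (auto simp: eventually_sequentially)
  obtain N4 :: nat where "(T / r)\<^sup>2 \<le> real N4" using real_arch_simple by blast
  then have N4: "T \<le> r * sqrt (real n)" if "n \<ge> N4" for n
  proof -
    have "T / r \<le> sqrt (real n)" using \<open>(T / r)\<^sup>2 \<le> real N4\<close> that by (intro real_le_rsqrt) linarith
    then show ?thesis using r by (simp add: divide_le_eq mult.commute)
  qed
  show ?thesis
  proof (rule exI[of _ "N0 + N1 + N2 + N3 + N4"], intro allI impI)
    fix n assume "n \<ge> N0 + N1 + N2 + N3 + N4"
    then have n: "n \<ge> N0" "n \<ge> N1" "n \<ge> N2" "n \<ge> N3" "n \<ge> N4" "n \<ge> 1" using N0 by auto
    note lk = likely_conj[OF likely_conj[OF K(2)[rule_format, OF n(6)] loc(3)[rule_format, OF n(2)]]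
        likely_conj[OF out(2)[rule_format, OF n(3)] low(2)[rule_format, OF n(6)]]]
    show "likely \<xi> (\<lambda>\<omega>. \<forall>B\<in>sets borel.
      \<bar>measure (posterior (priorB \<Otimes>\<^sub>M priorH) X n (\<lambda>i. Y i \<omega>))
          {\<theta> \<in> space (priorB \<Otimes>\<^sub>M priorH). sqrt (real n) *\<^sub>R (fst \<theta> - \<beta>0) \<in> B}
        - measure (mv_normal (centering X \<beta>0 \<eta>0 n (\<lambda>i. Y i \<omega>)) (matrix_inv (info_matrix X \<eta>0 n \<eta>0))) B\<bar> \<le> \<epsilon>)"
    proof (rule likely_mono[OF lk], goal_cases)
      case (2 \<omega>)
      then have G: "norm (grad n \<omega>) \<le> K"
        and l: "\<And>\<eta> u. \<eta> \<in> near \<kappa> \<eta>0 \<Longrightarrow> norm u \<le> r1 \<Longrightarrow>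
    \<bar>loglik n \<omega> u \<eta> - loglik n \<omega> 0 \<eta> - ((sqrt n *\<^sub>R u) \<bullet> grad n \<omega> - ?V * (\<Sum>i=1..n. ((sqrt n *\<^sub>R u) \<bullet> X i)\<^sup>2) / real n / 2)\<bar>
      \<le> \<gamma> * (norm (sqrt n *\<^sub>R u) + (norm (sqrt n *\<^sub>R u))\<^sup>2)"
        and o: "\<And>\<eta> u. \<eta> \<in> HH \<Longrightarrow> r \<le> norm u \<or> \<eta> \<notin> near \<kappa> \<eta>0 \<Longrightarrow> loglik n \<omega> u \<eta> - loglik n \<omega> 0 \<eta>0 \<le> - c * real n"
        and w: "\<And>\<eta>. \<eta> \<in> near \<kappa>1 \<eta>0 \<Longrightarrow> - (c / 2) * real n \<le> loglik n \<omega> 0 \<eta> - loglik n \<omega> 0 \<eta>0"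
        by blast+
      show ?case
      proof
        fix B :: "(real^'p) set" assume B: "B \<in> sets borel"
        have "\<bar>measure (posterior (priorB \<Otimes>\<^sub>M priorH) X n (\<lambda>i. Y i \<omega>))
          {\<theta> \<in> space (priorB \<Otimes>\<^sub>M priorH). sqrt (real n) *\<^sub>R (fst \<theta> - \<beta>0) \<in> B}
        - measure (mv_normal (centering X \<beta>0 \<eta>0 n (\<lambda>i. Y i \<omega>)) (matrix_inv (info_matrix X \<eta>0 n \<eta>0))) B\<bar> \<le> 4 * \<rho> / (m - 2 * \<rho>)"
        proof (rule posterior_tv[where \<kappa>=\<kappa> and \<kappa>'=\<kappa>' and c=c and r=r and \<gamma>=\<gamma> and T=T and K=K])
          show "sqrt (real n) ^ CARD('p) * exp (- (c / 2) * real n) \<le> \<rho> * f \<beta>0 * measure priorH (near \<kappa>' \<eta>0)"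
            using N3[OF n(4)] by simp
          show "- (c / 2) * real n \<le> loglik n \<omega> 0 \<eta> - loglik n \<omega> 0 \<eta>0" if "\<eta> \<in> near \<kappa>' \<eta>0" for \<eta>
            using that \<kappa>'(3) by (intro w) blast
          show "\<bar>loglik n \<omega> u \<eta> - loglik n \<omega> 0 \<eta> - ((sqrt n *\<^sub>R u) \<bullet> grad n \<omega> - ?V * (\<Sum>i=1..n. ((sqrt n *\<^sub>R u) \<bullet> X i)\<^sup>2) / real n / 2)\<bar>
            \<le> \<gamma> * (norm (sqrt n *\<^sub>R u) + (norm (sqrt n *\<^sub>R u))\<^sup>2)" if "\<eta> \<in> near \<kappa> \<eta>0" "norm u \<le> r" for \<eta> u
            using that r(2) by (intro l) auto
          show "loglik n \<omega> u \<eta> - loglik n \<omega> 0 \<eta>0 \<le> - c * real n"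
            if "\<eta> \<in> HH" "r \<le> norm u \<or> \<eta> \<notin> near \<kappa> \<eta>0" for \<eta> u using that by (rule o)
          show "f \<beta>0 * exp (- \<gamma>) \<le> f \<beta> \<and> f \<beta> \<le> f \<beta>0 * exp \<gamma>" if "\<beta> \<in> ball \<beta>0 r" for \<beta>
            using that r2(3) r(3) by blast
          show "m = exp (- (K + ?V * L\<^sup>2 / 2)) * measure lborel (ball (0::real^'p) 1)" by (rule m_def)
          show "ball \<beta>0 r \<subseteq> U0" using r(3) r2(2) by blast
          show "T \<le> r * sqrt (real n)" by (rule N4[OF n(5)])
          show "2 * \<rho> < m" using \<rho> m by linarith
          show "\<omega> \<in> space P" using 2 by blast
        qed (use n r \<gamma> G K \<rho> \<kappa>' B in \<open>auto intro: less_imp_le\<close>)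
        then show "\<bar>measure (posterior (priorB \<Otimes>\<^sub>M priorH) X n (\<lambda>i. Y i \<omega>))
          {\<theta> \<in> space (priorB \<Otimes>\<^sub>M priorH). sqrt (real n) *\<^sub>R (fst \<theta> - \<beta>0) \<in> B}
        - measure (mv_normal (centering X \<beta>0 \<eta>0 n (\<lambda>i. Y i \<omega>)) (matrix_inv (info_matrix X \<eta>0 n \<eta>0))) B\<bar> \<le> \<epsilon>"
          using tv by linarith
      qed
    qed simp
  qed
qed

end

theorem theorem3p3p2:
  fixes M s1 s2 L :: real
    and \<B> :: "(real^'p) set"
    and X :: "nat \<Rightarrow> real^'p"
    and \<beta>0 :: "real^'p" and \<eta>0 :: "(real \<times> real) measure"
    and P :: "'w measure" and err Y :: "nat \<Rightarrow> 'w \<Rightarrow> real"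
    and priorB :: "(real^'p) measure" and priorH :: "(real \<times> real) measure measure"
  assumes "M > 0" and "0 < s1" and "s1 < s2"
    and "open \<B>" and "\<beta>0 \<in> \<B>" and "\<eta>0 \<in> mixing_set M s1 s2"
    and "prob_space P"
    and "prob_space.indep_vars P (\<lambda>_. borel) err {1..}"
    and "\<And>i. i \<ge> 1 \<Longrightarrow> distributed P lborel (err i) (\<lambda>y. ennreal (mix_density \<eta>0 y))"
    and "\<And>i \<omega>. i \<ge> 1 \<Longrightarrow> \<omega> \<in> space P \<Longrightarrow> Y i \<omega> = \<beta>0 \<bullet> X i + err i \<omega>"
    and "liminf (\<lambda>n. ereal (min_eigenvalue (design_matrix X n))) > 0"
    and "L > 0" and "\<And>i. i \<ge> 1 \<Longrightarrow> norm (X i) \<le> L"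
    and "prob_space priorB" and "sets priorB = sets (restrict_space borel \<B>)"
    and "thick_at priorB \<beta>0"
    and "prob_space priorH" and "sets priorH = sets (mixing_space M s1 s2)"
    and "\<And>U. weak_nbhd M s1 s2 \<eta>0 U \<Longrightarrow> U \<in> sets priorH \<Longrightarrow> emeasure priorH U > 0"
  shows "tendsto_in_prob P
    (\<lambda>n \<omega>. SUP B\<in>sets borel.
       \<bar>measure (posterior (priorB \<Otimes>\<^sub>M priorH) X n (\<lambda>i. Y i \<omega>))
          {\<theta> \<in> space (priorB \<Otimes>\<^sub>M priorH). sqrt (real n) *\<^sub>R (fst \<theta> - \<beta>0) \<in> B}
        - measure (mv_normal (centering X \<beta>0 \<eta>0 n (\<lambda>i. Y i \<omega>))
            (matrix_inv (info_matrix X \<eta>0 n \<eta>0))) B\<bar>)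
    0"
proof -
  \<comment> \<open>A number strictly between 0 and the limit inferior eventually bounds the
    smallest eigenvalues from below.\<close>
  obtain c0 where c0: "0 < c0" "ereal c0 < liminf (\<lambda>n. ereal (min_eigenvalue (design_matrix X n)))"
    using ereal_dense2[OF assms(11)] by (auto simp: zero_ereal_def)
  from less_LiminfD[OF c0(2)] obtain N where N: "\<And>n. n \<ge> N \<Longrightarrow> c0 < min_eigenvalue (design_matrix X n)"
    by (auto simp: eventually_sequentially)
  have design: "c0 * (norm v)\<^sup>2 \<le> (\<Sum>i=1..n. (v \<bullet> X i)\<^sup>2) / real n" if "n \<ge> max N 1" for n and v :: "real^'p"
  proof -
    have "c0 * (norm v)\<^sup>2 \<le> min_eigenvalue (design_matrix X n) * (norm v)\<^sup>2"
      using N[of n] that by (intro mult_right_mono) auto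
    also have "\<dots> \<le> v \<bullet> (design_matrix X n *v v)" by (rule min_eigenvalue_le[OF design_matrix_transpose])
    finally show ?thesis by (simp add: design_matrix_quadratic)
  qed
  obtain U f where U: "open U" "\<beta>0 \<in> U" "U \<subseteq> space priorB" "continuous_on U f" "\<forall>\<beta>\<in>U. f \<beta> > (0::real)"
    "\<forall>A\<in>sets borel. A \<subseteq> U \<longrightarrow> emeasure priorB A = (\<integral>\<^sup>+\<beta>. ennreal (f \<beta>) * indicator A \<beta> \<partial>lborel)"
    using assms(16) unfolding thick_at_def by blast
  interpret prob_space P by fact
  interpret symmetric_regression_prior M s1 s2 P X err \<eta>0 L c0 "max N 1" \<B> \<beta>0 Y priorB priorH U f
  proof (intro symmetric_regression_prior.intro symmetric_regression.intro normal_mixture.intro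
      symmetric_regression_axioms.intro symmetric_regression_prior_axioms.intro)
    show "\<And>n v. n \<ge> max N 1 \<Longrightarrow> c0 * (norm v)\<^sup>2 \<le> (\<Sum>i=1..n. (v \<bullet> X i)\<^sup>2) / real n" by (rule design)
    show "\<And>A. A \<in> sets borel \<Longrightarrow> A \<subseteq> U \<Longrightarrow> emeasure priorB A = (\<integral>\<^sup>+\<beta>. ennreal (f \<beta>) * indicator A \<beta> \<partial>lborel)"
      using U(6) by blast
    show "\<And>\<beta>. \<beta> \<in> U \<Longrightarrow> f \<beta> > 0" using U(5) by blast
    show "max N 1 \<ge> 1" by simp
  qed (fact assms U c0)+
  let ?d = "\<lambda>n \<omega> B. \<bar>measure (posterior (priorB \<Otimes>\<^sub>M priorH) X n (\<lambda>i. Y i \<omega>))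
          {\<theta> \<in> space (priorB \<Otimes>\<^sub>M priorH). sqrt (real n) *\<^sub>R (fst \<theta> - \<beta>0) \<in> B}
        - measure (mv_normal (centering X \<beta>0 \<eta>0 n (\<lambda>i. Y i \<omega>))
            (matrix_inv (info_matrix X \<eta>0 n \<eta>0))) B\<bar>"
  show ?thesis
    unfolding tendsto_in_prob_def
  proof (intro allI impI)
    fix \<epsilon> :: real assume \<epsilon>: "\<epsilon> > 0"
    let ?O = "\<lambda>n. outer_measure_of P {\<omega> \<in> space P. \<epsilon> < \<bar>(SUP B\<in>sets borel. ?d n \<omega> B) - 0\<bar>}"
    have bound: "\<forall>\<^sub>F n in sequentially. ?O n \<le> ennreal \<xi>" if \<xi>: "\<xi> > 0" for \<xi>
    proof -
      obtain N' where N': "\<And>n. n \<ge> N' \<Longrightarrow> likely \<xi> (\<lambda>\<omega>. \<forall>B\<in>sets borel. ?d n \<omega> B \<le> \<epsilon>)"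
        using total_variation_likely[OF \<epsilon> \<xi>] by blast
      have "?O n \<le> ennreal \<xi>" if n: "n \<ge> N'" for n
      proof -
        obtain E where E: "E \<in> events" "prob E \<ge> 1 - \<xi>" "\<And>\<omega>. \<omega> \<in> E \<Longrightarrow> \<forall>B\<in>sets borel. ?d n \<omega> B \<le> \<epsilon>"
          using N'[OF n] by (auto simp: likely_def)
        have "\<bar>(SUP B\<in>sets borel. ?d n \<omega> B) - 0\<bar> \<le> \<epsilon>" if "\<omega> \<in> E" for \<omega>
        proof -
          have le: "?d n \<omega> B \<le> \<epsilon>" if "B \<in> sets borel" for B using E(3)[OF \<open>\<omega> \<in> E\<close>] that by blast
          have "(SUP B\<in>sets borel. ?d n \<omega> B) \<le> \<epsilon>" by (rule cSUP_least) (use le in auto)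
          moreover have "?d n \<omega> {} \<le> (SUP B\<in>sets borel. ?d n \<omega> B)"
            by (rule cSUP_upper) (use le in \<open>auto intro!: bdd_aboveI2\<close>)
          moreover have "0 \<le> ?d n \<omega> {}" by simp
          ultimately show ?thesis by linarith
        qed
        then have "{\<omega> \<in> space P. \<epsilon> < \<bar>(SUP B\<in>sets borel. ?d n \<omega> B) - 0\<bar>} \<subseteq> space P - E" by fastforce
        then have "?O n \<le> outer_measure_of P (space P - E)" by (rule outer_measure_of_mono)
        also have "\<dots> = ennreal (prob (space P - E))" using E by (simp add: outer_measure_of_eq emeasure_eq_measure)
        also have "\<dots> \<le> ennreal \<xi>" using E prob_compl[OF E(1)] by (intro ennreal_leI) linarith
        finally show ?thesis .
      qed
      then show ?thesis by (auto simp: eventually_sequentially)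
    qed
    show "?O \<longlonglongrightarrow> 0"
    proof (rule order_tendstoI)
      fix a :: ennreal assume "0 < a"
      \<comment> \<open>Even if a is infinite, an intermediate b is finite and hence comes from a
        real \<xi>.\<close>
      then obtain b where b: "0 < b" "b < a" using dense by blast
      define \<xi> where "\<xi> = enn2real b"
      have "b < \<top>" by (rule order_less_le_trans[OF b(2)]) simp
      then have \<xi>: "\<xi> > 0" "ennreal \<xi> < a" using b by (simp_all add: \<xi>_def enn2real_positive_iff)
      show "\<forall>\<^sub>F n in sequentially. ?O n < a"
        using bound[OF \<xi>(1)]
      proof eventually_elim
        case (elim n)
        then show ?case using \<xi>(2) by (rule order_le_less_trans)
      qed
    qed simp
  qed
qed

end
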